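(* Let $\beta>1$, $1<\alpha<\beta$ and $1<\gamma<\beta/\alpha$ with $\gamma\le2$. There exists a constant $C_{\alpha,\beta,\gamma}$ such that for all $\xi,\xi'\in L^{\beta}_G(\Omega_T)$, with $\xi=M_T-K_T$ and $\xi'=M'_T-K'_T$ their decompositions (as defined in the context), one has $$\|K_T\|_{\alpha,G}^{\alpha}\le C_{\alpha,\beta,\gamma}\big\{\|\xi\|^{\alpha}_{\beta,G}+\|\xi\|^{\beta/\gamma}_{\beta,G}\big\}$$ and $$\begin{aligned}\|M_T-M'_T\|_{\alpha,G}^{\alpha}\le\ & C_{\alpha,\beta,\gamma}\big\{\|\xi-\xi'\|^{\alpha}_{\beta,G}+\|\xi-\xi'\|^{\beta/\gamma}_{\beta,G}\big\}\\&+C_{\alpha,\beta,\gamma}\big\{\|\xi-\xi'\|^{\alpha}_{\beta,G}+\|\xi-\xi'\|^{\beta/\gamma}_{\beta,G}\big\}^{1/2}\big\{1+\|\xi\|^{\beta/\gamma}_{\beta,G}+\|\xi'\|^{\beta/\gamma}_{\beta,G}\big\}^{1/2}.\end{aligned}$$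
   Context: Sublinear expectations. Let $\mathcal{H}$ be a linear space of real functions on a set $\Omega$ containing the constants. A sublinear expectation on $\mathcal{H}$ is a functional $\hat{E}:\mathcal{H}\to\mathbb{R}$ that is monotone, satisfies $\hat{E}(c)=c$ for constants $c$, $\hat{E}(X)-\hat{E}(Y)\le\hat{E}(X-Y)$, and $\hat{E}(\lambda X)=\lambda\hat{E}(X)$ for $\lambda\ge 0$. $C_{l,Lip}(\mathbb{R}^n)$ is the set of $\varphi:\mathbb{R}^n\to\mathbb{R}$ with $|\varphi(x)-\varphi(y)|\le C(1+|x|^k+|y|^k)|x-y|$ for some $C,k$ depending on $\varphi$. Random vectors $X_1,X_2$ (on possibly different sublinear expectation spaces, with sublinear expectations $\hat{E}_1,\hat{E}_2$) are identically distributed, $X_1\sim X_2$, if $\hat{E}_1[\varphi(X_1)]=\hat{E}_2[\varphi(X_2)]$ for all $\varphi\in C_{l,Lip}$. $Y$ is independent to $X$ if $\hat{E}[\varphi(X,Y)]=\hat{E}[\hat{E}[\varphi(x,Y)]_{x=X}]$ for all $\varphi\in C_{l,Lip}$. A $d$-dimensional $X$ is $G$-normal distributed if $aX+b\hat{X}\sim\sqrt{a^2+b^2}\,X$ for all $a,b\in\mathbb{R}$, where $\hat{X}$ is an independent copy of $X$; here $G(A):=\frac12\hat{E}[(AX,X)]$ for $A$ in the space $S_d$ of symmetric $d\times d$ matrices. One has $G(A)=\frac12\sup_{\gamma\in\Gamma}\mathrm{Tr}(\gamma A)$ for a bounded, convex, closed set $\Gamma$ of nonnegative symmetric matrices. Standing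 assumption (non-degeneracy): there is $\beta_0>0$ with $G(A)-G(B)\ge\beta_0\mathrm{Tr}(A-B)$ whenever $A\ge B$. $G$-expectation. $\Omega_T=C_0([0,T];\mathbb{R}^d)$ (continuous paths starting at $0$) with the supremum norm, $B_t(\omega)=\omega_t$ is the canonical process ($G$-Brownian motion), and $$\mathcal{H}^0_T=\{\varphi(B_{t_1},\dots,B_{t_n}): n\ge1,\ t_1,\dots,t_n\in[0,T],\ \varphi\in C_{l,Lip}(\mathbb{R}^{d\times n})\};$$ $L_{ip}(\Omega_t)$ is the set of $\varphi(B_{t_1},\dots,B_{t_n})$ with $t_1,\dots,t_n\in[0,t]$ and $\varphi$ bounded and Lipschitz. The $G$-expectation is the sublinear expectation on $\mathcal{H}^0_T$ given, for $0=t_0<t_1<\dots<t_m\le T$, by $$\hat{E}[\varphi(B_{t_1}-B_{t_0},\dots,B_{t_m}-B_{t_{m-1}})]=\tilde{E}[\varphi(\sqrt{t_1-t_0}\,\xi_1,\dots,\sqrt{t_m-t_{m-1}}\,\xi_m)],$$ where $\xi_1,\dots,\xi_m$ are identically distributed $G$-normal $d$-dimensional vectors (with the given function $G$) on a sublinear expectation space with sublinear expectation $\tilde{E}$, and $\xi_{i+1}$ is independent to $(\xi_1,\dots,\xi_i)$ for each $i$. The conditional expectation is $\hat{E}_{t_i}[\varphi(B_{t_1}-B_{t_0},\dots,B_{t_m}-B_{t_{m-1}})]=\tilde\varphi(B_{t_1}-B_{t_0},\dots,B_{t_i}-B_{t_{i-1}})$ with $\tilde\varphi(x_1,\dots,x_i)=\hat{E}[\varphi(x_1,\dots,x_i,B_{t_{i+1}}-B_{t_i},\dots,B_{t_m}-B_{t_{m-1}})]$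 (any time $t\in[0,T]$ may be inserted into the partition). For $p\ge1$ put $\|\xi\|_{p,G}=[\hat{E}(|\xi|^p)]^{1/p}$; $L^p_G(\Omega_T)$ is the completion of $\mathcal{H}^0_T$ under $\|\cdot\|_{p,G}$, and $\hat{E}$, $\hat{E}_t$ extend continuously to $L^1_G(\Omega_T)$. It is known that there is a weakly compact set $\mathcal{P}$ of Borel probability measures on $\Omega_T$ with $\hat{E}(\xi)=\max_{P\in\mathcal{P}}E_P(\xi)$ on $\mathcal{H}^0_T$; the capacity is $c(A)=\sup_{P\in\mathcal{P}}P(A)$, and "q.s." means outside a set of capacity $c$ zero. A process $\{M_t\}_{t\in[0,T]}$ with values in $L^1_G(\Omega_T)$ is a $G$-martingale if $\hat{E}_s(M_t)=M_s$ for all $s\le t$. Stochastic integral. $H^0_G(0,T)$ is the set of processes $\eta_t=\sum_{j=0}^{N-1}\xi_j1_{[t_j,t_{j+1})}(t)$, where $0=t_0<\dots<t_N=T$ and $\xi_j$ is an ($\mathbb{R}^d$-valued) random variable with components in $L_{ip}(\Omega_{t_j})$. For $p\ge1$, $\|\eta\|_{H^p_G}=\{\hat{E}(\int_0^T|\eta_s|^2ds)^{p/2}\}^{1/p}$ and $H^p_G(0,T)$ is the completion of $H^0_G(0,T)$ under this norm. For $\eta\in H^0_G(0,T)$, $\int_0^T\eta_s\,dB_s:=\sum_{j}\xi_j\cdot(B_{t_{j+1}}-B_{t_j})$; this map into $L^p_G(\Omega_T)$ is continuous and extends to $H^p_G(0,T)$; $\int_0^t\eta_s\,dB_s:=\int_0^T1_{[0,t]}(s)\eta_s\,dB_s$.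 Decomposition. For $\xi\in L^{\beta}_G(\Omega_T)$ with $\beta>1$ there is a unique decomposition $\hat{E}_t(\xi)=\hat{E}(\xi)+\int_0^tZ_s\,dB_s-K_t$ q.s., $t\in[0,T]$, with $\{Z_t\}\in H^1_G(0,T)$ and $\{K_t\}$ a continuous increasing process with $K_0=0$ and $\{-K_t\}$ a $G$-martingale; moreover $\{Z_t\}\in H^{\alpha}_G(0,T)$ and $K_T\in L^\alpha_G(\Omega_T)$ for $1\le\alpha<\beta$. One writes $M_t=\hat{E}(\xi)+\int_0^tZ_s\,dB_s$, so that $\xi=M_T-K_T$; this is "the decomposition" of $\xi$, and similarly $\xi'=M'_T-K'_T$ for $\xi'$. *)

theory Defs
  imports "HOL-Probability.Probability"
begin

section \<open>Test functions\<close>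

definition C_lLip :: "('v::real_normed_vector \<Rightarrow> real) set" where
  "C_lLip = {\<phi>. \<exists>C (k::nat). \<forall>x y.
     \<bar>\<phi> x - \<phi> y\<bar> \<le> C * (1 + norm x ^ k + norm y ^ k) * norm (x - y)}"

text \<open>
  The number of blocks of a vector in \<open>(\<real>\<^sup>d)\<^sup>n\<close> varies, so such a vector is given
  by a sequence of which only the entries below \<open>n\<close> matter. A function on
  \<open>(\<real>\<^sup>d)\<^sup>n\<close> is a function on sequences; the (local) Lipschitz conditions below
  force it to depend on the first \<open>n\<close> entries only (see \<open>C_lLip_tuple_cong\<close>).
\<close>

definition tuple_norm :: "nat \<Rightarrow> (nat \<Rightarrow> 'v::real_normed_vector) \<Rightarrow> real" where
  "tuple_norm n x = L2_set (\<lambda>i. norm (x i)) {..<n}"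

definition C_lLip_tuple :: "nat \<Rightarrow> ((nat \<Rightarrow> 'v::real_normed_vector) \<Rightarrow> real) set" where
  "C_lLip_tuple n = {\<phi>. \<exists>C (k::nat). \<forall>x y.
     \<bar>\<phi> x - \<phi> y\<bar> \<le> C * (1 + tuple_norm n x ^ k + tuple_norm n y ^ k)
                        * tuple_norm n (\<lambda>i. x i - y i)}"

definition bdd_Lip_tuple :: "nat \<Rightarrow> ((nat \<Rightarrow> 'v::real_normed_vector) \<Rightarrow> real) set" where
  "bdd_Lip_tuple n = {\<phi>. bounded (range \<phi>) \<and>
     (\<exists>L. \<forall>x y. \<bar>\<phi> x - \<phi> y\<bar> \<le> L * tuple_norm n (\<lambda>i. x i - y i))}"

lemma C_lLip_tuple_cong:
  assumes "\<phi> \<in> C_lLip_tuple n" "\<And>i. i < n \<Longrightarrow> x i = y i"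
  shows "\<phi> x = \<phi> y"
proof -
  have "tuple_norm n (\<lambda>i. x i - y i) = 0"
    using assms(2) by (simp add: tuple_norm_def L2_set_def)
  moreover obtain C and k :: nat where
    "\<bar>\<phi> x - \<phi> y\<bar> \<le> C * (1 + tuple_norm n x ^ k + tuple_norm n y ^ k)
                       * tuple_norm n (\<lambda>i. x i - y i)"
    using assms(1) by (auto simp: C_lLip_tuple_def)
  ultimately show ?thesis by simp
qed

section \<open>Sublinear expectation spaces\<close>

text \<open>
  The underlying set \<open>\<Omega>\<close> may be a proper subset of its type: random variables are
  functions on the whole type, and monotonicity, which only looks at \<open>\<Omega>\<close>, makes the
  expectation depend on the values on \<open>\<Omega>\<close> alone.
\<close>

definition sublinear_expectation ::
  "'a set \<Rightarrow> ('a \<Rightarrow> real) set \<Rightarrow> (('a \<Rightarrow> real) \<Rightarrow> real) \<Rightarrow> bool" where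
  "sublinear_expectation \<Omega> H E \<longleftrightarrow>
     (\<forall>c. (\<lambda>_. c) \<in> H) \<and>
     (\<forall>X\<in>H. \<forall>Y\<in>H. (\<lambda>\<omega>. X \<omega> + Y \<omega>) \<in> H) \<and>
     (\<forall>X\<in>H. \<forall>c. (\<lambda>\<omega>. c * X \<omega>) \<in> H) \<and>
     (\<forall>X\<in>H. \<forall>Y\<in>H. (\<forall>\<omega>\<in>\<Omega>. X \<omega> \<le> Y \<omega>) \<longrightarrow> E X \<le> E Y) \<and>
     (\<forall>c. E (\<lambda>_. c) = c) \<and>
     (\<forall>X\<in>H. \<forall>Y\<in>H. E X - E Y \<le> E (\<lambda>\<omega>. X \<omega> - Y \<omega>)) \<and>
     (\<forall>X\<in>H. \<forall>l\<ge>0. E (\<lambda>\<omega>. l * X \<omega>) = l * E X)"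

text \<open>
  \<open>X\<close> with \<open>n\<close> blocks is a random vector of the space if all its test functions are
  admissible arguments of the expectation.
\<close>

definition random_tuple ::
  "('a \<Rightarrow> real) set \<Rightarrow> nat \<Rightarrow> ('a \<Rightarrow> nat \<Rightarrow> 'v::real_normed_vector) \<Rightarrow> bool" where
  "random_tuple H n X \<longleftrightarrow> (\<forall>\<phi>\<in>C_lLip_tuple n. (\<lambda>\<omega>. \<phi> (X \<omega>)) \<in> H)"

definition identically_distributed ::
  "(('a \<Rightarrow> real) \<Rightarrow> real) \<Rightarrow> ('a \<Rightarrow> 'v::real_normed_vector) \<Rightarrow>
   (('b \<Rightarrow> real) \<Rightarrow> real) \<Rightarrow> ('b \<Rightarrow> 'v) \<Rightarrow> bool" where
  "identically_distributed E1 X1 E2 X2 \<longleftrightarrow>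
     (\<forall>\<phi>\<in>C_lLip. E1 (\<lambda>\<omega>. \<phi> (X1 \<omega>)) = E2 (\<lambda>\<omega>. \<phi> (X2 \<omega>)))"

text \<open>\<open>Y\<close> (one block) is independent to \<open>X\<close> (\<open>n\<close> blocks).\<close>

definition independent_to ::
  "(('a \<Rightarrow> real) \<Rightarrow> real) \<Rightarrow> nat \<Rightarrow> ('a \<Rightarrow> 'v::real_normed_vector) \<Rightarrow>
   ('a \<Rightarrow> nat \<Rightarrow> 'v) \<Rightarrow> bool" where
  "independent_to E n Y X \<longleftrightarrow>
     (\<forall>\<phi>\<in>C_lLip_tuple (Suc n).
        E (\<lambda>\<omega>. \<phi> ((X \<omega>)(n := Y \<omega>))) = E (\<lambda>\<omega>. E (\<lambda>\<omega>'. \<phi> ((X \<omega>)(n := Y \<omega>')))))"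

text \<open>
  The independent copy is taken on the same space; this only asks the space to be large
  enough, as the condition concerns the law of \<open>X\<close>.
\<close>

definition G_normal ::
  "('a \<Rightarrow> real) set \<Rightarrow> (('a \<Rightarrow> real) \<Rightarrow> real) \<Rightarrow> (real^'d^'d \<Rightarrow> real) \<Rightarrow>
   ('a \<Rightarrow> real^'d) \<Rightarrow> bool" where
  "G_normal H E G X \<longleftrightarrow>
     (\<exists>X'. random_tuple H 2 (\<lambda>\<omega> i. if i = 0 then X \<omega> else X' \<omega>) \<and>
        identically_distributed E X' E X \<and>
        independent_to E 1 X' (\<lambda>\<omega> _. X \<omega>) \<and>
        (\<forall>a b. identically_distributed E (\<lambda>\<omega>. a *\<^sub>R X \<omega> + b *\<^sub>R X' \<omega>)
                                       E (\<lambda>\<omega>. sqrt (a\<^sup>2 + b\<^sup>2) *\<^sub>R X \<omega>))) \<and>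
     (\<forall>A. transpose A = A \<longrightarrow> G A = 1/2 * E (\<lambda>\<omega>. (A *v X \<omega>) \<bullet> X \<omega>))"

definition iid_G_normal ::
  "('a \<Rightarrow> real) set \<Rightarrow> (('a \<Rightarrow> real) \<Rightarrow> real) \<Rightarrow> (real^'d^'d \<Rightarrow> real) \<Rightarrow>
   (nat \<Rightarrow> 'a \<Rightarrow> real^'d) \<Rightarrow> bool" where
  "iid_G_normal H E G \<zeta> \<longleftrightarrow>
     (\<forall>n. random_tuple H n (\<lambda>\<omega> i. \<zeta> i \<omega>)) \<and>
     (\<forall>i. G_normal H E G (\<zeta> i)) \<and>
     (\<forall>i j. identically_distributed E (\<zeta> i) E (\<zeta> j)) \<and>
     (\<forall>n\<ge>1. independent_to E n (\<zeta> n) (\<lambda>\<omega> i. \<zeta> i \<omega>))"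

definition nondegenerate :: "(real^'d^'d \<Rightarrow> real) \<Rightarrow> bool" where
  "nondegenerate G \<longleftrightarrow>
     (\<exists>\<beta>\<^sub>0>0. \<forall>A B. transpose A = A \<longrightarrow> transpose B = B \<longrightarrow>
        (\<forall>v. (B *v v) \<bullet> v \<le> (A *v v) \<bullet> v) \<longrightarrow>
        G A - G B \<ge> \<beta>\<^sub>0 * trace (A - B))"

section \<open>Path space\<close>

text \<open>
  A continuous path on \<open>[0,T]\<close> is identified with its constant extension to the real line;
  the norm of \<open>bcontfun\<close> then is the supremum norm over \<open>[0,T]\<close>.
\<close>

type_synonym 'd path = "real \<Rightarrow>\<^sub>C (real^'d)"

definition B :: "real \<Rightarrow> 'd::finite path \<Rightarrow> real^'d" where
  "B t \<omega> = apply_bcontfun \<omega> t"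

definition Omega :: "real \<Rightarrow> 'd::finite path set" where
  "Omega T = {\<omega>. B 0 \<omega> = 0 \<and> (\<forall>t\<le>0. B t \<omega> = B 0 \<omega>) \<and> (\<forall>t\<ge>T. B t \<omega> = B T \<omega>)}"

abbreviation Borel_Omega :: "real \<Rightarrow> 'd::finite path measure" where
  "Borel_Omega T \<equiv> restrict_space borel (Omega T)"

definition H0 :: "real \<Rightarrow> ('d::finite path \<Rightarrow> real) set" where
  "H0 T = {X. \<exists>n t \<phi>. n \<ge> 1 \<and> (\<forall>i<n. t i \<in> {0..T}) \<and> \<phi> \<in> C_lLip_tuple n \<and>
                X = (\<lambda>\<omega>. \<phi> (\<lambda>i. B (t i) \<omega>))}"

definition Lip :: "real \<Rightarrow> ('d::finite path \<Rightarrow> real) set" where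
  "Lip s = {X. \<exists>n t \<phi>. n \<ge> 1 \<and> (\<forall>i<n. t i \<in> {0..s}) \<and> \<phi> \<in> bdd_Lip_tuple n \<and>
                X = (\<lambda>\<omega>. \<phi> (\<lambda>i. B (t i) \<omega>))}"

section \<open>G-expectation\<close>

definition partition_upto :: "real \<Rightarrow> nat \<Rightarrow> (nat \<Rightarrow> real) \<Rightarrow> bool" where
  "partition_upto T m t \<longleftrightarrow> m \<ge> 1 \<and> t 0 = 0 \<and> strict_mono_on {0..m} t \<and> t m \<le> T"

definition increments :: "(nat \<Rightarrow> real) \<Rightarrow> 'd::finite path \<Rightarrow> nat \<Rightarrow> real^'d" where
  "increments t \<omega> j = B (t (Suc j)) \<omega> - B (t j) \<omega>"

definition is_G_expectation ::
  "real \<Rightarrow> (('b \<Rightarrow> real) \<Rightarrow> real) \<Rightarrow> (nat \<Rightarrow> 'b \<Rightarrow> real^'d) \<Rightarrow>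
   (('d::finite path \<Rightarrow> real) \<Rightarrow> real) \<Rightarrow> bool" where
  "is_G_expectation T E' \<zeta> E \<longleftrightarrow>
     sublinear_expectation (Omega T) (H0 T) E \<and>
     (\<forall>m t. partition_upto T m t \<longrightarrow> (\<forall>\<phi>\<in>C_lLip_tuple m.
        E (\<lambda>\<omega>. \<phi> (increments t \<omega>)) =
        E' (\<lambda>x. \<phi> (\<lambda>j. sqrt (t (Suc j) - t j) *\<^sub>R \<zeta> j x))))"

section \<open>Representing measures and capacity\<close>

definition prob_measures :: "real \<Rightarrow> 'd::finite path measure set" where
  "prob_measures T = {P. sets P = sets (Borel_Omega T) \<and> prob_space P}"

definition weak_topology :: "real \<Rightarrow> 'd::finite path measure topology" where
  "weak_topology T = topology_generated_by
     {{P \<in> prob_measures T. (\<integral>\<omega>. f \<omega> \<partial>P) \<in> U} | f U.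
        continuous_on (Omega T) f \<and> bounded (f ` Omega T) \<and> open (U :: real set)}"

definition represents ::
  "real \<Rightarrow> (('d::finite path \<Rightarrow> real) \<Rightarrow> real) \<Rightarrow> 'd path measure set \<Rightarrow> bool" where
  "represents T E \<P> \<longleftrightarrow>
     \<P> \<subseteq> prob_measures T \<and> compactin (weak_topology T) \<P> \<and>
     (\<forall>X\<in>H0 T. (\<forall>P\<in>\<P>. integrable P X \<and> (\<integral>\<omega>. X \<omega> \<partial>P) \<le> E X) \<and>
                (\<exists>P\<in>\<P>. (\<integral>\<omega>. X \<omega> \<partial>P) = E X))"

definition capacity :: "'a measure set \<Rightarrow> 'a set \<Rightarrow> ennreal" where
  "capacity \<P> A = (SUP P\<in>\<P>. emeasure P A)"

definition qs :: "real \<Rightarrow> 'd::finite path measure set \<Rightarrow> ('d path \<Rightarrow> bool) \<Rightarrow> bool" where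
  "qs T \<P> Q \<longleftrightarrow>
     (\<exists>A\<in>sets (Borel_Omega T). capacity \<P> A = 0 \<and> (\<forall>\<omega>\<in>Omega T - A. Q \<omega>))"

section \<open>The spaces of integrable random variables\<close>

text \<open>
  \<open>L_G T \<P> p\<close> models the completion of \<open>H0 T\<close> by Borel functions (two functions
  that agree quasi-surely represent the same element): on \<open>H0 T\<close> the \<open>p\<close>-th power of the
  norm of \<open>X - Y\<close> is \<open>Lp_dist \<P> p X Y\<close>, and the Borel functions of finite upper
  \<open>p\<close>-th moment are complete for it, so that the completion is the closure of \<open>H0 T\<close>.
\<close>

definition Lp_dist ::
  "'a measure set \<Rightarrow> real \<Rightarrow> ('a \<Rightarrow> real) \<Rightarrow> ('a \<Rightarrow> real) \<Rightarrow> ennreal" where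
  "Lp_dist \<P> p X Y = (SUP P\<in>\<P>. \<integral>\<^sup>+\<omega>. ennreal (\<bar>X \<omega> - Y \<omega>\<bar> powr p) \<partial>P)"

definition L_G ::
  "real \<Rightarrow> 'd::finite path measure set \<Rightarrow> real \<Rightarrow> ('d path \<Rightarrow> real) set" where
  "L_G T \<P> p = {X \<in> borel_measurable (Borel_Omega T).
     \<exists>Xn. (\<forall>n. Xn n \<in> H0 T) \<and> (\<lambda>n. Lp_dist \<P> p (Xn n) X) \<longlonglongrightarrow> 0}"

text \<open>Continuous extension of \<open>E\<close> from \<open>H0 T\<close> to \<open>L_G T \<P> 1\<close>.\<close>

definition ext_E ::
  "real \<Rightarrow> 'd::finite path measure set \<Rightarrow> (('d path \<Rightarrow> real) \<Rightarrow> real) \<Rightarrow>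
   ('d path \<Rightarrow> real) \<Rightarrow> real" where
  "ext_E T \<P> E X = (THE r. \<forall>Xn. (\<forall>n. Xn n \<in> H0 T) \<and>
     (\<lambda>n. Lp_dist \<P> 1 (Xn n) X) \<longlonglongrightarrow> 0 \<longrightarrow> (\<lambda>n. E (Xn n)) \<longlonglongrightarrow> r)"

definition G_norm ::
  "real \<Rightarrow> 'd::finite path measure set \<Rightarrow> (('d path \<Rightarrow> real) \<Rightarrow> real) \<Rightarrow>
   real \<Rightarrow> ('d path \<Rightarrow> real) \<Rightarrow> real" where
  "G_norm T \<P> E p X = ext_E T \<P> E (\<lambda>\<omega>. \<bar>X \<omega>\<bar> powr p) powr (1 / p)"

section \<open>Conditional expectation and G-martingales\<close>

text \<open>\<open>Y\<close> is the conditional expectation at time \<open>s\<close> of the cylinder variable \<open>X\<close>.\<close>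

definition is_cond_E0 ::
  "real \<Rightarrow> (('d::finite path \<Rightarrow> real) \<Rightarrow> real) \<Rightarrow> real \<Rightarrow>
   ('d path \<Rightarrow> real) \<Rightarrow> ('d path \<Rightarrow> real) \<Rightarrow> bool" where
  "is_cond_E0 T E s X Y \<longleftrightarrow>
     (\<exists>m t \<phi> i. partition_upto T m t \<and> \<phi> \<in> C_lLip_tuple m \<and> i \<le> m \<and> t i = s \<and>
        (\<forall>\<omega>\<in>Omega T. X \<omega> = \<phi> (increments t \<omega>)) \<and>
        (\<forall>\<omega>\<in>Omega T. Y \<omega> =
           E (\<lambda>\<omega>'. \<phi> (\<lambda>j. if j < i then increments t \<omega> j else increments t \<omega>' j))))"

text \<open>
  Continuous extension to \<open>L_G T \<P> 1\<close>; \<open>Y\<close> is determined up to quasi-sure equality,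
  whence a relation.
\<close>

definition is_cond_E ::
  "real \<Rightarrow> 'd::finite path measure set \<Rightarrow> (('d path \<Rightarrow> real) \<Rightarrow> real) \<Rightarrow> real \<Rightarrow>
   ('d path \<Rightarrow> real) \<Rightarrow> ('d path \<Rightarrow> real) \<Rightarrow> bool" where
  "is_cond_E T \<P> E s X Y \<longleftrightarrow> X \<in> L_G T \<P> 1 \<and> Y \<in> L_G T \<P> 1 \<and>
     (\<forall>Xn Yn. (\<forall>n. is_cond_E0 T E s (Xn n) (Yn n)) \<and>
        (\<lambda>n. Lp_dist \<P> 1 (Xn n) X) \<longlonglongrightarrow> 0 \<longrightarrow> (\<lambda>n. Lp_dist \<P> 1 (Yn n) Y) \<longlonglongrightarrow> 0)"

definition G_martingale ::
  "real \<Rightarrow> 'd::finite path measure set \<Rightarrow> (('d path \<Rightarrow> real) \<Rightarrow> real) \<Rightarrow>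
   (real \<Rightarrow> 'd path \<Rightarrow> real) \<Rightarrow> bool" where
  "G_martingale T \<P> E M \<longleftrightarrow>
     (\<forall>t\<in>{0..T}. M t \<in> L_G T \<P> 1) \<and>
     (\<forall>s t. 0 \<le> s \<and> s \<le> t \<and> t \<le> T \<longrightarrow> is_cond_E T \<P> E s (M t) (M s))"

section \<open>Stochastic integral\<close>

text \<open>An element of \<open>H\<^sup>0\<^sub>G(0,T)\<close> is given by \<open>N\<close>, \<open>t\<close> and \<open>\<eta>\<close> with \<open>simple_process T N t \<eta>\<close>.\<close>

definition simple_process ::
  "real \<Rightarrow> nat \<Rightarrow> (nat \<Rightarrow> real) \<Rightarrow> (nat \<Rightarrow> 'd::finite path \<Rightarrow> real^'d) \<Rightarrow> bool" where
  "simple_process T N t \<eta> \<longleftrightarrow> partition_upto T N t \<and> t N = T \<and>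
     (\<forall>j<N. \<forall>k. (\<lambda>\<omega>. \<eta> j \<omega> $ k) \<in> Lip (t j))"

definition process_of ::
  "nat \<Rightarrow> (nat \<Rightarrow> real) \<Rightarrow> (nat \<Rightarrow> 'd::finite path \<Rightarrow> real^'d) \<Rightarrow>
   real \<Rightarrow> 'd path \<Rightarrow> real^'d" where
  "process_of N t \<eta> s \<omega> = (\<Sum>j<N. indicator {t j..<t (Suc j)} s *\<^sub>R \<eta> j \<omega>)"

definition simple_integral ::
  "nat \<Rightarrow> (nat \<Rightarrow> real) \<Rightarrow> (nat \<Rightarrow> 'd::finite path \<Rightarrow> real^'d) \<Rightarrow> 'd path \<Rightarrow> real" where
  "simple_integral N t \<eta> \<omega> = (\<Sum>j<N. \<eta> j \<omega> \<bullet> (B (t (Suc j)) \<omega> - B (t j) \<omega>))"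

definition ennreal_powr :: "ennreal \<Rightarrow> real \<Rightarrow> ennreal" where
  "ennreal_powr x a = (if x = top then top else ennreal (enn2real x powr a))"

text \<open>The \<open>p\<close>-th power of the norm of \<open>\<eta> - \<eta>'\<close> in \<open>H\<^sup>p\<^sub>G(0,T)\<close>.\<close>

definition Hp_dist ::
  "real \<Rightarrow> 'd::finite path measure set \<Rightarrow> real \<Rightarrow>
   (real \<Rightarrow> 'd path \<Rightarrow> real^'d) \<Rightarrow> (real \<Rightarrow> 'd path \<Rightarrow> real^'d) \<Rightarrow> ennreal" where
  "Hp_dist T \<P> p \<eta> \<eta>' = (SUP P\<in>\<P>. \<integral>\<^sup>+\<omega>. ennreal_powr
     (\<integral>\<^sup>+s. ennreal ((norm (\<eta> s \<omega> - \<eta>' s \<omega>))\<^sup>2) \<partial>restrict_space lborel {0..T}) (p / 2) \<partial>P)"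

text \<open>
  The completion of the simple processes, modelled like \<open>L_G\<close> as a closure inside a space
  of measurable functions.
\<close>

definition H_G ::
  "real \<Rightarrow> 'd::finite path measure set \<Rightarrow> real \<Rightarrow> (real \<Rightarrow> 'd path \<Rightarrow> real^'d) set" where
  "H_G T \<P> p = {Z.
     case_prod Z \<in> borel_measurable (restrict_space borel {0..T} \<Otimes>\<^sub>M Borel_Omega T) \<and>
     (\<exists>N t \<eta>. (\<forall>n. simple_process T (N n) (t n) (\<eta> n)) \<and>
        (\<lambda>n. Hp_dist T \<P> p (process_of (N n) (t n) (\<eta> n)) Z) \<longlonglongrightarrow> 0)}"

text \<open>\<open>I\<close> is (a version of) the integral of \<open>Z\<close> over \<open>[0,T]\<close>, by continuous extension.\<close>

definition is_integral ::
  "real \<Rightarrow> 'd::finite path measure set \<Rightarrow> real \<Rightarrow>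
   (real \<Rightarrow> 'd path \<Rightarrow> real^'d) \<Rightarrow> ('d path \<Rightarrow> real) \<Rightarrow> bool" where
  "is_integral T \<P> p Z I \<longleftrightarrow> Z \<in> H_G T \<P> p \<and> I \<in> L_G T \<P> p \<and>
     (\<forall>N t \<eta>. (\<forall>n. simple_process T (N n) (t n) (\<eta> n)) \<and>
        (\<lambda>n. Hp_dist T \<P> p (process_of (N n) (t n) (\<eta> n)) Z) \<longlonglongrightarrow> 0 \<longrightarrow>
        (\<lambda>n. Lp_dist \<P> p (simple_integral (N n) (t n) (\<eta> n)) I) \<longlonglongrightarrow> 0)"

definition is_integral_upto ::
  "real \<Rightarrow> 'd::finite path measure set \<Rightarrow> real \<Rightarrow> real \<Rightarrow>
   (real \<Rightarrow> 'd path \<Rightarrow> real^'d) \<Rightarrow> ('d path \<Rightarrow> real) \<Rightarrow> bool" where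
  "is_integral_upto T \<P> p t Z I \<longleftrightarrow>
     is_integral T \<P> p (\<lambda>s \<omega>. indicator {0..t} s *\<^sub>R Z s \<omega>) I"

section \<open>Decomposition of G-martingales\<close>

text \<open>
  \<open>M\<close> and \<open>K\<close> are versions of the two processes in the decomposition of \<open>X\<close>. The
  identities between elements of \<open>L_G T \<P> 1\<close> hold quasi-surely for each fixed time; the
  path properties of \<open>K\<close> hold quasi-surely for all times simultaneously.
\<close>

definition G_decomposition ::
  "real \<Rightarrow> 'd::finite path measure set \<Rightarrow> (('d path \<Rightarrow> real) \<Rightarrow> real) \<Rightarrow>
   ('d path \<Rightarrow> real) \<Rightarrow> (real \<Rightarrow> 'd path \<Rightarrow> real) \<Rightarrow> (real \<Rightarrow> 'd path \<Rightarrow> real) \<Rightarrow> bool" where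
  "G_decomposition T \<P> E X M K \<longleftrightarrow>
     (\<exists>Z\<in>H_G T \<P> 1. \<forall>t\<in>{0..T}.
        \<exists>I. is_integral_upto T \<P> 1 t Z I \<and> (\<forall>\<omega>\<in>Omega T. M t \<omega> = ext_E T \<P> E X + I \<omega>)) \<and>
     (\<forall>t\<in>{0..T}. \<exists>Y. is_cond_E T \<P> E t X Y \<and> qs T \<P> (\<lambda>\<omega>. Y \<omega> = M t \<omega> - K t \<omega>)) \<and>
     qs T \<P> (\<lambda>\<omega>. K 0 \<omega> = 0 \<and> continuous_on {0..T} (\<lambda>t. K t \<omega>) \<and>
                    mono_on {0..T} (\<lambda>t. K t \<omega>)) \<and>
     G_martingale T \<P> E (\<lambda>t \<omega>. - K t \<omega>)"

end

theory Submission
  imports Defs "HOL-Probability.Probability"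
begin

text \<open>
  For \<open>Y\<^sub>t\<close> the conditional expectation of \<open>\<xi>\<close>, the tower property yields a weak type maximal
  inequality along every time grid, whence under each representing measure the running maximum of
  \<open>Y - Y'\<close> has moments of order \<open>\<alpha> < \<beta>\<close> controlled by the \<open>\<beta>\<close>-norm of \<open>\<xi> - \<xi>'\<close>.
  Under each representing measure \<open>M = Y + K\<close> is a martingale. Integrating \<open>K powr (\<alpha> - 1)\<close>
  against it and summing by parts bounds \<open>K\<^sub>T\<close> by the running maximum of \<open>Y\<close>.
  For \<open>M - M' = (Y - Y') + (K - K')\<close> one integrates the derivative of a smoothing of
  \<open>\<bar>x\<bar> powr \<alpha>\<close> along \<open>K - K'\<close>: as \<open>K - K'\<close> is continuous of finite variation, the Taylor expansion
  is of first order up to errors vanishing with the mesh, and \<open>Y - Y'\<close> enters through its running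
  maximum times \<open>K\<^sub>T + K'\<^sub>T\<close>. Only the exponent \<open>\<alpha>\<close> appears in these bounds; the
  exponent \<open>\<beta> / \<gamma>\<close> comes in through \<open>x powr \<alpha> \<le> 1 + x powr (\<beta> / \<gamma>)\<close>.
\<close>

section \<open>Power inequalities\<close>

text \<open>Two obstacles shape the proof. No moment of \<open>K T\<close> beyond the first is known
  at the outset, so its weights are truncated at a level c, and the moments of \<open>K T\<close>
  are settled before the difference is treated; only then may a part of the left-hand side be
  absorbed. And for \<alpha> < 2 the slope of \<bar>x\<bar> powr \<alpha> is not Lipschitz at the
  origin, so its changes cannot be paired directly with a process of which only a running maximum R
  is known. The smoothing parameter S = R * (R + V) with V = K + K' therefore moves with time: its
  own growth pays for the changes of the slope, and its final value to the power \<alpha> / 2 is the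
  origin of the mixed term in the second estimate. Classical martingale arguments are available
  because the upper expectation of Z times a later Brownian increment vanishes for Z and for -Z,
  which makes the increments centred under every representing measure. The constants depend on
  \<alpha> and \<beta> only and are fixed before the time horizon, the spaces and the
  measure.\<close>

lemma powr_tangent:
  fixes x y p :: real
  assumes "1 \<le> p" "0 \<le> x" "0 \<le> y"
  shows "p * x * y powr (p - 1) \<le> x powr p + (p - 1) * y powr p"
proof (cases "p = 1 \<or> y = 0 \<or> x = 0")
  case True
  then show ?thesis using assms by auto
next
  case False
  then have p: "1 < p" and x: "0 < x" and y: "0 < y" using assms by auto
  have "x * y powr (p - 1) \<le> x powr p / p + (y powr (p - 1)) powr (p / (p - 1)) / (p / (p - 1))"
    by (rule Youngs_inequality) (use p x y in \<open>auto simp: field_simps\<close>)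
  also have "(y powr (p - 1)) powr (p / (p - 1)) = y powr p" using p by (simp add: powr_powr)
  finally have "x * y powr (p - 1) \<le> x powr p / p + y powr p / (p / (p - 1))" .
  then have "p * (x * y powr (p - 1)) \<le> p * (x powr p / p + y powr p / (p / (p - 1)))"
    using p by (intro mult_left_mono) auto
  also have "\<dots> = x powr p + (p - 1) * y powr p" using p by (simp add: field_simps)
  finally show ?thesis by (simp add: mult.assoc)
qed

lemma powr_mult_self: "0 \<le> (y::real) \<Longrightarrow> y * y powr (p - 1) = y powr p"
  by (cases "y = 0") (auto simp: powr_mult_base)

lemma powr_diff_le:
  fixes x y p :: real
  assumes "1 \<le> p" "0 \<le> x" "0 \<le> y"
  shows "y powr p - x powr p \<le> p * y powr (p - 1) * (y - x)"
proof -
  have "p * y powr (p - 1) * (y - x) = p * (y * y powr (p - 1)) - p * x * y powr (p - 1)"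
    by (simp add: algebra_simps)
  also have "\<dots> = p * y powr p - p * x * y powr (p - 1)"
    using assms by (simp add: powr_mult_self)
  finally show ?thesis using powr_tangent[OF assms] by (simp add: left_diff_distrib)
qed

text \<open>The tangent of the concave function x powr a at y. It comes from the convex case with
  exponent 1 / a at the points x powr a and y powr a.\<close>

lemma powr_concave_diff:
  fixes x y a :: real
  assumes "0 < a" "a \<le> 1" "0 \<le> x" "0 < y"
  shows "a * (y powr (a - 1) * (y - x)) \<le> y powr a - x powr a"
proof -
  have "(1/a) * x powr a * (y powr a) powr (1/a - 1) \<le> (x powr a) powr (1/a) + (1/a - 1) * (y powr a) powr (1/a)"
    by (rule powr_tangent) (use assms in auto)
  moreover have "(y powr a) powr (1/a - 1) = y powr (1 - a)"
    using assms by (simp add: powr_powr right_diff_distrib)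
  ultimately have "(1/a) * (x powr a * y powr (1 - a)) \<le> x + (1/a - 1) * y"
    using assms by (simp add: powr_powr mult.assoc)
  then have "a * ((1/a) * (x powr a * y powr (1 - a))) \<le> a * (x + (1/a - 1) * y)"
    using assms by (intro mult_left_mono) auto
  then have "x powr a * y powr (1 - a) \<le> a * x + (1 - a) * y"
    using assms by (simp add: distrib_left left_diff_distrib right_diff_distrib)
  then have "x powr a * y powr (1 - a) * y powr (a - 1) \<le> (a * x + (1 - a) * y) * y powr (a - 1)"
    by (intro mult_right_mono) auto
  also have "x powr a * y powr (1 - a) * y powr (a - 1) = x powr a"
    using assms by (simp add: powr_add[symmetric] mult.assoc)
  also have "(a * x + (1 - a) * y) * y powr (a - 1) = a * x * y powr (a - 1) + (1 - a) * y powr a"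
    using assms powr_mult_self[of y a] by (simp add: distrib_right mult.assoc)
  finally have le: "x powr a \<le> a * x * y powr (a - 1) + (1 - a) * y powr a" .
  have "a * (y powr (a - 1) * (y - x)) = a * (y * y powr (a - 1)) - a * x * y powr (a - 1)"
    by (simp add: algebra_simps)
  also have "\<dots> = a * y powr a - a * x * y powr (a - 1)"
    using assms powr_mult_self[of y a] by simp
  finally show ?thesis using le by (simp add: left_diff_distrib)
qed

text \<open>If y \<le> e * x the first summand suffices, otherwise x \<le> y / e and the second
  does. The explicit constants matter: a small multiple of x powr p is later absorbed into a
  left-hand side.\<close>

lemma powr_young:
  fixes x y e p :: real
  assumes "0 \<le> x" "0 \<le> y" "0 < e" "1 \<le> p"
  shows "x powr (p - 1) * y \<le> e * x powr p + e powr (1 - p) * y powr p"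
proof (cases "y \<le> e * x")
  case True
  have "x powr (p - 1) * y \<le> x powr (p - 1) * (e * x)" using True by (intro mult_left_mono) auto
  also have "\<dots> = e * x powr p" using assms powr_mult_self[of x p] by (simp add: mult_ac)
  also have "\<dots> \<le> e * x powr p + e powr (1 - p) * y powr p" by simp
  finally show ?thesis .
next
  case False
  then have "x \<le> y / e" using assms by (simp add: field_simps)
  have "x powr (p - 1) * y \<le> (y / e) powr (p - 1) * y"
    using assms \<open>x \<le> y / e\<close> by (intro mult_right_mono powr_mono2) auto
  also have "\<dots> = e powr (1 - p) * (y * y powr (p - 1))"
    using assms powr_minus_divide[of e "p - 1"] by (simp add: powr_divide)
  also have "\<dots> = e powr (1 - p) * y powr p" using assms by (simp add: powr_mult_self)
  also have "\<dots> \<le> e * x powr p + e powr (1 - p) * y powr p" using assms by simp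
  finally show ?thesis .
qed

text \<open>\<open>powr_young\<close> at the square of x with exponent p / 2.\<close>

lemma powr_young2:
  fixes x w e p :: real
  assumes "0 \<le> x" "0 \<le> w" "0 < e" "2 < p"
  shows "x powr (p - 2) * w \<le> e * x powr p + e powr (1 - p / 2) * w powr (p / 2)"
proof -
  have "(x powr 2) powr (p/2 - 1) * w \<le> e * (x powr 2) powr (p/2) + e powr (1 - p/2) * w powr (p/2)"
    by (rule powr_young) (use assms in auto)
  moreover have "2 * (p / 2 - 1) = p - 2" "2 * (p / 2) = p" by simp_all
  ultimately show ?thesis by (simp only: powr_powr)
qed

lemma powr_add_le:
  fixes x y p :: real
  assumes "0 \<le> x" "0 \<le> y" "0 \<le> p"
  shows "(x + y) powr p \<le> 2 powr p * (x powr p + y powr p)"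
proof -
  have "(x + y) powr p \<le> (2 * max x y) powr p" using assms by (intro powr_mono2) auto
  also have "\<dots> = 2 powr p * max x y powr p" using assms by (simp add: powr_mult)
  also have "max x y powr p \<le> x powr p + y powr p" by (auto simp: max_def)
  finally show ?thesis by simp
qed

text \<open>The derivative in u is nonpositive because a - 1 is, so the increment is largest at u =
  0. In the applications u is a square, and only the growth of S has to be paid for.\<close>

lemma powr_concave_increments:
  fixes u S S' a :: real
  assumes "0 < a" "a \<le> 1" "0 \<le> u" "0 < S" "S \<le> S'"
  shows "(u + S') powr a - (u + S) powr a \<le> S' powr a - S powr a"
proof -
  let ?h = "\<lambda>t. (t + S') powr a - (t + S) powr a"
  have "?h u \<le> ?h 0"
  proof (rule DERIV_nonpos_imp_nonincreasing[OF \<open>0 \<le> u\<close>])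
    fix t assume "0 \<le> t" "t \<le> u"
    have "(?h has_real_derivative (a * (t + S') powr (a - 1) - a * (t + S) powr (a - 1))) (at t)"
      using assms \<open>0 \<le> t\<close> by (auto intro!: derivative_eq_intros)
    moreover have "(t + S') powr (a - 1) \<le> (t + S) powr (a - 1)"
      using assms \<open>0 \<le> t\<close> by (intro powr_mono2') auto
    ultimately show "\<exists>y. (?h has_real_derivative y) (at t) \<and> y \<le> 0"
      using assms by (intro exI[of _ "a * (t + S') powr (a - 1) - a * (t + S) powr (a - 1)"])
        (auto intro: mult_left_mono)
  qed
  then show ?thesis by simp
qed

section \<open>Signed powers and the smoothed slope\<close>

definition signed_powr :: "real \<Rightarrow> real \<Rightarrow> real" where
  "signed_powr r x = sgn x * \<bar>x\<bar> powr r"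

lemma abs_signed_powr: "\<bar>signed_powr r x\<bar> = \<bar>x\<bar> powr r"
  by (auto simp: signed_powr_def abs_mult sgn_if)

text \<open>On a half-line this is the tangent bound. Across the origin the two bounds from zero add
  up, since \<bar>x - y\<bar> is then \<bar>x\<bar> + \<bar>y\<bar>.\<close>

lemma signed_powr_lipschitz:
  assumes "1 \<le> r" "\<bar>x\<bar> \<le> m" "\<bar>y\<bar> \<le> m"
  shows "\<bar>signed_powr r x - signed_powr r y\<bar> \<le> r * m powr (r - 1) * \<bar>x - y\<bar>"
proof -
  have same: "x powr r - y powr r \<le> r * m powr (r - 1) * (x - y)"
    if "0 \<le> y" "y \<le> x" "x \<le> m" for x y :: real
  proof -
    have "x powr r - y powr r \<le> r * x powr (r - 1) * (x - y)"
      by (rule powr_diff_le) (use that assms in auto)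
    also have "\<dots> \<le> r * m powr (r - 1) * (x - y)"
      using that assms by (intro mult_right_mono mult_left_mono powr_mono2) auto
    finally show ?thesis .
  qed
  have one: "x powr r \<le> r * m powr (r - 1) * x" if "0 \<le> x" "x \<le> m" for x :: real
    using same[of 0 x] that by simp
  have mono: "y powr r \<le> x powr r" if "0 \<le> y" "y \<le> x" for x y :: real
    using that assms by (intro powr_mono2) auto
  consider "0 \<le> y" "y \<le> x" | "0 \<le> x" "x \<le> y" | "x \<le> 0" "y \<le> x" | "y \<le> 0" "x \<le> y"
    | "x < 0" "0 < y" | "y < 0" "0 < x" by linarith
  then show ?thesis
  proof cases
    case 1 then show ?thesis using same[of y x] mono[of y x] assms
      by (auto simp: signed_powr_def sgn_if)
  next
    case 2 then show ?thesis using same[of x y] mono[of x y] assms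
      by (auto simp: signed_powr_def sgn_if)
  next
    case 3 then show ?thesis using same[of "-x" "-y"] mono[of "-x" "-y"] assms
      by (auto simp: signed_powr_def sgn_if)
  next
    case 4 then show ?thesis using same[of "-y" "-x"] mono[of "-y" "-x"] assms
      by (auto simp: signed_powr_def sgn_if)
  next
    case 5
    then have e: "signed_powr r x = - ((-x) powr r)" "signed_powr r y = y powr r" by (simp_all add: signed_powr_def)
    have "\<bar>signed_powr r x - signed_powr r y\<bar> = (-x) powr r + y powr r"
      using powr_ge_zero[of "-x" r] powr_ge_zero[of y r] unfolding e by linarith
    also have "\<dots> \<le> r * m powr (r - 1) * (-x) + r * m powr (r - 1) * y"
      using one[of "-x"] one[of y] 5 assms by (intro add_mono) auto
    finally show ?thesis using 5 by (simp add: algebra_simps)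
  next
    case 6
    then have e: "signed_powr r x = x powr r" "signed_powr r y = - ((-y) powr r)" by (simp_all add: signed_powr_def)
    have "\<bar>signed_powr r x - signed_powr r y\<bar> = x powr r + (-y) powr r"
      using powr_ge_zero[of "-y" r] powr_ge_zero[of x r] unfolding e by linarith
    also have "\<dots> \<le> r * m powr (r - 1) * x + r * m powr (r - 1) * (-y)"
      using one[of "-y"] one[of x] 6 assms by (intro add_mono) auto
    finally show ?thesis using 6 by (simp add: algebra_simps)
  qed
qed

lemma abs_powr_diff_le:
  assumes "1 \<le> (p::real)"
  shows "\<bar>x\<bar> powr p - \<bar>y\<bar> powr p \<le> p * signed_powr (p - 1) x * (x - y)"
proof -
  have "\<bar>x\<bar> powr p - \<bar>y\<bar> powr p \<le> p * \<bar>x\<bar> powr (p - 1) * (\<bar>x\<bar> - \<bar>y\<bar>)"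
    by (rule powr_diff_le) (use assms in auto)
  also have "\<dots> \<le> p * \<bar>x\<bar> powr (p - 1) * (sgn x * (x - y))"
    using assms by (cases "x = 0") (auto intro!: mult_left_mono simp: sgn_if)
  finally show ?thesis by (simp add: signed_powr_def mult_ac)
qed

text \<open>For \<open>q = \<alpha> / 2 - 1\<close>, \<open>\<alpha>\<close> times this is the derivative of \<open>(x\<^sup>2 + S) powr (\<alpha> / 2)\<close>, a smoothing
  of \<open>\<bar>x\<bar> powr \<alpha>\<close>; when \<open>\<alpha> \<le> 2\<close> its slope stays bounded at the origin.\<close>

definition smooth_powr :: "real \<Rightarrow> real \<Rightarrow> real \<Rightarrow> real" where
  "smooth_powr q S x = x * (x\<^sup>2 + S) powr q"

text \<open>With v and u the Euclidean norms of (x, sqrt S) and (y, sqrt S), the tangent inequality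
  for v powr \<alpha> leaves the factor v * (v - u), which Cauchy-Schwarz in the plane bounds by x *
  (x - y).\<close>

lemma smooth_powr_convex:
  assumes "1 \<le> \<alpha>" "0 < S"
  shows "(x\<^sup>2 + S) powr (\<alpha> / 2) - (y\<^sup>2 + S) powr (\<alpha> / 2)
     \<le> \<alpha> * smooth_powr (\<alpha> / 2 - 1) S x * (x - y)"
proof -
  define u v where "u = sqrt (y\<^sup>2 + S)" and "v = sqrt (x\<^sup>2 + S)"
  have pos: "y\<^sup>2 + S > 0" "x\<^sup>2 + S > 0" using assms by (auto intro: add_nonneg_pos)
  then have u: "u > 0" "u\<^sup>2 = y\<^sup>2 + S" and v: "v > 0" "v\<^sup>2 = x\<^sup>2 + S"
    by (auto simp: u_def v_def)
  have up: "(y\<^sup>2 + S) powr r = u powr (2 * r)" for r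
  proof -
    have "y\<^sup>2 + S = u powr 2" using u by simp
    then show ?thesis by (simp only: powr_powr)
  qed
  have vp: "(x\<^sup>2 + S) powr r = v powr (2 * r)" for r
  proof -
    have "x\<^sup>2 + S = v powr 2" using v by simp
    then show ?thesis by (simp only: powr_powr)
  qed
  have "(x * y + S)\<^sup>2 \<le> (u * v)\<^sup>2"
  proof -
    have "(u * v)\<^sup>2 - (x * y + S)\<^sup>2 = S * (x - y)\<^sup>2"
      by (simp add: power_mult_distrib u(2) v(2)) (simp add: power2_eq_square algebra_simps)
    moreover have "0 \<le> S * (x - y)\<^sup>2" using assms by simp
    ultimately show ?thesis by linarith
  qed
  then have uv: "x * y + S \<le> u * v"
    by (rule power2_le_imp_le) (use u(1) v(1) in simp)
  have "v powr \<alpha> - u powr \<alpha> \<le> \<alpha> * v powr (\<alpha> - 1) * (v - u)"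
    by (rule powr_diff_le) (use assms u(1) v(1) in auto)
  also have "v powr (\<alpha> - 1) = v powr (\<alpha> - 2) * v"
    using v(1) powr_mult_self[of v "\<alpha> - 1"] by (simp add: mult.commute)
  also have "\<alpha> * (v powr (\<alpha> - 2) * v) * (v - u) = \<alpha> * v powr (\<alpha> - 2) * (v\<^sup>2 - u * v)"
    by (simp add: power2_eq_square algebra_simps)
  also have "\<dots> \<le> \<alpha> * v powr (\<alpha> - 2) * (x * (x - y))"
    unfolding v(2) by (rule mult_left_mono) (use uv assms in \<open>auto simp: power2_eq_square right_diff_distrib\<close>)
  finally have "v powr \<alpha> - u powr \<alpha> \<le> \<alpha> * (x * v powr (\<alpha> - 2)) * (x - y)"
    by (simp only: mult_ac)
  then show ?thesis unfolding up vp smooth_powr_def by (simp add: right_diff_distrib)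
qed

text \<open>The slope of a convex function is monotone: the gradient inequalities between x and y in
  both orders add up to a nonnegative product.\<close>

lemma smooth_powr_mono:
  assumes "1 \<le> \<alpha>" "0 < S" "y \<le> x"
  shows "smooth_powr (\<alpha> / 2 - 1) S y \<le> smooth_powr (\<alpha> / 2 - 1) S x"
proof (rule ccontr)
  assume "\<not> ?thesis"
  then have lt: "smooth_powr (\<alpha> / 2 - 1) S x - smooth_powr (\<alpha> / 2 - 1) S y < 0" by simp
  then have "y < x" using assms(3) by (cases "x = y") auto
  have "0 \<le> \<alpha> * smooth_powr (\<alpha> / 2 - 1) S x * (x - y) + \<alpha> * smooth_powr (\<alpha> / 2 - 1) S y * (y - x)"
    using smooth_powr_convex[OF assms(1,2), of x y] smooth_powr_convex[OF assms(1,2), of y x] by linarith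
  also have "\<dots> = \<alpha> * ((smooth_powr (\<alpha> / 2 - 1) S x - smooth_powr (\<alpha> / 2 - 1) S y) * (x - y))"
    by (simp add: algebra_simps)
  also have "\<dots> < 0" using lt \<open>y < x\<close> assms by (intro mult_pos_neg mult_neg_pos) auto
  finally show False by simp
qed

text \<open>On the positive half-line the power factor decreases, so growth comes from the factor x
  alone, at a rate of at most S powr (\<alpha> / 2 - 1). Oddness gives the other half-line, and the
  two are joined at the origin.\<close>

lemma smooth_powr_lipschitz:
  assumes "1 \<le> \<alpha>" "\<alpha> \<le> 2" "0 < S"
  shows "\<bar>smooth_powr (\<alpha> / 2 - 1) S x - smooth_powr (\<alpha> / 2 - 1) S y\<bar> \<le> S powr (\<alpha> / 2 - 1) * \<bar>x - y\<bar>"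
proof -
  let ?q = "\<alpha> / 2 - 1"
  have qS: "(z\<^sup>2 + S) powr ?q \<le> S powr ?q" for z
    using assms by (intro powr_mono2') auto
  have nonneg: "smooth_powr ?q S x - smooth_powr ?q S y \<le> S powr ?q * (x - y)"
    if "0 \<le> y" "y \<le> x" for x y
  proof -
    have "(x\<^sup>2 + S) powr ?q \<le> (y\<^sup>2 + S) powr ?q"
      using assms that by (intro powr_mono2') (auto intro: add_nonneg_pos power_mono)
    then have "smooth_powr ?q S x - smooth_powr ?q S y \<le> (x - y) * (x\<^sup>2 + S) powr ?q"
      using that mult_left_mono[of "(x\<^sup>2 + S) powr ?q" "(y\<^sup>2 + S) powr ?q" y]
      by (simp add: smooth_powr_def algebra_simps)
    also have "\<dots> \<le> (x - y) * S powr ?q" using that qS by (intro mult_left_mono) auto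
    finally show ?thesis by (simp add: mult.commute)
  qed
  have le: "smooth_powr ?q S x - smooth_powr ?q S y \<le> S powr ?q * (x - y)" if "y \<le> x" for x y
  proof -
    consider "0 \<le> y" | "x \<le> 0" | "y < 0" "0 < x" by linarith
    then show ?thesis
    proof cases
      case 1 then show ?thesis using nonneg that by simp
    next
      case 2 then show ?thesis using nonneg[of "-x" "-y"] that by (simp add: smooth_powr_def)
    next
      case 3
      have "smooth_powr ?q S x \<le> S powr ?q * x" "smooth_powr ?q S (-y) \<le> S powr ?q * (-y)"
        using nonneg[of 0 x] nonneg[of 0 "-y"] 3 by (auto simp: smooth_powr_def)
      then show ?thesis by (simp add: smooth_powr_def algebra_simps)
    qed
  qed
  show ?thesis
    using le[of x y] le[of y x] smooth_powr_mono[OF assms(1,3), of x y] smooth_powr_mono[OF assms(1,3), of y x]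
    by (cases "y \<le> x") (auto simp: abs_if)
qed

text \<open>The exponent \<alpha> / 2 - 1 is nonpositive, so dropping S increases the power. The
  bound is free of S, which controls the weights whatever the smoothing.\<close>

lemma smooth_powr_bound:
  assumes "\<alpha> \<le> 2" "0 < S"
  shows "\<bar>smooth_powr (\<alpha> / 2 - 1) S x\<bar> \<le> \<bar>x\<bar> powr (\<alpha> - 1)"
proof (cases "x = 0")
  case True then show ?thesis by (simp add: smooth_powr_def)
next
  case False
  have "(x\<^sup>2 + S) powr (\<alpha> / 2 - 1) \<le> (x\<^sup>2) powr (\<alpha> / 2 - 1)"
    using assms False by (intro powr_mono2') auto
  also have "(x\<^sup>2) powr (\<alpha> / 2 - 1) = \<bar>x\<bar> powr (\<alpha> - 2)"
  proof -
    have "x\<^sup>2 = \<bar>x\<bar> powr 2" using False by simp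
    then show ?thesis by (simp only: powr_powr) (simp add: algebra_simps)
  qed
  finally have "\<bar>smooth_powr (\<alpha> / 2 - 1) S x\<bar> \<le> \<bar>x\<bar> * \<bar>x\<bar> powr (\<alpha> - 2)"
    by (simp add: smooth_powr_def abs_mult mult_left_mono)
  also have "\<dots> = \<bar>x\<bar> powr (\<alpha> - 1)" using powr_mult_self[of "\<bar>x\<bar>" "\<alpha> - 1"] by (simp add: algebra_simps)
  finally show ?thesis .
qed

text \<open>Only the part of \<open>S\<close> that dominates \<open>w\<close> pays for the decrease of the weight.\<close>

lemma smooth_powr_weight_change:
  assumes "0 < \<alpha>" "\<alpha> \<le> 2" "0 < S" "S \<le> S'" "0 \<le> w" "w * \<bar>x\<bar> \<le> S"
  shows "w * \<bar>smooth_powr (\<alpha> / 2 - 1) S x - smooth_powr (\<alpha> / 2 - 1) S' x\<bar>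
    \<le> (2 / \<alpha>) * (S' powr (\<alpha> / 2) - S powr (\<alpha> / 2))"
proof -
  let ?a = "\<alpha> / 2"
  define t t' where "t = x\<^sup>2 + S" and "t' = x\<^sup>2 + S'"
  have t: "0 < t" "t \<le> t'" "S \<le> t" using assms by (auto simp: t_def t'_def intro: add_nonneg_pos)
  have dec: "t' powr (?a - 1) \<le> t powr (?a - 1)" using t assms by (intro powr_mono2') auto
  have "w * \<bar>smooth_powr (\<alpha> / 2 - 1) S x - smooth_powr (\<alpha> / 2 - 1) S' x\<bar>
     = w * \<bar>x\<bar> * (t powr (?a - 1) - t' powr (?a - 1))"
    using dec by (simp add: smooth_powr_def t_def[symmetric] t'_def[symmetric] abs_mult
        right_diff_distrib[symmetric])
  \<comment> \<open>\<open>w * \<bar>x\<bar> \<le> S \<le> t\<close> replaces the factor by t. The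
    product then splits into a nonpositive difference of powers and a tangent term, which concavity
    bounds by an increment of t powr (\<alpha> / 2).\<close>
  also have "\<dots> \<le> t * (t powr (?a - 1) - t' powr (?a - 1))"
    using dec assms t by (intro mult_right_mono) auto
  also have "\<dots> = (t powr ?a - t' powr ?a) + t' powr (?a - 1) * (t' - t)"
    using t powr_mult_self[of t ?a] powr_mult_self[of t' ?a]
    by (simp only: right_diff_distrib left_diff_distrib mult.commute[of _ t']) simp
  also have "\<dots> \<le> t' powr (?a - 1) * (t' - t)"
    using powr_mono2[of ?a t t'] t assms by simp
  also have "\<dots> \<le> (2 / \<alpha>) * (t' powr ?a - t powr ?a)"
    using powr_concave_diff[of ?a t t'] t assms by (simp add: field_simps)
  also have "\<dots> \<le> (2 / \<alpha>) * (S' powr ?a - S powr ?a)"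
    unfolding t_def t'_def using assms by (intro mult_left_mono powr_concave_increments) auto
  finally show ?thesis .
qed

section \<open>Pathwise inequalities along a time grid\<close>

primrec running_max :: "(nat \<Rightarrow> real) \<Rightarrow> nat \<Rightarrow> real" where
  "running_max x 0 = \<bar>x 0\<bar>"
| "running_max x (Suc i) = max (running_max x i) \<bar>x (Suc i)\<bar>"

lemma running_max_ge: "i \<le> n \<Longrightarrow> \<bar>x i\<bar> \<le> running_max x n"
  by (induction n) (auto simp: le_Suc_eq)

lemma running_max_mono: "i \<le> j \<Longrightarrow> running_max x i \<le> running_max x j"
  by (induction j) (auto simp: le_Suc_eq)

lemma running_max_nonneg [simp]: "0 \<le> running_max x n"
  by (induction n) auto

lemma running_max_le: "(\<And>i. i \<le> n \<Longrightarrow> \<bar>x i\<bar> \<le> c) \<Longrightarrow> running_max x n \<le> c"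
  by (induction n) auto

text \<open>A pathwise form of Doob's inequality. The running maximum moves only where it equals the
  current \<bar>x\<bar>, and the tangent inequality controls the growth of its p-th power there. The
  weights are nonnegative and known at time i + 1, so that for a martingale each \<bar>x\<bar> can
  be replaced in mean by the terminal one, after which they telescope.\<close>

lemma doob_pathwise:
  assumes "1 < p"
  shows "running_max x n powr p \<le> p / (p - 1) *
    (running_max x 0 powr (p - 1) * \<bar>x 0\<bar> +
     (\<Sum>i<n. (running_max x (Suc i) powr (p - 1) - running_max x i powr (p - 1)) * \<bar>x (Suc i)\<bar>))"
proof (induction n)
  case 0
  have "1 \<le> p / (p - 1)" using assms by (simp add: field_simps)
  then have "1 * \<bar>x 0\<bar> powr p \<le> p / (p - 1) * \<bar>x 0\<bar> powr p" by (intro mult_right_mono) auto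
  then show ?case using powr_mult_self[of "\<bar>x 0\<bar>" p] by (simp add: mult_ac)
next
  case (Suc n)
  let ?m = "running_max x n" and ?m' = "running_max x (Suc n)"
  have "p * ?m' * ?m powr (p - 1) \<le> ?m' powr p + (p - 1) * ?m powr p"
    by (rule powr_tangent) (use assms in \<open>auto simp del: running_max.simps\<close>)
  then have "(p - 1) * (?m' powr p - ?m powr p) \<le> p * (?m' powr p - ?m powr (p - 1) * ?m')"
    by (simp only: left_diff_distrib right_diff_distrib mult_1 mult_ac)
  also have "?m' powr p - ?m powr (p - 1) * ?m' = (?m' powr (p - 1) - ?m powr (p - 1)) * ?m'"
    using powr_mult_self[OF running_max_nonneg[of x "Suc n"], of p] by (simp add: algebra_simps del: running_max.simps)
  also have "\<dots> = (?m' powr (p - 1) - ?m powr (p - 1)) * \<bar>x (Suc n)\<bar>"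
    by (auto simp: max_def)
  finally have "?m' powr p - ?m powr p \<le> p / (p - 1) * ((?m' powr (p - 1) - ?m powr (p - 1)) * \<bar>x (Suc n)\<bar>)"
    using assms by (simp add: field_simps del: running_max.simps)
  with Suc show ?case by (simp add: distrib_left del: running_max.simps)
qed

lemma abel_sum_diff:
  fixes G D :: "nat \<Rightarrow> real"
  shows "- (\<Sum>i<n. G i * (D (Suc i) - D i)) =
    G 0 * D 0 - G n * D n + (\<Sum>i<n. D (Suc i) * (G (Suc i) - G i))"
  by (induction n) (auto simp: algebra_simps)

text \<open>Write N = y + k with \<bar>y\<bar> \<le> Q. Against increasing weights \<psi> the
  increments of k reproduce the p-th power up to the mesh, and those of y cost at most 2 * \<psi> n
  * Q after summation by parts. Truncation at c bounds the weights, so that for a martingale N the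
  sum over its increments has mean zero without any higher moment of k.\<close>

lemma increasing_part_pathwise:
  fixes k N :: "nat \<Rightarrow> real"
  assumes p: "1 < p" and c: "0 < c" and k0: "k 0 = 0"
    and inc: "\<And>i. i < n \<Longrightarrow> k i \<le> k (Suc i)"
    and small: "\<And>i. i < n \<Longrightarrow> k (Suc i) - k i \<le> \<delta>"
    and Q: "\<And>i. i \<le> n \<Longrightarrow> \<bar>N i - k i\<bar> \<le> Q"
  shows "min (k n) c powr p \<le> p * ((\<Sum>i<n. min (k i) c powr (p - 1) * (N (Suc i) - N i))
      + 2 * (min (k n) c powr (p - 1) * Q) + min (k n) c powr (p - 1) * \<delta>)"
proof -
  define \<psi> where "\<psi> i = min (k i) c powr (p - 1)" for i
  define y where "y i = N i - k i" for i
  have nonneg: "0 \<le> k i" if "i \<le> n" for i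
    using that by (induction i) (use inc k0 in \<open>auto intro: order_trans\<close>)
  have \<psi>_inc: "\<psi> i \<le> \<psi> (Suc i)" if "i < n" for i
    unfolding \<psi>_def using p c nonneg[of i] nonneg[of "Suc i"] inc[of i] that by (intro powr_mono2) auto
  \<comment> \<open>The tangent inequality asks for the weight at the right end of a step. Moving it
    to the left end costs the increment of \<psi> times \<delta>, and these costs telescope to
    \<psi> j * \<delta>.\<close>
  have K: "min (k j) c powr p \<le> p * ((\<Sum>i<j. \<psi> i * (k (Suc i) - k i)) + \<psi> j * \<delta>)" if "j \<le> n" for j
    using that
  proof (induction j)
    case 0
    then show ?case using k0 c p by (simp add: \<psi>_def)
  next
    case (Suc j)
    then have j: "j < n" "j \<le> n" by auto
    have "min (k (Suc j)) c powr p - min (k j) c powr p \<le> p * \<psi> (Suc j) * (min (k (Suc j)) c - min (k j) c)"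
      unfolding \<psi>_def using nonneg[of j] nonneg[of "Suc j"] Suc.prems c p by (intro powr_diff_le) auto
    also have "\<dots> \<le> p * \<psi> (Suc j) * (k (Suc j) - k j)"
      using inc[OF j(1)] p by (intro mult_left_mono) (auto simp: \<psi>_def)
    also have "\<dots> = p * (\<psi> j * (k (Suc j) - k j) + (\<psi> (Suc j) - \<psi> j) * (k (Suc j) - k j))"
      by (simp add: algebra_simps)
    also have "\<dots> \<le> p * (\<psi> j * (k (Suc j) - k j) + (\<psi> (Suc j) - \<psi> j) * \<delta>)"
      using p \<psi>_inc[OF j(1)] small[OF j(1)] by (intro mult_left_mono add_left_mono) auto
    finally show ?case using Suc.IH[OF j(2)] by (simp add: algebra_simps)
  qed
  \<comment> \<open>Each step of the induction leaves the room (\<psi> (Suc j) - \<psi> j) * (Q - y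
    (Suc j)), nonnegative because the weights increase.\<close>
  have Y: "- (\<Sum>i<j. \<psi> i * (y (Suc i) - y i)) \<le> \<psi> j * Q - \<psi> j * y j" if "j \<le> n" for j
    using that
  proof (induction j)
    case 0
    then show ?case using Q[of 0] by (simp add: \<psi>_def y_def mult_left_mono flip: right_diff_distrib)
  next
    case (Suc j)
    have "0 \<le> (\<psi> (Suc j) - \<psi> j) * (Q - y (Suc j))"
      using \<psi>_inc[of j] Q[of "Suc j"] Suc.prems by (intro mult_nonneg_nonneg) (auto simp: y_def)
    then show ?case using Suc by (simp add: algebra_simps)
  qed
  have "(\<Sum>i<n. \<psi> i * (k (Suc i) - k i)) =
      (\<Sum>i<n. \<psi> i * (N (Suc i) - N i)) - (\<Sum>i<n. \<psi> i * (y (Suc i) - y i))"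
    by (simp add: sum_subtractf[symmetric] y_def algebra_simps)
  also have "\<dots> \<le> (\<Sum>i<n. \<psi> i * (N (Suc i) - N i)) + (\<psi> n * Q - \<psi> n * y n)"
    using Y[of n] by simp
  also have "\<dots> \<le> (\<Sum>i<n. \<psi> i * (N (Suc i) - N i)) + 2 * (\<psi> n * Q)"
  proof -
    have "\<psi> n * (- y n) \<le> \<psi> n * Q"
      using Q[of n] by (intro mult_left_mono) (auto simp: \<psi>_def y_def)
    then show ?thesis by (simp add: algebra_simps)
  qed
  finally have "(\<Sum>i<n. \<psi> i * (k (Suc i) - k i)) \<le> (\<Sum>i<n. \<psi> i * (N (Suc i) - N i)) + 2 * (\<psi> n * Q)" .
  then have "p * ((\<Sum>i<n. \<psi> i * (k (Suc i) - k i)) + \<psi> n * \<delta>)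
     \<le> p * ((\<Sum>i<n. \<psi> i * (N (Suc i) - N i)) + 2 * (\<psi> n * Q) + \<psi> n * \<delta>)"
    using p by (intro mult_left_mono) auto
  with K[of n] show ?thesis by (simp add: \<psi>_def)
qed

text \<open>
  The martingale \<open>N = D + (k - k')\<close> is integrated against \<open>grid_weight\<close>, an approximation of
  the derivative of \<open>\<bar>x\<bar>\<close> to the power \<open>\<alpha>\<close> along \<open>k - k'\<close>; no quadratic variation is needed
  because \<open>k - k'\<close> has finite variation.
\<close>

definition grid_weight :: "real \<Rightarrow> real \<Rightarrow> real \<Rightarrow> real" where
  "grid_weight \<alpha> S x =
     (if \<alpha> \<le> 2 then smooth_powr (\<alpha> / 2 - 1) S x else signed_powr (\<alpha> - 1) x)"

text \<open>The price of evaluating the weight at the left end of each step: a bound on its change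
  over a step, times the total variation v. For \<alpha> \<le> 2 the first entry of the minimum
  tends to zero with the mesh, and the second keeps the product below 2 * v powr \<alpha>, an
  integrable majorant.\<close>

definition grid_error :: "real \<Rightarrow> real \<Rightarrow> real \<Rightarrow> real \<Rightarrow> real" where
  "grid_error \<alpha> S \<delta> v = (if \<alpha> \<le> 2 then min (S powr (\<alpha> / 2 - 1) * \<delta>) (2 * v powr (\<alpha> - 1)) * v
     else (\<alpha> - 1) * v powr (\<alpha> - 2) * v * \<delta>)"

lemma grid_weight_bound:
  assumes "0 < S"
  shows "\<bar>grid_weight \<alpha> S x\<bar> \<le> \<bar>x\<bar> powr (\<alpha> - 1)"
  using smooth_powr_bound[of \<alpha> S x] assms by (auto simp: grid_weight_def abs_signed_powr)

text \<open>The indices that count are those at which R more than doubles, so the summands are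
  dominated by a geometric series that ends at R n.\<close>

lemma sum_doubling_le:
  fixes R :: "nat \<Rightarrow> real"
  assumes "\<And>i. i < n \<Longrightarrow> R i \<le> R (Suc i)" "0 \<le> R 0"
  shows "(\<Sum>i<n. if R (Suc i) \<le> 2 * R i then 0 else R (Suc i)) \<le> 2 * R n"
  using assms
proof (induction n)
  case (Suc n)
  have "(\<Sum>i<n. if R (Suc i) \<le> 2 * R i then 0 else R (Suc i)) \<le> 2 * R n"
    using Suc by auto
  moreover have "R n \<le> R (Suc n)" using Suc.prems by auto
  ultimately show ?case by auto
qed auto

section \<open>The difference of two increasing paths along a grid\<close>

lemma grid_mono:
  fixes f :: "nat \<Rightarrow> 'a::preorder"
  assumes "\<And>i. i < n \<Longrightarrow> f i \<le> f (Suc i)" "i \<le> j" "j \<le> n"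
  shows "f i \<le> f j"
  using assms(2,3)
proof (induction j)
  case (Suc j)
  then show ?case using assms(1)[of j] by (auto simp: le_Suc_eq intro: order_trans)
qed simp

text \<open>D stands for Y - Y' at the grid times, R for a positive increasing envelope of
  \<bar>D\<bar>, and \<delta> bounds the steps of k + k'. Positivity of R at time 0 keeps the
  smoothing parameter away from zero.\<close>

locale grid_path =
  fixes k k' D R :: "nat \<Rightarrow> real" and n :: nat and \<alpha> \<delta> :: real
  assumes \<alpha>: "1 < \<alpha>"
    and k0: "k 0 = 0" "k' 0 = 0"
    and inc: "\<And>i. i < n \<Longrightarrow> k i \<le> k (Suc i)" "\<And>i. i < n \<Longrightarrow> k' i \<le> k' (Suc i)"
    and small: "\<And>i. i < n \<Longrightarrow> (k (Suc i) + k' (Suc i)) - (k i + k' i) \<le> \<delta>"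
    and R0: "0 < R 0" and R_inc: "\<And>i. i < n \<Longrightarrow> R i \<le> R (Suc i)"
    and D_le: "\<And>i. i \<le> n \<Longrightarrow> \<bar>D i\<bar> \<le> R i"
begin

definition "A i = k i - k' i"
definition "V i = k i + k' i"
text \<open>The smoothing parameter. It increases, dominates R * R and R * V, and its increment
  dominates R (Suc i) * (V (Suc i) - V i); these three facts make the weighted changes of the slope
  telescope.\<close>

definition "S i = R i * (R i + V i)"
definition "m = running_max A n"
definition "G i = grid_weight \<alpha> (S i) (A i)"

lemma k_nonneg: "i \<le> n \<Longrightarrow> 0 \<le> k i" "i \<le> n \<Longrightarrow> 0 \<le> k' i"
  using grid_mono[of n k 0 i] grid_mono[of n k' 0 i] inc k0 by auto

lemma V_inc: "i < n \<Longrightarrow> V i \<le> V (Suc i)"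
  using inc[of i] by (simp add: V_def)

lemma V_le: "i \<le> n \<Longrightarrow> V i \<le> V n"
  using grid_mono[of n V i n] V_inc by auto

lemma V_nonneg: "i \<le> n \<Longrightarrow> 0 \<le> V i"
  using k_nonneg by (simp add: V_def)

lemma V0: "V 0 = 0" by (simp add: V_def k0)
lemma A0: "A 0 = 0" by (simp add: A_def k0)

lemma A_le_V: "i \<le> n \<Longrightarrow> \<bar>A i\<bar> \<le> V i"
  using k_nonneg[of i] by (auto simp: A_def V_def)

lemma A_le_m: "i \<le> n \<Longrightarrow> \<bar>A i\<bar> \<le> m"
  unfolding m_def by (rule running_max_ge)

lemma m_nonneg: "0 \<le> m" by (simp add: m_def)

lemma m_le_V: "m \<le> V n"
  unfolding m_def by (rule running_max_le) (use A_le_V V_le in \<open>auto intro: order_trans\<close>)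

lemma A_diff_le: "i < n \<Longrightarrow> \<bar>A (Suc i) - A i\<bar> \<le> V (Suc i) - V i"
  using inc[of i] by (auto simp: A_def V_def)

lemma V_small: "i < n \<Longrightarrow> V (Suc i) - V i \<le> \<delta>"
  using small by (simp add: V_def)

lemma R_pos: "i \<le> n \<Longrightarrow> 0 < R i"
  using grid_mono[of n R 0 i] R0 R_inc by auto

lemma R_le: "i \<le> n \<Longrightarrow> R i \<le> R n"
  using grid_mono[of n R i n] R_inc by auto

lemma S_pos: "i \<le> n \<Longrightarrow> 0 < S i"
  using R_pos[of i] V_nonneg[of i] by (simp add: S_def)

lemma S_inc: "i < n \<Longrightarrow> S i \<le> S (Suc i)"
  unfolding S_def using R_pos[of i] V_nonneg[of i] R_inc[of i] V_inc[of i]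
  by (intro mult_mono add_mono) auto

lemma S0_le: "i \<le> n \<Longrightarrow> S 0 \<le> S i"
  by (rule grid_mono[of n]) (auto intro: S_inc)

lemma R_powr_le: "R n powr \<alpha> \<le> S n powr (\<alpha> / 2)"
proof -
  have "R n powr \<alpha> = (R n powr 2) powr (\<alpha> / 2)" unfolding powr_powr by simp
  also have "\<dots> \<le> S n powr (\<alpha> / 2)"
    using R_pos[of n] V_nonneg[of n] \<alpha>
    by (intro powr_mono2) (auto simp: S_def power2_eq_square distrib_left)
  finally show ?thesis .
qed

lemma VR_le_S: "i \<le> n \<Longrightarrow> R i * V i \<le> S i"
  using R_pos[of i] by (simp add: S_def distrib_left)

lemma G0: "G 0 = 0"
  by (simp add: G_def A0 grid_weight_def smooth_powr_def signed_powr_def)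

lemma G_le: "i \<le> n \<Longrightarrow> \<bar>G i\<bar> \<le> m powr (\<alpha> - 1)"
proof -
  assume i: "i \<le> n"
  have "\<bar>G i\<bar> \<le> \<bar>A i\<bar> powr (\<alpha> - 1)" unfolding G_def by (rule grid_weight_bound[OF S_pos[OF i]])
  also have "\<dots> \<le> m powr (\<alpha> - 1)" using A_le_m[OF i] \<alpha> by (intro powr_mono2) auto
  finally show ?thesis .
qed

text \<open>Summation by parts moves the increments from D, of which only the size is known, to the
  weights. The boundary term at 0 vanishes with the weight (\<open>G0\<close>).\<close>

lemma sum_D_le: "- (\<Sum>i<n. G i * (D (Suc i) - D i))
    \<le> m powr (\<alpha> - 1) * R n + (\<Sum>i<n. R (Suc i) * \<bar>G (Suc i) - G i\<bar>)"
proof -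
  have "- (\<Sum>i<n. G i * (D (Suc i) - D i)) = - G n * D n + (\<Sum>i<n. D (Suc i) * (G (Suc i) - G i))"
    unfolding abel_sum_diff by (simp add: G0)
  also have "- G n * D n \<le> \<bar>G n\<bar> * \<bar>D n\<bar>" by (metis abs_ge_self abs_minus_cancel abs_mult)
  also have "\<bar>G n\<bar> * \<bar>D n\<bar> \<le> m powr (\<alpha> - 1) * R n"
    using G_le[of n] D_le[of n] by (intro mult_mono) auto
  also have "(\<Sum>i<n. D (Suc i) * (G (Suc i) - G i)) \<le> (\<Sum>i<n. R (Suc i) * \<bar>G (Suc i) - G i\<bar>)"
  proof (rule sum_mono)
    fix i assume "i \<in> {..<n}"
    then have "\<bar>D (Suc i)\<bar> * \<bar>G (Suc i) - G i\<bar> \<le> R (Suc i) * \<bar>G (Suc i) - G i\<bar>"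
      using D_le[of "Suc i"] by (intro mult_right_mono) auto
    then show "D (Suc i) * (G (Suc i) - G i) \<le> R (Suc i) * \<bar>G (Suc i) - G i\<bar>"
      by (metis abs_ge_self abs_mult order_trans)
  qed
  finally show ?thesis by simp
qed

lemma sum_V_diff: "(\<Sum>i<n. V (Suc i) - V i) = V n"
  by (simp add: sum_lessThan_telescope V0)

text \<open>\<open>F\<close> follows the smoothed power along the grid, in each step first moving A
  and then S. Its sum over A is the sum over the martingale D + A minus the sum over D, and the
  latter reduces to changes of the weight, which \<open>change\<close> bounds by increments of S
  powr (\<alpha> / 2) and a term at the doublings of R. The 7 is 1 from \<open>F\<close> and 6 from
  \<open>change\<close>; 3 * \<alpha> collects the boundary term and twice the doublings.\<close>

lemma small_exponent:
  assumes "\<alpha> \<le> 2"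
  shows "\<bar>A n\<bar> powr \<alpha> \<le> \<alpha> * (\<Sum>i<n. G i * ((D (Suc i) + A (Suc i)) - (D i + A i)))
     + \<alpha> * grid_error \<alpha> (S 0) \<delta> (V n) + 7 * S n powr (\<alpha> / 2) + 3 * \<alpha> * (m powr (\<alpha> - 1) * R n)"
proof -
  define q a where "q = \<alpha> / 2 - 1" and "a = \<alpha> / 2"
  have a: "0 < a" "a \<le> 1" "q = a - 1" using \<alpha> assms by (auto simp: a_def q_def)
  have G: "G i = smooth_powr q (S i) (A i)" for i
    using assms by (simp add: G_def grid_weight_def q_def)
  define e where "e = min (S 0 powr q * \<delta>) (2 * V n powr (\<alpha> - 1))"
  have F: "((A j)\<^sup>2 + S j) powr a
      \<le> S j powr a + \<alpha> * (\<Sum>i<j. G i * (A (Suc i) - A i)) + \<alpha> * (e * V j)" if "j \<le> n" for j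
    using that
  proof (induction j)
    case 0
    then show ?case by (simp add: A0 V0)
  next
    case (Suc j)
    then have j: "j < n" "j \<le> n" "Suc j \<le> n" by auto
    let ?d = "A (Suc j) - A j" and ?g = "smooth_powr q (S j) (A (Suc j))"
    have "((A (Suc j))\<^sup>2 + S (Suc j)) powr a - ((A (Suc j))\<^sup>2 + S j) powr a
        \<le> S (Suc j) powr a - S j powr a"
      using a S_pos[OF j(2)] S_inc[OF j(1)] by (intro powr_concave_increments) auto
    moreover have "((A (Suc j))\<^sup>2 + S j) powr a - ((A j)\<^sup>2 + S j) powr a \<le> \<alpha> * ?g * ?d"
      unfolding a_def q_def using \<alpha> S_pos[OF j(2)] by (intro smooth_powr_convex) auto
    moreover have "\<alpha> * ?g * ?d \<le> \<alpha> * (G j * ?d + e * (V (Suc j) - V j))"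
    proof -
      \<comment> \<open>Two bounds for the move to the left end: Lipschitz constant times mesh, and
        the sum of the sizes of both weights. Their minimum is \<open>e\<close>.\<close>
      have "\<bar>?g - G j\<bar> \<le> S j powr q * \<bar>?d\<bar>"
        unfolding G q_def using \<alpha> assms S_pos[OF j(2)] by (intro smooth_powr_lipschitz) auto
      also have "\<dots> \<le> S 0 powr q * \<delta>"
        using S0_le[OF j(2)] S_pos[of 0] a A_diff_le[OF j(1)] V_small[OF j(1)]
        by (intro mult_mono powr_mono2') auto
      finally have 1: "\<bar>?g - G j\<bar> \<le> S 0 powr q * \<delta>" .
      have "\<bar>?g\<bar> \<le> \<bar>A (Suc j)\<bar> powr (\<alpha> - 1)"
        unfolding q_def using assms S_pos[OF j(2)] by (intro smooth_powr_bound)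
      also have "\<dots> \<le> V n powr (\<alpha> - 1)"
        using A_le_V[OF j(3)] V_le[OF j(3)] \<alpha> by (intro powr_mono2) auto
      finally have "\<bar>?g\<bar> \<le> V n powr (\<alpha> - 1)" .
      moreover have "\<bar>G j\<bar> \<le> V n powr (\<alpha> - 1)"
        by (rule order_trans[OF G_le[OF j(2)]]) (use m_le_V m_nonneg \<alpha> in \<open>auto intro!: powr_mono2\<close>)
      ultimately have "\<bar>?g - G j\<bar> \<le> e" using 1 by (auto simp: e_def)
      then have "\<bar>?g - G j\<bar> * \<bar>?d\<bar> \<le> e * (V (Suc j) - V j)"
        using A_diff_le[OF j(1)] by (intro mult_mono) auto
      then have "(?g - G j) * ?d \<le> e * (V (Suc j) - V j)"
        by (metis abs_ge_self abs_mult order_trans)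
      then have "?g * ?d \<le> G j * ?d + e * (V (Suc j) - V j)" by (simp add: left_diff_distrib)
      then show ?thesis using \<alpha> by (simp add: mult.assoc)
    qed
    ultimately show ?case using Suc.IH[OF j(2)] by (simp add: algebra_simps)
  qed
  have change: "R (Suc i) * \<bar>G (Suc i) - G i\<bar> \<le> 3 * (2 / \<alpha>) * (S (Suc i) powr a - S i powr a)
      + (if R (Suc i) \<le> 2 * R i then 0 else R (Suc i)) * m powr (\<alpha> - 1)" if "i < n" for i
  proof -
    have i: "i \<le> n" "Suc i \<le> n" using that by auto
    have Sa: "S i powr a \<le> S (Suc i) powr a" using S_inc[OF that] S_pos[OF i(1)] a by (intro powr_mono2) auto
    \<comment> \<open>The intermediate weight has the new S and the old A, which separates the
      change of A from the change of S.\<close>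
    let ?h = "smooth_powr q (S (Suc i)) (A i)"
    have "R (Suc i) * \<bar>G (Suc i) - ?h\<bar> \<le> R (Suc i) * (S (Suc i) powr q * (V (Suc i) - V i))"
    proof (intro mult_left_mono)
      have "\<bar>G (Suc i) - ?h\<bar> \<le> S (Suc i) powr q * \<bar>A (Suc i) - A i\<bar>"
        unfolding G q_def using \<alpha> assms S_pos[OF i(2)] by (intro smooth_powr_lipschitz) auto
      also have "\<dots> \<le> S (Suc i) powr q * (V (Suc i) - V i)"
        using A_diff_le[OF that] by (intro mult_left_mono) auto
      finally show "\<bar>G (Suc i) - ?h\<bar> \<le> S (Suc i) powr q * (V (Suc i) - V i)" .
    qed (use R_pos[OF i(2)] in simp)
    also have "\<dots> \<le> S (Suc i) powr q * (S (Suc i) - S i)"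
    proof -
      \<comment> \<open>Once R alone is raised, what remains of the increment of S is exactly R (Suc
        i) times the increment of V.\<close>
      have "R i * (R i + V i) \<le> R (Suc i) * (R (Suc i) + V i)"
        using R_pos[OF i(1)] R_inc[OF that] V_nonneg[OF i(1)] by (intro mult_mono) auto
      then have "R (Suc i) * (V (Suc i) - V i) \<le> S (Suc i) - S i"
        by (simp add: S_def algebra_simps)
      then have "S (Suc i) powr q * (R (Suc i) * (V (Suc i) - V i)) \<le> S (Suc i) powr q * (S (Suc i) - S i)"
        by (intro mult_left_mono) auto
      then show ?thesis by (simp add: mult_ac)
    qed
    also have "\<dots> \<le> (2 / \<alpha>) * (S (Suc i) powr a - S i powr a)"
      using powr_concave_diff[of a "S i" "S (Suc i)"] a S_pos[OF i(1)] S_pos[OF i(2)] \<alpha>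
      by (simp add: a_def[symmetric] a(3)) (simp add: a_def field_simps)
    finally have 1: "R (Suc i) * \<bar>G (Suc i) - ?h\<bar> \<le> (2 / \<alpha>) * (S (Suc i) powr a - S i powr a)" .
    have dec: "\<bar>?h\<bar> \<le> \<bar>G i\<bar>"  "\<bar>?h - G i\<bar> \<le> \<bar>G i\<bar>"
    proof -
      have "((A i)\<^sup>2 + S (Suc i)) powr q \<le> ((A i)\<^sup>2 + S i) powr q"
        using S_inc[OF that] S_pos[OF i(1)] a by (intro powr_mono2') (auto intro: add_nonneg_pos)
      then show "\<bar>?h\<bar> \<le> \<bar>G i\<bar>"  "\<bar>?h - G i\<bar> \<le> \<bar>G i\<bar>"
        unfolding G smooth_powr_def right_diff_distrib[symmetric] abs_mult by (auto intro!: mult_left_mono)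
    qed
    have 2: "R (Suc i) * \<bar>?h - G i\<bar> \<le> 2 * ((2 / \<alpha>) * (S (Suc i) powr a - S i powr a))
      + (if R (Suc i) \<le> 2 * R i then 0 else R (Suc i)) * m powr (\<alpha> - 1)"
    \<comment> \<open>\<open>smooth_powr_weight_change\<close> wants a factor w with w * \<bar>A
      i\<bar> \<le> S i, which is known for w = R i. Where R at most doubles, this passes to R (Suc
      i) with a factor 2; elsewhere the full change is charged, and \<open>sum_doubling_le\<close>
      sums these charges.\<close>
    proof (cases "R (Suc i) \<le> 2 * R i")
      case True
      have "R (Suc i) * \<bar>?h - G i\<bar> \<le> 2 * (R i * \<bar>smooth_powr q (S i) (A i) - ?h\<bar>)"
        using True mult_right_mono[of "R (Suc i)" "2 * R i" "\<bar>?h - G i\<bar>"]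
        by (simp add: G abs_minus_commute mult.assoc)
      also have "\<dots> \<le> 2 * ((2 / \<alpha>) * (S (Suc i) powr a - S i powr a))"
      proof (intro mult_left_mono)
        have "R i * \<bar>A i\<bar> \<le> S i"
          using VR_le_S[OF i(1)] mult_left_mono[OF A_le_V[OF i(1)] less_imp_le[OF R_pos[OF i(1)]]] by linarith
        then show "R i * \<bar>smooth_powr q (S i) (A i) - ?h\<bar> \<le> (2 / \<alpha>) * (S (Suc i) powr a - S i powr a)"
          unfolding q_def a_def using \<alpha> assms S_pos[OF i(1)] S_inc[OF that] R_pos[OF i(1)]
          by (intro smooth_powr_weight_change) auto
      qed simp
      finally show ?thesis using True by simp
    next
      case False
      have "R (Suc i) * \<bar>?h - G i\<bar> \<le> R (Suc i) * m powr (\<alpha> - 1)"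
        using dec(2) G_le[OF i(1)] R_pos[OF i(2)] by (intro mult_left_mono) auto
      moreover have "0 \<le> 2 * ((2 / \<alpha>) * (S (Suc i) powr a - S i powr a))"
        using Sa \<alpha> by simp
      ultimately show ?thesis using False by simp
    qed
    have "R (Suc i) * \<bar>G (Suc i) - G i\<bar> \<le> R (Suc i) * (\<bar>G (Suc i) - ?h\<bar> + \<bar>?h - G i\<bar>)"
      using R_pos[OF i(2)] by (intro mult_left_mono) auto
    then show ?thesis using 1 2 by (simp only: distrib_left)
  qed
  have "(\<Sum>i<n. R (Suc i) * \<bar>G (Suc i) - G i\<bar>) \<le> (\<Sum>i<n. 3 * (2 / \<alpha>) * (S (Suc i) powr a - S i powr a)
      + (if R (Suc i) \<le> 2 * R i then 0 else R (Suc i)) * m powr (\<alpha> - 1))"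
    by (intro sum_mono change) auto
  also have "\<dots> = 3 * (2 / \<alpha>) * (S n powr a - S 0 powr a)
      + (\<Sum>i<n. if R (Suc i) \<le> 2 * R i then 0 else R (Suc i)) * m powr (\<alpha> - 1)"
    by (simp only: sum.distrib sum_distrib_left[symmetric] sum_distrib_right[symmetric]
        sum_lessThan_telescope[of "\<lambda>i. S i powr a"])
  also have "\<dots> \<le> 3 * (2 / \<alpha>) * S n powr a + 2 * R n * m powr (\<alpha> - 1)"
    using sum_doubling_le[of n R] R_inc R0 \<alpha>
    by (intro add_mono mult_left_mono mult_right_mono) auto
  finally have "- (\<Sum>i<n. G i * (D (Suc i) - D i))
      \<le> m powr (\<alpha> - 1) * R n + (3 * (2 / \<alpha>) * S n powr a + 2 * R n * m powr (\<alpha> - 1))"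
    using sum_D_le by linarith
  then have D: "\<alpha> * - (\<Sum>i<n. G i * (D (Suc i) - D i))
      \<le> 6 * S n powr a + 3 * \<alpha> * (m powr (\<alpha> - 1) * R n)"
    using \<alpha> mult_left_mono[of "- (\<Sum>i<n. G i * (D (Suc i) - D i))" _ \<alpha>]
    by (fastforce simp: field_simps)
  have "\<bar>A n\<bar> powr \<alpha> = ((A n)\<^sup>2) powr a"
  proof -
    have "(A n)\<^sup>2 = \<bar>A n\<bar> powr 2" by simp
    then show ?thesis by (simp only: powr_powr a_def) simp
  qed
  also have "\<dots> \<le> ((A n)\<^sup>2 + S n) powr a" using S_pos[of n] a by (intro powr_mono2) auto
  also note F[OF order_refl]
  also have "(\<Sum>i<n. G i * (A (Suc i) - A i))
     = (\<Sum>i<n. G i * ((D (Suc i) + A (Suc i)) - (D i + A i))) + - (\<Sum>i<n. G i * (D (Suc i) - D i))"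
    by (simp add: sum_subtractf[symmetric] algebra_simps)
  finally have "\<bar>A n\<bar> powr \<alpha> \<le> S n powr a
      + (\<alpha> * (\<Sum>i<n. G i * ((D (Suc i) + A (Suc i)) - (D i + A i)))
      + \<alpha> * - (\<Sum>i<n. G i * (D (Suc i) - D i))) + \<alpha> * (e * V n)"
    by (simp only: distrib_left)
  then show ?thesis using D assms unfolding a_def[symmetric]
    by (simp add: grid_error_def e_def q_def)
qed

text \<open>For \<alpha> > 2 the slope of \<bar>x\<bar> powr \<alpha> itself is Lipschitz on [-m, m]
  with constant (\<alpha> - 1) * m powr (\<alpha> - 2), up to the factor \<alpha>. The unsmoothed
  slope therefore serves as weight, and its changes are bounded by those of V.\<close>

lemma large_exponent:
  assumes "2 < \<alpha>"
  shows "\<bar>A n\<bar> powr \<alpha> \<le> \<alpha> * (\<Sum>i<n. G i * ((D (Suc i) + A (Suc i)) - (D i + A i)))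
     + \<alpha> * grid_error \<alpha> (S 0) \<delta> (V n) + \<alpha> * (m powr (\<alpha> - 1) * R n)
     + \<alpha> * (\<alpha> - 1) * (m powr (\<alpha> - 2) * (R n * V n))"
proof -
  have G: "G i = signed_powr (\<alpha> - 1) (A i)" for i
    using assms by (simp add: G_def grid_weight_def)
  define c where "c = (\<alpha> - 1) * m powr (\<alpha> - 2)"
  have c: "0 \<le> c" using \<alpha> by (simp add: c_def)
  have change: "\<bar>G (Suc i) - G i\<bar> \<le> c * (V (Suc i) - V i)" if "i < n" for i
  proof -
    have "\<alpha> - 1 - 1 = \<alpha> - 2" by simp
    then have "\<bar>G (Suc i) - G i\<bar> \<le> (\<alpha> - 1) * m powr (\<alpha> - 2) * \<bar>A (Suc i) - A i\<bar>"
      using signed_powr_lipschitz[of "\<alpha> - 1" "A (Suc i)" m "A i"] that assms A_le_m[of i] A_le_m[of "Suc i"]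
      unfolding G by auto
    also have "\<dots> \<le> c * (V (Suc i) - V i)"
      unfolding c_def using A_diff_le[OF that] \<alpha> by (intro mult_left_mono) auto
    finally show ?thesis .
  qed
  have F: "\<bar>A j\<bar> powr \<alpha> \<le> \<alpha> * (\<Sum>i<j. G i * (A (Suc i) - A i)) + \<alpha> * (c * \<delta> * V j)" if "j \<le> n" for j
    using that
  proof (induction j)
    case 0
    then show ?case by (simp add: A0 V0)
  next
    case (Suc j)
    then have j: "j < n" "j \<le> n" by auto
    let ?d = "A (Suc j) - A j"
    have "\<bar>A (Suc j)\<bar> powr \<alpha> - \<bar>A j\<bar> powr \<alpha> \<le> \<alpha> * (G (Suc j) * ?d)"
      using abs_powr_diff_le[of \<alpha> "A (Suc j)" "A j"] \<alpha> by (simp add: G mult.assoc)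
    moreover have "G (Suc j) * ?d \<le> G j * ?d + c * \<delta> * (V (Suc j) - V j)"
    proof -
      have "(G (Suc j) - G j) * ?d \<le> \<bar>G (Suc j) - G j\<bar> * \<bar>?d\<bar>" by (metis abs_ge_self abs_mult)
      also have "\<dots> \<le> (c * (V (Suc j) - V j)) * (V (Suc j) - V j)"
        using change[OF j(1)] A_diff_le[OF j(1)] c V_inc[OF j(1)] by (intro mult_mono) auto
      also have "\<dots> \<le> c * \<delta> * (V (Suc j) - V j)"
        using V_small[OF j(1)] c V_inc[OF j(1)] by (intro mult_right_mono mult_left_mono) auto
      finally show ?thesis by (simp add: left_diff_distrib)
    qed
    then have "\<alpha> * (G (Suc j) * ?d) \<le> \<alpha> * (G j * ?d + c * \<delta> * (V (Suc j) - V j))"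
      using \<alpha> by (intro mult_left_mono) auto
    ultimately show ?case using Suc.IH[OF j(2)] by (simp add: algebra_simps)
  qed
  have "(\<Sum>i<n. R (Suc i) * \<bar>G (Suc i) - G i\<bar>) \<le> (\<Sum>i<n. R n * c * (V (Suc i) - V i))"
  proof (rule sum_mono)
    fix i assume "i \<in> {..<n}"
    then show "R (Suc i) * \<bar>G (Suc i) - G i\<bar> \<le> R n * c * (V (Suc i) - V i)"
      using change[of i] R_le[of "Suc i"] R_pos[of n] unfolding mult.assoc by (intro mult_mono) auto
  qed
  also have "\<dots> = R n * c * V n" by (simp only: sum_distrib_left[symmetric] sum_V_diff)
  finally have "- (\<Sum>i<n. G i * (D (Suc i) - D i)) \<le> m powr (\<alpha> - 1) * R n + R n * c * V n"
    using sum_D_le by linarith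
  then have D: "\<alpha> * - (\<Sum>i<n. G i * (D (Suc i) - D i)) \<le> \<alpha> * (m powr (\<alpha> - 1) * R n + R n * c * V n)"
    using \<alpha> by (intro mult_left_mono) auto
  have c_le: "c * \<delta> * V n \<le> grid_error \<alpha> (S 0) \<delta> (V n)"
  proof (cases "n = 0")
    case True
    then show ?thesis by (simp add: V0 grid_error_def)
  next
    case False
    then have "0 \<le> \<delta>" using V_small[of 0] V_inc[of 0] by auto
    have "m powr (\<alpha> - 2) \<le> V n powr (\<alpha> - 2)" using m_le_V m_nonneg assms by (intro powr_mono2) auto
    then have "c * (\<delta> * V n) \<le> (\<alpha> - 1) * V n powr (\<alpha> - 2) * (\<delta> * V n)"
      unfolding c_def using \<open>0 \<le> \<delta>\<close> V_nonneg[of n] \<alpha> by (intro mult_right_mono mult_left_mono) auto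
    then show ?thesis using assms by (simp add: grid_error_def mult_ac)
  qed
  have "\<bar>A n\<bar> powr \<alpha> \<le> \<alpha> * (\<Sum>i<n. G i * (A (Suc i) - A i)) + \<alpha> * (c * \<delta> * V n)"
    by (rule F) simp
  also have "(\<Sum>i<n. G i * (A (Suc i) - A i))
     = (\<Sum>i<n. G i * ((D (Suc i) + A (Suc i)) - (D i + A i))) + - (\<Sum>i<n. G i * (D (Suc i) - D i))"
    by (simp add: sum_subtractf[symmetric] algebra_simps)
  also have "\<alpha> * (c * \<delta> * V n) \<le> \<alpha> * grid_error \<alpha> (S 0) \<delta> (V n)"
    using c_le \<alpha> by (intro mult_left_mono) auto
  finally have "\<bar>A n\<bar> powr \<alpha> \<le> (\<alpha> * (\<Sum>i<n. G i * ((D (Suc i) + A (Suc i)) - (D i + A i)))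
      + \<alpha> * - (\<Sum>i<n. G i * (D (Suc i) - D i))) + \<alpha> * grid_error \<alpha> (S 0) \<delta> (V n)"
    by (simp only: distrib_left)
  moreover have "\<alpha> * (m powr (\<alpha> - 1) * R n + R n * c * V n) =
      \<alpha> * (m powr (\<alpha> - 1) * R n) + \<alpha> * (\<alpha> - 1) * (m powr (\<alpha> - 2) * (R n * V n))"
    by (simp add: c_def distrib_left mult_ac)
  ultimately show ?thesis using D by linarith
qed

end

text \<open>Young's inequality splits the mixed terms of both cases into a small multiple of the
  running maximum of k - k' and a multiple of the final power of S. The constants make 3 * \<alpha>
  * \<open>e\<close> and \<alpha> * (\<alpha> - 1) * \<open>e2\<close> equal to \<eta> / 2
  each.\<close>

lemma grid_inequality:
  assumes "1 < \<alpha>" "0 < \<eta>"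
  obtains C where "0 \<le> C"
    "\<And>k k' D R n \<delta>. grid_path k k' D R n \<alpha> \<delta> \<Longrightarrow>
      \<bar>k n - k' n\<bar> powr \<alpha> \<le>
        \<alpha> * (\<Sum>i<n. grid_weight \<alpha> (R i * (R i + (k i + k' i))) (k i - k' i) *
                   ((D (Suc i) + (k (Suc i) - k' (Suc i))) - (D i + (k i - k' i))))
        + \<alpha> * grid_error \<alpha> (R 0 * R 0) \<delta> (k n + k' n)
        + \<eta> * running_max (\<lambda>i. k i - k' i) n powr \<alpha> + C * (R n * (R n + (k n + k' n))) powr (\<alpha> / 2)"
proof -
  define e where "e = \<eta> / (6 * \<alpha>)"
  define e2 where "e2 = \<eta> / (2 * (\<alpha> * (\<alpha> - 1)))"
  have e: "0 < e" "0 < e2" using assms by (auto simp: e_def e2_def)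
  define C where "C = 7 + 3 * \<alpha> * e powr (1 - \<alpha>) + \<alpha> * (\<alpha> - 1) * e2 powr (1 - \<alpha> / 2)"
  have "0 \<le> C" using assms by (auto simp: C_def)
  moreover have "\<bar>k n - k' n\<bar> powr \<alpha> \<le>
        \<alpha> * (\<Sum>i<n. grid_weight \<alpha> (R i * (R i + (k i + k' i))) (k i - k' i) *
                   ((D (Suc i) + (k (Suc i) - k' (Suc i))) - (D i + (k i - k' i))))
        + \<alpha> * grid_error \<alpha> (R 0 * R 0) \<delta> (k n + k' n)
        + \<eta> * running_max (\<lambda>i. k i - k' i) n powr \<alpha> + C * (R n * (R n + (k n + k' n))) powr (\<alpha> / 2)"
    if "grid_path k k' D R n \<alpha> \<delta>" for k k' D R n \<delta>
  proof -
    interpret grid_path k k' D R n \<alpha> \<delta> by fact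
    let ?Sn = "S n powr (\<alpha> / 2)"
    let ?X = "\<alpha> * (\<Sum>i<n. G i * ((D (Suc i) + A (Suc i)) - (D i + A i)))
     + \<alpha> * grid_error \<alpha> (S 0) \<delta> (V n)"
    have "m powr (\<alpha> - 1) * R n \<le> e * m powr \<alpha> + e powr (1 - \<alpha>) * R n powr \<alpha>"
      using assms m_nonneg R_pos[of n] e by (intro powr_young) auto
    also have "\<dots> \<le> e * m powr \<alpha> + e powr (1 - \<alpha>) * ?Sn"
      using R_powr_le by (intro add_left_mono mult_left_mono) auto
    finally have "3 * \<alpha> * (m powr (\<alpha> - 1) * R n) \<le> 3 * \<alpha> * (e * m powr \<alpha> + e powr (1 - \<alpha>) * ?Sn)"
      using assms by (intro mult_left_mono) auto
    also have "\<dots> = \<eta> / 2 * m powr \<alpha> + 3 * \<alpha> * e powr (1 - \<alpha>) * ?Sn"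
      using assms by (simp add: e_def field_simps)
    finally have 1: "3 * \<alpha> * (m powr (\<alpha> - 1) * R n) \<le> \<eta> / 2 * m powr \<alpha> + 3 * \<alpha> * e powr (1 - \<alpha>) * ?Sn" .
    have Sn: "0 \<le> ?Sn" "0 \<le> m powr \<alpha>" by auto
    have "\<bar>A n\<bar> powr \<alpha> \<le> ?X + \<eta> * m powr \<alpha> + C * ?Sn"
    proof (cases "\<alpha> \<le> 2")
      case True
      have "0 \<le> \<eta> / 2 * m powr \<alpha>" "0 \<le> \<alpha> * (\<alpha> - 1) * e2 powr (1 - \<alpha> / 2) * ?Sn" using assms by auto
      moreover have "C * ?Sn = 7 * ?Sn + 3 * \<alpha> * e powr (1 - \<alpha>) * ?Sn + \<alpha> * (\<alpha> - 1) * e2 powr (1 - \<alpha> / 2) * ?Sn"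
        by (simp add: C_def distrib_right)
      ultimately show ?thesis using small_exponent[OF True] 1 by linarith
    next
      case False
      then have \<alpha>2: "2 < \<alpha>" by simp
      have RV: "0 \<le> R n * V n" using R_pos[of n] V_nonneg[of n] by simp
      have "m powr (\<alpha> - 2) * (R n * V n) \<le> e2 * m powr \<alpha> + e2 powr (1 - \<alpha> / 2) * (R n * V n) powr (\<alpha> / 2)"
        using \<alpha>2 m_nonneg e RV by (intro powr_young2) auto
      also have "\<dots> \<le> e2 * m powr \<alpha> + e2 powr (1 - \<alpha> / 2) * ?Sn"
        using VR_le_S[of n] RV assms by (intro add_left_mono mult_left_mono powr_mono2) auto
      finally have "\<alpha> * (\<alpha> - 1) * (m powr (\<alpha> - 2) * (R n * V n))
          \<le> \<alpha> * (\<alpha> - 1) * (e2 * m powr \<alpha> + e2 powr (1 - \<alpha> / 2) * ?Sn)"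
        using assms by (intro mult_left_mono) auto
      also have "\<dots> = \<eta> / 2 * m powr \<alpha> + \<alpha> * (\<alpha> - 1) * e2 powr (1 - \<alpha> / 2) * ?Sn"
        using assms by (simp add: e2_def distrib_left)
      finally have 2: "\<alpha> * (\<alpha> - 1) * (m powr (\<alpha> - 2) * (R n * V n))
          \<le> \<eta> / 2 * m powr \<alpha> + \<alpha> * (\<alpha> - 1) * e2 powr (1 - \<alpha> / 2) * ?Sn" .
      have "0 \<le> 2 * \<alpha> * (m powr (\<alpha> - 1) * R n)" using assms R_pos[of n] by simp
      moreover have "C * ?Sn = 7 * ?Sn + 3 * \<alpha> * e powr (1 - \<alpha>) * ?Sn + \<alpha> * (\<alpha> - 1) * e2 powr (1 - \<alpha> / 2) * ?Sn"
        by (simp add: C_def distrib_right)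
      ultimately show ?thesis using large_exponent[OF \<alpha>2] 1 2 Sn by linarith
    qed
    moreover have "A = (\<lambda>i. k i - k' i)" by (simp add: A_def fun_eq_iff)
    ultimately show ?thesis by (simp add: G_def S_def V_def m_def k0)
  qed
  ultimately show ?thesis by (rule that)
qed

section \<open>Discrete-time martingales\<close>

text \<open>The martingale property is orthogonality of the increments to all earlier weights with
  integrable product. In this form it is applied to unbounded weights, and in this form it is later
  derived for stochastic integrals.\<close>

locale discrete_martingale = prob_space M
  for M :: "'a measure" and F :: "nat \<Rightarrow> 'a measure" and n :: nat and N :: "nat \<Rightarrow> 'a \<Rightarrow> real" +
  assumes subalg: "\<And>i. subalgebra M (F i)"
    and filtration: "\<And>i j. i \<le> j \<Longrightarrow> subalgebra (F j) (F i)"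
    and adapted: "\<And>i. i \<le> n \<Longrightarrow> N i \<in> borel_measurable (F i)"
    and mart: "\<And>i j H. i \<le> j \<Longrightarrow> j \<le> n \<Longrightarrow> H \<in> borel_measurable (F i) \<Longrightarrow>
      integrable M (\<lambda>\<omega>. H \<omega> * (N j \<omega> - N i \<omega>)) \<Longrightarrow> (\<integral>\<omega>. H \<omega> * (N j \<omega> - N i \<omega>) \<partial>M) = 0"
begin

lemma measurable_later: "i \<le> j \<Longrightarrow> X \<in> borel_measurable (F i) \<Longrightarrow> X \<in> borel_measurable (F j)"
  using filtration[of i j] measurable_from_subalg by blast

lemma measurable_M: "X \<in> borel_measurable (F i) \<Longrightarrow> X \<in> borel_measurable M"
  using subalg[of i] measurable_from_subalg by blast

lemma running_max_measurable:
  assumes "\<And>i. i \<le> j \<Longrightarrow> X i \<in> borel_measurable (F i)"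
  shows "(\<lambda>\<omega>. running_max (\<lambda>i. X i \<omega>) j) \<in> borel_measurable (F j)"
  using assms
proof (induction j)
  case 0
  then have [measurable]: "X 0 \<in> borel_measurable (F 0)" by simp
  show ?case by simp
next
  case (Suc j)
  then have [measurable]: "(\<lambda>\<omega>. running_max (\<lambda>i. X i \<omega>) j) \<in> borel_measurable (F (Suc j))"
      "X (Suc j) \<in> borel_measurable (F (Suc j))"
    by (auto intro: measurable_later[of j "Suc j"])
  show ?case by simp
qed

lemma running_max_integrable:
  assumes "0 \<le> p" "\<And>i. i \<le> j \<Longrightarrow> X i \<in> borel_measurable M"
    and "\<And>i. i \<le> j \<Longrightarrow> integrable M (\<lambda>\<omega>. \<bar>X i \<omega>\<bar> powr p)"
  shows "integrable M (\<lambda>\<omega>. running_max (\<lambda>i. X i \<omega>) j powr p)"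
  using assms
proof (induction j)
  case (Suc j)
  then have "integrable M (\<lambda>\<omega>. max (running_max (\<lambda>i. X i \<omega>) j powr p) (\<bar>X (Suc j) \<omega>\<bar> powr p))"
    by (intro integrable_max) auto
  moreover have "max (running_max (\<lambda>i. X i \<omega>) j powr p) (\<bar>X (Suc j) \<omega>\<bar> powr p)
      = running_max (\<lambda>i. X i \<omega>) (Suc j) powr p" for \<omega>
    using assms(1) powr_mono2[of p "running_max (\<lambda>i. X i \<omega>) j" "\<bar>X (Suc j) \<omega>\<bar>"]
      powr_mono2[of p "\<bar>X (Suc j) \<omega>\<bar>" "running_max (\<lambda>i. X i \<omega>) j"]
    by (auto simp: max_def)
  ultimately show ?case by (simp only:)
qed simp

text \<open>In the mean of \<open>doob_pathwise\<close> each \<bar>N i\<bar> is exchanged for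
  \<bar>N n\<bar>, and the weights telescope to the power p - 1 of the maximum. Young's inequality
  with 1 / (2 * r), used in place of Hoelder's, absorbs half of the left-hand side and puts the
  additional 2 into the constant.\<close>

lemma doob:
  assumes p: "1 < p" and int: "\<And>i. i \<le> n \<Longrightarrow> integrable M (\<lambda>\<omega>. \<bar>N i \<omega>\<bar> powr p)"
  shows "(\<integral>\<omega>. running_max (\<lambda>i. N i \<omega>) n powr p \<partial>M)
    \<le> (2 * (p / (p - 1))) powr p * (\<integral>\<omega>. \<bar>N n \<omega>\<bar> powr p \<partial>M)"
proof -
  define m where "m i \<omega> = running_max (\<lambda>i. N i \<omega>) i" for i \<omega>
  define q where "q i \<omega> = m i \<omega> powr (p - 1)" for i \<omega>
  define r where "r = p / (p - 1)"
  have r: "0 < r" using p by (simp add: r_def)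
  have N_M[measurable]: "N i \<in> borel_measurable M" if "i \<le> n" for i
    using measurable_M[OF adapted[OF that]] .
  have m_F: "m i \<in> borel_measurable (F i)" if "i \<le> n" for i
    unfolding m_def by (rule running_max_measurable) (use adapted that in auto)
  then have m_M: "m i \<in> borel_measurable M" if "i \<le> n" for i using measurable_M that by blast
  have q_F: "q i \<in> borel_measurable (F i)" if "i \<le> n" for i
    unfolding q_def using m_F[OF that] by measurable
  then have q_M[measurable]: "q i \<in> borel_measurable M" if "i \<le> n" for i using measurable_M that by blast
  have mn: "integrable M (\<lambda>\<omega>. m n \<omega> powr p)"
    unfolding m_def by (rule running_max_integrable) (use p int N_M in auto)
  have m_mono: "m i \<omega> \<le> m j \<omega>" if "i \<le> j" for i j \<omega>
    unfolding m_def by (rule running_max_mono[OF that])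
  have m0: "0 \<le> m i \<omega>" for i \<omega> by (simp add: m_def)
  have q_mono: "q i \<omega> \<le> q j \<omega>" if "i \<le> j" for i j \<omega>
    unfolding q_def using m_mono[OF that] m0 p by (intro powr_mono2) auto
  have q0: "0 \<le> q i \<omega>" for i \<omega> by (simp add: q_def)
  have bound: "q i \<omega> * \<bar>N j \<omega>\<bar> \<le> m n \<omega> powr p" if "i \<le> n" "j \<le> n" for i j \<omega>
  proof -
    have "q i \<omega> * \<bar>N j \<omega>\<bar> \<le> q n \<omega> * m n \<omega>"
      using q_mono[OF that(1)] running_max_ge[OF that(2), of "\<lambda>i. N i \<omega>"] q0
      by (intro mult_mono) (auto simp: m_def)
    also have "\<dots> = m n \<omega> powr p" using powr_mult_self[OF m0[of n \<omega>], of p] by (simp add: q_def mult.commute)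
    finally show ?thesis .
  qed
  have int_qN: "integrable M (\<lambda>\<omega>. q i \<omega> * \<bar>N j \<omega>\<bar>)" if "i \<le> n" "j \<le> n" for i j
  proof (rule Bochner_Integration.integrable_bound[OF mn])
    show "AE \<omega> in M. norm (q i \<omega> * \<bar>N j \<omega>\<bar>) \<le> norm (m n \<omega> powr p)"
      using bound[OF that] q0 by (auto simp: abs_mult)
  qed (use that in measurable)
  \<comment> \<open>The weight h * sgn (N i) is known at time i, so in h * sgn (N i) * N i the last
    factor may be exchanged for N n before the sign is dropped.\<close>
  have swap: "(\<integral>\<omega>. h \<omega> * \<bar>N i \<omega>\<bar> \<partial>M) \<le> (\<integral>\<omega>. h \<omega> * \<bar>N n \<omega>\<bar> \<partial>M)"
    if i: "i \<le> n" and h: "h \<in> borel_measurable (F i)" "\<And>\<omega>. 0 \<le> h \<omega>" "\<And>\<omega>. h \<omega> \<le> q i \<omega>" for h i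
  proof -
    have hM[measurable]: "h \<in> borel_measurable M" using measurable_M h(1) .
    note N_M[OF i, measurable] N_M[OF order_refl, measurable]
    have ih: "integrable M (\<lambda>\<omega>. h \<omega> * sgn (N i \<omega>) * N j \<omega>)" "integrable M (\<lambda>\<omega>. h \<omega> * \<bar>N j \<omega>\<bar>)" if "j = i \<or> j = n" for j
    proof -
      have j: "j \<le> n" using that i by auto
      note N_M[OF j, measurable]
      have *: "\<bar>h \<omega>\<bar> * \<bar>N j \<omega>\<bar> \<le> q i \<omega> * \<bar>N j \<omega>\<bar>" for \<omega> using h(2,3)[of \<omega>] by (intro mult_right_mono) auto
      show "integrable M (\<lambda>\<omega>. h \<omega> * sgn (N i \<omega>) * N j \<omega>)"
      proof (rule Bochner_Integration.integrable_bound[OF int_qN[OF i j]])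
        show "AE \<omega> in M. norm (h \<omega> * sgn (N i \<omega>) * N j \<omega>) \<le> norm (q i \<omega> * \<bar>N j \<omega>\<bar>)"
          using * q0 by (auto simp: abs_mult sgn_if)
      qed measurable
      show "integrable M (\<lambda>\<omega>. h \<omega> * \<bar>N j \<omega>\<bar>)"
      proof (rule Bochner_Integration.integrable_bound[OF int_qN[OF i j]])
        show "AE \<omega> in M. norm (h \<omega> * \<bar>N j \<omega>\<bar>) \<le> norm (q i \<omega> * \<bar>N j \<omega>\<bar>)"
          using * q0 by (auto simp: abs_mult)
      qed measurable
    qed
    have "integrable M (\<lambda>\<omega>. h \<omega> * sgn (N i \<omega>) * N n \<omega> - h \<omega> * sgn (N i \<omega>) * N i \<omega>)"
      using ih by (intro Bochner_Integration.integrable_diff) auto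
    then have "integrable M (\<lambda>\<omega>. (h \<omega> * sgn (N i \<omega>)) * (N n \<omega> - N i \<omega>))"
      by (simp add: right_diff_distrib)
    moreover have "(\<lambda>\<omega>. h \<omega> * sgn (N i \<omega>)) \<in> borel_measurable (F i)"
      using h(1) adapted[OF i] by measurable
    ultimately have "(\<integral>\<omega>. (h \<omega> * sgn (N i \<omega>)) * (N n \<omega> - N i \<omega>) \<partial>M) = 0"
      by (rule mart[OF i order_refl, rotated])
    then have "(\<integral>\<omega>. h \<omega> * sgn (N i \<omega>) * N n \<omega> - h \<omega> * sgn (N i \<omega>) * N i \<omega> \<partial>M) = 0"
      by (simp add: right_diff_distrib)
    then have "(\<integral>\<omega>. h \<omega> * sgn (N i \<omega>) * N n \<omega> \<partial>M) = (\<integral>\<omega>. h \<omega> * sgn (N i \<omega>) * N i \<omega> \<partial>M)"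
      using ih by (subst (asm) Bochner_Integration.integral_diff) auto
    also have "\<dots> = (\<integral>\<omega>. h \<omega> * \<bar>N i \<omega>\<bar> \<partial>M)"
      by (intro Bochner_Integration.integral_cong) (auto simp: sgn_if)
    finally have "(\<integral>\<omega>. h \<omega> * \<bar>N i \<omega>\<bar> \<partial>M) = (\<integral>\<omega>. h \<omega> * sgn (N i \<omega>) * N n \<omega> \<partial>M)" ..
    also have "\<dots> \<le> (\<integral>\<omega>. h \<omega> * \<bar>N n \<omega>\<bar> \<partial>M)"
    proof (rule integral_mono)
      fix \<omega>
      have "sgn (N i \<omega>) * N n \<omega> \<le> \<bar>N n \<omega>\<bar>" by (auto simp: sgn_if)
      then show "h \<omega> * sgn (N i \<omega>) * N n \<omega> \<le> h \<omega> * \<bar>N n \<omega>\<bar>"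
        using h(2)[of \<omega>] by (simp add: mult.assoc mult_left_mono)
    qed (use ih in auto)
    finally show ?thesis .
  qed
  let ?T = "\<lambda>x i \<omega>. (q (Suc i) \<omega> - q i \<omega>) * \<bar>x \<omega>\<bar>"
  have intT: "integrable M (?T (N j) i)" if "i < n" "j \<le> n" for i j
    using int_qN[of "Suc i" j] int_qN[of i j] that by (simp add: left_diff_distrib)
  have split: "(\<integral>\<omega>. q 0 \<omega> * \<bar>N a \<omega>\<bar> + (\<Sum>i<n. ?T (N (b i)) i \<omega>) \<partial>M)
      = (\<integral>\<omega>. q 0 \<omega> * \<bar>N a \<omega>\<bar> \<partial>M) + (\<Sum>i<n. \<integral>\<omega>. ?T (N (b i)) i \<omega> \<partial>M)"
    if "a \<le> n" "\<And>i. i < n \<Longrightarrow> b i \<le> n" for a b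
  proof -
    have "integrable M (\<lambda>\<omega>. \<Sum>i<n. ?T (N (b i)) i \<omega>)"
      using intT that by (intro Bochner_Integration.integrable_sum) auto
    moreover have "(\<integral>\<omega>. (\<Sum>i<n. ?T (N (b i)) i \<omega>) \<partial>M) = (\<Sum>i<n. \<integral>\<omega>. ?T (N (b i)) i \<omega> \<partial>M)"
      using intT that by (intro Bochner_Integration.integral_sum) auto
    ultimately show ?thesis using int_qN[of 0 a] that by simp
  qed
  have "(\<integral>\<omega>. m n \<omega> powr p \<partial>M) \<le> (\<integral>\<omega>. r * (q 0 \<omega> * \<bar>N 0 \<omega>\<bar> + (\<Sum>i<n. ?T (N (Suc i)) i \<omega>)) \<partial>M)"
  proof (rule integral_mono)
    show "integrable M (\<lambda>\<omega>. r * (q 0 \<omega> * \<bar>N 0 \<omega>\<bar> + (\<Sum>i<n. ?T (N (Suc i)) i \<omega>)))"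
      using int_qN[of 0 0] intT
      by (intro integrable_mult_right Bochner_Integration.integrable_add Bochner_Integration.integrable_sum) auto
    show "m n \<omega> powr p \<le> r * (q 0 \<omega> * \<bar>N 0 \<omega>\<bar> + (\<Sum>i<n. ?T (N (Suc i)) i \<omega>))" for \<omega>
      unfolding m_def q_def r_def by (rule doob_pathwise[OF p])
  qed (rule mn)
  also have "\<dots> = r * ((\<integral>\<omega>. q 0 \<omega> * \<bar>N 0 \<omega>\<bar> \<partial>M) + (\<Sum>i<n. \<integral>\<omega>. ?T (N (Suc i)) i \<omega> \<partial>M))"
    using split[of 0 Suc] by simp
  also have "\<dots> \<le> r * ((\<integral>\<omega>. q 0 \<omega> * \<bar>N n \<omega>\<bar> \<partial>M) + (\<Sum>i<n. \<integral>\<omega>. ?T (N n) i \<omega> \<partial>M))"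
  proof (intro mult_left_mono add_mono sum_mono)
    show "(\<integral>\<omega>. q 0 \<omega> * \<bar>N 0 \<omega>\<bar> \<partial>M) \<le> (\<integral>\<omega>. q 0 \<omega> * \<bar>N n \<omega>\<bar> \<partial>M)"
      by (rule swap) (use q_F q0 in auto)
    fix i assume "i \<in> {..<n}"
    then show "(\<integral>\<omega>. ?T (N (Suc i)) i \<omega> \<partial>M) \<le> (\<integral>\<omega>. ?T (N n) i \<omega> \<partial>M)"
      using q_F[of "Suc i"] measurable_later[of i "Suc i" "q i"] q_F[of i] q_mono[of i "Suc i"] q0
      by (intro swap borel_measurable_diff) auto
  qed (use r in simp)
  also have "\<dots> = r * (\<integral>\<omega>. q 0 \<omega> * \<bar>N n \<omega>\<bar> + (\<Sum>i<n. ?T (N n) i \<omega>) \<partial>M)"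
    using split[of n "\<lambda>_. n"] by simp
  also have "(\<lambda>\<omega>. q 0 \<omega> * \<bar>N n \<omega>\<bar> + (\<Sum>i<n. ?T (N n) i \<omega>)) = (\<lambda>\<omega>. q n \<omega> * \<bar>N n \<omega>\<bar>)"
  proof
    fix \<omega>
    have "(\<Sum>i<n. ?T (N n) i \<omega>) = (q n \<omega> - q 0 \<omega>) * \<bar>N n \<omega>\<bar>"
      by (simp only: sum_distrib_right[symmetric] sum_lessThan_telescope[of "\<lambda>i. q i \<omega>"])
    then show "q 0 \<omega> * \<bar>N n \<omega>\<bar> + (\<Sum>i<n. ?T (N n) i \<omega>) = q n \<omega> * \<bar>N n \<omega>\<bar>"
      by (simp add: algebra_simps)
  qed
  also have "(\<integral>\<omega>. q n \<omega> * \<bar>N n \<omega>\<bar> \<partial>M)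
      \<le> (\<integral>\<omega>. 1 / (2 * r) * m n \<omega> powr p + (1 / (2 * r)) powr (1 - p) * \<bar>N n \<omega>\<bar> powr p \<partial>M)"
  proof (rule integral_mono)
    show "q n \<omega> * \<bar>N n \<omega>\<bar> \<le> 1 / (2 * r) * m n \<omega> powr p + (1 / (2 * r)) powr (1 - p) * \<bar>N n \<omega>\<bar> powr p" for \<omega>
      unfolding q_def using m0 p r by (intro powr_young) auto
  qed (use mn int int_qN in auto)
  also have "\<dots> = 1 / (2 * r) * (\<integral>\<omega>. m n \<omega> powr p \<partial>M) + (1 / (2 * r)) powr (1 - p) * (\<integral>\<omega>. \<bar>N n \<omega>\<bar> powr p \<partial>M)"
    using mn int by (subst Bochner_Integration.integral_add) auto
  finally have "(\<integral>\<omega>. m n \<omega> powr p \<partial>M) \<le>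
      r * (1 / (2 * r) * (\<integral>\<omega>. m n \<omega> powr p \<partial>M) + (1 / (2 * r)) powr (1 - p) * (\<integral>\<omega>. \<bar>N n \<omega>\<bar> powr p \<partial>M))"
    using r by (simp add: mult_left_mono)
  also have "\<dots> = 1 / 2 * (\<integral>\<omega>. m n \<omega> powr p \<partial>M) + r * (1 / (2 * r)) powr (1 - p) * (\<integral>\<omega>. \<bar>N n \<omega>\<bar> powr p \<partial>M)"
    using r by (simp add: distrib_left)
  finally have "(\<integral>\<omega>. m n \<omega> powr p \<partial>M) \<le> (2 * r) * (1 / (2 * r)) powr (1 - p) * (\<integral>\<omega>. \<bar>N n \<omega>\<bar> powr p \<partial>M)"
    by simp
  also have "(2 * r) * (1 / (2 * r)) powr (1 - p) = (2 * r) powr p"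
  proof -
    have "(1 / (2 * r)) powr (1 - p) = (2 * r) powr (p - 1)"
      using r powr_minus_divide[of "2 * r" "1 - p"] by (simp add: powr_divide)
    then show ?thesis using r powr_mult_self[of "2 * r" p] by simp
  qed
  finally show ?thesis by (simp add: m_def r_def)
qed

text \<open>In the mean of \<open>increasing_part_pathwise\<close> the sum over N vanishes. Young's
  inequality with 1 / (4 * p) turns the term in Q into half of the left-hand side, which is finite
  by truncation, and a multiple of the moment of Q.\<close>

lemma increasing_part_bound:
  assumes p: "1 < p" and c: "0 < c"
    and k: "\<And>i. i \<le> n \<Longrightarrow> k i \<in> borel_measurable (F i)"
    and N: "\<And>i. i \<le> n \<Longrightarrow> integrable M (N i)"
    and path: "AE \<omega> in M. k 0 \<omega> = 0 \<and> (\<forall>i<n. k i \<omega> \<le> k (Suc i) \<omega> \<and> k (Suc i) \<omega> - k i \<omega> \<le> \<delta> \<omega>)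
        \<and> (\<forall>i\<le>n. \<bar>N i \<omega> - k i \<omega>\<bar> \<le> Q \<omega>) \<and> 0 \<le> \<delta> \<omega>"
    and \<delta>: "integrable M \<delta>" and Q: "integrable M (\<lambda>\<omega>. Q \<omega> powr p)" "Q \<in> borel_measurable M"
  shows "(\<integral>\<omega>. min (k n \<omega>) c powr p \<partial>M)
     \<le> (4 * p) powr p * (\<integral>\<omega>. Q \<omega> powr p \<partial>M) + 2 * p * c powr (p - 1) * (\<integral>\<omega>. \<delta> \<omega> \<partial>M)"
proof -
  define \<psi> where "\<psi> i \<omega> = min (k i \<omega>) c powr (p - 1)" for i \<omega>
  have k_M[measurable]: "k i \<in> borel_measurable M" if "i \<le> n" for i using k measurable_M that by blast
  have \<psi>_F: "\<psi> i \<in> borel_measurable (F i)" if "i \<le> n" for i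
    unfolding \<psi>_def using k[OF that] by measurable
  have nonneg: "AE \<omega> in M. 0 \<le> k i \<omega>" if "i \<le> n" for i
    using path
  proof eventually_elim
    case (elim \<omega>)
    then show ?case using grid_mono[of n "\<lambda>i. k i \<omega>" 0 i] that by auto
  qed
  have \<psi>_le: "AE \<omega> in M. \<psi> i \<omega> \<le> c powr (p - 1)" if "i \<le> n" for i
    using nonneg[OF that] by eventually_elim (use p c in \<open>auto simp: \<psi>_def intro!: powr_mono2\<close>)
  have \<psi>0: "0 \<le> \<psi> i \<omega>" for i \<omega> by (simp add: \<psi>_def)
  have int_\<psi>: "integrable M (\<lambda>\<omega>. \<psi> i \<omega> * (N (Suc i) \<omega> - N i \<omega>))" if i: "i < n" for i
  proof (rule Bochner_Integration.integrable_bound)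
    show "integrable M (\<lambda>\<omega>. c powr (p - 1) * (\<bar>N (Suc i) \<omega>\<bar> + \<bar>N i \<omega>\<bar>))" using N i by auto
    show "AE \<omega> in M. norm (\<psi> i \<omega> * (N (Suc i) \<omega> - N i \<omega>)) \<le> norm (c powr (p - 1) * (\<bar>N (Suc i) \<omega>\<bar> + \<bar>N i \<omega>\<bar>))"
      using \<psi>_le[OF less_imp_le[OF i]]
      by eventually_elim (use \<psi>0 in \<open>auto simp: abs_mult intro!: mult_mono\<close>)
    show "(\<lambda>\<omega>. \<psi> i \<omega> * (N (Suc i) \<omega> - N i \<omega>)) \<in> borel_measurable M"
      using measurable_M[OF \<psi>_F[of i]] N[of i] N[of "Suc i"] i by auto
  qed
  have zero: "(\<integral>\<omega>. \<psi> i \<omega> * (N (Suc i) \<omega> - N i \<omega>) \<partial>M) = 0" if i: "i < n" for i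
    using i by (intro mart \<psi>_F int_\<psi>) auto
  define X where "X \<omega> = min (k n \<omega>) c" for \<omega>
  have X_M[measurable]: "X \<in> borel_measurable M" unfolding X_def by measurable
  have X: "AE \<omega> in M. 0 \<le> X \<omega> \<and> X \<omega> \<le> c" using nonneg[of n] c by (auto simp: X_def)
  have Q0: "AE \<omega> in M. 0 \<le> Q \<omega>" using path by eventually_elim (force intro: order_trans[OF abs_ge_zero])
  have "AE \<omega> in M. norm (X \<omega> powr p) \<le> c powr p"
    using X by eventually_elim (use p in \<open>auto intro!: powr_mono2\<close>)
  then have intX: "integrable M (\<lambda>\<omega>. X \<omega> powr p)"
    by (rule integrable_const_bound) measurable
  let ?b = "\<lambda>\<omega>. p * ((\<Sum>i<n. \<psi> i \<omega> * (N (Suc i) \<omega> - N i \<omega>))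
        + 2 * (1 / (4 * p) * X \<omega> powr p + (1 / (4 * p)) powr (1 - p) * Q \<omega> powr p) + c powr (p - 1) * \<delta> \<omega>)"
  have "AE \<omega> in M. X \<omega> powr p \<le> ?b \<omega>"
    using path X Q0
  proof eventually_elim
    case (elim \<omega>)
    have "X \<omega> powr p \<le> p * ((\<Sum>i<n. \<psi> i \<omega> * (N (Suc i) \<omega> - N i \<omega>))
        + 2 * (X \<omega> powr (p - 1) * Q \<omega>) + X \<omega> powr (p - 1) * \<delta> \<omega>)"
      unfolding X_def \<psi>_def by (rule increasing_part_pathwise[OF p c]) (use elim in auto)
    also have "\<dots> \<le> ?b \<omega>"
      using p elim by (intro mult_left_mono add_mono order_refl powr_young mult_right_mono powr_mono2) auto
    finally show ?case .
  qed
  moreover have IS: "integrable M (\<lambda>\<omega>. \<Sum>i<n. \<psi> i \<omega> * (N (Suc i) \<omega> - N i \<omega>))"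
    using int_\<psi> by (intro Bochner_Integration.integrable_sum) auto
  moreover have IS0: "(\<integral>\<omega>. (\<Sum>i<n. \<psi> i \<omega> * (N (Suc i) \<omega> - N i \<omega>)) \<partial>M) = 0"
    using int_\<psi> zero by (subst Bochner_Integration.integral_sum) auto
  ultimately have "(\<integral>\<omega>. X \<omega> powr p \<partial>M) \<le> (\<integral>\<omega>. ?b \<omega> \<partial>M)"
    using intX Q \<delta> by (intro integral_mono_AE) auto
  also have "\<dots> = p * (2 * (1 / (4 * p) * (\<integral>\<omega>. X \<omega> powr p \<partial>M) + (1 / (4 * p)) powr (1 - p) * (\<integral>\<omega>. Q \<omega> powr p \<partial>M))
      + c powr (p - 1) * (\<integral>\<omega>. \<delta> \<omega> \<partial>M))"
    using intX Q \<delta> IS IS0 by simp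
  also have "\<dots> = 1 / 2 * (\<integral>\<omega>. X \<omega> powr p \<partial>M) + 2 * p * (1 / (4 * p)) powr (1 - p) * (\<integral>\<omega>. Q \<omega> powr p \<partial>M)
      + p * c powr (p - 1) * (\<integral>\<omega>. \<delta> \<omega> \<partial>M)"
    using p by (simp add: field_simps)
  finally have "(\<integral>\<omega>. X \<omega> powr p \<partial>M) \<le> 4 * p * (1 / (4 * p)) powr (1 - p) * (\<integral>\<omega>. Q \<omega> powr p \<partial>M)
      + 2 * p * c powr (p - 1) * (\<integral>\<omega>. \<delta> \<omega> \<partial>M)"
    by simp
  also have "4 * p * (1 / (4 * p)) powr (1 - p) = (4 * p) powr p"
  proof -
    have "(1 / (4 * p)) powr (1 - p) = (4 * p) powr (p - 1)"
      using p powr_minus_divide[of "4 * p" "1 - p"] by (simp add: powr_divide)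
    then show ?thesis using p powr_mult_self[of "4 * p" p] by simp
  qed
  finally show ?thesis by (simp add: X_def)
qed

end

section \<open>The error term and the moment bound for k - k'\<close>

lemma grid_error_antimono:
  assumes "0 < S" "S \<le> S'" "0 \<le> \<delta>" "0 \<le> v"
  shows "grid_error \<alpha> S' \<delta> v \<le> grid_error \<alpha> S \<delta> v"
proof -
  have "S' powr (\<alpha> / 2 - 1) * \<delta> \<le> S powr (\<alpha> / 2 - 1) * \<delta>" if "\<alpha> \<le> 2"
    using assms that by (intro mult_right_mono powr_mono2') auto
  then have "min (S' powr (\<alpha> / 2 - 1) * \<delta>) (2 * v powr (\<alpha> - 1)) * v
      \<le> min (S powr (\<alpha> / 2 - 1) * \<delta>) (2 * v powr (\<alpha> - 1)) * v" if "\<alpha> \<le> 2"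
    using assms that by (intro mult_right_mono[OF min.mono[OF _ order_refl]]) auto
  then show ?thesis by (simp add: grid_error_def)
qed

text \<open>The multiple of v powr \<alpha> is the majorant under which the error is sent to zero
  with the mesh. For \<alpha> \<le> 2 it stems from the second entry of the minimum, for \<alpha> >
  2 from \<delta> \<le> v.\<close>

lemma grid_error_bounds:
  assumes "1 < \<alpha>" "0 \<le> \<delta>" "\<delta> \<le> v"
  shows "0 \<le> grid_error \<alpha> S \<delta> v" "grid_error \<alpha> S \<delta> v \<le> (\<alpha> + 1) * v powr \<alpha>"
proof -
  have v: "0 \<le> v" using assms by simp
  show "0 \<le> grid_error \<alpha> S \<delta> v" using assms v by (auto simp: grid_error_def)
  show "grid_error \<alpha> S \<delta> v \<le> (\<alpha> + 1) * v powr \<alpha>"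
  proof (cases "\<alpha> \<le> 2")
    case True
    have "grid_error \<alpha> S \<delta> v \<le> (2 * v powr (\<alpha> - 1)) * v"
      using True v by (auto simp: grid_error_def intro!: mult_right_mono)
    also have "\<dots> = 2 * v powr \<alpha>" using powr_mult_self[OF v, of \<alpha>] by (simp add: mult_ac)
    also have "\<dots> \<le> (\<alpha> + 1) * v powr \<alpha>" using assms by (intro mult_right_mono) auto
    finally show ?thesis .
  next
    case False
    have "grid_error \<alpha> S \<delta> v \<le> (\<alpha> - 1) * v powr (\<alpha> - 2) * v * v"
      using False v assms by (auto simp: grid_error_def intro!: mult_left_mono)
    also have "\<dots> = (\<alpha> - 1) * v powr \<alpha>"
      using powr_mult_self[OF v, of \<alpha>] powr_mult_self[OF v, of "\<alpha> - 1"] by (simp add: mult_ac)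
    also have "\<dots> \<le> (\<alpha> + 1) * v powr \<alpha>" by (intro mult_right_mono) auto
    finally show ?thesis .
  qed
qed

lemma grid_weight_measurable [measurable]:
  assumes [measurable]: "S \<in> borel_measurable M" "x \<in> borel_measurable M"
  shows "(\<lambda>\<omega>. grid_weight \<alpha> (S \<omega>) (x \<omega>)) \<in> borel_measurable M"
  unfolding grid_weight_def smooth_powr_def signed_powr_def by (cases "\<alpha> \<le> 2") simp_all

lemma grid_error_measurable [measurable]:
  assumes [measurable]: "\<delta> \<in> borel_measurable M" "v \<in> borel_measurable M"
  shows "(\<lambda>\<omega>. grid_error \<alpha> S (\<delta> \<omega>) (v \<omega>)) \<in> borel_measurable M"
  unfolding grid_error_def by (cases "\<alpha> \<le> 2") simp_all

text \<open>A predicate, so that one constant can be named before the measure, the filtration, the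
  grid and \<epsilon> are chosen (\<open>difference_constant_exists\<close>). Adding \<epsilon> to
  the running maximum of D produces the positive envelope that \<open>grid_path\<close> asks
  for.\<close>

definition difference_constant :: "'a measure \<Rightarrow> real \<Rightarrow> real \<Rightarrow> bool" where
  "difference_constant M \<alpha> C \<longleftrightarrow> (\<forall>F n D k k' \<delta> \<epsilon>.
      discrete_martingale M F n (\<lambda>i \<omega>. D i \<omega> + (k i \<omega> - k' i \<omega>)) \<longrightarrow> 0 < \<epsilon> \<longrightarrow>
      (\<forall>i\<le>n. D i \<in> borel_measurable (F i)) \<longrightarrow>
      (\<forall>i\<le>n. k i \<in> borel_measurable (F i)) \<longrightarrow>
      (\<forall>i\<le>n. k' i \<in> borel_measurable (F i)) \<longrightarrow>
      \<delta> \<in> borel_measurable M \<longrightarrow>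
      (AE \<omega> in M. k 0 \<omega> = 0 \<and> k' 0 \<omega> = 0 \<and> 0 \<le> \<delta> \<omega> \<and> \<delta> \<omega> \<le> k n \<omega> + k' n \<omega> \<and>
        (\<forall>i<n. k i \<omega> \<le> k (Suc i) \<omega> \<and> k' i \<omega> \<le> k' (Suc i) \<omega> \<and>
               (k (Suc i) \<omega> + k' (Suc i) \<omega>) - (k i \<omega> + k' i \<omega>) \<le> \<delta> \<omega>)) \<longrightarrow>
      integrable M (\<lambda>\<omega>. (k n \<omega> + k' n \<omega>) powr \<alpha>) \<longrightarrow>
      integrable M (\<lambda>\<omega>. running_max (\<lambda>i. D i \<omega>) n powr \<alpha>) \<longrightarrow>
      (\<integral>\<omega>. \<bar>k n \<omega> - k' n \<omega>\<bar> powr \<alpha> \<partial>M) \<le>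
        C * ((\<integral>\<omega>. (\<epsilon> + running_max (\<lambda>i. D i \<omega>) n) powr \<alpha> \<partial>M)
           + (\<integral>\<omega>. ((\<epsilon> + running_max (\<lambda>i. D i \<omega>) n) * (k n \<omega> + k' n \<omega>)) powr (\<alpha> / 2) \<partial>M)
           + (\<integral>\<omega>. grid_error \<alpha> (\<epsilon> * \<epsilon>) (\<delta> \<omega>) (k n \<omega> + k' n \<omega>) \<partial>M)))"

text \<open>The term of \<open>grid_inequality\<close> in the running maximum m of k - k' is led
  back to the left-hand side: m is at most the running maximum of N = D + (k - k') plus R, Doob's
  inequality bounds the former by N n, and N n is A + D n. The loop costs the factor b * Cd * b, and
  \<eta> is half its inverse, so that half of the left-hand side is absorbed.\<close>

lemma difference_constant_exists:
  assumes \<alpha>: "1 < \<alpha>"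
  obtains C where "0 \<le> C" "\<And>M :: 'a measure. difference_constant M \<alpha> C"
proof -
  define Cd where "Cd = (2 * (\<alpha> / (\<alpha> - 1))) powr \<alpha>"
  have Cd: "0 < Cd" using \<alpha> by (simp add: Cd_def)
  define b where "b = 2 powr \<alpha>"
  have b: "0 < b" by (simp add: b_def)
  define \<eta> where "\<eta> = 1 / (2 * (b * Cd * b))"
  have \<eta>: "0 < \<eta>" using Cd b by (simp add: \<eta>_def)
  obtain C1 where C1: "0 \<le> C1" and path: "\<And>k k' D R n \<delta>. grid_path k k' D R n \<alpha> \<delta> \<Longrightarrow>
      \<bar>k n - k' n\<bar> powr \<alpha> \<le>
        \<alpha> * (\<Sum>i<n. grid_weight \<alpha> (R i * (R i + (k i + k' i))) (k i - k' i) *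
                   ((D (Suc i) + (k (Suc i) - k' (Suc i))) - (D i + (k i - k' i))))
        + \<alpha> * grid_error \<alpha> (R 0 * R 0) \<delta> (k n + k' n)
        + \<eta> * running_max (\<lambda>i. k i - k' i) n powr \<alpha> + C1 * (R n * (R n + (k n + k' n))) powr (\<alpha> / 2)"
    using grid_inequality[OF \<alpha> \<eta>] by blast
  define a where "a = 2 powr (\<alpha> / 2)"
  have a: "0 < a" by (simp add: a_def)
  define C where "C = 2 * \<alpha> + 2 * (\<eta> * (b * Cd * b + b)) + 2 * (C1 * a)"
  have "0 \<le> C" using \<alpha> \<eta> b Cd C1 a by (auto simp: C_def)
  moreover have "difference_constant M \<alpha> C" for M :: "'a measure"
    unfolding difference_constant_def
  proof (intro allI impI)
    fix F n and D k k' :: "nat \<Rightarrow> 'a \<Rightarrow> real" and \<delta> :: "'a \<Rightarrow> real" and \<epsilon> :: real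
    assume dm: "discrete_martingale M F n (\<lambda>i \<omega>. D i \<omega> + (k i \<omega> - k' i \<omega>))" and \<epsilon>: "0 < \<epsilon>"
      and adapted': "\<forall>i\<le>n. D i \<in> borel_measurable (F i)" "\<forall>i\<le>n. k i \<in> borel_measurable (F i)"
        "\<forall>i\<le>n. k' i \<in> borel_measurable (F i)"
      and \<delta>[measurable]: "\<delta> \<in> borel_measurable M"
      and paths: "AE \<omega> in M. k 0 \<omega> = 0 \<and> k' 0 \<omega> = 0 \<and> 0 \<le> \<delta> \<omega> \<and> \<delta> \<omega> \<le> k n \<omega> + k' n \<omega> \<and>
        (\<forall>i<n. k i \<omega> \<le> k (Suc i) \<omega> \<and> k' i \<omega> \<le> k' (Suc i) \<omega> \<and>
               (k (Suc i) \<omega> + k' (Suc i) \<omega>) - (k i \<omega> + k' i \<omega>) \<le> \<delta> \<omega>)"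
      and iV: "integrable M (\<lambda>\<omega>. (k n \<omega> + k' n \<omega>) powr \<alpha>)"
      and iD: "integrable M (\<lambda>\<omega>. running_max (\<lambda>i. D i \<omega>) n powr \<alpha>)"
    note D = adapted'(1)[rule_format] and k = adapted'(2)[rule_format] and k' = adapted'(3)[rule_format]
    interpret discrete_martingale M F n "\<lambda>i \<omega>. D i \<omega> + (k i \<omega> - k' i \<omega>)" by fact
    have M_meas: "D i \<in> borel_measurable M" "k i \<in> borel_measurable M" "k' i \<in> borel_measurable M"
      if "i \<le> n" for i using D k k' measurable_M that by blast+
    note M_meas[OF order_refl, measurable]
    define N where "N i \<omega> = D i \<omega> + (k i \<omega> - k' i \<omega>)" for i \<omega>
    define R where "R i \<omega> = \<epsilon> + running_max (\<lambda>i. D i \<omega>) i" for i \<omega>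
    define V where "V i \<omega> = k i \<omega> + k' i \<omega>" for i \<omega>
    define G where "G i \<omega> = grid_weight \<alpha> (R i \<omega> * (R i \<omega> + V i \<omega>)) (k i \<omega> - k' i \<omega>)" for i \<omega>
    define e where "e \<omega> = grid_error \<alpha> (\<epsilon> * \<epsilon>) (\<delta> \<omega>) (V n \<omega>)" for \<omega>
    define m where "m \<omega> = running_max (\<lambda>i. k i \<omega> - k' i \<omega>) n" for \<omega>
    have R_F: "R i \<in> borel_measurable (F i)" if "i \<le> n" for i
    proof -
      have [measurable]: "(\<lambda>\<omega>. running_max (\<lambda>i. D i \<omega>) i) \<in> borel_measurable (F i)"
        by (rule running_max_measurable) (use D that in auto)
      show ?thesis unfolding R_def by measurable
    qed
    have G_F: "G i \<in> borel_measurable (F i)" if "i \<le> n" for i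
      unfolding G_def V_def using R_F[OF that] k[OF that] k'[OF that] by measurable
    have R_M[measurable]: "R n \<in> borel_measurable M" using R_F measurable_M by blast
    have V_M[measurable]: "V n \<in> borel_measurable M" unfolding V_def by measurable
    have e_M[measurable]: "e \<in> borel_measurable M" unfolding e_def by measurable
    have m_M[measurable]: "m \<in> borel_measurable M"
    proof -
      have "m \<in> borel_measurable (F n)"
        unfolding m_def by (rule running_max_measurable) (use k k' in \<open>auto intro!: borel_measurable_diff\<close>)
      then show ?thesis by (rule measurable_M)
    qed
    have R0: "\<epsilon> \<le> R i \<omega>" for i \<omega> by (simp add: R_def)
    have R_pos: "0 < R i \<omega>" for i \<omega> using R0[of i \<omega>] \<epsilon> by simp
    have R_mono: "R i \<omega> \<le> R j \<omega>" if "i \<le> j" for i j \<omega>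
      unfolding R_def using running_max_mono[OF that] by simp
    have D_le: "\<bar>D i \<omega>\<bar> \<le> R i \<omega>" for i \<omega>
      unfolding R_def using running_max_ge[OF order_refl, of "\<lambda>i. D i \<omega>" i] \<epsilon> by simp
    have gp: "AE \<omega> in M. grid_path (\<lambda>i. k i \<omega>) (\<lambda>i. k' i \<omega>) (\<lambda>i. D i \<omega>) (\<lambda>i. R i \<omega>) n \<alpha> (\<delta> \<omega>)
        \<and> 0 \<le> \<delta> \<omega> \<and> \<delta> \<omega> \<le> V n \<omega>"
      using paths
    proof eventually_elim
      case (elim \<omega>)
      then show ?case
        unfolding V_def using \<alpha> R_pos R_mono D_le by (intro conjI grid_path.intro) auto
    qed
    have V_facts: "AE \<omega> in M. 0 \<le> V i \<omega> \<and> V i \<omega> \<le> V n \<omega> \<and> \<bar>k i \<omega> - k' i \<omega>\<bar> \<le> V i \<omega>" if i: "i \<le> n" for i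
      using gp
    proof eventually_elim
      case (elim \<omega>)
      then interpret gp: grid_path "\<lambda>i. k i \<omega>" "\<lambda>i. k' i \<omega>" "\<lambda>i. D i \<omega>" "\<lambda>i. R i \<omega>" n \<alpha> "\<delta> \<omega>" by simp
      show ?case using gp.V_nonneg[OF i] gp.V_le[OF i] gp.A_le_V[OF i]
        by (simp add: V_def gp.V_def gp.A_def)
    qed
    have Vn0: "AE \<omega> in M. 0 \<le> V n \<omega>" using V_facts[of n, OF order_refl] by eventually_elim auto
    have iR: "integrable M (\<lambda>\<omega>. R n \<omega> powr \<alpha>)"
    proof (rule Bochner_Integration.integrable_bound)
      show "integrable M (\<lambda>\<omega>. 2 powr \<alpha> * (\<epsilon> powr \<alpha> + running_max (\<lambda>i. D i \<omega>) n powr \<alpha>))"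
        using iD by auto
      show "AE \<omega> in M. norm (R n \<omega> powr \<alpha>) \<le> norm (2 powr \<alpha> * (\<epsilon> powr \<alpha> + running_max (\<lambda>i. D i \<omega>) n powr \<alpha>))"
        unfolding R_def using powr_add_le[of \<epsilon> "running_max _ n" \<alpha>] \<epsilon> \<alpha> by (auto simp: abs_mult)
    qed measurable
    have iV': "integrable M (\<lambda>\<omega>. V n \<omega> powr \<alpha>)" using iV by (simp add: V_def)
    \<comment> \<open>U dominates all quantities along the path, so every integrability claim is
      checked against U powr \<alpha>.\<close>
    define U where "U \<omega> = R n \<omega> + V n \<omega>" for \<omega>
    have U_M[measurable]: "U \<in> borel_measurable M" unfolding U_def by measurable
    have iU: "integrable M (\<lambda>\<omega>. U \<omega> powr \<alpha>)"
    proof (rule Bochner_Integration.integrable_bound)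
      show "integrable M (\<lambda>\<omega>. 2 powr \<alpha> * (R n \<omega> powr \<alpha> + V n \<omega> powr \<alpha>))"
        using iR iV' by auto
      show "AE \<omega> in M. norm (U \<omega> powr \<alpha>) \<le> norm (2 powr \<alpha> * (R n \<omega> powr \<alpha> + V n \<omega> powr \<alpha>))"
        using Vn0
      proof eventually_elim
        case (elim \<omega>)
        show ?case unfolding U_def
          using powr_add_le[of "R n \<omega>" "V n \<omega>" \<alpha>] R_pos[of n \<omega>] elim \<alpha> by (auto simp: abs_mult)
      qed
    qed measurable
    have N_le: "AE \<omega> in M. \<bar>N i \<omega>\<bar> \<le> U \<omega>" if "i \<le> n" for i
      using V_facts[OF that]
    proof eventually_elim
      case (elim \<omega>)
      then show ?case using D_le[of i \<omega>] R_mono[OF that, of \<omega>] by (auto simp: N_def U_def)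
    qed
    have N_M: "N i \<in> borel_measurable M" if "i \<le> n" for i
      unfolding N_def using M_meas[OF that] by measurable
    have U_dom: "integrable M f" if "f \<in> borel_measurable M" "AE \<omega> in M. \<bar>f \<omega>\<bar> \<le> c * U \<omega> powr \<alpha>" for f :: "'a \<Rightarrow> real" and c
    proof (rule Bochner_Integration.integrable_bound)
      show "integrable M (\<lambda>\<omega>. c * U \<omega> powr \<alpha>)" using iU by simp
      show "AE \<omega> in M. norm (f \<omega>) \<le> norm (c * U \<omega> powr \<alpha>)" using that(2) by eventually_elim auto
    qed (rule that(1))
    have iN: "integrable M (\<lambda>\<omega>. \<bar>N i \<omega>\<bar> powr \<alpha>)" if "i \<le> n" for i
    proof (rule U_dom[of _ 1])
      show "AE \<omega> in M. \<bar>\<bar>N i \<omega>\<bar> powr \<alpha>\<bar> \<le> 1 * U \<omega> powr \<alpha>"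
        using N_le[OF that] by eventually_elim (use \<alpha> in \<open>auto intro!: powr_mono2\<close>)
      show "(\<lambda>\<omega>. \<bar>N i \<omega>\<bar> powr \<alpha>) \<in> borel_measurable M" using N_M[OF that] by measurable
    qed
    have GN: "integrable M (\<lambda>\<omega>. G i \<omega> * (N (Suc i) \<omega> - N i \<omega>))" if i: "i < n" for i
    proof (rule U_dom[of _ 2])
      show "(\<lambda>\<omega>. G i \<omega> * (N (Suc i) \<omega> - N i \<omega>)) \<in> borel_measurable M"
        using measurable_M[OF G_F[of i]] N_M[of i] N_M[of "Suc i"] i
        by (intro borel_measurable_times borel_measurable_diff) auto
      have i': "i \<le> n" "Suc i \<le> n" using i by auto
      show "AE \<omega> in M. \<bar>G i \<omega> * (N (Suc i) \<omega> - N i \<omega>)\<bar> \<le> 2 * U \<omega> powr \<alpha>"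
        using V_facts[OF i'(1)] N_le[OF i'(1)] N_le[OF i'(2)]
      proof eventually_elim
        case (elim \<omega>)
        have "0 < R i \<omega> * (R i \<omega> + V i \<omega>)" using R_pos[of i \<omega>] elim by simp
        then have "\<bar>G i \<omega>\<bar> \<le> \<bar>k i \<omega> - k' i \<omega>\<bar> powr (\<alpha> - 1)"
          unfolding G_def by (rule grid_weight_bound)
        also have "\<dots> \<le> U \<omega> powr (\<alpha> - 1)"
          using elim R_pos[of n \<omega>] \<alpha> by (intro powr_mono2) (auto simp: U_def)
        finally have "\<bar>G i \<omega> * (N (Suc i) \<omega> - N i \<omega>)\<bar> \<le> U \<omega> powr (\<alpha> - 1) * (2 * U \<omega>)"
          unfolding abs_mult using elim by (intro mult_mono) auto
        also have "\<dots> = 2 * U \<omega> powr \<alpha>"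
        proof -
          have "0 \<le> U \<omega>" using elim R_pos[of n \<omega>] by (simp add: U_def)
          then show ?thesis using powr_mult_self[of "U \<omega>" \<alpha>] by (simp add: mult_ac)
        qed
        finally show ?case .
      qed
    qed
    have GN0: "(\<integral>\<omega>. G i \<omega> * (N (Suc i) \<omega> - N i \<omega>) \<partial>M) = 0" if i: "i < n" for i
      using mart[of i "Suc i" "G i"] G_F[of i] GN[OF i] i by (auto simp: N_def)
    define A where "A \<omega> = k n \<omega> - k' n \<omega>" for \<omega>
    have A_M[measurable]: "A \<in> borel_measurable M" unfolding A_def by measurable
    have iA: "integrable M (\<lambda>\<omega>. \<bar>A \<omega>\<bar> powr \<alpha>)"
    proof (rule U_dom[of _ 1])
      show "AE \<omega> in M. \<bar>\<bar>A \<omega>\<bar> powr \<alpha>\<bar> \<le> 1 * U \<omega> powr \<alpha>"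
        using V_facts[of n, OF order_refl]
      proof eventually_elim
        case (elim \<omega>)
        then show ?case using \<alpha> R_pos[of n \<omega>] by (auto simp: A_def U_def intro!: powr_mono2)
      qed
    qed measurable
    define mN where "mN \<omega> = running_max (\<lambda>i. N i \<omega>) n" for \<omega>
    have imN: "integrable M (\<lambda>\<omega>. mN \<omega> powr \<alpha>)"
      unfolding mN_def by (rule running_max_integrable) (use \<alpha> N_M iN in auto)
    have doobN: "(\<integral>\<omega>. mN \<omega> powr \<alpha> \<partial>M) \<le> Cd * (\<integral>\<omega>. \<bar>N n \<omega>\<bar> powr \<alpha> \<partial>M)"
      unfolding Cd_def mN_def using doob[OF \<alpha>] iN by (simp add: N_def)
    have "(\<integral>\<omega>. \<bar>N n \<omega>\<bar> powr \<alpha> \<partial>M) \<le> (\<integral>\<omega>. b * (\<bar>A \<omega>\<bar> powr \<alpha> + R n \<omega> powr \<alpha>) \<partial>M)"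
    proof (rule integral_mono)
      fix \<omega>
      have "\<bar>N n \<omega>\<bar> powr \<alpha> \<le> (\<bar>A \<omega>\<bar> + R n \<omega>) powr \<alpha>"
        using D_le[of n \<omega>] \<alpha> by (intro powr_mono2) (auto simp: N_def A_def)
      also have "\<dots> \<le> b * (\<bar>A \<omega>\<bar> powr \<alpha> + R n \<omega> powr \<alpha>)"
        unfolding b_def using R_pos[of n \<omega>] \<alpha> by (intro powr_add_le) auto
      finally show "\<bar>N n \<omega>\<bar> powr \<alpha> \<le> b * (\<bar>A \<omega>\<bar> powr \<alpha> + R n \<omega> powr \<alpha>)" .
    qed (use iN iA iR in auto)
    then have EN: "(\<integral>\<omega>. \<bar>N n \<omega>\<bar> powr \<alpha> \<partial>M) \<le> b * ((\<integral>\<omega>. \<bar>A \<omega>\<bar> powr \<alpha> \<partial>M) + (\<integral>\<omega>. R n \<omega> powr \<alpha> \<partial>M))"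
      using iA iR by simp
    have m_le: "m \<omega> powr \<alpha> \<le> b * (mN \<omega> powr \<alpha> + R n \<omega> powr \<alpha>)" for \<omega>
    proof -
      have "m \<omega> \<le> mN \<omega> + R n \<omega>"
        unfolding m_def
      proof (rule running_max_le)
        fix i assume i: "i \<le> n"
        have "\<bar>k i \<omega> - k' i \<omega>\<bar> \<le> \<bar>N i \<omega>\<bar> + \<bar>D i \<omega>\<bar>" by (auto simp: N_def)
        then show "\<bar>k i \<omega> - k' i \<omega>\<bar> \<le> mN \<omega> + R n \<omega>"
          using D_le[of i \<omega>] R_mono[OF i, of \<omega>] running_max_ge[OF i, of "\<lambda>i. N i \<omega>"] by (auto simp: mN_def)
      qed
      then have "m \<omega> powr \<alpha> \<le> (mN \<omega> + R n \<omega>) powr \<alpha>"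
        using \<alpha> by (intro powr_mono2) (auto simp: m_def)
      also have "\<dots> \<le> b * (mN \<omega> powr \<alpha> + R n \<omega> powr \<alpha>)"
        unfolding b_def using R_pos[of n \<omega>] \<alpha> by (intro powr_add_le) (auto simp: mN_def)
      finally show ?thesis .
    qed
    have im: "integrable M (\<lambda>\<omega>. m \<omega> powr \<alpha>)"
    proof (rule Bochner_Integration.integrable_bound)
      show "integrable M (\<lambda>\<omega>. b * (mN \<omega> powr \<alpha> + R n \<omega> powr \<alpha>))" using imN iR by auto
      show "AE \<omega> in M. norm (m \<omega> powr \<alpha>) \<le> norm (b * (mN \<omega> powr \<alpha> + R n \<omega> powr \<alpha>))"
        using m_le b by (auto simp: abs_mult)
    qed measurable
    have "(\<integral>\<omega>. m \<omega> powr \<alpha> \<partial>M) \<le> (\<integral>\<omega>. b * (mN \<omega> powr \<alpha> + R n \<omega> powr \<alpha>) \<partial>M)"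
      by (rule integral_mono) (use im imN iR m_le in auto)
    then have "(\<integral>\<omega>. m \<omega> powr \<alpha> \<partial>M) \<le> b * ((\<integral>\<omega>. mN \<omega> powr \<alpha> \<partial>M) + (\<integral>\<omega>. R n \<omega> powr \<alpha> \<partial>M))"
      using imN iR by simp
    also have "\<dots> \<le> b * (Cd * (b * ((\<integral>\<omega>. \<bar>A \<omega>\<bar> powr \<alpha> \<partial>M) + (\<integral>\<omega>. R n \<omega> powr \<alpha> \<partial>M))) + (\<integral>\<omega>. R n \<omega> powr \<alpha> \<partial>M))"
      using b Cd order_trans[OF doobN mult_left_mono[OF EN less_imp_le[OF Cd]]]
      by (intro mult_left_mono add_right_mono) auto
    finally have Em: "(\<integral>\<omega>. m \<omega> powr \<alpha> \<partial>M) \<le>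
        (b * Cd * b) * (\<integral>\<omega>. \<bar>A \<omega>\<bar> powr \<alpha> \<partial>M) + (b * Cd * b + b) * (\<integral>\<omega>. R n \<omega> powr \<alpha> \<partial>M)"
      by (simp add: algebra_simps)
    define W where "W \<omega> = (R n \<omega> * V n \<omega>) powr (\<alpha> / 2)" for \<omega>
    have W_M[measurable]: "W \<in> borel_measurable M" unfolding W_def by measurable
    have powr2: "x powr \<alpha> = (x * x) powr (\<alpha> / 2)" if "0 \<le> x" for x :: real
    proof -
      have "(x * x) powr (\<alpha> / 2) = (x powr 2) powr (\<alpha> / 2)"
        using that by (simp add: power2_eq_square)
      then show ?thesis by (simp add: powr_powr)
    qed
    have iW: "integrable M W"
    proof (rule U_dom[of _ 1])
      show "AE \<omega> in M. \<bar>W \<omega>\<bar> \<le> 1 * U \<omega> powr \<alpha>"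
        using Vn0
      proof eventually_elim
        case (elim \<omega>)
        have "U \<omega> powr \<alpha> = (U \<omega> * U \<omega>) powr (\<alpha> / 2)"
          using elim R_pos[of n \<omega>] by (intro powr2) (simp add: U_def)
        moreover have "W \<omega> \<le> (U \<omega> * U \<omega>) powr (\<alpha> / 2)"
          unfolding W_def using elim R_pos[of n \<omega>] \<alpha>
          by (intro powr_mono2 mult_mono) (auto simp: U_def)
        ultimately show ?case by (simp add: W_def)
      qed
    qed measurable
    have ie: "integrable M e"
    proof (rule U_dom[of _ "\<alpha> + 1"])
      show "AE \<omega> in M. \<bar>e \<omega>\<bar> \<le> (\<alpha> + 1) * U \<omega> powr \<alpha>"
        using gp
      proof eventually_elim
        case (elim \<omega>)
        then have "0 \<le> V n \<omega>" by auto
        then have "V n \<omega> powr \<alpha> \<le> U \<omega> powr \<alpha>"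
          using R_pos[of n \<omega>] \<alpha> by (intro powr_mono2) (auto simp: U_def)
        then have "(\<alpha> + 1) * V n \<omega> powr \<alpha> \<le> (\<alpha> + 1) * U \<omega> powr \<alpha>"
          using \<alpha> by (intro mult_left_mono) auto
        then show ?case
          using grid_error_bounds[OF \<alpha>, of "\<delta> \<omega>" "V n \<omega>" "\<epsilon> * \<epsilon>"] elim by (simp add: e_def)
      qed
    qed measurable
    let ?b = "\<lambda>\<omega>. \<alpha> * (\<Sum>i<n. G i \<omega> * (N (Suc i) \<omega> - N i \<omega>)) + \<alpha> * e \<omega> + \<eta> * m \<omega> powr \<alpha>
        + C1 * (a * (R n \<omega> powr \<alpha> + W \<omega>))"
    have "AE \<omega> in M. \<bar>A \<omega>\<bar> powr \<alpha> \<le> ?b \<omega>"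
      using gp Vn0
    proof eventually_elim
      case (elim \<omega>)
      then have "\<bar>A \<omega>\<bar> powr \<alpha> \<le> \<alpha> * (\<Sum>i<n. G i \<omega> * (N (Suc i) \<omega> - N i \<omega>))
          + \<alpha> * grid_error \<alpha> (R 0 \<omega> * R 0 \<omega>) (\<delta> \<omega>) (V n \<omega>) + \<eta> * m \<omega> powr \<alpha>
          + C1 * (R n \<omega> * (R n \<omega> + V n \<omega>)) powr (\<alpha> / 2)"
        unfolding A_def G_def N_def V_def m_def by (intro path) auto
      \<comment> \<open>R 0 depends on the path; its lower bound \<epsilon> yields an error with a
        constant parameter.\<close>
      moreover have "grid_error \<alpha> (R 0 \<omega> * R 0 \<omega>) (\<delta> \<omega>) (V n \<omega>) \<le> e \<omega>"
        unfolding e_def using \<epsilon> R0[of 0 \<omega>] elim by (intro grid_error_antimono mult_mono) auto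
      then have "\<alpha> * grid_error \<alpha> (R 0 \<omega> * R 0 \<omega>) (\<delta> \<omega>) (V n \<omega>) \<le> \<alpha> * e \<omega>"
        using \<alpha> by (intro mult_left_mono) auto
      moreover have "C1 * (R n \<omega> * (R n \<omega> + V n \<omega>)) powr (\<alpha> / 2) \<le> C1 * (a * (R n \<omega> powr \<alpha> + W \<omega>))"
      proof (intro mult_left_mono C1)
        have "(R n \<omega> * (R n \<omega> + V n \<omega>)) powr (\<alpha> / 2) = (R n \<omega> * R n \<omega> + R n \<omega> * V n \<omega>) powr (\<alpha> / 2)"
          by (simp add: distrib_left)
        also have "\<dots> \<le> a * ((R n \<omega> * R n \<omega>) powr (\<alpha> / 2) + W \<omega>)"
          unfolding a_def W_def using elim R_pos[of n \<omega>] \<alpha> by (intro powr_add_le) auto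
        finally show "(R n \<omega> * (R n \<omega> + V n \<omega>)) powr (\<alpha> / 2) \<le> a * (R n \<omega> powr \<alpha> + W \<omega>)"
          using powr2[of "R n \<omega>"] R_pos[of n \<omega>] by simp
      qed
      ultimately show ?case by linarith
    qed
    moreover have IS: "integrable M (\<lambda>\<omega>. \<Sum>i<n. G i \<omega> * (N (Suc i) \<omega> - N i \<omega>))"
      using GN by (intro Bochner_Integration.integrable_sum) auto
    moreover have IS0: "(\<integral>\<omega>. (\<Sum>i<n. G i \<omega> * (N (Suc i) \<omega> - N i \<omega>)) \<partial>M) = 0"
      using GN GN0 by (subst Bochner_Integration.integral_sum) auto
    ultimately have "(\<integral>\<omega>. \<bar>A \<omega>\<bar> powr \<alpha> \<partial>M) \<le> (\<integral>\<omega>. ?b \<omega> \<partial>M)"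
      using iA ie im iR iW by (intro integral_mono_AE) auto
    also have "\<dots> = \<alpha> * (\<integral>\<omega>. e \<omega> \<partial>M) + \<eta> * (\<integral>\<omega>. m \<omega> powr \<alpha> \<partial>M)
        + C1 * (a * ((\<integral>\<omega>. R n \<omega> powr \<alpha> \<partial>M) + (\<integral>\<omega>. W \<omega> \<partial>M)))"
      using ie im iR iW IS IS0 by simp
    also have "\<eta> * (\<integral>\<omega>. m \<omega> powr \<alpha> \<partial>M) \<le> \<eta> * ((b * Cd * b) * (\<integral>\<omega>. \<bar>A \<omega>\<bar> powr \<alpha> \<partial>M)
        + (b * Cd * b + b) * (\<integral>\<omega>. R n \<omega> powr \<alpha> \<partial>M))"
      using Em \<eta> by (intro mult_left_mono) auto
    also have "\<dots> = 1/2 * (\<integral>\<omega>. \<bar>A \<omega>\<bar> powr \<alpha> \<partial>M) + \<eta> * (b * Cd * b + b) * (\<integral>\<omega>. R n \<omega> powr \<alpha> \<partial>M)"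
    proof -
      have "\<eta> * (b * Cd * b) = 1/2" using b Cd by (simp add: \<eta>_def)
      then show ?thesis by (simp only: distrib_left mult.assoc[symmetric])
    qed
    finally have fin: "(\<integral>\<omega>. \<bar>A \<omega>\<bar> powr \<alpha> \<partial>M) \<le> 2 * \<alpha> * (\<integral>\<omega>. e \<omega> \<partial>M)
        + 2 * (\<eta> * (b * Cd * b + b)) * (\<integral>\<omega>. R n \<omega> powr \<alpha> \<partial>M)
        + 2 * (C1 * a) * ((\<integral>\<omega>. R n \<omega> powr \<alpha> \<partial>M) + (\<integral>\<omega>. W \<omega> \<partial>M))"
      by (simp add: algebra_simps)
    let ?e = "\<integral>\<omega>. e \<omega> \<partial>M" and ?r = "\<integral>\<omega>. R n \<omega> powr \<alpha> \<partial>M" and ?w = "\<integral>\<omega>. W \<omega> \<partial>M"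
    have "0 \<le> ?r" by simp
    moreover have "0 \<le> ?w" by (simp add: W_def)
    moreover have "0 \<le> ?e"
    proof (rule integral_nonneg_AE)
      show "AE \<omega> in M. 0 \<le> e \<omega>"
        using gp by eventually_elim (use grid_error_bounds(1)[OF \<alpha>] in \<open>auto simp: e_def\<close>)
    qed
    ultimately have nn: "0 \<le> ?e" "0 \<le> ?r" "0 \<le> ?w" by auto
    define s where "s = ?r + ?w + ?e"
    have "2 * \<alpha> * ?e \<le> 2 * \<alpha> * s" "2 * (\<eta> * (b * Cd * b + b)) * ?r \<le> 2 * (\<eta> * (b * Cd * b + b)) * s"
        "2 * (C1 * a) * (?r + ?w) \<le> 2 * (C1 * a) * s"
      using nn \<alpha> \<eta> b Cd C1 a by (auto intro!: mult_left_mono simp: s_def)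
    then have "(\<integral>\<omega>. \<bar>A \<omega>\<bar> powr \<alpha> \<partial>M) \<le> C * s"
      using fin unfolding C_def distrib_right by linarith
    then show "(\<integral>\<omega>. \<bar>k n \<omega> - k' n \<omega>\<bar> powr \<alpha> \<partial>M) \<le>
        C * ((\<integral>\<omega>. (\<epsilon> + running_max (\<lambda>i. D i \<omega>) n) powr \<alpha> \<partial>M)
           + (\<integral>\<omega>. ((\<epsilon> + running_max (\<lambda>i. D i \<omega>) n) * (k n \<omega> + k' n \<omega>)) powr (\<alpha> / 2) \<partial>M)
           + (\<integral>\<omega>. grid_error \<alpha> (\<epsilon> * \<epsilon>) (\<delta> \<omega>) (k n \<omega> + k' n \<omega>) \<partial>M))"
      by (simp add: s_def A_def R_def W_def V_def e_def)
  qed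
  ultimately show ?thesis by (rule that)
qed

section \<open>From weak type tails to moments\<close>

definition tail_const :: "real \<Rightarrow> real \<Rightarrow> real" where
  "tail_const \<alpha> \<beta> = 1 + (\<Sum>j. (2 ^ Suc j) powr \<alpha> * (3 / 2 ^ j) powr \<beta>)"

lemma tail_series:
  assumes "0 < \<alpha>" "\<alpha> < \<beta>"
  shows "summable (\<lambda>j. ((2::real) ^ Suc j) powr \<alpha> * (3 / 2 ^ j) powr \<beta>)"
proof -
  have "((2::real) ^ Suc j) powr \<alpha> * (3 / 2 ^ j) powr \<beta> = 2 powr \<alpha> * 3 powr \<beta> * (2 powr (\<alpha> - \<beta>)) ^ j" for j
  proof -
    have "((2::real) ^ j) powr r = (2 powr r) ^ j" for r
      by (simp add: powr_realpow[symmetric] powr_powr mult.commute)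
    then show ?thesis by (simp add: powr_mult powr_divide powr_diff power_divide)
  qed
  moreover have "norm ((2::real) powr (\<alpha> - \<beta>)) < 1" using assms powr_less_one[of 2 "\<alpha> - \<beta>"] by simp
  ultimately show ?thesis by (simp only:) (intro summable_mult summable_geometric)
qed

text \<open>Layers at the levels 2 ^ j * L: between two of them Q is below 2 ^ (j + 1) * L, and the
  tail at 3 * a = 2 ^ j * L has probability at most (3 / 2 ^ j) powr \<beta>. The series converges
  because \<alpha> < \<beta>; the 1 in \<open>tail_const\<close> is the part below L.\<close>

lemma moment_of_tail:
  assumes "prob_space P" and \<alpha>: "0 < \<alpha>" "\<alpha> < \<beta>" and L: "0 < L"
    and Q0: "\<And>\<omega>. 0 \<le> Q \<omega>" and Q[measurable]: "Q \<in> borel_measurable P"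
    and tail: "\<And>a. 0 < a \<Longrightarrow> emeasure P {\<omega>\<in>space P. 3 * a \<le> Q \<omega>} \<le> ennreal (a powr - \<beta> * L powr \<beta>)"
  shows "(\<integral>\<^sup>+\<omega>. ennreal (Q \<omega> powr \<alpha>) \<partial>P) \<le> ennreal (tail_const \<alpha> \<beta> * L powr \<alpha>)"
proof -
  interpret prob_space P by fact
  define A where "A j = {\<omega>\<in>space P. 2 ^ j * L \<le> Q \<omega>}" for j :: nat
  have [measurable]: "A j \<in> sets P" for j unfolding A_def by measurable
  define c where "c j = ((2::real) ^ Suc j) powr \<alpha> * (3 / 2 ^ j) powr \<beta>" for j :: nat
  have \<beta>: "0 < \<beta>" using \<alpha> by simp
  have tailA: "emeasure P (A j) \<le> ennreal ((3 / 2 ^ j) powr \<beta>)" for j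
  proof -
    define a where "a = 2 ^ j * L / 3"
    have "0 < a" using L by (simp add: a_def)
    have three: "3 * a = 2 ^ j * L" by (simp add: a_def)
    have "emeasure P (A j) \<le> ennreal (a powr - \<beta> * L powr \<beta>)"
      using tail[OF \<open>0 < a\<close>] by (simp add: A_def three)
    also have "a powr - \<beta> * L powr \<beta> = (L / a) powr \<beta>"
      using \<open>0 < a\<close> L by (simp add: powr_divide powr_minus_divide)
    also have "L / a = 3 / 2 ^ j" using L by (simp add: a_def)
    finally show ?thesis .
  qed
  have le: "ennreal (Q \<omega> powr \<alpha>) \<le> ennreal (L powr \<alpha>) + (\<Sum>j. ennreal ((2 ^ Suc j * L) powr \<alpha>) * indicator (A j) \<omega>)"
    if \<omega>: "\<omega> \<in> space P" for \<omega>
  proof (cases "Q \<omega> < L")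
    case True
    then have "ennreal (Q \<omega> powr \<alpha>) \<le> ennreal (L powr \<alpha>)"
      using Q0[of \<omega>] \<alpha> by (intro ennreal_leI powr_mono2) auto
    then show ?thesis by (rule order_trans) simp
  next
    case False
    obtain i :: nat where "Q \<omega> / L < 2 ^ i" using real_arch_pow[of 2 "Q \<omega> / L"] by auto
    then have i: "Q \<omega> < 2 ^ i * L" using L by (simp add: field_simps)
    \<comment> \<open>The least dyadic level above Q. It is not 0 as Q \<ge> L, and by minimality
      its predecessor is not above Q.\<close>
    define k where "k = (LEAST i. Q \<omega> < 2 ^ i * L)"
    have k: "Q \<omega> < 2 ^ k * L" unfolding k_def using i by (rule LeastI)
    have "k \<noteq> 0" using k False by (cases "k = 0") auto
    then obtain j where j: "k = Suc j" by (cases k) auto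
    have "\<not> Q \<omega> < 2 ^ j * L" using not_less_Least[of j "\<lambda>i. Q \<omega> < 2 ^ i * L"] j by (simp add: k_def)
    then have "\<omega> \<in> A j" using \<omega> by (simp add: A_def)
    have "ennreal (Q \<omega> powr \<alpha>) \<le> ennreal ((2 ^ Suc j * L) powr \<alpha>) * indicator (A j) \<omega>"
      using \<open>\<omega> \<in> A j\<close> k j Q0[of \<omega>] \<alpha> by (simp add: powr_mono2 ennreal_leI)
    also have "\<dots> \<le> (\<Sum>j. ennreal ((2 ^ Suc j * L) powr \<alpha>) * indicator (A j) \<omega>)"
    proof -
      have "f j \<le> suminf f" for f :: "nat \<Rightarrow> ennreal"
        using sum_le_suminf[of f "{j}"] by simp
      then show ?thesis .
    qed
    finally show ?thesis by (rule order_trans) simp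
  qed
  have "(\<integral>\<^sup>+\<omega>. ennreal (Q \<omega> powr \<alpha>) \<partial>P)
      \<le> (\<integral>\<^sup>+\<omega>. ennreal (L powr \<alpha>) + (\<Sum>j. ennreal ((2 ^ Suc j * L) powr \<alpha>) * indicator (A j) \<omega>) \<partial>P)"
    by (intro nn_integral_mono le)
  also have "\<dots> = ennreal (L powr \<alpha>) + (\<Sum>j. ennreal ((2 ^ Suc j * L) powr \<alpha>) * emeasure P (A j))"
    by (subst nn_integral_add) (auto simp: nn_integral_suminf emeasure_space_1 nn_integral_cmult_indicator)
  also have "\<dots> \<le> ennreal (L powr \<alpha>) + (\<Sum>j. ennreal (L powr \<alpha> * c j))"
  proof (intro add_left_mono suminf_le)
    fix j
    have "ennreal ((2 ^ Suc j * L) powr \<alpha>) * emeasure P (A j)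
        \<le> ennreal ((2 ^ Suc j * L) powr \<alpha>) * ennreal ((3 / 2 ^ j) powr \<beta>)"
      by (intro mult_left_mono tailA) simp
    also have "\<dots> = ennreal (L powr \<alpha> * c j)"
      using L by (simp add: ennreal_mult'[symmetric] c_def powr_mult mult_ac)
    finally show "ennreal ((2 ^ Suc j * L) powr \<alpha>) * emeasure P (A j) \<le> ennreal (L powr \<alpha> * c j)" .
  qed auto
  also have "(\<Sum>j. ennreal (L powr \<alpha> * c j)) = ennreal (\<Sum>j. L powr \<alpha> * c j)"
    using tail_series[OF \<alpha>] by (intro suminf_ennreal2) (auto simp: c_def intro!: summable_mult)
  also have "(\<Sum>j. L powr \<alpha> * c j) = L powr \<alpha> * (\<Sum>j. c j)"
    using tail_series[OF \<alpha>] by (intro suminf_mult) (simp add: c_def)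
  also have "ennreal (L powr \<alpha>) + ennreal (L powr \<alpha> * (\<Sum>j. c j)) = ennreal (tail_const \<alpha> \<beta> * L powr \<alpha>)"
  proof -
    have c_def': "c = (\<lambda>j. (2 ^ Suc j) powr \<alpha> * (3 / 2 ^ j) powr \<beta>)" by (simp add: c_def fun_eq_iff)
    have "0 \<le> suminf c"
      using tail_series[OF \<alpha>] unfolding c_def' by (intro suminf_nonneg) auto
    moreover have "tail_const \<alpha> \<beta> = 1 + suminf c" unfolding tail_const_def c_def' ..
    ultimately show ?thesis by (simp add: algebra_simps flip: ennreal_plus)
  qed
  finally show ?thesis .
qed

lemma tail_const_ge: "0 < \<alpha> \<Longrightarrow> \<alpha> < \<beta> \<Longrightarrow> 1 \<le> tail_const \<alpha> \<beta>"
  unfolding tail_const_def using suminf_nonneg[OF tail_series] by simp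

section \<open>Locally Lipschitz functions of polynomial growth\<close>

lemma tuple_norm_nonneg [simp]: "0 \<le> tuple_norm n x"
  by (simp add: tuple_norm_def L2_set_nonneg)

lemma tuple_norm_zero [simp]: "tuple_norm n (\<lambda>i. 0) = 0"
  by (simp add: tuple_norm_def L2_set_def)

lemma norm_le_tuple_norm: "i < n \<Longrightarrow> norm (x i) \<le> tuple_norm n x"
  unfolding tuple_norm_def by (rule member_le_L2_set) auto

lemma tuple_norm_le_sum: "tuple_norm n x \<le> (\<Sum>i<n. norm (x i))"
  unfolding tuple_norm_def by (rule L2_set_le_sum) auto

lemma tuple_norm_triangle: "tuple_norm n (\<lambda>i. x i + y i) \<le> tuple_norm n x + tuple_norm n y"
proof -
  have "tuple_norm n (\<lambda>i. x i + y i) \<le> L2_set (\<lambda>i. norm (x i) + norm (y i)) {..<n}"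
    unfolding tuple_norm_def by (rule L2_set_mono) (auto simp: norm_triangle_ineq)
  also have "\<dots> \<le> tuple_norm n x + tuple_norm n y"
    unfolding tuple_norm_def by (rule L2_set_triangle_ineq)
  finally show ?thesis .
qed

lemma tuple_norm_minus: "tuple_norm n (\<lambda>i. x i - y i) = tuple_norm n (\<lambda>i. y i - x i)"
  by (simp add: tuple_norm_def norm_minus_commute)

lemma powers_le_power_sum:
  fixes a b :: real
  assumes "0 \<le> a" "0 \<le> b"
  shows "1 + a ^ k + b ^ k \<le> 3 * (1 + a + b) ^ k"
proof -
  have "1 \<le> (1 + a + b) ^ k" using assms by (intro one_le_power) auto
  moreover have "a ^ k \<le> (1 + a + b) ^ k" "b ^ k \<le> (1 + a + b) ^ k"
    using assms by (auto intro!: power_mono)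
  ultimately show ?thesis by linarith
qed

lemma power_sum_le_powers:
  fixes a b :: real
  assumes "0 \<le> a" "0 \<le> b"
  shows "(1 + a + b) ^ k \<le> 3 ^ k * (1 + a ^ k + b ^ k)"
proof -
  let ?m = "max 1 (max a b)"
  have "(1 + a + b) ^ k \<le> (3 * ?m) ^ k" using assms by (intro power_mono) auto
  also have "\<dots> = 3 ^ k * ?m ^ k" by (simp add: power_mult_distrib)
  also have "?m ^ k \<le> 1 + a ^ k + b ^ k"
    using assms by (auto simp: max_def)
  finally show ?thesis by simp
qed

text \<open>Powers of one base 1 + \<bar>x\<bar> + \<bar>y\<bar> multiply by adding exponents, which
  the sum of powers in the definition does not allow. This rule and the next one translate between
  the two forms.\<close>

lemma C_lLip_tupleI:
  fixes \<phi> :: "(nat \<Rightarrow> 'v::real_normed_vector) \<Rightarrow> real"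
  assumes "\<And>x y. \<bar>\<phi> x - \<phi> y\<bar>
     \<le> C * (1 + tuple_norm n x + tuple_norm n y) ^ k * tuple_norm n (\<lambda>i. x i - y i)"
  shows "\<phi> \<in> C_lLip_tuple n"
proof -
  have "\<bar>\<phi> x - \<phi> y\<bar> \<le> (\<bar>C\<bar> * 3 ^ k) * (1 + tuple_norm n x ^ k + tuple_norm n y ^ k)
                        * tuple_norm n (\<lambda>i. x i - y i)" for x y
  proof -
    have "C * (1 + tuple_norm n x + tuple_norm n y) ^ k
        \<le> \<bar>C\<bar> * (3 ^ k * (1 + tuple_norm n x ^ k + tuple_norm n y ^ k))"
      by (intro mult_mono power_sum_le_powers) auto
    from mult_right_mono[OF this tuple_norm_nonneg[of n "\<lambda>i. x i - y i"]] assms[of x y]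
    show ?thesis by (simp add: mult.assoc)
  qed
  then show ?thesis unfolding C_lLip_tuple_def by blast
qed

lemma C_lLip_tupleE:
  fixes \<phi> :: "(nat \<Rightarrow> 'v::real_normed_vector) \<Rightarrow> real"
  assumes "\<phi> \<in> C_lLip_tuple n"
  obtains C k where "C \<ge> 0" "\<And>x y. \<bar>\<phi> x - \<phi> y\<bar>
     \<le> C * (1 + tuple_norm n x + tuple_norm n y) ^ k * tuple_norm n (\<lambda>i. x i - y i)"
proof -
  obtain C and k :: nat where C: "\<And>x y. \<bar>\<phi> x - \<phi> y\<bar> \<le> C * (1 + tuple_norm n x ^ k + tuple_norm n y ^ k)
                       * tuple_norm n (\<lambda>i. x i - y i)"
    using assms by (auto simp: C_lLip_tuple_def)
  have "\<bar>\<phi> x - \<phi> y\<bar>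
     \<le> \<bar>C\<bar> * 3 * (1 + tuple_norm n x + tuple_norm n y) ^ k * tuple_norm n (\<lambda>i. x i - y i)" for x y
  proof -
    have "C * (1 + tuple_norm n x ^ k + tuple_norm n y ^ k)
        \<le> \<bar>C\<bar> * (3 * (1 + tuple_norm n x + tuple_norm n y) ^ k)"
      by (intro mult_mono powers_le_power_sum) auto
    from mult_right_mono[OF this tuple_norm_nonneg[of n "\<lambda>i. x i - y i"]] C[of x y]
    show ?thesis by (simp add: mult.assoc)
  qed
  then show ?thesis using that[of "\<bar>C\<bar> * 3" k] by auto
qed

lemma C_lLip_tuple_growth:
  fixes \<phi> :: "(nat \<Rightarrow> 'v::real_normed_vector) \<Rightarrow> real"
  assumes "\<phi> \<in> C_lLip_tuple n"
  obtains C k where "C \<ge> 0" "\<And>x. \<bar>\<phi> x\<bar> \<le> C * (1 + tuple_norm n x) ^ k"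
proof -
  obtain C k where C: "C \<ge> 0" and le: "\<And>x y. \<bar>\<phi> x - \<phi> y\<bar>
     \<le> C * (1 + tuple_norm n x + tuple_norm n y) ^ k * tuple_norm n (\<lambda>i. x i - y i)"
    using assms by (rule C_lLip_tupleE) blast
  have "\<bar>\<phi> x\<bar> \<le> (\<bar>\<phi> (\<lambda>_. 0)\<bar> + C) * (1 + tuple_norm n x) ^ Suc k" for x
  proof -
    let ?t = "tuple_norm n x"
    have "\<bar>\<phi> x\<bar> \<le> \<bar>\<phi> (\<lambda>_. 0)\<bar> + C * (1 + ?t) ^ k * ?t"
      using le[of x "\<lambda>_. 0"] by simp
    also have "\<bar>\<phi> (\<lambda>_. 0)\<bar> \<le> \<bar>\<phi> (\<lambda>_. 0)\<bar> * (1 + ?t) ^ Suc k"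
      by (rule mult_left_mono[of 1 _ "\<bar>\<phi> (\<lambda>_. 0)\<bar>", simplified mult_1_right])
         (auto intro: one_le_power simp del: power_Suc)
    also have "C * (1 + ?t) ^ k * ?t \<le> C * (1 + ?t) ^ k * (1 + ?t)"
      using C by (intro mult_left_mono) auto
    also have "\<dots> = C * (1 + ?t) ^ Suc k" by simp
    finally show ?thesis by (simp only: distrib_right add_mono)
  qed
  then show ?thesis using that[of "\<bar>\<phi> (\<lambda>_. 0)\<bar> + C" "Suc k"] C by auto
qed

lemma C_lLip_tuple_const: "(\<lambda>_. c) \<in> C_lLip_tuple n"
  by (rule C_lLip_tupleI[of _ 0 _ 0]) simp

lemma C_lLip_tuple_lipschitz:
  assumes "\<And>x y. \<bar>\<phi> x - \<phi> y\<bar> \<le> L * tuple_norm n (\<lambda>i. x i - y i)"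
  shows "\<phi> \<in> C_lLip_tuple n"
  by (rule C_lLip_tupleI[of _ L _ 0]) (simp add: assms)

lemma bdd_Lip_tuple_subset: "bdd_Lip_tuple n \<subseteq> C_lLip_tuple n"
  unfolding bdd_Lip_tuple_def by (auto intro: C_lLip_tuple_lipschitz)

lemma C_lLip_tuple_add:
  fixes \<phi> \<psi> :: "(nat \<Rightarrow> 'v::real_normed_vector) \<Rightarrow> real"
  assumes "\<phi> \<in> C_lLip_tuple n" "\<psi> \<in> C_lLip_tuple n"
  shows "(\<lambda>x. \<phi> x + \<psi> x) \<in> C_lLip_tuple n"
proof -
  obtain C k where C: "C \<ge> 0" and leC: "\<And>x y. \<bar>\<phi> x - \<phi> y\<bar>
     \<le> C * (1 + tuple_norm n x + tuple_norm n y) ^ k * tuple_norm n (\<lambda>i. x i - y i)"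
    using assms(1) by (rule C_lLip_tupleE) blast
  obtain C' k' where C': "C' \<ge> 0" and leC': "\<And>x y. \<bar>\<psi> x - \<psi> y\<bar>
     \<le> C' * (1 + tuple_norm n x + tuple_norm n y) ^ k' * tuple_norm n (\<lambda>i. x i - y i)"
    using assms(2) by (rule C_lLip_tupleE) blast
  show ?thesis
  proof (rule C_lLip_tupleI)
    fix x y :: "nat \<Rightarrow> 'v"
    let ?s = "1 + tuple_norm n x + tuple_norm n y" and ?d = "tuple_norm n (\<lambda>i. x i - y i)"
    have "\<bar>(\<phi> x + \<psi> x) - (\<phi> y + \<psi> y)\<bar> \<le> C * ?s ^ k * ?d + C' * ?s ^ k' * ?d"
      using leC[of x y] leC'[of x y] by linarith
    also have "\<dots> \<le> C * ?s ^ (max k k') * ?d + C' * ?s ^ (max k k') * ?d"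
      using C C' by (intro add_mono mult_right_mono mult_left_mono power_increasing) auto
    finally show "\<bar>(\<phi> x + \<psi> x) - (\<phi> y + \<psi> y)\<bar> \<le> (C + C') * ?s ^ (max k k') * ?d"
      by (simp add: algebra_simps)
  qed
qed

text \<open>The scalar counterpart of the test functions. Scalings, absolute values, truncations,
  powers and, by polarization, products of test functions are obtained by composition with such
  functions.\<close>

definition poly_lipschitz :: "(real \<Rightarrow> real) \<Rightarrow> bool" where
  "poly_lipschitz f \<longleftrightarrow> (\<exists>C k. \<forall>a b. \<bar>f a - f b\<bar> \<le> C * (1 + \<bar>a\<bar> + \<bar>b\<bar>) ^ k * \<bar>a - b\<bar>)"

lemma poly_lipschitzI:
  assumes "\<And>a b. \<bar>f a - f b\<bar> \<le> C * (1 + \<bar>a\<bar> + \<bar>b\<bar>) ^ k * \<bar>a - b\<bar>"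
  shows "poly_lipschitz f"
  using assms unfolding poly_lipschitz_def by blast

lemma poly_lipschitz_lipschitz:
  assumes "\<And>a b. \<bar>f a - f b\<bar> \<le> L * \<bar>a - b\<bar>"
  shows "poly_lipschitz f"
  by (rule poly_lipschitzI[of _ L 0]) (simp add: assms)

text \<open>The Lipschitz constant of f is taken at \<phi> x and \<phi> y, which grow polynomially
  themselves; the exponents combine to l * j + k.\<close>

lemma C_lLip_tuple_comp:
  fixes \<phi> :: "(nat \<Rightarrow> 'v::real_normed_vector) \<Rightarrow> real"
  assumes "poly_lipschitz f" "\<phi> \<in> C_lLip_tuple n"
  shows "(\<lambda>x. f (\<phi> x)) \<in> C_lLip_tuple n"
proof -
  obtain C0 j where f0: "\<And>a b. \<bar>f a - f b\<bar> \<le> C0 * (1 + \<bar>a\<bar> + \<bar>b\<bar>) ^ j * \<bar>a - b\<bar>"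
    using assms(1) unfolding poly_lipschitz_def by blast
  have f: "\<bar>f a - f b\<bar> \<le> \<bar>C0\<bar> * (1 + \<bar>a\<bar> + \<bar>b\<bar>) ^ j * \<bar>a - b\<bar>" for a b
    by (rule order_trans[OF f0]) (intro mult_right_mono, auto)
  obtain C k where C: "C \<ge> 0" and leC: "\<And>x y. \<bar>\<phi> x - \<phi> y\<bar>
     \<le> C * (1 + tuple_norm n x + tuple_norm n y) ^ k * tuple_norm n (\<lambda>i. x i - y i)"
    using assms(2) by (rule C_lLip_tupleE) blast
  obtain D l where D: "D \<ge> 0" and leD: "\<And>x. \<bar>\<phi> x\<bar> \<le> D * (1 + tuple_norm n x) ^ l"
    using assms(2) by (rule C_lLip_tuple_growth) blast
  show ?thesis
  proof (rule C_lLip_tupleI)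
    fix x y :: "nat \<Rightarrow> 'v"
    let ?s = "1 + tuple_norm n x + tuple_norm n y" and ?d = "tuple_norm n (\<lambda>i. x i - y i)"
    have *: "\<bar>\<phi> z\<bar> \<le> D * ?s ^ l" if "z = x \<or> z = y" for z
      by (rule order_trans[OF leD]) (use D that in \<open>intro mult_left_mono power_mono, auto\<close>)
    have "1 + \<bar>\<phi> x\<bar> + \<bar>\<phi> y\<bar> \<le> ?s ^ l + D * ?s ^ l + D * ?s ^ l"
      using *[of x] *[of y] by (intro add_mono one_le_power) auto
    then have b: "1 + \<bar>\<phi> x\<bar> + \<bar>\<phi> y\<bar> \<le> (1 + 2 * D) * ?s ^ l" by (simp add: algebra_simps)
    have "\<bar>f (\<phi> x) - f (\<phi> y)\<bar> \<le> \<bar>C0\<bar> * (1 + \<bar>\<phi> x\<bar> + \<bar>\<phi> y\<bar>) ^ j * \<bar>\<phi> x - \<phi> y\<bar>"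
      by (rule f)
    also have "\<dots> \<le> \<bar>C0\<bar> * ((1 + 2 * D) * ?s ^ l) ^ j * (C * ?s ^ k * ?d)"
      using b leC[of x y] C D by (intro mult_mono power_mono) (auto intro!: mult_nonneg_nonneg)
    also have "\<dots> = (\<bar>C0\<bar> * (1 + 2 * D) ^ j * C) * ?s ^ (l * j + k) * ?d"
      by (simp add: power_mult_distrib power_mult[symmetric] power_add mult_ac)
    finally show "\<bar>f (\<phi> x) - f (\<phi> y)\<bar> \<le> (\<bar>C0\<bar> * (1 + 2 * D) ^ j * C) * ?s ^ (l * j + k) * ?d" .
  qed
qed

lemma C_lLip_tuple_scale:
  assumes "\<phi> \<in> C_lLip_tuple n"
  shows "(\<lambda>x. c * \<phi> x) \<in> C_lLip_tuple n"
  by (rule C_lLip_tuple_comp[OF _ assms], rule poly_lipschitz_lipschitz[of _ "\<bar>c\<bar>"])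
     (simp add: right_diff_distrib[symmetric] abs_mult)

lemma C_lLip_tuple_diff:
  assumes "\<phi> \<in> C_lLip_tuple n" "\<psi> \<in> C_lLip_tuple n"
  shows "(\<lambda>x. \<phi> x - \<psi> x) \<in> C_lLip_tuple n"
  using C_lLip_tuple_add[OF assms(1) C_lLip_tuple_scale[OF assms(2), of "-1"]] by simp

lemma C_lLip_tuple_abs:
  assumes "\<phi> \<in> C_lLip_tuple n"
  shows "(\<lambda>x. \<bar>\<phi> x\<bar>) \<in> C_lLip_tuple n"
  by (rule C_lLip_tuple_comp[OF _ assms], rule poly_lipschitz_lipschitz[of _ 1]) simp

lemma C_lLip_tuple_max:
  assumes "\<phi> \<in> C_lLip_tuple n" "\<psi> \<in> C_lLip_tuple n"
  shows "(\<lambda>x. max (\<phi> x) (\<psi> x)) \<in> C_lLip_tuple n"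
proof -
  have "(\<lambda>x. max (\<phi> x) (\<psi> x)) = (\<lambda>x. (1/2) * (\<phi> x + \<psi> x + \<bar>\<phi> x - \<psi> x\<bar>))"
    by (auto simp: max_def)
  then show ?thesis
    by (auto intro!: C_lLip_tuple_scale C_lLip_tuple_add C_lLip_tuple_abs C_lLip_tuple_diff assms
             simp del: times_divide_eq_left)
qed

lemma poly_lipschitz_power: "poly_lipschitz (\<lambda>a. a ^ Suc k)"
proof (rule poly_lipschitzI)
  fix a b :: real
  have "\<bar>a ^ Suc k - b ^ Suc k\<bar> = \<bar>a - b\<bar> * \<bar>\<Sum>p<Suc k. b ^ (k - p) * a ^ p\<bar>"
    by (subst power_diff_sumr2) (simp add: abs_mult)
  also have "\<bar>\<Sum>p<Suc k. b ^ (k - p) * a ^ p\<bar> \<le> (\<Sum>p<Suc k. (1 + \<bar>a\<bar> + \<bar>b\<bar>) ^ k)"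
  proof (rule order_trans[OF sum_abs], rule sum_mono)
    fix p assume "p \<in> {..<Suc k}"
    have "\<bar>b ^ (k - p) * a ^ p\<bar> \<le> (1 + \<bar>a\<bar> + \<bar>b\<bar>) ^ p * (1 + \<bar>a\<bar> + \<bar>b\<bar>) ^ (k - p)"
      unfolding abs_mult power_abs by (subst mult.commute, intro mult_mono power_mono) auto
    also have "\<dots> = (1 + \<bar>a\<bar> + \<bar>b\<bar>) ^ k"
      using \<open>p \<in> {..<Suc k}\<close> by (simp add: power_add[symmetric])
    finally show "\<bar>b ^ (k - p) * a ^ p\<bar> \<le> (1 + \<bar>a\<bar> + \<bar>b\<bar>) ^ k" .
  qed
  finally have "\<bar>a ^ Suc k - b ^ Suc k\<bar> \<le> \<bar>a - b\<bar> * (\<Sum>p<Suc k. (1 + \<bar>a\<bar> + \<bar>b\<bar>) ^ k)"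
    by (simp add: mult_left_mono)
  then show "\<bar>a ^ Suc k - b ^ Suc k\<bar> \<le> real (Suc k) * (1 + \<bar>a\<bar> + \<bar>b\<bar>) ^ k * \<bar>a - b\<bar>"
    by (simp add: mult_ac)
qed

text \<open>Polarization reduces products to squares.\<close>

lemma C_lLip_tuple_mult:
  assumes "\<phi> \<in> C_lLip_tuple n" "\<psi> \<in> C_lLip_tuple n"
  shows "(\<lambda>x. \<phi> x * \<psi> x) \<in> C_lLip_tuple n"
proof -
  have "(\<lambda>x. \<phi> x * \<psi> x) = (\<lambda>x. (1/4) * ((\<phi> x + \<psi> x)\<^sup>2 - (\<phi> x - \<psi> x)\<^sup>2))"
    by (auto simp: power2_eq_square algebra_simps)
  moreover have "poly_lipschitz (\<lambda>a. a\<^sup>2)"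
    using poly_lipschitz_power[of 1] by (simp add: numeral_2_eq_2)
  ultimately show ?thesis
    by (auto intro!: C_lLip_tuple_scale C_lLip_tuple_diff C_lLip_tuple_comp[of "\<lambda>a. a\<^sup>2"]
        C_lLip_tuple_add assms simp del: times_divide_eq_left)
qed

text \<open>A Lipschitz change of variables grows at most linearly and so preserves polynomial
  growth of the local Lipschitz constant. It covers regrouping, partial sums, scaling and grafting
  of arguments.\<close>

lemma C_lLip_tuple_reparam:
  fixes g :: "(nat \<Rightarrow> 'u::real_normed_vector) \<Rightarrow> (nat \<Rightarrow> 'v::real_normed_vector)"
  assumes \<phi>: "\<phi> \<in> C_lLip_tuple n"
    and lip: "\<And>x y :: nat \<Rightarrow> 'u. tuple_norm n (\<lambda>i. g x i - g y i) \<le> c * tuple_norm m (\<lambda>i. x i - y i)"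
  shows "(\<lambda>x. \<phi> (g x)) \<in> C_lLip_tuple m"
proof -
  obtain C k where C: "C \<ge> 0" and leC: "\<And>x y. \<bar>\<phi> x - \<phi> y\<bar>
     \<le> C * (1 + tuple_norm n x + tuple_norm n y) ^ k * tuple_norm n (\<lambda>i. x i - y i)"
    using \<phi> by (rule C_lLip_tupleE) blast
  have lip': "tuple_norm n (\<lambda>i. g x i - g y i) \<le> \<bar>c\<bar> * tuple_norm m (\<lambda>i. x i - y i)" for x y
    by (rule order_trans[OF lip]) (auto intro!: mult_right_mono)
  define b where "b = tuple_norm n (g (\<lambda>_. 0))"
  have gr: "tuple_norm n (g x) \<le> \<bar>c\<bar> * tuple_norm m x + b" for x
  proof -
    have "tuple_norm n (g x) = tuple_norm n (\<lambda>i. (g x i - g (\<lambda>_. 0) i) + g (\<lambda>_. 0) i)" by simp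
    also have "\<dots> \<le> tuple_norm n (\<lambda>i. g x i - g (\<lambda>_. 0) i) + b"
      unfolding b_def by (rule tuple_norm_triangle)
    also have "tuple_norm n (\<lambda>i. g x i - g (\<lambda>_. 0) i) \<le> \<bar>c\<bar> * tuple_norm m x"
      using lip'[of x "\<lambda>_. 0"] by simp
    finally show ?thesis by simp
  qed
  show ?thesis
  proof (rule C_lLip_tupleI)
    fix x y :: "nat \<Rightarrow> 'u"
    let ?s = "1 + tuple_norm m x + tuple_norm m y" and ?d = "tuple_norm m (\<lambda>i. x i - y i)"
    have b0: "b \<ge> 0" by (simp add: b_def)
    have "1 + tuple_norm n (g x) + tuple_norm n (g y)
      \<le> 1 * ?s + \<bar>c\<bar> * ?s + (2 * b) * ?s"
    proof -
      define s where "s = ?s"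
      have "1 \<le> s" by (simp add: s_def)
      moreover have "2 * b \<le> (2 * b) * s" using b0 mult_left_mono[of 1 s "2*b"] by (simp add: s_def)
      moreover have "\<bar>c\<bar> * tuple_norm m x + \<bar>c\<bar> * tuple_norm m y \<le> \<bar>c\<bar> * s"
        by (simp add: s_def algebra_simps)
      ultimately show ?thesis using gr[of x] gr[of y] unfolding s_def[symmetric] by linarith
    qed
    then have s: "1 + tuple_norm n (g x) + tuple_norm n (g y) \<le> (1 + \<bar>c\<bar> + 2 * b) * ?s"
      by (simp add: algebra_simps)
    have "\<bar>\<phi> (g x) - \<phi> (g y)\<bar> \<le> C * (1 + tuple_norm n (g x) + tuple_norm n (g y)) ^ k
            * tuple_norm n (\<lambda>i. g x i - g y i)" by (rule leC)
    also have "\<dots> \<le> C * ((1 + \<bar>c\<bar> + 2 * b) * ?s) ^ k * (\<bar>c\<bar> * ?d)"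
      using C s lip'[of x y] b0 by (intro mult_mono power_mono) (auto intro!: mult_nonneg_nonneg)
    also have "\<dots> = (C * (1 + \<bar>c\<bar> + 2 * b) ^ k * \<bar>c\<bar>) * ?s ^ k * ?d"
      by (simp only: power_mult_distrib mult_ac)
    finally show "\<bar>\<phi> (g x) - \<phi> (g y)\<bar> \<le> (C * (1 + \<bar>c\<bar> + 2 * b) ^ k * \<bar>c\<bar>) * ?s ^ k * ?d" .
  qed
qed


lemma tuple_norm_le_const:
  assumes "\<And>i. i < n \<Longrightarrow> norm (x i) \<le> c" "0 \<le> c"
  shows "tuple_norm n x \<le> real n * c"
  using order_trans[OF tuple_norm_le_sum sum_bounded_above[of "{..<n}" "\<lambda>i. norm (x i)" c]] assms
  by auto

lemma C_lLip_tuple_reparam_coordinatewise: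
  fixes g :: "(nat \<Rightarrow> 'u::real_normed_vector) \<Rightarrow> (nat \<Rightarrow> 'v::real_normed_vector)"
  assumes \<phi>: "\<phi> \<in> C_lLip_tuple n" and "0 \<le> c"
    and lip: "\<And>x y i. i < n \<Longrightarrow> norm (g x i - g y i) \<le> c * tuple_norm m (\<lambda>i. x i - y i)"
  shows "(\<lambda>x. \<phi> (g x)) \<in> C_lLip_tuple m"
proof (rule C_lLip_tuple_reparam[OF \<phi>, of _ "real n * c"])
  show "tuple_norm n (\<lambda>i. g x i - g y i) \<le> real n * c * tuple_norm m (\<lambda>i. x i - y i)" for x y
    using tuple_norm_le_const[of n "\<lambda>i. g x i - g y i" "c * tuple_norm m (\<lambda>i. x i - y i)"]
      lip \<open>0 \<le> c\<close> by (simp add: mult.assoc)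
qed

lemma C_lLip_tuple_mono:
  assumes "\<phi> \<in> C_lLip_tuple n" "n \<le> m"
  shows "\<phi> \<in> C_lLip_tuple m"
proof -
  have "(\<lambda>x. \<phi> (\<lambda>i. x i)) \<in> C_lLip_tuple m"
    by (rule C_lLip_tuple_reparam_coordinatewise[OF assms(1), of 1])
       (use assms(2) in \<open>auto intro: norm_le_tuple_norm less_le_trans\<close>)
  then show ?thesis by simp
qed

lemma C_lLip_tuple_coordinate:
  fixes k :: "'d::finite"
  assumes "j < n"
  shows "(\<lambda>x :: nat \<Rightarrow> real^'d. x j $ k) \<in> C_lLip_tuple n"
proof (rule C_lLip_tuple_lipschitz[of _ 1])
  fix x y :: "nat \<Rightarrow> real^'d"
  have "\<bar>x j $ k - y j $ k\<bar> \<le> norm (x j - y j)"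
    using component_le_norm_cart[of "x j - y j" k] by simp
  also have "\<dots> \<le> tuple_norm n (\<lambda>i. x i - y i)" by (rule norm_le_tuple_norm[OF assms])
  finally show "\<bar>x j $ k - y j $ k\<bar> \<le> 1 * tuple_norm n (\<lambda>i. x i - y i)" by simp
qed

section \<open>Cylinder functions\<close>

lemma H0I:
  assumes "n \<ge> 1" "\<And>i. i < n \<Longrightarrow> t i \<in> {0..s}" "\<phi> \<in> C_lLip_tuple n"
  shows "(\<lambda>\<omega>. \<phi> (\<lambda>i. B (t i) \<omega>)) \<in> H0 s"
  unfolding H0_def using assms by blast

lemma H0E:
  assumes "X \<in> H0 s"
  obtains n t \<phi> where "n \<ge> 1" "\<And>i. i < n \<Longrightarrow> t i \<in> {0..s}" "\<phi> \<in> C_lLip_tuple n"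
    "X = (\<lambda>\<omega>. \<phi> (\<lambda>i. B (t i) \<omega>))"
  using assms unfolding H0_def by blast

lemma H0_mono: "s \<le> s' \<Longrightarrow> X \<in> H0 s \<Longrightarrow> X \<in> H0 s'"
  by (erule H0E) (force intro: H0I)

lemma Lip_subset_H0: "Lip s \<subseteq> H0 s"
proof
  fix X :: "'a path \<Rightarrow> real" assume "X \<in> Lip s"
  then obtain n t \<phi> where "n \<ge> 1" "\<forall>i<n. t i \<in> {0..s}" "\<phi> \<in> bdd_Lip_tuple n"
      "X = (\<lambda>\<omega>. \<phi> (\<lambda>i. B (t i) \<omega>))"
    unfolding Lip_def by blast
  then show "X \<in> H0 s" using H0I[of n t s \<phi>] bdd_Lip_tuple_subset[of n] by auto
qed

lemma H0_comp:
  assumes "poly_lipschitz f" "X \<in> H0 s"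
  shows "(\<lambda>\<omega>. f (X \<omega>)) \<in> H0 s"
proof -
  obtain n t \<phi> where X: "n \<ge> 1" "\<And>i. i < n \<Longrightarrow> t i \<in> {0..s}" "\<phi> \<in> C_lLip_tuple n"
    "X = (\<lambda>\<omega>. \<phi> (\<lambda>i. B (t i) \<omega>))"
    using assms(2) by (rule H0E) blast
  then show ?thesis using H0I[OF X(1,2) C_lLip_tuple_comp[OF assms(1) X(3)]] by simp
qed

lemma H0_const: "0 \<le> s \<Longrightarrow> (\<lambda>_. c) \<in> H0 s"
  using H0I[of 1 "\<lambda>_. 0" s "\<lambda>_. c"] C_lLip_tuple_const by auto

lemma H0_add:
  assumes "X \<in> H0 s" "Y \<in> H0 s"
  shows "(\<lambda>\<omega>. X \<omega> + Y \<omega>) \<in> H0 s"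
proof -
  obtain n t \<phi> where 1: "n \<ge> 1" "\<And>i. i < n \<Longrightarrow> t i \<in> {0..s}" "\<phi> \<in> C_lLip_tuple n"
      "X = (\<lambda>\<omega>. \<phi> (\<lambda>i. B (t i) \<omega>))"
    using assms(1) by (rule H0E) blast
  obtain n' t' \<phi>' where 2: "n' \<ge> 1" "\<And>i. i < n' \<Longrightarrow> t' i \<in> {0..s}" "\<phi>' \<in> C_lLip_tuple n'"
      "Y = (\<lambda>\<omega>. \<phi>' (\<lambda>i. B (t' i) \<omega>))"
    using assms(2) by (rule H0E) blast
  define u where "u i = (if i < n then t i else t' (i - n))" for i
  have "(\<lambda>x. \<phi>' (\<lambda>i. x (n + i))) \<in> C_lLip_tuple (n + n')"
    by (rule C_lLip_tuple_reparam_coordinatewise[OF 2(3), of 1])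
       (auto intro: norm_le_tuple_norm[where x = "\<lambda>i. _ i - _ i"])
  then have "(\<lambda>x. \<phi> x + \<phi>' (\<lambda>i. x (n + i))) \<in> C_lLip_tuple (n + n')"
    by (intro C_lLip_tuple_add C_lLip_tuple_mono[OF 1(3)]) auto
  then have "(\<lambda>\<omega>. \<phi> (\<lambda>i. B (u i) \<omega>) + \<phi>' (\<lambda>i. B (u (n + i)) \<omega>)) \<in> H0 s"
    using H0I[of "n + n'" u s "\<lambda>x. \<phi> x + \<phi>' (\<lambda>i. x (n + i))"] 1(1,2) 2(2) by (auto simp: u_def)
  moreover have "\<phi> (\<lambda>i. B (u i) \<omega>) = X \<omega>" for \<omega>
    unfolding 1(4) by (rule C_lLip_tuple_cong[OF 1(3)]) (simp add: u_def)
  moreover have "\<phi>' (\<lambda>i. B (u (n + i)) \<omega>) = Y \<omega>" for \<omega>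
    unfolding 2(4) by (rule C_lLip_tuple_cong[OF 2(3)]) (simp add: u_def)
  ultimately show ?thesis by simp
qed

lemma H0_scale: "X \<in> H0 s \<Longrightarrow> (\<lambda>\<omega>. c * X \<omega>) \<in> H0 s"
  by (rule H0_comp[of "\<lambda>x. c * x"], rule poly_lipschitz_lipschitz[of _ "\<bar>c\<bar>"])
     (simp_all add: right_diff_distrib[symmetric] abs_mult)

lemma H0_diff: "X \<in> H0 s \<Longrightarrow> Y \<in> H0 s \<Longrightarrow> (\<lambda>\<omega>. X \<omega> - Y \<omega>) \<in> H0 s"
  using H0_add[of X s "\<lambda>\<omega>. -1 * Y \<omega>"] H0_scale[of Y s "-1"] by simp

lemma H0_abs: "X \<in> H0 s \<Longrightarrow> (\<lambda>\<omega>. \<bar>X \<omega>\<bar>) \<in> H0 s"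
  by (rule H0_comp[of abs], rule poly_lipschitz_lipschitz[of _ 1]) auto

lemma H0_min:
  assumes "X \<in> H0 s" "Y \<in> H0 s"
  shows "(\<lambda>\<omega>. min (X \<omega>) (Y \<omega>)) \<in> H0 s"
proof -
  have "(\<lambda>\<omega>. min (X \<omega>) (Y \<omega>)) = (\<lambda>\<omega>. (1/2) * (X \<omega> + Y \<omega> - \<bar>X \<omega> - Y \<omega>\<bar>))"
    by (auto simp: min_def)
  then show ?thesis
    by (simp only:) (intro H0_scale H0_diff H0_add H0_abs assms)
qed

lemma H0_mult:
  assumes "X \<in> H0 s" "Y \<in> H0 s"
  shows "(\<lambda>\<omega>. X \<omega> * Y \<omega>) \<in> H0 s"
proof -
  have eq: "(\<lambda>\<omega>. X \<omega> * Y \<omega>) = (\<lambda>\<omega>. (1/4) * ((X \<omega> + Y \<omega>)\<^sup>2 - (X \<omega> - Y \<omega>)\<^sup>2))"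
    by (auto simp: power2_eq_square algebra_simps)
  have sq: "poly_lipschitz (\<lambda>a. a\<^sup>2)"
    using poly_lipschitz_power[of 1] by (simp add: numeral_2_eq_2)
  have "(\<lambda>\<omega>. (1/4) * ((X \<omega> + Y \<omega>)\<^sup>2 - (X \<omega> - Y \<omega>)\<^sup>2)) \<in> H0 s"
    by (intro H0_scale H0_diff[OF H0_comp[OF sq] H0_comp[OF sq]] H0_diff[OF assms] H0_add[OF assms])
  then show ?thesis unfolding eq .
qed

lemma H0_sum:
  assumes "0 \<le> s" "\<And>i. i \<in> I \<Longrightarrow> X i \<in> H0 s"
  shows "(\<lambda>\<omega>. \<Sum>i\<in>I. X i \<omega>) \<in> H0 s"
  using assms(2)
proof (induction I rule: infinite_finite_induct)
  case (insert i I)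
  then show ?case using H0_add[of "X i" s "\<lambda>\<omega>. \<Sum>i\<in>I. X i \<omega>"] by simp
qed (use H0_const[OF assms(1)] in auto)

lemma H0_B_component: "0 \<le> u \<Longrightarrow> u \<le> s \<Longrightarrow> (\<lambda>\<omega>. B u \<omega> $ k) \<in> H0 s"
  using H0I[of 1 "\<lambda>_. u" s "\<lambda>x. x 0 $ k"] C_lLip_tuple_coordinate[of 0 1 k] by auto

lemma H0_increments:
  assumes "0 \<le> s" "\<And>i. i \<le> m \<Longrightarrow> t i \<in> {0..s}" "\<phi> \<in> C_lLip_tuple m"
  shows "(\<lambda>\<omega>. \<phi> (increments t \<omega>)) \<in> H0 s"
proof -
  have "(\<lambda>x. \<phi> (\<lambda>i. x (Suc i) - x i)) \<in> C_lLip_tuple (Suc m)"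
  proof (rule C_lLip_tuple_reparam_coordinatewise[OF assms(3), of 2])
    fix x y :: "nat \<Rightarrow> real^'a" and i assume "i < m"
    have "norm ((x (Suc i) - x i) - (y (Suc i) - y i)) = norm ((x (Suc i) - y (Suc i)) - (x i - y i))"
      by (simp add: algebra_simps)
    also have "\<dots> \<le> norm (x (Suc i) - y (Suc i)) + norm (x i - y i)" by (rule norm_triangle_ineq4)
    also have "\<dots> \<le> 2 * tuple_norm (Suc m) (\<lambda>i. x i - y i)"
      using norm_le_tuple_norm[of "Suc i" "Suc m" "\<lambda>i. x i - y i"]
        norm_le_tuple_norm[of i "Suc m" "\<lambda>i. x i - y i"] \<open>i < m\<close> by simp
    finally show "norm ((x (Suc i) - x i) - (y (Suc i) - y i)) \<le> 2 * tuple_norm (Suc m) (\<lambda>i. x i - y i)" .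
  qed simp
  from H0I[OF _ _ this, of t s] assms(2) show ?thesis by (simp add: increments_def[abs_def])
qed

text \<open>The increasing enumeration of S with 0 and u added. For u = 0 it degenerates to m =
  0.\<close>

lemma exists_partition:
  assumes "finite S" "S \<subseteq> {0..u}" "0 \<le> (u::real)"
  obtains m and t :: "nat \<Rightarrow> real" where "t 0 = 0" "strict_mono_on {0..m} t" "t m = u" "S \<subseteq> t ` {0..m}"
proof -
  define A where "A = insert 0 (insert u S)"
  define xs where "xs = sorted_list_of_set A"
  have A: "finite A" "A \<subseteq> {0..u}" "0 \<in> A" "u \<in> A" using assms by (auto simp: A_def)
  have set: "set xs = A" and sorted: "sorted_wrt (<) xs"
    using A by (auto simp: xs_def)
  have len: "length xs > 0" using A set by (cases xs) auto
  define m where "m = length xs - 1"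
  have idx: "i \<le> m \<longleftrightarrow> i < length xs" for i using len unfolding m_def by linarith
  have mono: "strict_mono_on {0..m} (\<lambda>i. xs ! i)"
    using sorted_wrt_nth_less[OF sorted] by (auto simp: strict_mono_on_def idx)
  have range: "A = (\<lambda>i. xs ! i) ` {0..m}"
    unfolding set[symmetric] set_conv_nth using idx by auto
  have "xs ! 0 = 0"
  proof -
    obtain i where i: "i \<le> m" "xs ! i = 0" using A(3) range by auto
    have "xs ! 0 \<in> A" using set len by auto
    then show ?thesis
      using i A(2) strict_mono_onD[OF mono, of 0 i] by (cases "i = 0") auto
  qed
  moreover have "xs ! m = u"
  proof -
    obtain i where i: "i \<le> m" "xs ! i = u" using A(4) range by auto
    have "xs ! m \<in> A" using range by auto
    then show ?thesis
      using i A(2) strict_mono_onD[OF mono, of i m] by (cases "i = m") auto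
  qed
  ultimately show ?thesis
    using that[of "\<lambda>i. xs ! i" m] mono range by (auto simp: A_def)
qed

text \<open>Paths in \<open>Omega\<close> start at 0, so the value at a partition point is the sum
  of the increments before it. A finite set of times is returned instead of one partition, so that
  several variables can share a partition through all their times.\<close>

lemma H0_as_increments:
  assumes "X \<in> H0 s"
  obtains S where "finite S" "S \<subseteq> {0..s}"
    "\<And>m t T. t 0 = 0 \<Longrightarrow> S \<subseteq> t ` {0..m} \<Longrightarrow>
       \<exists>\<phi>\<in>C_lLip_tuple m. \<forall>\<omega>\<in>Omega T. X \<omega> = \<phi> (increments t \<omega>)"
proof -
  obtain n v \<phi> where X: "n \<ge> 1" "\<And>i. i < n \<Longrightarrow> v i \<in> {0..s}" "\<phi> \<in> C_lLip_tuple n"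
      "X = (\<lambda>\<omega>. \<phi> (\<lambda>i. B (v i) \<omega>))"
    using assms by (rule H0E) blast
  show ?thesis
  proof (rule that[of "v ` {..<n}"])
    fix m and t :: "nat \<Rightarrow> real" and T
    assume t: "t 0 = 0" "v ` {..<n} \<subseteq> t ` {0..m}"
    have "\<forall>i<n. \<exists>j. j \<le> m \<and> v i = t j" using t(2) by force
    then obtain j where j: "\<And>i. i < n \<Longrightarrow> j i \<le> m \<and> v i = t (j i)" by metis
    have "(\<lambda>x. \<phi> (\<lambda>i. \<Sum>l<j i. x l)) \<in> C_lLip_tuple m"
    proof (rule C_lLip_tuple_reparam_coordinatewise[OF X(3), of "real m"])
      fix x y :: "nat \<Rightarrow> real^'a" and i assume i: "i < n"
      have "norm ((\<Sum>l<j i. x l) - (\<Sum>l<j i. y l)) \<le> (\<Sum>l<j i. norm (x l - y l))"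
        by (simp add: sum_subtractf[symmetric] norm_sum)
      also have "\<dots> \<le> (\<Sum>l<m. norm (x l - y l))"
        using j[OF i] by (intro sum_mono2) auto
      also have "\<dots> \<le> (\<Sum>l<m. tuple_norm m (\<lambda>l. x l - y l))"
        by (intro sum_mono norm_le_tuple_norm) auto
      finally show "norm ((\<Sum>l<j i. x l) - (\<Sum>l<j i. y l)) \<le> real m * tuple_norm m (\<lambda>l. x l - y l)"
        by simp
    qed simp
    moreover have "X \<omega> = \<phi> (\<lambda>i. \<Sum>l<j i. increments t \<omega> l)" if "\<omega> \<in> Omega T" for \<omega>
      unfolding X(4)
    proof (rule C_lLip_tuple_cong[OF X(3)])
      fix i assume "i < n"
      have "(\<Sum>l<j i. increments t \<omega> l) = B (t (j i)) \<omega> - B (t 0) \<omega>"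
        unfolding increments_def by (rule sum_lessThan_telescope)
      then show "B (v i) \<omega> = (\<Sum>l<j i. increments t \<omega> l)"
        using j[OF \<open>i < n\<close>] t(1) that by (simp add: Omega_def)
    qed
    ultimately show "\<exists>\<phi>\<in>C_lLip_tuple m. \<forall>\<omega>\<in>Omega T. X \<omega> = \<phi> (increments t \<omega>)"
      by (intro bexI[of _ "\<lambda>x. \<phi> (\<lambda>i. \<Sum>l<j i. x l)"]) auto
  qed (use X in auto)
qed

section \<open>Sublinear expectations\<close>

lemma sublinear_expectationD:
  assumes "sublinear_expectation \<Omega> H E"
  shows sublinear_const_mem: "(\<lambda>_. c) \<in> H"
    and sublinear_add_mem: "X \<in> H \<Longrightarrow> Y \<in> H \<Longrightarrow> (\<lambda>\<omega>. X \<omega> + Y \<omega>) \<in> H"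
    and sublinear_scale_mem: "X \<in> H \<Longrightarrow> (\<lambda>\<omega>. c * X \<omega>) \<in> H"
    and sublinear_mono: "X \<in> H \<Longrightarrow> Y \<in> H \<Longrightarrow> (\<And>\<omega>. \<omega> \<in> \<Omega> \<Longrightarrow> X \<omega> \<le> Y \<omega>) \<Longrightarrow> E X \<le> E Y"
    and sublinear_const: "E (\<lambda>_. c) = c"
    and sublinear_diff: "X \<in> H \<Longrightarrow> Y \<in> H \<Longrightarrow> E X - E Y \<le> E (\<lambda>\<omega>. X \<omega> - Y \<omega>)"
    and sublinear_scale: "X \<in> H \<Longrightarrow> 0 \<le> l \<Longrightarrow> E (\<lambda>\<omega>. l * X \<omega>) = l * E X"
  using assms unfolding sublinear_expectation_def by blast+

lemma sublinear_diff_mem: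
  assumes "sublinear_expectation \<Omega> H E" "X \<in> H" "Y \<in> H"
  shows "(\<lambda>\<omega>. X \<omega> - Y \<omega>) \<in> H"
  using sublinear_add_mem[OF assms(1,2) sublinear_scale_mem[OF assms(1,3), of "-1"]] by simp

lemma sublinear_cong:
  assumes "sublinear_expectation \<Omega> H E" "X \<in> H" "Y \<in> H" "\<And>\<omega>. \<omega> \<in> \<Omega> \<Longrightarrow> X \<omega> = Y \<omega>"
  shows "E X = E Y"
  using sublinear_mono[OF assms(1,2,3)] sublinear_mono[OF assms(1,3,2)] assms(4) by (auto intro: antisym)

lemma sublinear_add_const:
  assumes "sublinear_expectation \<Omega> H E" "X \<in> H"
  shows "E (\<lambda>\<omega>. X \<omega> + c) = E X + c"
proof -
  have mem: "(\<lambda>\<omega>. X \<omega> + c) \<in> H"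
    using sublinear_add_mem[OF assms sublinear_const_mem[OF assms(1)]] .
  have "E (\<lambda>\<omega>. X \<omega> + c) - E X \<le> c"
    using sublinear_diff[OF assms(1) mem assms(2)] sublinear_const[OF assms(1), of c] by simp
  moreover have "E X - E (\<lambda>\<omega>. X \<omega> + c) \<le> - c"
    using sublinear_diff[OF assms(1) assms(2) mem] sublinear_const[OF assms(1), of "-c"] by simp
  ultimately show ?thesis by simp
qed

section \<open>Conditioning on the first increments\<close>

definition graft :: "nat \<Rightarrow> (nat \<Rightarrow> 'v) \<Rightarrow> (nat \<Rightarrow> 'v) \<Rightarrow> nat \<Rightarrow> 'v" where
  "graft i x y j = (if j < i then x j else y j)"

lemma graft_0 [simp]: "graft 0 x y = y"
  by (simp add: graft_def fun_eq_iff)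

lemma tuple_norm_graft_diff:
  assumes "i \<le> m"
  shows "tuple_norm m (\<lambda>j. graft i x z j - graft i y z j) = tuple_norm i (\<lambda>j. x j - y j)"
proof -
  have "(\<Sum>j<m. (norm (graft i x z j - graft i y z j))\<^sup>2) = (\<Sum>j<i. (norm (x j - y j))\<^sup>2)"
    using assms by (intro sum.mono_neutral_cong_right) (auto simp: graft_def)
  then show ?thesis by (simp add: tuple_norm_def L2_set_def)
qed

lemma tuple_norm_graft_le:
  assumes "i \<le> m"
  shows "tuple_norm m (graft i x z) \<le> tuple_norm i x + tuple_norm m z"
proof -
  have "(\<lambda>j. graft i x z j) = (\<lambda>j. (graft i x (\<lambda>_. 0) j - graft i (\<lambda>_. 0) (\<lambda>_. 0) j) + graft i (\<lambda>_. 0) z j)"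
    by (auto simp: graft_def)
  then have "tuple_norm m (graft i x z)
      \<le> tuple_norm m (\<lambda>j. graft i x (\<lambda>_. 0) j - graft i (\<lambda>_. 0) (\<lambda>_. 0) j) + tuple_norm m (graft i (\<lambda>_. 0) z)"
    using tuple_norm_triangle[of m "\<lambda>j. graft i x (\<lambda>_. 0) j - graft i (\<lambda>_. 0) (\<lambda>_. 0) j" "graft i (\<lambda>_. 0) z"]
    by metis
  also have "tuple_norm m (\<lambda>j. graft i x (\<lambda>_. 0) j - graft i (\<lambda>_. 0) (\<lambda>_. 0) j) = tuple_norm i x"
    using tuple_norm_graft_diff[OF assms, of x "\<lambda>_. 0" "\<lambda>_. 0"] by simp
  also have "tuple_norm m (graft i (\<lambda>_. 0) z) \<le> tuple_norm m z"
    unfolding tuple_norm_def by (rule L2_set_mono) (auto simp: graft_def)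
  finally show ?thesis by simp
qed

locale G_expectation =
  fixes T :: real and \<Omega>' :: "'b set" and H' E' and G :: "real^'d::finite^'d \<Rightarrow> real"
    and \<zeta> :: "nat \<Rightarrow> 'b \<Rightarrow> real^'d" and E :: "('d path \<Rightarrow> real) \<Rightarrow> real" and \<P> :: "'d path measure set"
  assumes T: "0 < T" and E': "sublinear_expectation \<Omega>' H' E'" and iid: "iid_G_normal H' E' G \<zeta>"
    and E_def: "is_G_expectation T E' \<zeta> E" and \<P>: "represents T E \<P>"
begin

lemma E: "sublinear_expectation (Omega T) (H0 T) E"
  using E_def by (simp add: is_G_expectation_def)

definition "inc t z j = sqrt (t (Suc j) - t j) *\<^sub>R \<zeta> j z"

text \<open>The conditional expectation given the first i increments, as a function of their values
  x. It is computed on the space of \<zeta>, where independence is available;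
  \<open>E_graft_increments\<close> translates it to E.\<close>

definition "cond t i \<phi> x = E' (\<lambda>z. \<phi> (graft i x (inc t z)))"

lemma graft_inc_mem:
  assumes "\<phi> \<in> C_lLip_tuple n"
  shows "(\<lambda>z. \<phi> (graft i x (inc t z))) \<in> H'"
proof -
  define c where "c = (\<Sum>j<n. \<bar>sqrt (t (Suc j) - t j)\<bar>)"
  have c: "\<bar>sqrt (t (Suc j) - t j)\<bar> \<le> c" if "j < n" for j
    unfolding c_def using that by (intro member_le_sum) auto
  have "0 \<le> c" by (auto simp: c_def intro: sum_nonneg)
  then have "(\<lambda>y. \<phi> (graft i x (\<lambda>j. sqrt (t (Suc j) - t j) *\<^sub>R y j))) \<in> C_lLip_tuple n"
  proof (rule C_lLip_tuple_reparam_coordinatewise[OF assms])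
    fix y y' :: "nat \<Rightarrow> real^'d" and j assume j: "j < n"
    have "norm (graft i x (\<lambda>j. sqrt (t (Suc j) - t j) *\<^sub>R y j) j - graft i x (\<lambda>j. sqrt (t (Suc j) - t j) *\<^sub>R y' j) j)
        \<le> \<bar>sqrt (t (Suc j) - t j)\<bar> * norm (y j - y' j)"
      by (auto simp: graft_def scaleR_diff_right[symmetric])
    also have "\<dots> \<le> c * tuple_norm n (\<lambda>j. y j - y' j)"
      using c[OF j] \<open>0 \<le> c\<close> norm_le_tuple_norm[OF j, of "\<lambda>j. y j - y' j"] by (intro mult_mono) auto
    finally show "norm (graft i x (\<lambda>j. sqrt (t (Suc j) - t j) *\<^sub>R y j) j - graft i x (\<lambda>j. sqrt (t (Suc j) - t j) *\<^sub>R y' j) j)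
        \<le> c * tuple_norm n (\<lambda>j. y j - y' j)" .
  qed
  moreover have "random_tuple H' n (\<lambda>\<omega> i. \<zeta> i \<omega>)" using iid by (simp add: iid_G_normal_def)
  ultimately have "(\<lambda>z. \<phi> (graft i x (\<lambda>j. sqrt (t (Suc j) - t j) *\<^sub>R \<zeta> j z))) \<in> H'"
    unfolding random_tuple_def by (auto dest: bspec)
  then show ?thesis by (simp add: inc_def[abs_def])
qed

lemma cond_cong:
  assumes "\<phi> \<in> C_lLip_tuple m" "\<And>j. j < i \<Longrightarrow> x j = y j"
  shows "cond t i \<phi> x = cond t i \<phi> y"
proof -
  have "graft i x z = graft i y z" for z using assms(2) by (auto simp: graft_def)
  then show ?thesis by (simp add: cond_def)
qed

lemma cond_full:
  assumes "\<phi> \<in> C_lLip_tuple m"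
  shows "cond t m \<phi> x = \<phi> x"
proof -
  have "\<phi> (graft m x z) = \<phi> x" for z
    by (rule C_lLip_tuple_cong[OF assms]) (simp add: graft_def)
  then show ?thesis by (simp add: cond_def sublinear_const[OF E'])
qed

lemma cond_mono:
  assumes "\<phi> \<in> C_lLip_tuple m" "\<psi> \<in> C_lLip_tuple m" "\<And>x. \<phi> x \<le> \<psi> x"
  shows "cond t i \<phi> x \<le> cond t i \<psi> x"
  unfolding cond_def using assms by (intro sublinear_mono[OF E'] graft_inc_mem) auto

text \<open>Fixed and random arguments separate: with s = 1 + \<bar>x\<bar> + \<bar>y\<bar> one has
  s + 2 * w \<le> s * (1 + 2 * w), where w is the size of the random part. The power of the factor
  in w is a test function itself and integrates to the constant \<open>Mk\<close>.\<close>

lemma cond_C_lLip: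
  assumes \<phi>: "\<phi> \<in> C_lLip_tuple m" and i: "i \<le> m"
  shows "cond t i \<phi> \<in> C_lLip_tuple i"
proof -
  obtain C k where C: "C \<ge> 0" and le: "\<And>x y. \<bar>\<phi> x - \<phi> y\<bar>
     \<le> C * (1 + tuple_norm m x + tuple_norm m y) ^ k * tuple_norm m (\<lambda>i. x i - y i)"
    using \<phi> by (rule C_lLip_tupleE) blast
  define g where "g z = (1 + 2 * tuple_norm m (graft 0 (\<lambda>_. 0) z)) ^ Suc k" for z :: "nat \<Rightarrow> real^'d"
  have g: "g \<in> C_lLip_tuple m"
  proof -
    have "(\<lambda>z. tuple_norm m (\<lambda>j. z j :: real^'d)) \<in> C_lLip_tuple m"
    proof (rule C_lLip_tuple_lipschitz[of _ 1])
      fix x y :: "nat \<Rightarrow> real^'d"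
      show "\<bar>tuple_norm m x - tuple_norm m y\<bar> \<le> 1 * tuple_norm m (\<lambda>i. x i - y i)"
        using tuple_norm_triangle[of m "\<lambda>i. x i - y i" y] tuple_norm_triangle[of m "\<lambda>i. y i - x i" x]
        by (simp add: tuple_norm_minus[of m y x])
    qed
    then show ?thesis
      unfolding g_def graft_0
      by (intro C_lLip_tuple_comp[OF poly_lipschitz_power] C_lLip_tuple_add C_lLip_tuple_const C_lLip_tuple_scale) simp
  qed
  define Mk where "Mk = E' (\<lambda>z. g (graft 0 (\<lambda>_. 0) (inc t z)))"
  have diff: "cond t i \<phi> x - cond t i \<phi> y \<le> (C * Mk) * (1 + tuple_norm i x + tuple_norm i y) ^ Suc k * tuple_norm i (\<lambda>j. x j - y j)"
    for x y :: "nat \<Rightarrow> real^'d"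
  proof -
    let ?s = "1 + tuple_norm i x + tuple_norm i y" and ?d = "tuple_norm i (\<lambda>j. x j - y j)"
    define c where "c = C * ?s ^ Suc k * ?d"
    have c: "0 \<le> c" unfolding c_def using C by (intro mult_nonneg_nonneg) auto
    have "\<phi> (graft i x (inc t z)) - \<phi> (graft i y (inc t z)) \<le> c * g (inc t z)" for z
    proof -
      let ?x = "graft i x (inc t z)" and ?y = "graft i y (inc t z)" and ?w = "tuple_norm m (inc t z)"
      have "1 + tuple_norm m ?x + tuple_norm m ?y \<le> ?s + 2 * ?w"
        using tuple_norm_graft_le[OF i, of x "inc t z"] tuple_norm_graft_le[OF i, of y "inc t z"] by linarith
      also have "\<dots> \<le> ?s * (1 + 2 * ?w)"
        using mult_right_mono[of 1 ?s "2 * ?w"] by (simp add: distrib_left)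
      finally have b: "1 + tuple_norm m ?x + tuple_norm m ?y \<le> ?s * (1 + 2 * ?w)" .
      have "\<phi> ?x - \<phi> ?y \<le> C * (1 + tuple_norm m ?x + tuple_norm m ?y) ^ k * ?d"
        using le[of ?x ?y] tuple_norm_graft_diff[OF i, of x "inc t z" y] by simp
      \<comment> \<open>The exponent becomes a successor because
        \<open>poly_lipschitz_power\<close>, which makes g a test function, is about
        successors.\<close>
      also have "\<dots> \<le> C * (1 + tuple_norm m ?x + tuple_norm m ?y) ^ Suc k * ?d"
        using C by (intro mult_right_mono mult_left_mono power_increasing) auto
      also have "\<dots> \<le> C * (?s * (1 + 2 * ?w)) ^ Suc k * ?d"
        using C b by (intro mult_right_mono mult_left_mono power_mono) auto
      also have "\<dots> = c * g (inc t z)" by (simp only: power_mult_distrib c_def g_def mult_ac) simp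
      finally show ?thesis .
    qed
    then have "E' (\<lambda>z. \<phi> (graft i x (inc t z)) - \<phi> (graft i y (inc t z))) \<le> E' (\<lambda>z. c * g (graft 0 (\<lambda>_. 0) (inc t z)))"
      by (intro sublinear_mono[OF E'] sublinear_diff_mem[OF E'] sublinear_scale_mem[OF E'] graft_inc_mem[OF \<phi>] graft_inc_mem[OF g]) simp
    also have "\<dots> = c * Mk"
      unfolding Mk_def by (rule sublinear_scale[OF E' graft_inc_mem[OF g] c])
    finally have "cond t i \<phi> x - cond t i \<phi> y \<le> c * Mk"
      using sublinear_diff[OF E' graft_inc_mem[OF \<phi>, of i x t] graft_inc_mem[OF \<phi>, of i y t]]
      unfolding cond_def by linarith
    then show ?thesis by (simp add: c_def mult_ac)
  qed
  show ?thesis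
  proof (rule C_lLip_tupleI[of _ "C * Mk" _ "Suc k"])
    fix x y :: "nat \<Rightarrow> real^'d"
    show "\<bar>cond t i \<phi> x - cond t i \<phi> y\<bar> \<le> (C * Mk) * (1 + tuple_norm i x + tuple_norm i y) ^ Suc k * tuple_norm i (\<lambda>j. x j - y j)"
      using diff[of x y] diff[of y x] by (simp add: abs_if tuple_norm_minus[of i y x] add_ac)
  qed
qed

text \<open>Descending induction on l. One step integrates out the increment with index l before the
  earlier ones, and independence of \<zeta> l from its predecessors says that this does not change
  the expectation.\<close>

lemma tower_aux:
  assumes \<phi>: "\<phi> \<in> C_lLip_tuple m" and "l \<le> m" and "i \<le> l"
  shows "cond t i \<phi> x = cond t i (cond t l \<phi>) x"
  using assms(2,3)
proof (induction l arbitrary: i x rule: inc_induct)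
  case base
  have "cond t m \<phi> = \<phi>" by (rule ext) (rule cond_full[OF \<phi>])
  then show ?case by simp
next
  case (step l)
  define \<psi> where "\<psi> = cond t (Suc l) \<phi>"
  have \<psi>: "\<psi> \<in> C_lLip_tuple (Suc l)" unfolding \<psi>_def by (rule cond_C_lLip[OF \<phi>]) (use step in simp)
  have one: "cond t l \<phi> w = E' (\<lambda>z. \<psi> (w(l := inc t z l)))" for w
  proof -
    have "cond t l \<phi> w = E' (\<lambda>z. \<psi> (graft l w (inc t z)))"
      using step.IH[of l w] by (simp add: \<psi>_def cond_def)
    also have "(\<lambda>z. \<psi> (graft l w (inc t z))) = (\<lambda>z. \<psi> (w(l := inc t z l)))"
      by (intro ext C_lLip_tuple_cong[OF \<psi>]) (auto simp: graft_def less_Suc_eq)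
    finally show ?thesis .
  qed
  have "cond t i \<phi> x = E' (\<lambda>z. \<psi> (graft i x (inc t z)))"
    using step.IH[of i x] step.prems by (simp add: \<psi>_def cond_def)
  also have "\<dots> = E' (\<lambda>z. cond t l \<phi> (graft i x (inc t z)))"
  \<comment> \<open>Independence is available for l \<ge> 1. For l = 0 there are no earlier
    increments and \<open>cond t 0 \<phi>\<close> is constant.\<close>
  proof (cases "l = 0")
    case True
    then have i: "i = 0" using step.prems by simp
    have c: "cond t 0 \<phi> w = cond t 0 \<phi> w'" for w w' by (rule cond_cong[OF \<phi>]) simp
    have "E' (\<lambda>z. \<psi> (graft i x (inc t z))) = cond t 0 \<phi> x"
      using step.IH[of 0 x] i by (simp add: \<psi>_def cond_def)
    also have "\<dots> = E' (\<lambda>z. cond t 0 \<phi> x)" by (rule sublinear_const[OF E', symmetric])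
    also have "(\<lambda>z. cond t 0 \<phi> x) = (\<lambda>z. cond t l \<phi> (graft i x (inc t z)))"
      unfolding True by (rule ext) (rule c)
    finally show ?thesis .
  next
    case False
    let ?s = "\<lambda>y. graft i x (\<lambda>j. sqrt (t (Suc j) - t j) *\<^sub>R y j)"
    define c where "c = (\<Sum>j<Suc l. \<bar>sqrt (t (Suc j) - t j)\<bar>)"
    have c: "\<bar>sqrt (t (Suc j) - t j)\<bar> \<le> c" if "j < Suc l" for j
      unfolding c_def using that by (intro member_le_sum) auto
    have "0 \<le> c" unfolding c_def by (intro sum_nonneg) auto
    then have mem: "(\<lambda>y. \<psi> (?s y)) \<in> C_lLip_tuple (Suc l)"
    proof (rule C_lLip_tuple_reparam_coordinatewise[OF \<psi>])
      fix y y' :: "nat \<Rightarrow> real^'d" and j assume j: "j < Suc l"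
      have "norm (?s y j - ?s y' j) \<le> \<bar>sqrt (t (Suc j) - t j)\<bar> * norm (y j - y' j)"
        by (auto simp: graft_def scaleR_diff_right[symmetric])
      also have "\<dots> \<le> c * tuple_norm (Suc l) (\<lambda>j. y j - y' j)"
        using c[OF j] \<open>0 \<le> c\<close> norm_le_tuple_norm[OF j, of "\<lambda>j. y j - y' j"] by (intro mult_mono) auto
      finally show "norm (?s y j - ?s y' j) \<le> c * tuple_norm (Suc l) (\<lambda>j. y j - y' j)" .
    qed
    have "independent_to E' l (\<zeta> l) (\<lambda>\<omega> i. \<zeta> i \<omega>)"
      using iid False by (simp add: iid_G_normal_def)
    from bspec[OF this[unfolded independent_to_def] mem] have "E' (\<lambda>z. \<psi> (?s ((\<lambda>i. \<zeta> i z)(l := \<zeta> l z)))) =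
        E' (\<lambda>z. E' (\<lambda>z'. \<psi> (?s ((\<lambda>i. \<zeta> i z)(l := \<zeta> l z')))))"
      by simp
    moreover have "(\<lambda>i. \<zeta> i z)(l := \<zeta> l z) = (\<lambda>i. \<zeta> i z)" for z by auto
    moreover have "?s ((\<lambda>i. \<zeta> i z)(l := \<zeta> l z')) = (graft i x (inc t z))(l := inc t z' l)" for z z'
      using step.prems by (auto simp: graft_def inc_def fun_eq_iff)
    ultimately show ?thesis using one by (simp add: inc_def[abs_def])
  qed
  finally show ?case by (simp add: cond_def)
qed

lemma tower:
  assumes \<phi>: "\<phi> \<in> C_lLip_tuple m" and i: "i < m"
  shows "cond t i \<phi> x = E' (\<lambda>z. cond t (Suc i) \<phi> (x(i := inc t z i)))"
proof -
  have \<psi>: "cond t (Suc i) \<phi> \<in> C_lLip_tuple (Suc i)" using cond_C_lLip[OF \<phi>] i by simp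
  have "cond t i \<phi> x = E' (\<lambda>z. cond t (Suc i) \<phi> (graft i x (inc t z)))"
    using tower_aux[OF \<phi>, of "Suc i" i] i by (simp add: cond_def)
  also have "(\<lambda>z. cond t (Suc i) \<phi> (graft i x (inc t z))) = (\<lambda>z. cond t (Suc i) \<phi> (x(i := inc t z i)))"
    by (intro ext C_lLip_tuple_cong[OF \<psi>]) (auto simp: graft_def less_Suc_eq)
  finally show ?thesis .
qed

lemma update_mem:
  assumes "\<phi> \<in> C_lLip_tuple (Suc i)"
  shows "(\<lambda>z. \<phi> (x(i := inc t z i))) \<in> H'"
proof -
  have "(\<lambda>z. \<phi> (graft i x (inc t z))) = (\<lambda>z. \<phi> (x(i := inc t z i)))"
    by (intro ext C_lLip_tuple_cong[OF assms]) (auto simp: graft_def less_Suc_eq)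
  then show ?thesis using graft_inc_mem[OF assms, of i x t] by simp
qed

lemma E_increments:
  assumes "partition_upto T m t" "\<phi> \<in> C_lLip_tuple m"
  shows "E (\<lambda>\<omega>. \<phi> (increments t \<omega>)) = cond t 0 \<phi> x"
proof -
  have "E (\<lambda>\<omega>. \<phi> (increments t \<omega>)) = E' (\<lambda>z. \<phi> (\<lambda>j. sqrt (t (Suc j) - t j) *\<^sub>R \<zeta> j z))"
    using E_def assms unfolding is_G_expectation_def by blast
  then show ?thesis by (simp add: cond_def inc_def[abs_def])
qed

lemma E_graft_increments:
  assumes "partition_upto T m t" "\<phi> \<in> C_lLip_tuple m"
  shows "E (\<lambda>\<omega>'. \<phi> (\<lambda>j. if j < i then x j else increments t \<omega>' j)) = cond t i \<phi> x"
proof -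
  have "(\<lambda>y. \<phi> (graft i x y)) \<in> C_lLip_tuple m"
    by (rule C_lLip_tuple_reparam_coordinatewise[OF assms(2), of 1])
       (auto simp: graft_def norm_le_tuple_norm[where x = "\<lambda>j. _ j - _ j"])
  from E_increments[OF assms(1) this, of x] show ?thesis
    unfolding cond_def graft_0 by (simp add: graft_def[abs_def])
qed

section \<open>The maximal inequality\<close>

text \<open>A weak type bound for the process U i = cond t i u. The indicator of the event that the
  maximum exceeds a is no test function, so h is a Lipschitz ramp that rises from 0 at level a to 1
  at level 2 * a.\<close>

lemma maximal_inequality:
  assumes t: "partition_upto T m t" and u: "u \<in> C_lLip_tuple m" "\<And>x. 0 \<le> u x" and a: "0 < a"
    and h_def: "h = (\<lambda>x. max 0 (min 1 ((Max ((\<lambda>i. cond t i u x) ` {..m}) - a) / a)))"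
  shows "h \<in> C_lLip_tuple m" "a * E (\<lambda>\<omega>. h (increments t \<omega>)) \<le> E (\<lambda>\<omega>. u (increments t \<omega>))"
proof -
  define U where "U i = cond t i u" for i
  have U: "U i \<in> C_lLip_tuple i" if "i \<le> m" for i unfolding U_def using cond_C_lLip[OF u(1) that] .
  have "(\<lambda>x. Max ((\<lambda>i. U i x) ` {..j})) \<in> C_lLip_tuple m" if "j \<le> m" for j
    using that
  proof (induction j)
    case 0
    then show ?case using C_lLip_tuple_mono[OF U[of 0]] by simp
  next
    case (Suc j)
    have "(\<lambda>x. Max ((\<lambda>i. U i x) ` {..Suc j})) = (\<lambda>x. max (U (Suc j) x) (Max ((\<lambda>i. U i x) ` {..j})))"
      by (simp add: atMost_Suc)
    then show ?case using Suc C_lLip_tuple_mono[OF U[of "Suc j"]] by (auto intro: C_lLip_tuple_max)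
  qed
  then have Mx: "(\<lambda>x. Max ((\<lambda>i. U i x) ` {..m})) \<in> C_lLip_tuple m" by simp
  have "poly_lipschitz (\<lambda>y. max 0 (min 1 ((y - a) / a)))"
  proof (rule poly_lipschitz_lipschitz[of _ "1 / a"])
    fix y y' :: real
    have "\<bar>max 0 (min 1 ((y - a) / a)) - max 0 (min 1 ((y' - a) / a))\<bar> \<le> \<bar>(y - a) / a - (y' - a) / a\<bar>"
      by (auto simp: max_def min_def)
    also have "\<dots> = 1 / a * \<bar>y - y'\<bar>" using a by (simp add: diff_divide_distrib[symmetric])
    finally show "\<bar>max 0 (min 1 ((y - a) / a)) - max 0 (min 1 ((y' - a) / a))\<bar> \<le> 1 / a * \<bar>y - y'\<bar>" .
  qed
  from C_lLip_tuple_comp[OF this Mx] show h: "h \<in> C_lLip_tuple m" by (simp add: h_def U_def)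
  have h01: "0 \<le> h x" "h x \<le> 1" for x by (auto simp: h_def)
  \<comment> \<open>Stopping at the first passage above a, as a backward induction: where U k
    exceeds a, the bound h \<le> 1 suffices, and otherwise the tower property hands the inequality
    from k + 1 down to k.\<close>
  have claim: "a * cond t k h x \<le> U k x" if "k \<le> m" "\<forall>j<k. U j x \<le> a" for k x
    using that
  proof (induction k arbitrary: x rule: inc_induct)
    case base
    have "a * h x \<le> U m x"
    proof (cases "U m x \<le> a")
      case True
      have "U i x \<le> a" if "i \<le> m" for i using that base.prems True by (cases "i = m") auto
      then have "Max ((\<lambda>i. U i x) ` {..m}) \<le> a" by simp
      then have "(Max ((\<lambda>i. U i x) ` {..m}) - a) / a \<le> 0" using a by (intro divide_nonpos_pos) auto
      then have "h x = 0" by (simp only: h_def U_def)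
      moreover have "0 \<le> U m x" using cond_full[OF u(1)] u(2) by (simp add: U_def)
      ultimately show ?thesis by simp
    next
      case False
      moreover have "a * h x \<le> a * 1" using a h01(2) by (intro mult_left_mono) auto
      ultimately show ?thesis by simp
    qed
    then show ?case using cond_full[OF h] by simp
  next
    case (step k)
    show ?case
    proof (cases "U k x \<le> a")
      case True
      have "a * cond t k h x = a * E' (\<lambda>z. cond t (Suc k) h (x(k := inc t z k)))"
        by (simp add: tower[OF h step.hyps(2)])
      also have "\<dots> = E' (\<lambda>z. a * cond t (Suc k) h (x(k := inc t z k)))"
        using a step.hyps by (intro sublinear_scale[OF E', symmetric] update_mem cond_C_lLip[OF h]) auto
      also have "\<dots> \<le> E' (\<lambda>z. U (Suc k) (x(k := inc t z k)))"
      proof (rule sublinear_mono[OF E'])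
        fix z
        have "U j (x(k := inc t z k)) \<le> a" if "j < Suc k" for j
        proof -
          have "U j (x(k := inc t z k)) = U j x"
            unfolding U_def by (rule cond_cong[OF u(1)]) (use that in auto)
          then show ?thesis using step.prems True that by (cases "j = k") auto
        qed
        then show "a * cond t (Suc k) h (x(k := inc t z k)) \<le> U (Suc k) (x(k := inc t z k))"
          by (intro step.IH allI impI)
      qed (use step.hyps in \<open>auto intro!: update_mem C_lLip_tuple_scale cond_C_lLip[OF h] U\<close>)
      also have "\<dots> = U k x" unfolding U_def by (rule tower[OF u(1) step.hyps(2), symmetric])
      finally show ?thesis .
    next
      case False
      have "cond t k h x \<le> cond t k (\<lambda>_. 1) x"
        by (rule cond_mono[OF h C_lLip_tuple_const]) (rule h01)
      also have "\<dots> = 1" by (simp add: cond_def sublinear_const[OF E'])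
      finally have "a * cond t k h x \<le> a * 1" using a by (intro mult_left_mono) auto
      then show ?thesis using False by simp
    qed
  qed
  from claim[of 0 "\<lambda>_. 0"] show "a * E (\<lambda>\<omega>. h (increments t \<omega>)) \<le> E (\<lambda>\<omega>. u (increments t \<omega>))"
    using E_increments[OF t h] E_increments[OF t u(1)] by (simp add: U_def)
qed


section \<open>The representing measures\<close>

lemma P_sets: "P \<in> \<P> \<Longrightarrow> sets P = sets (Borel_Omega T)"
  and P_prob: "P \<in> \<P> \<Longrightarrow> prob_space P"
  and H0_integrable: "P \<in> \<P> \<Longrightarrow> X \<in> H0 T \<Longrightarrow> integrable P X"
  and H0_integral_le: "P \<in> \<P> \<Longrightarrow> X \<in> H0 T \<Longrightarrow> (\<integral>\<omega>. X \<omega> \<partial>P) \<le> E X"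
  and H0_attained: "X \<in> H0 T \<Longrightarrow> \<exists>P\<in>\<P>. (\<integral>\<omega>. X \<omega> \<partial>P) = E X"
  using \<P> by (auto simp: represents_def prob_measures_def)

lemma P_space: "P \<in> \<P> \<Longrightarrow> space P = Omega T"
  using sets_eq_imp_space_eq[OF P_sets] by (simp add: space_restrict_space)

lemma P_measurable:
  "P \<in> \<P> \<Longrightarrow> f \<in> measurable P M \<longleftrightarrow> f \<in> measurable (Borel_Omega T) M"
  using measurable_cong_sets[OF P_sets refl] by blast

lemma P_nonempty: "\<P> \<noteq> {}"
  using H0_attained[OF H0_const[of T 0]] T by auto

lemma H0_measurable:
  fixes X :: "'d path \<Rightarrow> real"
  assumes X: "X \<in> H0 T"
  shows "X \<in> borel_measurable (Borel_Omega T)"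
proof -
  obtain P where P: "P \<in> \<P>" using P_nonempty by blast
  show ?thesis using borel_measurable_integrable[OF H0_integrable[OF P X]] unfolding P_measurable[OF P] .
qed

lemma H0_nn_integral_le:
  assumes "P \<in> \<P>" "X \<in> H0 T" "\<And>\<omega>. 0 \<le> X \<omega>"
  shows "(\<integral>\<^sup>+\<omega>. ennreal (X \<omega>) \<partial>P) \<le> ennreal (E X)"
  using H0_integral_le[OF assms(1,2)] nn_integral_eq_integral[OF H0_integrable[OF assms(1,2)]] assms(3)
  by (auto intro: ennreal_leI)

lemma Lp_dist_ge: "P \<in> \<P> \<Longrightarrow> (\<integral>\<^sup>+\<omega>. ennreal (\<bar>X \<omega> - Y \<omega>\<bar> powr p) \<partial>P) \<le> Lp_dist \<P> p X Y"
  unfolding Lp_dist_def by (rule SUP_upper)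

lemma L1_dist_ge: "P \<in> \<P> \<Longrightarrow> (\<integral>\<^sup>+\<omega>. ennreal \<bar>X \<omega> - Y \<omega>\<bar> \<partial>P) \<le> Lp_dist \<P> 1 X Y"
  using Lp_dist_ge[of P X Y 1] by simp

section \<open>Increments have mean zero\<close>

lemma component_C_lLip: "(\<lambda>x :: real^'d. x $ k) \<in> C_lLip"
proof -
  have "\<bar>x $ k - y $ k\<bar> \<le> 1 * (1 + norm x ^ 0 + norm y ^ 0) * norm (x - y)" for x y :: "real^'d"
    using component_le_norm_cart[of "x - y" k] by (simp add: norm_ge_zero order_trans)
  then show ?thesis unfolding C_lLip_def by blast
qed

text \<open>Let e be the mean of a component. Stability with (-1, 0) gives the same mean to its
  negative; stability with (1, 1) gives sqrt 2 * e for the sum with an independent copy, where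
  independence gives 2 * e. Hence e = 0. Both signs of c have to be covered, as a sublinear
  expectation need not respect a change of sign.\<close>

lemma zeta_mean: "E' (\<lambda>z. c * \<zeta> i z $ k) = 0"
proof -
  let ?X = "\<zeta> i"
  obtain X' where rt: "random_tuple H' 2 (\<lambda>z i. if i = 0 then ?X z else X' z)"
    and id: "identically_distributed E' X' E' ?X"
    and ind: "independent_to E' 1 X' (\<lambda>z _. ?X z)"
    and stable: "\<And>a b. identically_distributed E' (\<lambda>z. a *\<^sub>R ?X z + b *\<^sub>R X' z) E' (\<lambda>z. sqrt (a\<^sup>2 + b\<^sup>2) *\<^sub>R ?X z)"
    using iid unfolding iid_G_normal_def G_normal_def by blast
  have mem: "(\<lambda>z. ?X z $ k) \<in> H'"
    using bspec[OF rt[unfolded random_tuple_def] C_lLip_tuple_coordinate[of 0 2 k]] by simp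
  define e where "e = E' (\<lambda>z. ?X z $ k)"
  note iddD = bspec[OF stable[unfolded identically_distributed_def] component_C_lLip[of k]]
  have neg: "E' (\<lambda>z. - ?X z $ k) = e"
    using iddD[of "-1" 0] by (simp add: e_def)
  have sum: "E' (\<lambda>z. ?X z $ k + X' z $ k) = sqrt 2 * e"
    using iddD[of 1 1] sublinear_scale[OF E' mem, of "sqrt 2"] by (simp add: e_def)
  have "(\<lambda>x :: nat \<Rightarrow> real^'d. x 0 $ k + x 1 $ k) \<in> C_lLip_tuple (Suc 1)"
    by (intro C_lLip_tuple_add C_lLip_tuple_coordinate) auto
  from bspec[OF ind[unfolded independent_to_def] this]
  have "E' (\<lambda>z. ?X z $ k + X' z $ k) = E' (\<lambda>z. E' (\<lambda>z'. ?X z $ k + X' z' $ k))"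
    by simp
  also have "(\<lambda>z. E' (\<lambda>z'. ?X z $ k + X' z' $ k)) = (\<lambda>z. ?X z $ k + e)"
  proof
    fix z
    have mem': "(\<lambda>z. X' z $ k) \<in> H'"
      using bspec[OF rt[unfolded random_tuple_def] C_lLip_tuple_coordinate[of 1 2 k]] by simp
    have "E' (\<lambda>z. X' z $ k) = e"
      using bspec[OF id[unfolded identically_distributed_def] component_C_lLip[of k]] by (simp add: e_def)
    then show "E' (\<lambda>z'. ?X z $ k + X' z' $ k) = ?X z $ k + e"
      using sublinear_add_const[OF E' mem', of "?X z $ k"] by (simp add: add.commute)
  qed
  also have "E' (\<lambda>z. ?X z $ k + e) = 2 * e"
    using sublinear_add_const[OF E' mem, of e] by (simp add: e_def)
  finally have "sqrt 2 * e = 2 * e" using sum by simp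
  moreover have "sqrt 2 \<noteq> (2::real)" using real_sqrt_less_iff[of 2 4] by (simp del: real_sqrt_less_iff)
  ultimately have "e = 0" by (metis mult_cancel_right)
  show ?thesis
  proof (cases "0 \<le> c")
    case True
    then show ?thesis using sublinear_scale[OF E' mem True] \<open>e = 0\<close> by (simp add: e_def)
  next
    case False
    have "(\<lambda>z. - ?X z $ k) \<in> H'" using sublinear_scale_mem[OF E' mem, of "-1"] by simp
    from sublinear_scale[OF E' this, of "-c"] show ?thesis using False neg \<open>e = 0\<close> by simp
  qed
qed

lemma increment_product_mem:
  assumes "0 \<le> u" "u \<le> v" "Z \<in> H0 u"
  shows "(\<lambda>\<omega>. Z \<omega> * (B v \<omega> - B u \<omega>) $ k) \<in> H0 v"
  using assms unfolding vector_minus_component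
  by (intro H0_mult H0_diff H0_B_component H0_mono[of u v]) auto

text \<open>In a partition whose last two points are u and v, conditioning at u leaves a real number
  times a component of \<zeta> m, which has mean zero whatever the sign of that number.\<close>

lemma E_increment_zero:
  assumes u: "0 \<le> u" "u \<le> v" "v \<le> T" and Z: "Z \<in> H0 u"
  shows "E (\<lambda>\<omega>. Z \<omega> * (B v \<omega> - B u \<omega>) $ k) = 0"
proof (cases "u = v")
  case True
  then show ?thesis using sublinear_const[OF E, of 0] by simp
next
  case False
  then have uv: "u < v" using u by simp
  obtain S where S: "finite S" "S \<subseteq> {0..u}"
    and rep: "\<And>m t T. t 0 = 0 \<Longrightarrow> S \<subseteq> t ` {0..m} \<Longrightarrow>
       \<exists>\<phi>\<in>C_lLip_tuple m. \<forall>\<omega>\<in>Omega T. Z \<omega> = \<phi> (increments t \<omega>)"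
    using H0_as_increments[OF Z] by metis
  obtain m and t :: "nat \<Rightarrow> real" where t: "t 0 = 0" "strict_mono_on {0..m} t" "t m = u" "S \<subseteq> t ` {0..m}"
    by (rule exists_partition[OF S u(1)]) blast
  define t' where "t' = t(Suc m := v)"
  have t': "t' 0 = 0" "t' (Suc m) = v" "t' m = u" "\<And>i. i \<le> m \<Longrightarrow> t' i = t i"
    using t by (auto simp: t'_def)
  have "strict_mono_on {0..Suc m} t'"
  proof (rule strict_mono_onI)
    fix r s assume rs: "r \<in> {0..Suc m}" "s \<in> {0..Suc m}" "r < s"
    show "t' r < t' s"
    proof (cases "s = Suc m")
      case True
      have "t r \<le> u" using rs True t(2,3) strict_mono_onD[OF t(2), of r m] by (cases "r = m") auto
      then show ?thesis using True rs t' uv by simp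
    next
      case False
      then show ?thesis using rs t' strict_mono_onD[OF t(2), of r s] by simp
    qed
  qed
  then have part: "partition_upto T (Suc m) t'" using t' u by (simp add: partition_upto_def)
  have "S \<subseteq> t' ` {0..m}" using t(4) t'(4) by (force simp: image_def)
  then obtain \<phi> where \<phi>: "\<phi> \<in> C_lLip_tuple m" "\<And>\<omega>. \<omega> \<in> Omega T \<Longrightarrow> Z \<omega> = \<phi> (increments t' \<omega>)"
    using rep[of t' m, OF t'(1)] by blast
  define \<psi> where "\<psi> x = \<phi> x * x m $ k" for x
  have \<psi>: "\<psi> \<in> C_lLip_tuple (Suc m)"
    unfolding \<psi>_def by (intro C_lLip_tuple_mult C_lLip_tuple_mono[OF \<phi>(1)] C_lLip_tuple_coordinate) auto
  have "E (\<lambda>\<omega>. Z \<omega> * (B v \<omega> - B u \<omega>) $ k) = E (\<lambda>\<omega>. \<psi> (increments t' \<omega>))"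
  proof (rule sublinear_cong[OF E])
    show "(\<lambda>\<omega>. Z \<omega> * (B v \<omega> - B u \<omega>) $ k) \<in> H0 T"
      using increment_product_mem[OF u(1,2) Z] H0_mono[OF u(3)] by blast
    show "(\<lambda>\<omega>. \<psi> (increments t' \<omega>)) \<in> H0 T"
    proof (rule H0_increments[OF _ _ \<psi>])
      fix i assume i: "i \<le> Suc m"
      have "0 \<le> t' i" using i t'(1) strict_mono_onD[OF \<open>strict_mono_on {0..Suc m} t'\<close>, of 0 i] by (cases "i = 0") auto
      moreover have "t' i \<le> v" using i t'(2) strict_mono_onD[OF \<open>strict_mono_on {0..Suc m} t'\<close>, of i "Suc m"] by (cases "i = Suc m") auto
      ultimately show "t' i \<in> {0..T}" using u by simp
    qed (use T in simp)
    show "Z \<omega> * (B v \<omega> - B u \<omega>) $ k = \<psi> (increments t' \<omega>)" if "\<omega> \<in> Omega T" for \<omega>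
      using \<phi>(2)[OF that] t' by (simp add: \<psi>_def increments_def)
  qed
  also have "\<dots> = cond t' 0 \<psi> (\<lambda>_. 0)" by (rule E_increments[OF part \<psi>])
  also have "\<dots> = cond t' 0 (cond t' m \<psi>) (\<lambda>_. 0)" by (rule tower_aux[OF \<psi>]) auto
  also have "cond t' m \<psi> = (\<lambda>x. 0)"
  proof
    fix x
    have "\<phi> (graft m x y) = \<phi> x" for y by (rule C_lLip_tuple_cong[OF \<phi>(1)]) (simp add: graft_def)
    then have "cond t' m \<psi> x = E' (\<lambda>z. (\<phi> x * sqrt (t' (Suc m) - t' m)) * \<zeta> m z $ k)"
      by (simp add: cond_def \<psi>_def graft_def inc_def mult.assoc)
    also have "\<dots> = 0" by (rule zeta_mean)
    finally show "cond t' m \<psi> x = 0" .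
  qed
  also have "cond t' 0 (\<lambda>x. 0) (\<lambda>_. 0) = 0" by (simp add: cond_def sublinear_const[OF E'])
  finally show ?thesis .
qed

text \<open>The upper expectation vanishes for Z and for -Z, so the mean under each representing
  measure is at most 0 and at least 0. This is where sublinear theory turns into classical
  martingale theory.\<close>

lemma integral_increment_zero:
  assumes P: "P \<in> \<P>" and u: "0 \<le> u" "u \<le> v" "v \<le> T" and Z: "Z \<in> H0 u"
  shows "(\<integral>\<omega>. Z \<omega> * (B v \<omega> - B u \<omega>) $ k \<partial>P) = 0"
proof -
  have mem: "(\<lambda>\<omega>. Z \<omega> * (B v \<omega> - B u \<omega>) $ k) \<in> H0 T" if "Z \<in> H0 u" for Z
    using increment_product_mem[OF u(1,2) that] H0_mono[OF u(3)] by blast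
  have "(\<integral>\<omega>. Z \<omega> * (B v \<omega> - B u \<omega>) $ k \<partial>P) \<le> 0"
    using H0_integral_le[OF P mem[OF Z]] E_increment_zero[OF u Z] by simp
  moreover have Z': "(\<lambda>\<omega>. -1 * Z \<omega>) \<in> H0 u" by (rule H0_scale[OF Z])
  have "- (\<integral>\<omega>. Z \<omega> * (B v \<omega> - B u \<omega>) $ k \<partial>P) \<le> 0"
    using H0_integral_le[OF P mem[OF Z']] E_increment_zero[OF u Z', of k] by simp
  ultimately show ?thesis by simp
qed

section \<open>Conditional expectations of cylinder functions\<close>

lemma partition_times:
  assumes "partition_upto T m t" "i \<le> m"
  shows "t i \<in> {0..T}"
proof -
  have m: "strict_mono_on {0..m} t" "t 0 = 0" "t m \<le> T" using assms by (auto simp: partition_upto_def)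
  have "0 \<le> t i" using assms(2) m strict_mono_onD[OF m(1), of 0 i] by (cases "i = 0") auto
  moreover have "t i \<le> t m" using assms(2) strict_mono_onD[OF m(1), of i m] by (cases "i = m") auto
  ultimately show ?thesis using m(3) by simp
qed

lemma is_cond_E0_cond:
  assumes t: "partition_upto T m t" "i \<le> m" and \<phi>: "\<phi> \<in> C_lLip_tuple m"
    and X: "\<And>\<omega>. \<omega> \<in> Omega T \<Longrightarrow> X \<omega> = \<phi> (increments t \<omega>)"
  shows "is_cond_E0 T E (t i) X (\<lambda>\<omega>. cond t i \<phi> (increments t \<omega>))"
  unfolding is_cond_E0_def
  using t \<phi> X E_graft_increments[OF t(1) \<phi>]
  by (intro exI[of _ m] exI[of _ t] exI[of _ \<phi>] exI[of _ i]) auto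

lemma cond_H0:
  assumes t: "partition_upto T m t" "i \<le> m" and \<phi>: "\<phi> \<in> C_lLip_tuple m"
  shows "(\<lambda>\<omega>. cond t i \<phi> (increments t \<omega>)) \<in> H0 (t i)"
proof (rule H0_increments[OF _ _ cond_C_lLip[OF \<phi> t(2)]])
  have m: "strict_mono_on {0..m} t" using t by (auto simp: partition_upto_def)
  show "0 \<le> t i" using partition_times[OF t] by simp
  fix j assume j: "j \<le> i"
  then have "t j \<le> t i" using strict_mono_onD[OF m, of j i] t(2) by (cases "j = i") auto
  then show "t j \<in> {0..t i}" using partition_times[OF t(1), of j] j t(2) by simp
qed

lemma common_partition:
  assumes X: "X \<in> H0 T" and X': "X' \<in> H0 T" and S: "finite S" "S \<subseteq> {0..T}"
  obtains m t \<phi> \<phi>' where "partition_upto T m t" "S \<subseteq> t ` {..m}"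
    "\<phi> \<in> C_lLip_tuple m" "\<And>\<omega>. \<omega> \<in> Omega T \<Longrightarrow> X \<omega> = \<phi> (increments t \<omega>)"
    "\<phi>' \<in> C_lLip_tuple m" "\<And>\<omega>. \<omega> \<in> Omega T \<Longrightarrow> X' \<omega> = \<phi>' (increments t \<omega>)"
proof -
  obtain S1 where S1: "finite S1" "S1 \<subseteq> {0..T}"
    and rep1: "\<And>m t. t 0 = 0 \<Longrightarrow> S1 \<subseteq> t ` {0..m} \<Longrightarrow>
       \<exists>\<phi>\<in>C_lLip_tuple m. \<forall>\<omega>\<in>Omega T. X \<omega> = \<phi> (increments t \<omega>)"
    using H0_as_increments[OF X] by metis
  obtain S2 where S2: "finite S2" "S2 \<subseteq> {0..T}"
    and rep2: "\<And>m t. t 0 = 0 \<Longrightarrow> S2 \<subseteq> t ` {0..m} \<Longrightarrow>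
       \<exists>\<phi>\<in>C_lLip_tuple m. \<forall>\<omega>\<in>Omega T. X' \<omega> = \<phi> (increments t \<omega>)"
    using H0_as_increments[OF X'] by metis
  have "finite (S \<union> (S1 \<union> S2))" "S \<union> (S1 \<union> S2) \<subseteq> {0..T}" using S S1 S2 by auto
  then obtain m and t :: "nat \<Rightarrow> real" where t: "t 0 = 0" "strict_mono_on {0..m} t" "t m = T" "S \<union> (S1 \<union> S2) \<subseteq> t ` {0..m}"
    using exists_partition[of "S \<union> (S1 \<union> S2)" T] T by (metis less_imp_le)
  have "m \<noteq> 0" using t T by (cases m) auto
  then have "partition_upto T m t" using t by (simp add: partition_upto_def)
  moreover obtain \<phi> where "\<phi> \<in> C_lLip_tuple m" "\<And>\<omega>. \<omega> \<in> Omega T \<Longrightarrow> X \<omega> = \<phi> (increments t \<omega>)"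
    using rep1[of t m] t by blast
  moreover obtain \<phi>' where "\<phi>' \<in> C_lLip_tuple m" "\<And>\<omega>. \<omega> \<in> Omega T \<Longrightarrow> X' \<omega> = \<phi>' (increments t \<omega>)"
    using rep2[of t m] t by blast
  ultimately show ?thesis using that[of m t \<phi> \<phi>'] t(4) by (auto simp: atLeast0AtMost)
qed

lemma is_cond_E0_exists:
  assumes "X \<in> H0 T" "s \<in> {0..T}"
  obtains Y where "is_cond_E0 T E s X Y" "Y \<in> H0 s"
proof -
  obtain m t \<phi> where t: "partition_upto T m t" "{s} \<subseteq> t ` {..m}"
    "\<phi> \<in> C_lLip_tuple m" "\<And>\<omega>. \<omega> \<in> Omega T \<Longrightarrow> X \<omega> = \<phi> (increments t \<omega>)"
    using common_partition[OF assms(1) assms(1), of "{s}"] assms(2) by (metis finite.emptyI finite.insertI empty_subsetI insert_subset)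
  obtain i where i: "i \<le> m" "t i = s" using t(2) by auto
  show ?thesis
    using that[of "\<lambda>\<omega>. cond t i \<phi> (increments t \<omega>)"] is_cond_E0_cond[OF t(1) i(1) t(3,4)]
      cond_H0[OF t(1) i(1) t(3)] i(2) by simp
qed

text \<open>By sublinearity \<bar>Y\<bar> is at most the conditional expectation of \<bar>X\<bar>,
  whose upper expectation is that of \<bar>X\<bar> by the tower property.\<close>

lemma is_cond_E0_contraction:
  assumes "is_cond_E0 T E s X Y" "P \<in> \<P>" "X \<in> H0 T"
  shows "(\<integral>\<^sup>+\<omega>. ennreal \<bar>Y \<omega>\<bar> \<partial>P) \<le> ennreal (E (\<lambda>\<omega>. \<bar>X \<omega>\<bar>))"
proof -
  obtain m t \<phi> i where t: "partition_upto T m t" and \<phi>: "\<phi> \<in> C_lLip_tuple m" and i: "i \<le> m"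
    and X: "\<forall>\<omega>\<in>Omega T. X \<omega> = \<phi> (increments t \<omega>)"
    and Y: "\<forall>\<omega>\<in>Omega T. Y \<omega> =
           E (\<lambda>\<omega>'. \<phi> (\<lambda>j. if j < i then increments t \<omega> j else increments t \<omega>' j))"
    using assms(1) unfolding is_cond_E0_def by blast
  define \<psi> where "\<psi> x = \<bar>\<phi> x\<bar>" for x
  have \<psi>: "\<psi> \<in> C_lLip_tuple m" unfolding \<psi>_def by (rule C_lLip_tuple_abs[OF \<phi>])
  define W where "W \<omega> = cond t i \<psi> (increments t \<omega>)" for \<omega>
  have W: "W \<in> H0 T"
    unfolding W_def using cond_H0[OF t i \<psi>] partition_times[OF t i] by (intro H0_mono[of "t i" T]) auto
  have "\<bar>cond t i \<phi> x\<bar> \<le> cond t i \<psi> x" for x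
  proof -
    have "(\<lambda>x. -1 * \<phi> x) \<in> C_lLip_tuple m" by (rule C_lLip_tuple_scale[OF \<phi>])
    have "cond t i \<phi> x \<le> cond t i \<psi> x" by (rule cond_mono[OF \<phi> \<psi>]) (simp add: \<psi>_def)
    moreover have "cond t i (\<lambda>_. 0) x - cond t i \<phi> x \<le> cond t i (\<lambda>x. 0 - \<phi> x) x"
      unfolding cond_def
      using sublinear_diff[OF E' graft_inc_mem[OF C_lLip_tuple_const[of 0 m]] graft_inc_mem[OF \<phi>]] by simp
    moreover have "cond t i (\<lambda>x. 0 - \<phi> x) x \<le> cond t i \<psi> x"
      by (rule cond_mono[OF C_lLip_tuple_diff[OF C_lLip_tuple_const \<phi>] \<psi>]) (simp add: \<psi>_def)
    moreover have "cond t i (\<lambda>_. 0) x = 0" by (simp add: cond_def sublinear_const[OF E'])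
    ultimately show ?thesis by simp
  qed
  then have le: "\<bar>Y \<omega>\<bar> \<le> W \<omega>" if "\<omega> \<in> Omega T" for \<omega>
    using that Y E_graft_increments[OF t \<phi>] by (simp add: W_def)
  have "0 \<le> W \<omega>" for \<omega>
  proof -
    have "cond t i (\<lambda>_. 0) (increments t \<omega>) \<le> W \<omega>"
      unfolding W_def by (rule cond_mono[OF C_lLip_tuple_const \<psi>]) (simp add: \<psi>_def)
    then show ?thesis by (simp add: cond_def sublinear_const[OF E'])
  qed
  then have "(\<integral>\<^sup>+\<omega>. ennreal (W \<omega>) \<partial>P) \<le> ennreal (E W)" by (rule H0_nn_integral_le[OF assms(2) W])
  moreover have "(\<integral>\<^sup>+\<omega>. ennreal \<bar>Y \<omega>\<bar> \<partial>P) \<le> (\<integral>\<^sup>+\<omega>. ennreal (W \<omega>) \<partial>P)"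
    by (rule nn_integral_mono) (use le P_space[OF assms(2)] in \<open>auto intro: ennreal_leI\<close>)
  moreover have "E W = cond t 0 \<psi> (\<lambda>_. 0)"
    unfolding W_def
    using E_increments[OF t C_lLip_tuple_mono[OF cond_C_lLip[OF \<psi> i] i]] tower_aux[OF \<psi> i, of 0] by simp
  moreover have "cond t 0 \<psi> (\<lambda>_. 0) = E (\<lambda>\<omega>. \<psi> (increments t \<omega>))" by (rule E_increments[OF t \<psi>, symmetric])
  moreover have "E (\<lambda>\<omega>. \<psi> (increments t \<omega>)) = E (\<lambda>\<omega>. \<bar>X \<omega>\<bar>)"
  proof (rule sublinear_cong[OF E])
    show "(\<lambda>\<omega>. \<psi> (increments t \<omega>)) \<in> H0 T"
      by (rule H0_increments[OF _ _ \<psi>]) (use T partition_times[OF t] in auto)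
  qed (use X H0_abs[OF assms(3)] in \<open>auto simp: \<psi>_def\<close>)
  ultimately show ?thesis by simp
qed

text \<open>\<open>is_cond_E\<close> quantifies over all approximating sequences, so the contraction
  property enters even here. The fact lets bounds for one conditional expectation be read off from
  bounds for differences.\<close>

lemma is_cond_E_zero:
  assumes "s \<in> {0..T}"
  shows "is_cond_E T \<P> E s (\<lambda>_. 0) (\<lambda>_. 0)"
proof -
  have dist0: "Lp_dist \<P> 1 (\<lambda>_. 0) (\<lambda>_. 0) = 0" unfolding Lp_dist_def using P_nonempty by simp
  have "(\<lambda>_. 0) \<in> L_G T \<P> 1"
    unfolding L_G_def using H0_const[of T 0] T dist0 by (auto intro!: exI[of _ "\<lambda>_ _. 0"])
  moreover have "(\<lambda>n. Lp_dist \<P> 1 (Yn n) (\<lambda>_. 0)) \<longlonglongrightarrow> 0"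
    if cond: "\<And>n. is_cond_E0 T E s (Xn n) (Yn n)" and lim: "(\<lambda>n. Lp_dist \<P> 1 (Xn n) (\<lambda>_. 0)) \<longlonglongrightarrow> 0" for Xn Yn
  proof (rule tendsto_sandwich[OF _ _ tendsto_const lim])
    show "\<forall>\<^sub>F n in sequentially. Lp_dist \<P> 1 (Yn n) (\<lambda>_. 0) \<le> Lp_dist \<P> 1 (Xn n) (\<lambda>_. 0)"
    proof (rule always_eventually, rule allI)
      fix n
      obtain m t \<phi> i where t: "partition_upto T m t" "\<phi> \<in> C_lLip_tuple m"
          "\<forall>\<omega>\<in>Omega T. Xn n \<omega> = \<phi> (increments t \<omega>)"
        and Yn: "i \<le> m" "t i = s" "\<forall>\<omega>\<in>Omega T. Yn n \<omega> =
           E (\<lambda>\<omega>'. \<phi> (\<lambda>j. if j < i then increments t \<omega> j else increments t \<omega>' j))"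
        using cond[of n] unfolding is_cond_E0_def by blast
      \<comment> \<open>\<open>Xn n\<close> is prescribed on \<open>Omega T\<close> only; X is a
        representative that lies in \<open>H0 T\<close>.\<close>
      define X where "X \<omega> = \<phi> (increments t \<omega>)" for \<omega>
      have X: "X \<in> H0 T"
        unfolding X_def by (rule H0_increments[OF _ _ t(2)]) (use T partition_times[OF t(1)] in auto)
      have cX: "is_cond_E0 T E s X (Yn n)"
        unfolding is_cond_E0_def
        using t Yn by (intro exI[of _ m] exI[of _ t] exI[of _ \<phi>] exI[of _ i]) (auto simp: X_def)
      obtain Q where Q: "Q \<in> \<P>" "(\<integral>\<omega>. \<bar>X \<omega>\<bar> \<partial>Q) = E (\<lambda>\<omega>. \<bar>X \<omega>\<bar>)"
        using H0_attained[OF H0_abs[OF X]] by blast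
      have "ennreal (E (\<lambda>\<omega>. \<bar>X \<omega>\<bar>)) = (\<integral>\<^sup>+\<omega>. ennreal \<bar>X \<omega>\<bar> \<partial>Q)"
        using nn_integral_eq_integral[OF H0_integrable[OF Q(1) H0_abs[OF X]]] Q(2) by simp
      also have "\<dots> = (\<integral>\<^sup>+\<omega>. ennreal \<bar>Xn n \<omega> - 0\<bar> \<partial>Q)"
        by (rule nn_integral_cong) (use t(3) P_space[OF Q(1)] in \<open>simp add: X_def\<close>)
      also have "\<dots> \<le> Lp_dist \<P> 1 (Xn n) (\<lambda>_. 0)" by (rule L1_dist_ge[OF Q(1)])
      finally show "Lp_dist \<P> 1 (Yn n) (\<lambda>_. 0) \<le> Lp_dist \<P> 1 (Xn n) (\<lambda>_. 0)"
        unfolding Lp_dist_def[of _ _ "Yn n"]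
        by (intro SUP_least) (use is_cond_E0_contraction[OF cX _ X] in \<open>auto intro: order_trans\<close>)
    qed
  qed auto
  ultimately show ?thesis unfolding is_cond_E_def by blast
qed

text \<open>By sublinearity the difference of the conditional expectations is at most a plus the
  conditional expectation of the excess of \<bar>X - X'\<bar> over a. Feeding only this excess into
  the maximal inequality later produces a tail of order a powr - \<beta>. The shift by a moves the
  ramp to the levels from 2 * a to 3 * a.\<close>

lemma cylinder_maximal:
  assumes X: "X \<in> H0 T" and X': "X' \<in> H0 T" and s: "\<And>j. j \<le> n \<Longrightarrow> s j \<in> {0..T}" and a: "0 < a"
  obtains Y Y' where "\<And>j. j \<le> n \<Longrightarrow> is_cond_E0 T E (s j) X (Y j)" "\<And>j. j \<le> n \<Longrightarrow> is_cond_E0 T E (s j) X' (Y' j)"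
    "\<And>j. j \<le> n \<Longrightarrow> Y j \<in> H0 T" "\<And>j. j \<le> n \<Longrightarrow> Y' j \<in> H0 T"
    "\<And>P. P \<in> \<P> \<Longrightarrow> (\<integral>\<^sup>+\<omega>. ennreal (max 0 (min 1 ((running_max (\<lambda>j. Y j \<omega> - Y' j \<omega>) n - 2 * a) / a))) \<partial>P)
       \<le> ennreal (1 / a) * ennreal (E (\<lambda>\<omega>. max 0 (\<bar>X \<omega> - X' \<omega>\<bar> - a)))"
proof -
  have "finite (s ` {..n})" "s ` {..n} \<subseteq> {0..T}" using s by auto
  then obtain m t \<phi> \<phi>' where t: "partition_upto T m t" and st: "s ` {..n} \<subseteq> t ` {..m}"
    and \<phi>: "\<phi> \<in> C_lLip_tuple m" and X\<phi>: "\<And>\<omega>. \<omega> \<in> Omega T \<Longrightarrow> X \<omega> = \<phi> (increments t \<omega>)"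
    and \<phi>': "\<phi>' \<in> C_lLip_tuple m" and X\<phi>': "\<And>\<omega>. \<omega> \<in> Omega T \<Longrightarrow> X' \<omega> = \<phi>' (increments t \<omega>)"
    using common_partition[OF X X', of "s ` {..n}"] by metis
  have "\<forall>j\<in>{..n}. \<exists>i. i \<le> m \<and> s j = t i" using st by force
  then obtain ix where ix: "\<And>j. j \<le> n \<Longrightarrow> ix j \<le> m \<and> s j = t (ix j)" by (metis atMost_iff)
  define Y where "Y j \<omega> = cond t (ix j) \<phi> (increments t \<omega>)" for j \<omega>
  define Y' where "Y' j \<omega> = cond t (ix j) \<phi>' (increments t \<omega>)" for j \<omega>
  define u where "u x = max 0 (\<bar>\<phi> x - \<phi>' x\<bar> - a)" for x
  have u: "u \<in> C_lLip_tuple m" "\<And>x. 0 \<le> u x"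
    unfolding u_def by (intro C_lLip_tuple_max C_lLip_tuple_diff C_lLip_tuple_abs C_lLip_tuple_const \<phi> \<phi>') simp
  define h where "h = (\<lambda>x. max 0 (min 1 ((Max ((\<lambda>i. cond t i u x) ` {..m}) - a) / a)))"
  note h = maximal_inequality[OF t u a h_def]
  have diff: "\<bar>cond t i \<phi> x - cond t i \<phi>' x\<bar> \<le> a + cond t i u x" for i x
  proof -
    have one: "cond t i \<psi> x - cond t i \<psi>' x \<le> a + cond t i u x"
      if \<psi>: "\<psi> \<in> C_lLip_tuple m" "\<psi>' \<in> C_lLip_tuple m" "\<And>x. \<psi> x - \<psi>' x \<le> a + u x" for \<psi> \<psi>'
    proof -
      have "cond t i \<psi> x - cond t i \<psi>' x \<le> cond t i (\<lambda>x. \<psi> x - \<psi>' x) x"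
        unfolding cond_def by (rule sublinear_diff[OF E' graft_inc_mem[OF \<psi>(1)] graft_inc_mem[OF \<psi>(2)]])
      also have "\<dots> \<le> cond t i (\<lambda>x. u x + a) x"
        by (rule cond_mono[OF C_lLip_tuple_diff[OF \<psi>(1,2)] C_lLip_tuple_add[OF u(1) C_lLip_tuple_const]])
           (use \<psi>(3) in \<open>simp add: add.commute\<close>)
      also have "\<dots> = cond t i u x + a"
        unfolding cond_def by (rule sublinear_add_const[OF E' graft_inc_mem[OF u(1)]])
      finally show ?thesis by simp
    qed
    have "cond t i \<phi> x - cond t i \<phi>' x \<le> a + cond t i u x"
      by (rule one[OF \<phi> \<phi>']) (simp add: u_def)
    moreover have "cond t i \<phi>' x - cond t i \<phi> x \<le> a + cond t i u x"
      by (rule one[OF \<phi>' \<phi>]) (simp add: u_def)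
    ultimately show ?thesis by simp
  qed
  have le: "max 0 (min 1 ((running_max (\<lambda>j. Y j \<omega> - Y' j \<omega>) n - 2 * a) / a)) \<le> h (increments t \<omega>)" for \<omega>
  proof -
    let ?M = "Max ((\<lambda>i. cond t i u (increments t \<omega>)) ` {..m})"
    have "running_max (\<lambda>j. Y j \<omega> - Y' j \<omega>) n \<le> a + ?M"
    proof (rule running_max_le)
      fix j assume "j \<le> n"
      then have "cond t (ix j) u (increments t \<omega>) \<le> ?M" using ix by (intro Max_ge) auto
      then show "\<bar>Y j \<omega> - Y' j \<omega>\<bar> \<le> a + ?M"
        using diff[of "ix j" "increments t \<omega>"] by (simp add: Y_def Y'_def)
    qed
    then have "(running_max (\<lambda>j. Y j \<omega> - Y' j \<omega>) n - 2 * a) / a \<le> (?M - a) / a"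
      using a by (intro divide_right_mono) auto
    then show ?thesis unfolding h_def by (intro max.mono min.mono order_refl)
  qed
  have inc_H0: "(\<lambda>\<omega>. \<psi> (increments t \<omega>)) \<in> H0 T" if "\<psi> \<in> C_lLip_tuple m" for \<psi>
    by (rule H0_increments[OF _ _ that]) (use T partition_times[OF t] in auto)
  show ?thesis
  proof (rule that)
    fix j assume j: "j \<le> n"
    show "is_cond_E0 T E (s j) X (Y j)" "is_cond_E0 T E (s j) X' (Y' j)"
      using ix[OF j] is_cond_E0_cond[OF t _ \<phi> X\<phi>] is_cond_E0_cond[OF t _ \<phi>' X\<phi>']
      by (auto simp: Y_def[abs_def] Y'_def[abs_def])
    show "Y j \<in> H0 T" "Y' j \<in> H0 T"
      using ix[OF j] cond_H0[OF t _ \<phi>, of "ix j"] cond_H0[OF t _ \<phi>', of "ix j"] s[OF j]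
        H0_mono[of "s j" T "\<lambda>\<omega>. cond t (ix j) \<phi> (increments t \<omega>)"]
        H0_mono[of "s j" T "\<lambda>\<omega>. cond t (ix j) \<phi>' (increments t \<omega>)"]
      by (auto simp: Y_def[abs_def] Y'_def[abs_def])
  next
    fix P assume P: "P \<in> \<P>"
    have "(\<integral>\<^sup>+\<omega>. ennreal (max 0 (min 1 ((running_max (\<lambda>j. Y j \<omega> - Y' j \<omega>) n - 2 * a) / a))) \<partial>P)
        \<le> (\<integral>\<^sup>+\<omega>. ennreal (h (increments t \<omega>)) \<partial>P)"
      by (intro nn_integral_mono ennreal_leI le)
    also have "\<dots> \<le> ennreal (E (\<lambda>\<omega>. h (increments t \<omega>)))"
      by (rule H0_nn_integral_le[OF P inc_H0[OF h(1)]]) (simp add: h_def)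
    also have "\<dots> \<le> ennreal (1 / a * E (\<lambda>\<omega>. u (increments t \<omega>)))"
      using h(2) a by (intro ennreal_leI) (simp add: field_simps)
    also have "\<dots> = ennreal (1 / a) * ennreal (E (\<lambda>\<omega>. u (increments t \<omega>)))"
      using a by (intro ennreal_mult') simp
    also have "E (\<lambda>\<omega>. u (increments t \<omega>)) = E (\<lambda>\<omega>. max 0 (\<bar>X \<omega> - X' \<omega>\<bar> - a))"
    proof (rule sublinear_cong[OF E inc_H0[OF u(1)]])
      have "poly_lipschitz (\<lambda>x. max 0 (\<bar>x\<bar> - a))"
        by (rule poly_lipschitz_lipschitz[of _ 1]) (auto simp: max_def)
      from H0_comp[OF this H0_diff[OF X X']] show "(\<lambda>\<omega>. max 0 (\<bar>X \<omega> - X' \<omega>\<bar> - a)) \<in> H0 T" .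
    qed (simp add: u_def X\<phi> X\<phi>')
    finally show "(\<integral>\<^sup>+\<omega>. ennreal (max 0 (min 1 ((running_max (\<lambda>j. Y j \<omega> - Y' j \<omega>) n - 2 * a) / a))) \<partial>P)
       \<le> ennreal (1 / a) * ennreal (E (\<lambda>\<omega>. max 0 (\<bar>X \<omega> - X' \<omega>\<bar> - a)))" .
  qed
qed


section \<open>The maximal inequality on the completion\<close>

lemma L_GE:
  assumes "X \<in> L_G T \<P> p"
  obtains Xn where "X \<in> borel_measurable (Borel_Omega T)" "\<And>n. Xn n \<in> H0 T"
    "(\<lambda>n. Lp_dist \<P> p (Xn n) X) \<longlonglongrightarrow> 0"
  using assms unfolding L_G_def by blast

lemma L_G_P_measurable: "P \<in> \<P> \<Longrightarrow> X \<in> L_G T \<P> p \<Longrightarrow> X \<in> borel_measurable P"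
  unfolding P_measurable by (auto simp: L_G_def)

lemma H0_P_measurable: "P \<in> \<P> \<Longrightarrow> X \<in> H0 T \<Longrightarrow> X \<in> borel_measurable P"
  using borel_measurable_integrable[OF H0_integrable] .

lemma ennreal_E_attained:
  assumes "X \<in> H0 T" "\<And>\<omega>. 0 \<le> X \<omega>"
  obtains Q where "Q \<in> \<P>" "ennreal (E X) = (\<integral>\<^sup>+\<omega>. ennreal (X \<omega>) \<partial>Q)"
proof -
  obtain Q where Q: "Q \<in> \<P>" "(\<integral>\<omega>. X \<omega> \<partial>Q) = E X" using H0_attained[OF assms(1)] by blast
  show ?thesis
    using that[OF Q(1)] nn_integral_eq_integral[OF H0_integrable[OF Q(1) assms(1)]] assms(2) Q(2) by simp
qed

lemma is_cond_E_lim: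
  assumes "is_cond_E T \<P> E s X Y" "\<And>n. is_cond_E0 T E s (Xn n) (Yn n)"
    "(\<lambda>n. Lp_dist \<P> 1 (Xn n) X) \<longlonglongrightarrow> 0"
  shows "(\<lambda>n. Lp_dist \<P> 1 (Yn n) Y) \<longlonglongrightarrow> 0"
proof -
  have "(\<forall>n. is_cond_E0 T E s (Xn n) (Yn n)) \<and> (\<lambda>n. Lp_dist \<P> 1 (Xn n) X) \<longlonglongrightarrow> 0 \<longrightarrow>
      (\<lambda>n. Lp_dist \<P> 1 (Yn n) Y) \<longlonglongrightarrow> 0"
    using assms(1) unfolding is_cond_E_def by (elim conjE) (drule spec[of _ Xn], drule spec[of _ Yn], assumption)
  then show ?thesis using assms(2,3) by simp
qed

text \<open>The ramp f is Lipschitz with constant 1 / a, so convergence in mean at the finitely many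
  times carries the cylinder bound over. Since f is 1 from 3 * a on, the result bounds a
  probability.\<close>

lemma maximal_limit:
  assumes Y: "\<And>j. j \<le> n \<Longrightarrow> is_cond_E T \<P> E (s j) \<xi> (Y j)"
    and Y': "\<And>j. j \<le> n \<Longrightarrow> is_cond_E T \<P> E (s j) \<xi>' (Y' j)"
    and s: "\<And>j. j \<le> n \<Longrightarrow> s j \<in> {0..T}" and a: "0 < a" and P: "P \<in> \<P>"
  shows "emeasure P {\<omega>\<in>space P. 3 * a \<le> running_max (\<lambda>j. Y j \<omega> - Y' j \<omega>) n}
    \<le> ennreal (1 / a) * (SUP Q\<in>\<P>. \<integral>\<^sup>+\<omega>. ennreal (max 0 (\<bar>\<xi> \<omega> - \<xi>' \<omega>\<bar> - a)) \<partial>Q)"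
proof -
  define \<kappa> where "\<kappa> = (SUP Q\<in>\<P>. \<integral>\<^sup>+\<omega>. ennreal (max 0 (\<bar>\<xi> \<omega> - \<xi>' \<omega>\<bar> - a)) \<partial>Q)"
  have L: "\<xi> \<in> L_G T \<P> 1" "\<xi>' \<in> L_G T \<P> 1" "\<And>j. j \<le> n \<Longrightarrow> Y j \<in> L_G T \<P> 1" "\<And>j. j \<le> n \<Longrightarrow> Y' j \<in> L_G T \<P> 1"
    using Y Y' unfolding is_cond_E_def by auto
  obtain X where X: "\<And>k. X k \<in> H0 T" "(\<lambda>k. Lp_dist \<P> 1 (X k) \<xi>) \<longlonglongrightarrow> 0"
    using L(1) by (rule L_GE) blast
  obtain X' where X': "\<And>k. X' k \<in> H0 T" "(\<lambda>k. Lp_dist \<P> 1 (X' k) \<xi>') \<longlonglongrightarrow> 0"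
    using L(2) by (rule L_GE) blast
  define f where "f x = max 0 (min 1 ((x - 2 * a) / a))" for x :: real
  define u where "u k \<omega> = max 0 (\<bar>X k \<omega> - X' k \<omega>\<bar> - a)" for k \<omega>
  define good where "good k Z Z' \<longleftrightarrow> (\<forall>j\<le>n. is_cond_E0 T E (s j) (X k) (Z j) \<and> is_cond_E0 T E (s j) (X' k) (Z' j)
      \<and> Z j \<in> H0 T \<and> Z' j \<in> H0 T)
      \<and> (\<integral>\<^sup>+\<omega>. ennreal (f (running_max (\<lambda>j. Z j \<omega> - Z' j \<omega>) n)) \<partial>P) \<le> ennreal (1 / a) * ennreal (E (u k))" for k Z Z'
  have "\<forall>k. \<exists>Z Z'. good k Z Z'"
  proof
    fix k
    obtain Z Z' where "\<And>j. j \<le> n \<Longrightarrow> is_cond_E0 T E (s j) (X k) (Z j)" "\<And>j. j \<le> n \<Longrightarrow> is_cond_E0 T E (s j) (X' k) (Z' j)"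
    "\<And>j. j \<le> n \<Longrightarrow> Z j \<in> H0 T" "\<And>j. j \<le> n \<Longrightarrow> Z' j \<in> H0 T"
    "\<And>P. P \<in> \<P> \<Longrightarrow> (\<integral>\<^sup>+\<omega>. ennreal (max 0 (min 1 ((running_max (\<lambda>j. Z j \<omega> - Z' j \<omega>) n - 2 * a) / a))) \<partial>P)
       \<le> ennreal (1 / a) * ennreal (E (\<lambda>\<omega>. max 0 (\<bar>X k \<omega> - X' k \<omega>\<bar> - a)))"
      by (rule cylinder_maximal[where s = s and n = n, OF X(1)[of k] X'(1)[of k] _ a]) (use s in blast)+
    then show "\<exists>Z Z'. good k Z Z'"
      using P unfolding good_def f_def u_def by (intro exI[of _ Z] exI[of _ Z']) auto
  qed
  then obtain Z Z' where "\<And>k. good k (Z k) (Z' k)" by metis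
  then have Z: "\<And>k j. j \<le> n \<Longrightarrow> is_cond_E0 T E (s j) (X k) (Z k j)"
      "\<And>k j. j \<le> n \<Longrightarrow> is_cond_E0 T E (s j) (X' k) (Z' k j)"
      "\<And>k j. j \<le> n \<Longrightarrow> Z k j \<in> H0 T" "\<And>k j. j \<le> n \<Longrightarrow> Z' k j \<in> H0 T"
    and Zint: "\<And>k. (\<integral>\<^sup>+\<omega>. ennreal (f (running_max (\<lambda>j. Z k j \<omega> - Z' k j \<omega>) n)) \<partial>P) \<le> ennreal (1 / a) * ennreal (E (u k))"
    unfolding good_def by blast+
  have limZ: "(\<lambda>k. Lp_dist \<P> 1 (Z k j) (Y j)) \<longlonglongrightarrow> 0" "(\<lambda>k. Lp_dist \<P> 1 (Z' k j) (Y' j)) \<longlonglongrightarrow> 0" if "j \<le> n" for j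
    using is_cond_E_lim[OF Y[OF that] Z(1)[OF that] X(2)] is_cond_E_lim[OF Y'[OF that] Z(2)[OF that] X'(2)] by auto
  define D where "D k = (\<Sum>j\<le>n. Lp_dist \<P> 1 (Z k j) (Y j) + Lp_dist \<P> 1 (Z' k j) (Y' j))" for k
  define e where "e k = Lp_dist \<P> 1 (X k) \<xi> + Lp_dist \<P> 1 (X' k) \<xi>'" for k
  have "D \<longlonglongrightarrow> (\<Sum>j\<le>n. 0 + 0)" unfolding D_def using limZ by (intro tendsto_sum tendsto_add) auto
  then have D0: "D \<longlonglongrightarrow> 0" by simp
  have "e \<longlonglongrightarrow> 0 + 0" unfolding e_def by (intro tendsto_add X(2) X'(2))
  then have e0: "e \<longlonglongrightarrow> 0" by simp
  \<comment> \<open>Some representing measure attains the upper expectation of the approximating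
    excess; under that measure it is compared with the supremum \<kappa>.\<close>
  have Eu: "ennreal (E (u k)) \<le> \<kappa> + e k" for k
  proof -
    have "poly_lipschitz (\<lambda>x. max 0 (\<bar>x\<bar> - a))"
      by (rule poly_lipschitz_lipschitz[of _ 1]) (auto simp: max_def)
    from H0_comp[OF this H0_diff[OF X(1) X'(1)]] have uH: "u k \<in> H0 T" by (simp add: u_def[abs_def])
    obtain Q where Q: "Q \<in> \<P>" "ennreal (E (u k)) = (\<integral>\<^sup>+\<omega>. ennreal (u k \<omega>) \<partial>Q)"
      using ennreal_E_attained[OF uH] by (auto simp: u_def)
    have [measurable]: "\<xi> \<in> borel_measurable Q" "\<xi>' \<in> borel_measurable Q" "X k \<in> borel_measurable Q" "X' k \<in> borel_measurable Q"
      using L_G_P_measurable[OF Q(1)] L H0_P_measurable[OF Q(1)] X X' by auto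
    have "ennreal (u k \<omega>) \<le> ennreal (max 0 (\<bar>\<xi> \<omega> - \<xi>' \<omega>\<bar> - a)) + (ennreal \<bar>X k \<omega> - \<xi> \<omega>\<bar> + ennreal \<bar>X' k \<omega> - \<xi>' \<omega>\<bar>)" for \<omega>
    proof -
      have "u k \<omega> \<le> max 0 (\<bar>\<xi> \<omega> - \<xi>' \<omega>\<bar> - a) + (\<bar>X k \<omega> - \<xi> \<omega>\<bar> + \<bar>X' k \<omega> - \<xi>' \<omega>\<bar>)"
        unfolding u_def max_def by auto
      then have "ennreal (u k \<omega>) \<le> ennreal (max 0 (\<bar>\<xi> \<omega> - \<xi>' \<omega>\<bar> - a) + (\<bar>X k \<omega> - \<xi> \<omega>\<bar> + \<bar>X' k \<omega> - \<xi>' \<omega>\<bar>))"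
        by (rule ennreal_leI)
      also have "\<dots> = ennreal (max 0 (\<bar>\<xi> \<omega> - \<xi>' \<omega>\<bar> - a)) + (ennreal \<bar>X k \<omega> - \<xi> \<omega>\<bar> + ennreal \<bar>X' k \<omega> - \<xi>' \<omega>\<bar>)"
        by (subst ennreal_plus, simp, simp, subst ennreal_plus) simp_all
      finally show ?thesis .
    qed
    then have "ennreal (E (u k)) \<le> (\<integral>\<^sup>+\<omega>. ennreal (max 0 (\<bar>\<xi> \<omega> - \<xi>' \<omega>\<bar> - a)) + (ennreal \<bar>X k \<omega> - \<xi> \<omega>\<bar> + ennreal \<bar>X' k \<omega> - \<xi>' \<omega>\<bar>) \<partial>Q)"
      unfolding Q(2) by (intro nn_integral_mono)
    also have "\<dots> = (\<integral>\<^sup>+\<omega>. ennreal (max 0 (\<bar>\<xi> \<omega> - \<xi>' \<omega>\<bar> - a)) \<partial>Q)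
        + ((\<integral>\<^sup>+\<omega>. ennreal \<bar>X k \<omega> - \<xi> \<omega>\<bar> \<partial>Q) + (\<integral>\<^sup>+\<omega>. ennreal \<bar>X' k \<omega> - \<xi>' \<omega>\<bar> \<partial>Q))"
      by (simp add: nn_integral_add)
    also have "\<dots> \<le> \<kappa> + e k"
      unfolding \<kappa>_def e_def using Q(1) by (intro add_mono L1_dist_ge SUP_upper) auto
    finally show ?thesis .
  qed
  have f_le: "f (running_max (\<lambda>j. Y j \<omega> - Y' j \<omega>) n) \<le> f (running_max (\<lambda>j. Z k j \<omega> - Z' k j \<omega>) n)
      + 1 / a * (\<Sum>j\<le>n. \<bar>Z k j \<omega> - Y j \<omega>\<bar> + \<bar>Z' k j \<omega> - Y' j \<omega>\<bar>)" for k \<omega>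
  proof -
    let ?d = "\<Sum>j\<le>n. \<bar>Z k j \<omega> - Y j \<omega>\<bar> + \<bar>Z' k j \<omega> - Y' j \<omega>\<bar>"
    let ?y = "running_max (\<lambda>j. Y j \<omega> - Y' j \<omega>) n" and ?z = "running_max (\<lambda>j. Z k j \<omega> - Z' k j \<omega>) n"
    have d0: "0 \<le> ?d" by (intro sum_nonneg) auto
    have "?y \<le> ?z + ?d"
    proof (rule running_max_le)
      fix j assume j: "j \<le> n"
      have "\<bar>Z k j \<omega> - Y j \<omega>\<bar> + \<bar>Z' k j \<omega> - Y' j \<omega>\<bar> \<le> ?d"
        using j by (intro member_le_sum) auto
      then show "\<bar>Y j \<omega> - Y' j \<omega>\<bar> \<le> ?z + ?d"
        using running_max_ge[OF j, of "\<lambda>j. Z k j \<omega> - Z' k j \<omega>"] by simp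
    qed
    then have "(?y - 2 * a) / a \<le> (?z + ?d - 2 * a) / a"
      using a by (intro divide_right_mono) auto
    then have "(?y - 2 * a) / a \<le> (?z - 2 * a) / a + 1 / a * ?d"
      by (simp add: add_divide_distrib diff_divide_distrib)
    moreover have "0 \<le> 1 / a * ?d" using a d0 by simp
    ultimately show ?thesis unfolding f_def max_def min_def by auto
  qed
  have meas: "(\<lambda>\<omega>. running_max (\<lambda>j. U j \<omega>) n) \<in> borel_measurable P"
    if "\<And>j. j \<le> n \<Longrightarrow> U j \<in> borel_measurable P" for U :: "nat \<Rightarrow> 'd path \<Rightarrow> real"
    using that
  proof (induction n)
    case (Suc n)
    then have [measurable]: "(\<lambda>\<omega>. running_max (\<lambda>j. U j \<omega>) n) \<in> borel_measurable P" "U (Suc n) \<in> borel_measurable P" by auto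
    show ?case by simp
  qed simp
  have [measurable]: "f \<in> borel_measurable borel" unfolding f_def by measurable
  have Ym: "Y j \<in> borel_measurable P" "Y' j \<in> borel_measurable P" "Z k j \<in> borel_measurable P" "Z' k j \<in> borel_measurable P"
    if "j \<le> n" for j k
    using L_G_P_measurable[OF P] L(3,4) H0_P_measurable[OF P] Z(3,4) that by auto
  have rmY[measurable]: "(\<lambda>\<omega>. running_max (\<lambda>j. Y j \<omega> - Y' j \<omega>) n) \<in> borel_measurable P"
    by (rule meas) (use Ym in auto)
  have rmZ[measurable]: "(\<lambda>\<omega>. running_max (\<lambda>j. Z k j \<omega> - Z' k j \<omega>) n) \<in> borel_measurable P" for k
    by (rule meas) (use Ym in auto)
  have bound: "(\<integral>\<^sup>+\<omega>. ennreal (f (running_max (\<lambda>j. Y j \<omega> - Y' j \<omega>) n)) \<partial>P) \<le> ennreal (1 / a) * (\<kappa> + e k + D k)" for k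
  proof -
    have "ennreal (f (running_max (\<lambda>j. Y j \<omega> - Y' j \<omega>) n)) \<le> ennreal (f (running_max (\<lambda>j. Z k j \<omega> - Z' k j \<omega>) n))
      + ennreal (1 / a) * (\<Sum>j\<le>n. ennreal \<bar>Z k j \<omega> - Y j \<omega>\<bar> + ennreal \<bar>Z' k j \<omega> - Y' j \<omega>\<bar>)" for \<omega>
    proof -
      have nn: "0 \<le> 1 / a * (\<Sum>j\<le>n. \<bar>Z k j \<omega> - Y j \<omega>\<bar> + \<bar>Z' k j \<omega> - Y' j \<omega>\<bar>)"
        using a by (intro mult_nonneg_nonneg sum_nonneg) auto
      have "(\<Sum>j\<le>n. ennreal \<bar>Z k j \<omega> - Y j \<omega>\<bar> + ennreal \<bar>Z' k j \<omega> - Y' j \<omega>\<bar>)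
          = ennreal (\<Sum>j\<le>n. \<bar>Z k j \<omega> - Y j \<omega>\<bar> + \<bar>Z' k j \<omega> - Y' j \<omega>\<bar>)"
        by (subst sum_ennreal[symmetric]) auto
      then have "ennreal (1 / a) * (\<Sum>j\<le>n. ennreal \<bar>Z k j \<omega> - Y j \<omega>\<bar> + ennreal \<bar>Z' k j \<omega> - Y' j \<omega>\<bar>)
          = ennreal (1 / a * (\<Sum>j\<le>n. \<bar>Z k j \<omega> - Y j \<omega>\<bar> + \<bar>Z' k j \<omega> - Y' j \<omega>\<bar>))"
        using a by (subst ennreal_mult) (auto intro!: sum_nonneg)
      moreover have "0 \<le> f (running_max (\<lambda>j. Z k j \<omega> - Z' k j \<omega>) n)" by (simp add: f_def)
      ultimately show ?thesis using f_le[of \<omega> k] nn by (simp only: ennreal_plus[symmetric] ennreal_leI)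
    qed
    then have "(\<integral>\<^sup>+\<omega>. ennreal (f (running_max (\<lambda>j. Y j \<omega> - Y' j \<omega>) n)) \<partial>P)
      \<le> (\<integral>\<^sup>+\<omega>. ennreal (f (running_max (\<lambda>j. Z k j \<omega> - Z' k j \<omega>) n))
      + ennreal (1 / a) * (\<Sum>j\<le>n. ennreal \<bar>Z k j \<omega> - Y j \<omega>\<bar> + ennreal \<bar>Z' k j \<omega> - Y' j \<omega>\<bar>) \<partial>P)"
      by (intro nn_integral_mono)
    also have "\<dots> = (\<integral>\<^sup>+\<omega>. ennreal (f (running_max (\<lambda>j. Z k j \<omega> - Z' k j \<omega>) n)) \<partial>P)
      + ennreal (1 / a) * (\<Sum>j\<le>n. (\<integral>\<^sup>+\<omega>. ennreal \<bar>Z k j \<omega> - Y j \<omega>\<bar> \<partial>P) + (\<integral>\<^sup>+\<omega>. ennreal \<bar>Z' k j \<omega> - Y' j \<omega>\<bar> \<partial>P))"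
    proof -
      have "(\<integral>\<^sup>+\<omega>. (\<Sum>j\<le>n. ennreal \<bar>Z k j \<omega> - Y j \<omega>\<bar> + ennreal \<bar>Z' k j \<omega> - Y' j \<omega>\<bar>) \<partial>P)
        = (\<Sum>j\<le>n. (\<integral>\<^sup>+\<omega>. ennreal \<bar>Z k j \<omega> - Y j \<omega>\<bar> + ennreal \<bar>Z' k j \<omega> - Y' j \<omega>\<bar> \<partial>P))"
        by (rule nn_integral_sum) (use Ym in auto)
      also have "\<dots> = (\<Sum>j\<le>n. (\<integral>\<^sup>+\<omega>. ennreal \<bar>Z k j \<omega> - Y j \<omega>\<bar> \<partial>P) + (\<integral>\<^sup>+\<omega>. ennreal \<bar>Z' k j \<omega> - Y' j \<omega>\<bar> \<partial>P))"
        by (intro sum.cong refl nn_integral_add) (use Ym in auto)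
      finally have eq: "(\<integral>\<^sup>+\<omega>. (\<Sum>j\<le>n. ennreal \<bar>Z k j \<omega> - Y j \<omega>\<bar> + ennreal \<bar>Z' k j \<omega> - Y' j \<omega>\<bar>) \<partial>P)
        = (\<Sum>j\<le>n. (\<integral>\<^sup>+\<omega>. ennreal \<bar>Z k j \<omega> - Y j \<omega>\<bar> \<partial>P) + (\<integral>\<^sup>+\<omega>. ennreal \<bar>Z' k j \<omega> - Y' j \<omega>\<bar> \<partial>P))" .
      have "(\<lambda>\<omega>. \<Sum>j\<le>n. ennreal \<bar>Z k j \<omega> - Y j \<omega>\<bar> + ennreal \<bar>Z' k j \<omega> - Y' j \<omega>\<bar>) \<in> borel_measurable P"
        by (rule borel_measurable_sum) (use Ym in auto)
      then show ?thesis by (subst nn_integral_add) (auto simp: nn_integral_cmult eq)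
    qed
    also have "\<dots> \<le> ennreal (1 / a) * (\<kappa> + e k) + ennreal (1 / a) * D k"
    proof (intro add_mono mult_left_mono)
      show "(\<integral>\<^sup>+\<omega>. ennreal (f (running_max (\<lambda>j. Z k j \<omega> - Z' k j \<omega>) n)) \<partial>P) \<le> ennreal (1 / a) * (\<kappa> + e k)"
        by (rule order_trans[OF Zint]) (intro mult_left_mono Eu, simp)
      show "(\<Sum>j\<le>n. (\<integral>\<^sup>+\<omega>. ennreal \<bar>Z k j \<omega> - Y j \<omega>\<bar> \<partial>P) + (\<integral>\<^sup>+\<omega>. ennreal \<bar>Z' k j \<omega> - Y' j \<omega>\<bar> \<partial>P)) \<le> D k"
        unfolding D_def by (intro sum_mono add_mono L1_dist_ge P)
    qed simp
    also have "\<dots> = ennreal (1 / a) * (\<kappa> + e k + D k)" by (simp add: distrib_left)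
    finally show ?thesis .
  qed
  have "(\<lambda>k. ennreal (1 / a) * (\<kappa> + e k + D k)) \<longlonglongrightarrow> ennreal (1 / a) * (\<kappa> + 0 + 0)"
    by (intro ennreal_tendsto_cmult tendsto_add tendsto_const e0 D0) simp
  then have lim: "(\<integral>\<^sup>+\<omega>. ennreal (f (running_max (\<lambda>j. Y j \<omega> - Y' j \<omega>) n)) \<partial>P) \<le> ennreal (1 / a) * \<kappa>"
    using LIMSEQ_le_const[of _ _ "\<integral>\<^sup>+\<omega>. ennreal (f (running_max (\<lambda>j. Y j \<omega> - Y' j \<omega>) n)) \<partial>P"] bound by auto
  have "emeasure P {\<omega>\<in>space P. 3 * a \<le> running_max (\<lambda>j. Y j \<omega> - Y' j \<omega>) n}
      = (\<integral>\<^sup>+\<omega>. indicator {\<omega>\<in>space P. 3 * a \<le> running_max (\<lambda>j. Y j \<omega> - Y' j \<omega>) n} \<omega> \<partial>P)"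
    by (rule nn_integral_indicator[symmetric]) measurable
  also have "\<dots> \<le> (\<integral>\<^sup>+\<omega>. ennreal (f (running_max (\<lambda>j. Y j \<omega> - Y' j \<omega>) n)) \<partial>P)"
  proof (rule nn_integral_mono)
    fix \<omega>
    show "indicator {\<omega>\<in>space P. 3 * a \<le> running_max (\<lambda>j. Y j \<omega> - Y' j \<omega>) n} \<omega>
        \<le> ennreal (f (running_max (\<lambda>j. Y j \<omega> - Y' j \<omega>) n))"
      using a by (auto simp: f_def indicator_def field_simps)
  qed
  also note lim
  finally show ?thesis by (simp add: \<kappa>_def)
qed

text \<open>For x > a one has 1 \<le> (x / a) powr (\<beta> - 1).\<close>

lemma excess_le:
  fixes x a \<beta> :: real
  assumes "0 < a" "1 < \<beta>" "0 \<le> x"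
  shows "max 0 (x - a) \<le> a powr (1 - \<beta>) * x powr \<beta>"
proof (cases "x \<le> a")
  case False
  then have "a powr (\<beta> - 1) \<le> x powr (\<beta> - 1)" using assms by (intro powr_mono2) auto
  then have "a powr (1 - \<beta>) * a powr (\<beta> - 1) * x \<le> a powr (1 - \<beta>) * x powr (\<beta> - 1) * x"
    using assms by (intro mult_right_mono mult_left_mono) auto
  moreover have "a powr (1 - \<beta>) * a powr (\<beta> - 1) = 1" using assms by (simp add: powr_add[symmetric])
  moreover have "x powr (\<beta> - 1) * x = x powr \<beta>" using powr_mult_self[of x \<beta>] assms by (simp add: mult.commute)
  ultimately show ?thesis using False assms by (simp add: mult.assoc)
qed (use assms in auto)

text \<open>The excess over a is at most a powr (1 - \<beta>) times the \<beta>-th power, so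
  \<open>maximal_limit\<close> supplies the tail a powr - \<beta> * L powr \<beta> for
  \<open>moment_of_tail\<close>. The bound depends neither on the number nor on the position of the
  times, which later allows the grid to be refined.\<close>

lemma conditional_moment:
  assumes Y: "\<And>j. j \<le> n \<Longrightarrow> is_cond_E T \<P> E (s j) \<xi> (Y j)"
    and Y': "\<And>j. j \<le> n \<Longrightarrow> is_cond_E T \<P> E (s j) \<xi>' (Y' j)"
    and s: "\<And>j. j \<le> n \<Longrightarrow> s j \<in> {0..T}" and P: "P \<in> \<P>"
    and \<alpha>: "1 < \<alpha>" "\<alpha> < \<beta>" and L: "0 < L" "Lp_dist \<P> \<beta> \<xi> \<xi>' \<le> ennreal (L powr \<beta>)"
  shows "(\<integral>\<^sup>+\<omega>. ennreal (running_max (\<lambda>j. Y j \<omega> - Y' j \<omega>) n powr \<alpha>) \<partial>P) \<le> ennreal (tail_const \<alpha> \<beta> * L powr \<alpha>)"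
proof (rule moment_of_tail[OF P_prob[OF P] _ \<alpha>(2) L(1)])
  have Ym: "Y j \<in> borel_measurable P" "Y' j \<in> borel_measurable P" if "j \<le> n" for j
    using L_G_P_measurable[OF P] Y[OF that] Y'[OF that] unfolding is_cond_E_def by auto
  show "(\<lambda>\<omega>. running_max (\<lambda>j. Y j \<omega> - Y' j \<omega>) n) \<in> borel_measurable P"
    using Ym
  proof (induction n)
    case (Suc n)
    then have [measurable]: "(\<lambda>\<omega>. running_max (\<lambda>j. Y j \<omega> - Y' j \<omega>) n) \<in> borel_measurable P"
      "Y (Suc n) \<in> borel_measurable P" "Y' (Suc n) \<in> borel_measurable P" by auto
    show ?case by simp
  qed simp
  fix a :: real assume a: "0 < a"
  have L1: "\<xi> \<in> L_G T \<P> 1" "\<xi>' \<in> L_G T \<P> 1" using Y[of 0] Y'[of 0] unfolding is_cond_E_def by auto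
  have "(SUP Q\<in>\<P>. \<integral>\<^sup>+\<omega>. ennreal (max 0 (\<bar>\<xi> \<omega> - \<xi>' \<omega>\<bar> - a)) \<partial>Q) \<le> ennreal (a powr (1 - \<beta>)) * ennreal (L powr \<beta>)"
  proof (rule SUP_least)
    fix Q assume Q: "Q \<in> \<P>"
    have [measurable]: "\<xi> \<in> borel_measurable Q" "\<xi>' \<in> borel_measurable Q"
      using L_G_P_measurable[OF Q] L1 by auto
    have "(\<integral>\<^sup>+\<omega>. ennreal (max 0 (\<bar>\<xi> \<omega> - \<xi>' \<omega>\<bar> - a)) \<partial>Q)
        \<le> (\<integral>\<^sup>+\<omega>. ennreal (a powr (1 - \<beta>)) * ennreal (\<bar>\<xi> \<omega> - \<xi>' \<omega>\<bar> powr \<beta>) \<partial>Q)"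
    proof (rule nn_integral_mono)
      fix \<omega>
      have "ennreal (max 0 (\<bar>\<xi> \<omega> - \<xi>' \<omega>\<bar> - a)) \<le> ennreal (a powr (1 - \<beta>) * \<bar>\<xi> \<omega> - \<xi>' \<omega>\<bar> powr \<beta>)"
        using a \<alpha> by (intro ennreal_leI excess_le) auto
      then show "ennreal (max 0 (\<bar>\<xi> \<omega> - \<xi>' \<omega>\<bar> - a))
          \<le> ennreal (a powr (1 - \<beta>)) * ennreal (\<bar>\<xi> \<omega> - \<xi>' \<omega>\<bar> powr \<beta>)"
        by (simp add: ennreal_mult')
    qed
    also have "\<dots> = ennreal (a powr (1 - \<beta>)) * (\<integral>\<^sup>+\<omega>. ennreal (\<bar>\<xi> \<omega> - \<xi>' \<omega>\<bar> powr \<beta>) \<partial>Q)"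
      by (rule nn_integral_cmult) measurable
    also have "\<dots> \<le> ennreal (a powr (1 - \<beta>)) * ennreal (L powr \<beta>)"
      by (intro mult_left_mono order_trans[OF Lp_dist_ge[OF Q] L(2)]) simp
    finally show "(\<integral>\<^sup>+\<omega>. ennreal (max 0 (\<bar>\<xi> \<omega> - \<xi>' \<omega>\<bar> - a)) \<partial>Q) \<le> ennreal (a powr (1 - \<beta>)) * ennreal (L powr \<beta>)" .
  qed
  then have "emeasure P {\<omega>\<in>space P. 3 * a \<le> running_max (\<lambda>j. Y j \<omega> - Y' j \<omega>) n}
      \<le> ennreal (1 / a) * (ennreal (a powr (1 - \<beta>)) * ennreal (L powr \<beta>))"
    by (intro order_trans[OF maximal_limit[OF Y Y' s a P]] mult_left_mono) auto
  also have "\<dots> = ennreal (1 / a * (a powr (1 - \<beta>) * L powr \<beta>))"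
    using a by (simp add: ennreal_mult'[symmetric] del: ennreal_1)
  also have "1 / a * (a powr (1 - \<beta>) * L powr \<beta>) = a powr - \<beta> * L powr \<beta>"
    using a by (simp add: powr_diff powr_minus field_simps)
  finally show "emeasure P {\<omega>\<in>space P. 3 * a \<le> running_max (\<lambda>j. Y j \<omega> - Y' j \<omega>) n} \<le> ennreal (a powr - \<beta> * L powr \<beta>)" .
qed (use \<alpha> in auto)

section \<open>The extended expectation as an upper expectation\<close>

text \<open>The description in \<open>ext_E\<close> has a meaning once all approximating sequences
  share one limit. The limit is the supremum of the means of X over the representing measures: a
  cylinder variable attains its own supremum, and under each measure the two means differ by at most
  the distance.\<close>

lemma ext_E_nonneg:
  assumes X: "X \<in> L_G T \<P> 1" and X0: "\<And>\<omega>. 0 \<le> X \<omega>"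
  shows "Lp_dist \<P> 1 X (\<lambda>_. 0) < \<infinity>" "ext_E T \<P> E X = enn2real (Lp_dist \<P> 1 X (\<lambda>_. 0))"
proof -
  define R where "R = Lp_dist \<P> 1 X (\<lambda>_. 0)"
  define r where "r = enn2real R"
  obtain X0n where X0n: "\<And>n. X0n n \<in> H0 T" "(\<lambda>n. Lp_dist \<P> 1 (X0n n) X) \<longlonglongrightarrow> 0"
    using X by (rule L_GE) blast
  note m = L_G_P_measurable[OF _ X]
  have fin: "R \<le> ennreal (E (\<lambda>\<omega>. \<bar>Z \<omega>\<bar>)) + Lp_dist \<P> 1 Z X" if Z: "Z \<in> H0 T" for Z
    unfolding R_def Lp_dist_def[of _ _ X]
  proof (rule SUP_least)
    fix P assume P: "P \<in> \<P>"
    note [measurable] = m[OF P] H0_P_measurable[OF P Z]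
    have "(\<integral>\<^sup>+\<omega>. ennreal (\<bar>X \<omega> - 0\<bar> powr 1) \<partial>P) \<le> (\<integral>\<^sup>+\<omega>. ennreal \<bar>Z \<omega>\<bar> + ennreal \<bar>Z \<omega> - X \<omega>\<bar> \<partial>P)"
      by (intro nn_integral_mono) (auto simp: ennreal_plus[symmetric] intro!: ennreal_leI simp del: ennreal_plus)
    also have "\<dots> = (\<integral>\<^sup>+\<omega>. ennreal \<bar>Z \<omega>\<bar> \<partial>P) + (\<integral>\<^sup>+\<omega>. ennreal \<bar>Z \<omega> - X \<omega>\<bar> \<partial>P)"
      by (rule nn_integral_add) measurable
    also have "\<dots> \<le> ennreal (E (\<lambda>\<omega>. \<bar>Z \<omega>\<bar>)) + Lp_dist \<P> 1 Z X"
      by (intro add_mono L1_dist_ge[OF P] H0_nn_integral_le[OF P H0_abs[OF Z]]) simp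
    finally show "(\<integral>\<^sup>+\<omega>. ennreal (\<bar>X \<omega> - 0\<bar> powr 1) \<partial>P) \<le> ennreal (E (\<lambda>\<omega>. \<bar>Z \<omega>\<bar>)) + Lp_dist \<P> 1 Z X" .
  qed
  have ev: "eventually (\<lambda>n. Lp_dist \<P> 1 (Xn n) X < 1) sequentially"
    if "(\<lambda>n. Lp_dist \<P> 1 (Xn n) X) \<longlonglongrightarrow> 0" for Xn
    using order_tendstoD(2)[OF that, of 1] by simp
  obtain n0 where "Lp_dist \<P> 1 (X0n n0) X < 1" using ev[OF X0n(2)] by (auto simp: eventually_sequentially)
  then have "ennreal (E (\<lambda>\<omega>. \<bar>X0n n0 \<omega>\<bar>)) + Lp_dist \<P> 1 (X0n n0) X < \<infinity>"
    by (simp add: order.strict_trans[OF _ ennreal_one_less_top])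
  then have Rfin: "R < \<infinity>" using fin[OF X0n(1)[of n0]] by (rule order.strict_trans1[rotated])
  then show "Lp_dist \<P> 1 X (\<lambda>_. 0) < \<infinity>" by (simp add: R_def)
  have Rr: "R = ennreal r" using Rfin by (simp add: r_def)
  have r0: "0 \<le> r" by (simp add: r_def)
  have PX: "(\<integral>\<^sup>+\<omega>. ennreal (X \<omega>) \<partial>P) \<le> R" if "P \<in> \<P>" for P
    using L1_dist_ge[OF that, of X "\<lambda>_. 0"] X0 by (simp add: R_def)
  have iX: "integrable P X" if P: "P \<in> \<P>" for P
    using PX[OF P] Rfin X0 m[OF P] by (intro integrableI_nonneg) (auto intro: order.strict_trans1)
  have IX: "(\<integral>\<omega>. X \<omega> \<partial>P) \<le> r" if P: "P \<in> \<P>" for P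
    using PX[OF P] nn_integral_eq_integral[OF iX[OF P]] X0 r0 by (simp add: Rr)
  have close: "\<bar>E Z - r\<bar> \<le> enn2real (Lp_dist \<P> 1 Z X)" if Z: "Z \<in> H0 T" and d1: "Lp_dist \<P> 1 Z X < 1" for Z
  proof -
    define d where "d = enn2real (Lp_dist \<P> 1 Z X)"
    have dfin: "Lp_dist \<P> 1 Z X = ennreal d" using d1 order.strict_trans[OF d1 ennreal_one_less_top] by (simp add: d_def)
    have d0: "0 \<le> d" by (simp add: d_def)
    have diff: "\<bar>(\<integral>\<omega>. Z \<omega> \<partial>P) - (\<integral>\<omega>. X \<omega> \<partial>P)\<bar> \<le> d" if P: "P \<in> \<P>" for P
    proof -
      note iZ = H0_integrable[OF P Z]
      have "ennreal (\<integral>\<omega>. \<bar>Z \<omega> - X \<omega>\<bar> \<partial>P) \<le> ennreal d"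
        using L1_dist_ge[OF P, of Z X] nn_integral_eq_integral[of P "\<lambda>\<omega>. \<bar>Z \<omega> - X \<omega>\<bar>"] iZ iX[OF P] by (simp add: dfin)
      then have "(\<integral>\<omega>. \<bar>Z \<omega> - X \<omega>\<bar> \<partial>P) \<le> d" using d0 by simp
      moreover have "\<bar>(\<integral>\<omega>. Z \<omega> - X \<omega> \<partial>P)\<bar> \<le> (\<integral>\<omega>. \<bar>Z \<omega> - X \<omega>\<bar> \<partial>P)" by (rule integral_abs_bound)
      moreover have "(\<integral>\<omega>. Z \<omega> - X \<omega> \<partial>P) = (\<integral>\<omega>. Z \<omega> \<partial>P) - (\<integral>\<omega>. X \<omega> \<partial>P)"
        by (rule Bochner_Integration.integral_diff[OF iZ iX[OF P]])
      ultimately show ?thesis by simp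
    qed
    obtain Q where Q: "Q \<in> \<P>" "(\<integral>\<omega>. Z \<omega> \<partial>Q) = E Z" using H0_attained[OF Z] by blast
    have up: "E Z \<le> r + d" using diff[OF Q(1)] IX[OF Q(1)] Q(2) by simp
    have le: "(\<integral>\<omega>. X \<omega> \<partial>P) \<le> E Z + d" if P: "P \<in> \<P>" for P
      using diff[OF P] H0_integral_le[OF P Z] by simp
    have "0 \<le> (\<integral>\<omega>. X \<omega> \<partial>Q)" using X0 by simp
    then have pos: "0 \<le> E Z + d" using le[OF Q(1)] by simp
    have "R \<le> ennreal (E Z + d)"
      unfolding R_def Lp_dist_def
      by (rule SUP_least) (use le nn_integral_eq_integral[OF iX] X0 in \<open>auto intro!: ennreal_leI\<close>)
    then have "r \<le> E Z + d" using pos r0 by (simp add: Rr)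
    with up show ?thesis by (simp add: d_def)
  qed
  have conv: "(\<lambda>n. E (Xn n)) \<longlonglongrightarrow> r"
    if Xn: "\<And>n. Xn n \<in> H0 T" and lim: "(\<lambda>n. Lp_dist \<P> 1 (Xn n) X) \<longlonglongrightarrow> 0" for Xn
  proof -
    have "(\<lambda>n. enn2real (Lp_dist \<P> 1 (Xn n) X)) \<longlonglongrightarrow> 0"
      by (rule tendsto_enn2real) (use lim in simp_all)
    moreover have "\<forall>\<^sub>F n in sequentially. norm (E (Xn n) - r) \<le> enn2real (Lp_dist \<P> 1 (Xn n) X)"
      using ev[OF lim] by eventually_elim (use close[OF Xn] in auto)
    ultimately have "(\<lambda>n. E (Xn n) - r) \<longlonglongrightarrow> 0"
      by (rule Lim_null_comparison[rotated])
    then show ?thesis by (simp add: LIM_zero_iff)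
  qed
  show "ext_E T \<P> E X = enn2real (Lp_dist \<P> 1 X (\<lambda>_. 0))"
    unfolding ext_E_def R_def[symmetric] r_def[symmetric]
  proof (rule the_equality)
    fix r' assume "\<forall>Xn. (\<forall>n. Xn n \<in> H0 T) \<and> (\<lambda>n. Lp_dist \<P> 1 (Xn n) X) \<longlonglongrightarrow> 0 \<longrightarrow> (\<lambda>n. E (Xn n)) \<longlonglongrightarrow> r'"
    then have "(\<lambda>n. E (X0n n)) \<longlonglongrightarrow> r'" using X0n by blast
    then show "r' = r" using conv[OF X0n] LIMSEQ_unique by blast
  qed (use conv in blast)
qed

text \<open>Membership of \<bar>X\<bar> powr p in the completion gives the norm its meaning;
  \<open>abs_powr_L_G_moment\<close> and \<open>abs_powr_L_G_closure\<close> provide it.\<close>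

lemma G_norm_eq:
  assumes "(\<lambda>\<omega>. \<bar>X \<omega>\<bar> powr p) \<in> L_G T \<P> 1"
  shows "Lp_dist \<P> p X (\<lambda>_. 0) < \<infinity>" "G_norm T \<P> E p X = enn2real (Lp_dist \<P> p X (\<lambda>_. 0)) powr (1 / p)"
proof -
  have eq: "Lp_dist \<P> 1 (\<lambda>\<omega>. \<bar>X \<omega>\<bar> powr p) (\<lambda>_. 0) = Lp_dist \<P> p X (\<lambda>_. 0)"
    by (simp add: Lp_dist_def)
  show "Lp_dist \<P> p X (\<lambda>_. 0) < \<infinity>" using ext_E_nonneg(1)[OF assms] by (simp add: eq)
  show "G_norm T \<P> E p X = enn2real (Lp_dist \<P> p X (\<lambda>_. 0)) powr (1 / p)"
    unfolding G_norm_def using ext_E_nonneg(2)[OF assms] by (simp add: eq)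
qed

end

section \<open>Closure properties of the completed spaces\<close>

lemma ennreal_squeeze_zero:
  fixes f g :: "nat \<Rightarrow> ennreal"
  assumes "g \<longlonglongrightarrow> 0" "\<And>n. f n \<le> g n"
  shows "f \<longlonglongrightarrow> 0"
  by (rule tendsto_sandwich[of "\<lambda>_. 0" f sequentially g 0]) (use assms in auto)

context G_expectation
begin

lemma L_GI:
  assumes "X \<in> borel_measurable (Borel_Omega T)" "\<And>n. Xn n \<in> H0 T"
    "(\<lambda>n. Lp_dist \<P> p (Xn n) X) \<longlonglongrightarrow> 0"
  shows "X \<in> L_G T \<P> p"
  using assms unfolding L_G_def by blast

lemma H0_L_G: "X \<in> H0 T \<Longrightarrow> X \<in> L_G T \<P> p"
  by (rule L_GI[of _ "\<lambda>_. X"]) (auto simp: Lp_dist_def P_nonempty intro: H0_measurable)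

lemma L_G_cong:
  assumes "X \<in> L_G T \<P> p" "\<And>\<omega>. \<omega> \<in> Omega T \<Longrightarrow> X \<omega> = Y \<omega>"
  shows "Y \<in> L_G T \<P> p"
proof -
  obtain Xn where Xn: "X \<in> borel_measurable (Borel_Omega T)" "\<And>n. Xn n \<in> H0 T"
    "(\<lambda>n. Lp_dist \<P> p (Xn n) X) \<longlonglongrightarrow> 0"
    using assms(1) by (rule L_GE) blast
  have "Lp_dist \<P> p (Xn n) Y = Lp_dist \<P> p (Xn n) X" for n
    unfolding Lp_dist_def
    by (intro SUP_cong refl nn_integral_cong) (use assms(2) P_space in auto)
  moreover have "Y \<in> borel_measurable (Borel_Omega T)"
    using measurable_cong[of "Borel_Omega T" X Y] Xn(1) assms(2) by (simp add: space_restrict_space)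
  ultimately show ?thesis using Xn by (intro L_GI[of Y Xn]) auto
qed

lemma Lp_dist_diff:
  assumes p: "0 \<le> p" and m: "\<And>P. P \<in> \<P> \<Longrightarrow> X \<in> borel_measurable P" "\<And>P. P \<in> \<P> \<Longrightarrow> Y \<in> borel_measurable P"
    "\<And>P. P \<in> \<P> \<Longrightarrow> X' \<in> borel_measurable P" "\<And>P. P \<in> \<P> \<Longrightarrow> Y' \<in> borel_measurable P"
  shows "Lp_dist \<P> p (\<lambda>\<omega>. X \<omega> - X' \<omega>) (\<lambda>\<omega>. Y \<omega> - Y' \<omega>)
    \<le> ennreal (2 powr p) * (Lp_dist \<P> p X Y + Lp_dist \<P> p X' Y')"
  unfolding Lp_dist_def[of _ _ "\<lambda>\<omega>. X \<omega> - X' \<omega>"]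
proof (rule SUP_least)
  fix P assume P: "P \<in> \<P>"
  note [measurable] = m[OF P]
  have "(\<integral>\<^sup>+\<omega>. ennreal (\<bar>(X \<omega> - X' \<omega>) - (Y \<omega> - Y' \<omega>)\<bar> powr p) \<partial>P)
      \<le> (\<integral>\<^sup>+\<omega>. ennreal (2 powr p) * (ennreal (\<bar>X \<omega> - Y \<omega>\<bar> powr p) + ennreal (\<bar>X' \<omega> - Y' \<omega>\<bar> powr p)) \<partial>P)"
  proof (rule nn_integral_mono)
    fix \<omega>
    have "\<bar>(X \<omega> - X' \<omega>) - (Y \<omega> - Y' \<omega>)\<bar> powr p \<le> (\<bar>X \<omega> - Y \<omega>\<bar> + \<bar>X' \<omega> - Y' \<omega>\<bar>) powr p"
      using p by (intro powr_mono2) auto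
    also have "\<dots> \<le> 2 powr p * (\<bar>X \<omega> - Y \<omega>\<bar> powr p + \<bar>X' \<omega> - Y' \<omega>\<bar> powr p)"
      using p by (intro powr_add_le) auto
    finally have "ennreal (\<bar>(X \<omega> - X' \<omega>) - (Y \<omega> - Y' \<omega>)\<bar> powr p)
        \<le> ennreal (2 powr p * (\<bar>X \<omega> - Y \<omega>\<bar> powr p + \<bar>X' \<omega> - Y' \<omega>\<bar> powr p))" by (rule ennreal_leI)
    then show "ennreal (\<bar>(X \<omega> - X' \<omega>) - (Y \<omega> - Y' \<omega>)\<bar> powr p)
        \<le> ennreal (2 powr p) * (ennreal (\<bar>X \<omega> - Y \<omega>\<bar> powr p) + ennreal (\<bar>X' \<omega> - Y' \<omega>\<bar> powr p))"
      by (simp add: ennreal_mult')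
  qed
  also have "\<dots> = ennreal (2 powr p) * ((\<integral>\<^sup>+\<omega>. ennreal (\<bar>X \<omega> - Y \<omega>\<bar> powr p) \<partial>P) + (\<integral>\<^sup>+\<omega>. ennreal (\<bar>X' \<omega> - Y' \<omega>\<bar> powr p) \<partial>P))"
    by (subst nn_integral_cmult) (auto simp: nn_integral_add)
  also have "\<dots> \<le> ennreal (2 powr p) * (Lp_dist \<P> p X Y + Lp_dist \<P> p X' Y')"
    using Lp_dist_ge[OF P] by (intro mult_left_mono add_mono) auto
  finally show "(\<integral>\<^sup>+\<omega>. ennreal (\<bar>(X \<omega> - X' \<omega>) - (Y \<omega> - Y' \<omega>)\<bar> powr p) \<partial>P)
      \<le> ennreal (2 powr p) * (Lp_dist \<P> p X Y + Lp_dist \<P> p X' Y')" .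
qed

lemma L_G_diff:
  assumes "0 \<le> p" "X \<in> L_G T \<P> p" "Y \<in> L_G T \<P> p"
  shows "(\<lambda>\<omega>. X \<omega> - Y \<omega>) \<in> L_G T \<P> p"
proof -
  obtain Xn where Xn: "X \<in> borel_measurable (Borel_Omega T)" "\<And>n. Xn n \<in> H0 T"
    "(\<lambda>n. Lp_dist \<P> p (Xn n) X) \<longlonglongrightarrow> 0"
    using assms(2) by (rule L_GE) blast
  obtain Yn where Yn: "Y \<in> borel_measurable (Borel_Omega T)" "\<And>n. Yn n \<in> H0 T"
    "(\<lambda>n. Lp_dist \<P> p (Yn n) Y) \<longlonglongrightarrow> 0"
    using assms(3) by (rule L_GE) blast
  have lim: "(\<lambda>n. ennreal (2 powr p) * (Lp_dist \<P> p (Xn n) X + Lp_dist \<P> p (Yn n) Y)) \<longlonglongrightarrow> ennreal (2 powr p) * (0 + 0)"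
    by (intro ennreal_tendsto_cmult tendsto_add Xn(3) Yn(3)) simp
  have le: "Lp_dist \<P> p (\<lambda>\<omega>. Xn n \<omega> - Yn n \<omega>) (\<lambda>\<omega>. X \<omega> - Y \<omega>)
      \<le> ennreal (2 powr p) * (Lp_dist \<P> p (Xn n) X + Lp_dist \<P> p (Yn n) Y)" for n
    using H0_P_measurable Xn(2) Yn(2) L_G_P_measurable assms by (intro Lp_dist_diff) auto
  show ?thesis
  proof (rule L_GI[of _ "\<lambda>n \<omega>. Xn n \<omega> - Yn n \<omega>"])
    show "(\<lambda>n. Lp_dist \<P> p (\<lambda>\<omega>. Xn n \<omega> - Yn n \<omega>) (\<lambda>\<omega>. X \<omega> - Y \<omega>)) \<longlonglongrightarrow> 0"
      by (rule ennreal_squeeze_zero[OF _ le]) (use lim in simp)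
    show "(\<lambda>\<omega>. X \<omega> - Y \<omega>) \<in> borel_measurable (Borel_Omega T)" using Xn(1) Yn(1) by measurable
  qed (intro H0_diff Xn Yn)
qed

lemma truncated_powr_lipschitz:
  fixes p m x y :: real
  assumes "1 \<le> p" "0 < m"
  shows "\<bar>min (\<bar>x\<bar>) m powr p - min (\<bar>y\<bar>) m powr p\<bar> \<le> p * m powr (p - 1) * \<bar>x - y\<bar>"
proof -
  have one: "min (\<bar>x\<bar>) m powr p - min (\<bar>y\<bar>) m powr p \<le> p * m powr (p - 1) * \<bar>x - y\<bar>" for x y :: real
  proof (cases "min (\<bar>y\<bar>) m \<le> min (\<bar>x\<bar>) m")
    case True
    have "min (\<bar>x\<bar>) m powr p - min (\<bar>y\<bar>) m powr p \<le> p * min (\<bar>x\<bar>) m powr (p - 1) * (min (\<bar>x\<bar>) m - min (\<bar>y\<bar>) m)"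
      using assms by (intro powr_diff_le) auto
    also have "\<dots> \<le> p * m powr (p - 1) * \<bar>x - y\<bar>"
      using assms True by (intro mult_mono powr_mono2) auto
    finally show ?thesis .
  next
    case False
    then have "min (\<bar>x\<bar>) m powr p \<le> min (\<bar>y\<bar>) m powr p" using assms by (intro powr_mono2) auto
    then show ?thesis using assms by (smt (verit) mult_nonneg_nonneg powr_ge_zero)
  qed
  show ?thesis unfolding abs_le_iff using one[of x y] one[of y x] by (simp add: abs_minus_commute)
qed

text \<open>Truncated at m, the power is a Lipschitz function of X and inherits its cylinder
  approximations; \<open>ui\<close> makes the part cut off small uniformly over the representing
  measures.\<close>

lemma abs_powr_L_G:
  assumes X: "X \<in> L_G T \<P> 1" and p: "1 \<le> p"
    and ui: "\<And>e. 0 < e \<Longrightarrow> \<exists>m>0. \<forall>P\<in>\<P>. (\<integral>\<^sup>+\<omega>. ennreal (\<bar>X \<omega>\<bar> powr p - min (\<bar>X \<omega>\<bar>) m powr p) \<partial>P) \<le> ennreal e"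
  shows "(\<lambda>\<omega>. \<bar>X \<omega>\<bar> powr p) \<in> L_G T \<P> 1"
proof -
  obtain Xn where Xn: "X \<in> borel_measurable (Borel_Omega T)" "\<And>n. Xn n \<in> H0 T"
    "(\<lambda>n. Lp_dist \<P> 1 (Xn n) X) \<longlonglongrightarrow> 0"
    using X by (rule L_GE) blast
  have "\<exists>Z. Z \<in> H0 T \<and> Lp_dist \<P> 1 Z (\<lambda>\<omega>. \<bar>X \<omega>\<bar> powr p) \<le> ennreal (2 * (1 / Suc k))" for k
  proof -
    define e where "e = 1 / real (Suc k)"
    have e: "0 < e" by (simp add: e_def)
    obtain m where m: "0 < m" "\<And>P. P \<in> \<P> \<Longrightarrow> (\<integral>\<^sup>+\<omega>. ennreal (\<bar>X \<omega>\<bar> powr p - min (\<bar>X \<omega>\<bar>) m powr p) \<partial>P) \<le> ennreal e"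
      using ui[OF e] by blast
    define l where "l = p * m powr (p - 1)"
    have l: "0 < l" using p m by (simp add: l_def)
    have "\<forall>\<^sub>F n in sequentially. Lp_dist \<P> 1 (Xn n) X < ennreal (e / l)"
      using e l by (intro order_tendstoD(2)[OF Xn(3)]) simp
    then obtain i where i: "Lp_dist \<P> 1 (Xn i) X < ennreal (e / l)" by (auto simp: eventually_sequentially)
    define f where "f x = min (\<bar>x\<bar>) m powr p" for x :: real
    have f_lip: "\<bar>f x - f y\<bar> \<le> l * \<bar>x - y\<bar>" for x y
      unfolding f_def l_def by (rule truncated_powr_lipschitz[OF p m(1)])
    define Z where "Z \<omega> = f (Xn i \<omega>)" for \<omega>
    have "Z \<in> H0 T" unfolding Z_def by (rule H0_comp[OF poly_lipschitz_lipschitz[OF f_lip] Xn(2)])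
    moreover have "Lp_dist \<P> 1 Z (\<lambda>\<omega>. \<bar>X \<omega>\<bar> powr p) \<le> ennreal (2 * e)"
      unfolding Lp_dist_def
    proof (rule SUP_least)
      fix P assume P: "P \<in> \<P>"
      note [measurable] = L_G_P_measurable[OF P X] H0_P_measurable[OF P Xn(2)[of i]]
      have "(\<integral>\<^sup>+\<omega>. ennreal (\<bar>Z \<omega> - \<bar>X \<omega>\<bar> powr p\<bar> powr 1) \<partial>P)
          \<le> (\<integral>\<^sup>+\<omega>. ennreal l * ennreal \<bar>Xn i \<omega> - X \<omega>\<bar> + ennreal (\<bar>X \<omega>\<bar> powr p - min (\<bar>X \<omega>\<bar>) m powr p) \<partial>P)"
      proof (rule nn_integral_mono)
        fix \<omega>
        have ge: "0 \<le> \<bar>X \<omega>\<bar> powr p - f (X \<omega>)"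
          unfolding f_def using p m by (simp add: powr_mono2)
        have "\<bar>Z \<omega> - \<bar>X \<omega>\<bar> powr p\<bar> \<le> l * \<bar>Xn i \<omega> - X \<omega>\<bar> + (\<bar>X \<omega>\<bar> powr p - f (X \<omega>))"
          using f_lip[of "Xn i \<omega>" "X \<omega>"] ge by (simp add: Z_def)
        then have "ennreal \<bar>Z \<omega> - \<bar>X \<omega>\<bar> powr p\<bar> \<le> ennreal (l * \<bar>Xn i \<omega> - X \<omega>\<bar> + (\<bar>X \<omega>\<bar> powr p - f (X \<omega>)))"
          by (rule ennreal_leI)
        also have "\<dots> = ennreal (l * \<bar>Xn i \<omega> - X \<omega>\<bar>) + ennreal (\<bar>X \<omega>\<bar> powr p - f (X \<omega>))"
          using l ge by (intro ennreal_plus) auto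
        also have "ennreal (l * \<bar>Xn i \<omega> - X \<omega>\<bar>) = ennreal l * ennreal \<bar>Xn i \<omega> - X \<omega>\<bar>"
          using l by (intro ennreal_mult) auto
        finally show "ennreal (\<bar>Z \<omega> - \<bar>X \<omega>\<bar> powr p\<bar> powr 1)
          \<le> ennreal l * ennreal \<bar>Xn i \<omega> - X \<omega>\<bar> + ennreal (\<bar>X \<omega>\<bar> powr p - min (\<bar>X \<omega>\<bar>) m powr p)"
          by (simp add: f_def)
      qed
      also have "\<dots> = ennreal l * (\<integral>\<^sup>+\<omega>. ennreal \<bar>Xn i \<omega> - X \<omega>\<bar> \<partial>P)
          + (\<integral>\<^sup>+\<omega>. ennreal (\<bar>X \<omega>\<bar> powr p - min (\<bar>X \<omega>\<bar>) m powr p) \<partial>P)"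
        by (subst nn_integral_add) (auto simp: nn_integral_cmult)
      also have "\<dots> \<le> ennreal l * ennreal (e / l) + ennreal e"
        using L1_dist_ge[OF P, of "Xn i" X] i m(2)[OF P] by (intro add_mono mult_left_mono) auto
      also have "\<dots> = ennreal (2 * e)"
        using l e by (simp add: ennreal_mult[symmetric] ennreal_plus[symmetric] del: ennreal_plus)
      finally show "(\<integral>\<^sup>+\<omega>. ennreal (\<bar>Z \<omega> - \<bar>X \<omega>\<bar> powr p\<bar> powr 1) \<partial>P) \<le> ennreal (2 * e)" .
    qed
    ultimately show ?thesis unfolding e_def by blast
  qed
  then obtain Z where Z: "\<And>k. Z k \<in> H0 T" "\<And>k. Lp_dist \<P> 1 (Z k) (\<lambda>\<omega>. \<bar>X \<omega>\<bar> powr p) \<le> ennreal (2 * (1 / Suc k))"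
    by metis
  show ?thesis
  proof (rule L_GI[of _ Z])
    have "(\<lambda>k. 2 * (1 / real (Suc k))) \<longlonglongrightarrow> 2 * 0"
      by (intro tendsto_mult tendsto_const LIMSEQ_Suc[OF lim_1_over_n])
    from tendsto_ennrealI[OF this] have "(\<lambda>k. ennreal (2 * (1 / real (Suc k)))) \<longlonglongrightarrow> 0" by simp
    then show "(\<lambda>k. Lp_dist \<P> 1 (Z k) (\<lambda>\<omega>. \<bar>X \<omega>\<bar> powr p)) \<longlonglongrightarrow> 0"
      by (rule ennreal_squeeze_zero[OF _ Z(2)])
    show "(\<lambda>\<omega>. \<bar>X \<omega>\<bar> powr p) \<in> borel_measurable (Borel_Omega T)" using Xn(1) by measurable
  qed (rule Z)
qed

lemma truncation_error:
  assumes "0 < m" "p < p'" "0 \<le> (x::real)" "0 < p"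
  shows "x powr p - min x m powr p \<le> m powr (p - p') * x powr p'"
proof (cases "x \<le> m")
  case False
  have "x powr p = x powr p' * x powr (p - p')" using False assms by (simp add: powr_add[symmetric])
  also have "\<dots> \<le> x powr p' * m powr (p - p')"
    using False assms by (intro mult_left_mono powr_mono2') auto
  finally have "x powr p \<le> m powr (p - p') * x powr p'" by (simp only: mult.commute)
  then show ?thesis using powr_ge_zero[of "min x m" p] by linarith
qed (use assms in auto)

lemma exists_truncation_level:
  assumes "p < p'" "0 \<le> c" "0 < (e::real)" "0 < m0"
  obtains m where "m0 \<le> m" "m powr (p - p') * c \<le> e"
proof -
  define m where "m = max m0 (((c + 1) / e) powr (1 / (p' - p)))"
  have pos: "0 < ((c + 1) / e) powr (1 / (p' - p))" using assms by simp
  have "m powr (p - p') \<le> (((c + 1) / e) powr (1 / (p' - p))) powr (p - p')"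
    unfolding m_def using pos assms by (intro powr_mono2') auto
  also have "\<dots> = ((c + 1) / e) powr - 1"
  proof -
    have "1 / (p' - p) * (p - p') = -1" using assms by (simp add: field_simps)
    then show ?thesis by (simp only: powr_powr)
  qed
  also have "\<dots> = e / (c + 1)" using assms by (simp add: powr_minus field_simps)
  finally have "m powr (p - p') * c \<le> e / (c + 1) * c" using assms by (intro mult_right_mono) auto
  also have "\<dots> \<le> e" using assms by (simp add: field_simps)
  finally show ?thesis using that[of m] by (simp add: m_def)
qed

text \<open>A finite moment of higher order gives uniform integrability. The lemma is applied to
  \<open>K T\<close> and to the difference of the martingale parts, with p' halfway between \<alpha>
  and \<beta>.\<close>

lemma abs_powr_L_G_moment:
  assumes X: "X \<in> L_G T \<P> 1" and p: "1 \<le> p" "p < p'" and fin: "Lp_dist \<P> p' X (\<lambda>_. 0) < \<infinity>"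
  shows "(\<lambda>\<omega>. \<bar>X \<omega>\<bar> powr p) \<in> L_G T \<P> 1"
proof (rule abs_powr_L_G[OF X p(1)])
  fix e :: real assume e: "0 < e"
  define c where "c = enn2real (Lp_dist \<P> p' X (\<lambda>_. 0))"
  have c: "Lp_dist \<P> p' X (\<lambda>_. 0) = ennreal c" "0 \<le> c" using fin by (auto simp: c_def)
  obtain m where m: "1 \<le> m" "m powr (p - p') * c \<le> e"
    using exists_truncation_level[OF p(2) c(2) e, of 1] by auto
  have "(\<integral>\<^sup>+\<omega>. ennreal (\<bar>X \<omega>\<bar> powr p - min (\<bar>X \<omega>\<bar>) m powr p) \<partial>P) \<le> ennreal e" if P: "P \<in> \<P>" for P
  proof -
    note [measurable] = L_G_P_measurable[OF P X]
    have "(\<integral>\<^sup>+\<omega>. ennreal (\<bar>X \<omega>\<bar> powr p - min (\<bar>X \<omega>\<bar>) m powr p) \<partial>P)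
        \<le> (\<integral>\<^sup>+\<omega>. ennreal (m powr (p - p')) * ennreal (\<bar>X \<omega>\<bar> powr p') \<partial>P)"
    proof (rule nn_integral_mono)
      fix \<omega>
      have "ennreal (\<bar>X \<omega>\<bar> powr p - min (\<bar>X \<omega>\<bar>) m powr p) \<le> ennreal (m powr (p - p') * \<bar>X \<omega>\<bar> powr p')"
        using m p by (intro ennreal_leI truncation_error) auto
      then show "ennreal (\<bar>X \<omega>\<bar> powr p - min (\<bar>X \<omega>\<bar>) m powr p) \<le> ennreal (m powr (p - p')) * ennreal (\<bar>X \<omega>\<bar> powr p')"
        by (simp add: ennreal_mult')
    qed
    also have "\<dots> = ennreal (m powr (p - p')) * (\<integral>\<^sup>+\<omega>. ennreal (\<bar>X \<omega>\<bar> powr p') \<partial>P)"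
      by (rule nn_integral_cmult) measurable
    also have "\<dots> \<le> ennreal (m powr (p - p')) * ennreal c"
      using Lp_dist_ge[OF P, of X "\<lambda>_. 0" p'] by (intro mult_left_mono) (auto simp: c(1))
    also have "\<dots> \<le> ennreal e" using m(2) c(2) by (simp add: ennreal_mult'[symmetric] ennreal_leI)
    finally show ?thesis .
  qed
  then show "\<exists>m>0. \<forall>P\<in>\<P>. (\<integral>\<^sup>+\<omega>. ennreal (\<bar>X \<omega>\<bar> powr p - min (\<bar>X \<omega>\<bar>) m powr p) \<partial>P) \<le> ennreal e"
    using m(1) by (intro exI[of _ m]) auto
qed

text \<open>Uniform integrability comes from a cylinder approximation, all of whose moments are
  finite: where \<bar>X\<bar> > 2 * l, either the approximation exceeds l in absolute value or
  \<bar>X\<bar> is at most twice the approximation error.\<close>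

lemma abs_powr_L_G_closure:
  assumes X1: "X \<in> L_G T \<P> 1" and p: "1 \<le> p" and X: "X \<in> L_G T \<P> p"
  shows "(\<lambda>\<omega>. \<bar>X \<omega>\<bar> powr p) \<in> L_G T \<P> 1"
proof (rule abs_powr_L_G[OF X1 p])
  fix e :: real assume e: "0 < e"
  obtain Xn where Xn: "\<And>n. Xn n \<in> H0 T" "(\<lambda>n. Lp_dist \<P> p (Xn n) X) \<longlonglongrightarrow> 0"
    using X by (rule L_GE) blast
  define b where "b = (2::real) powr p"
  have b: "0 < b" by (simp add: b_def)
  have "\<forall>\<^sub>F n in sequentially. Lp_dist \<P> p (Xn n) X < ennreal (e / (2 * b))"
    using e b by (intro order_tendstoD(2)[OF Xn(2)]) simp
  then obtain i where i: "Lp_dist \<P> p (Xn i) X < ennreal (e / (2 * b))" by (auto simp: eventually_sequentially)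
  \<comment> \<open>A natural exponent above p, so that \<bar>Xn i\<bar> ^ k is again a cylinder
    variable.\<close>
  obtain k :: nat where k: "p < real k" using reals_Archimedean2 by blast
  then obtain k' where k': "k = Suc k'" using p by (cases k) auto
  define Z where "Z \<omega> = \<bar>Xn i \<omega>\<bar> ^ k" for \<omega>
  have Z: "Z \<in> H0 T" unfolding Z_def k' by (rule H0_comp[OF poly_lipschitz_power H0_abs[OF Xn(1)]])
  have "0 \<le> E Z" using sublinear_mono[OF E H0_const Z, of 0] sublinear_const[OF E, of 0] T by (simp add: Z_def)
  then obtain l where l: "1 \<le> l" "l powr (p - real k) * E Z \<le> e / (2 * b)"
    using exists_truncation_level[OF k, of "E Z" "e / (2 * b)" 1] e b by auto
  define m where "m = 2 * l"
  have m: "0 < m" using l by (simp add: m_def)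
  have pt: "\<bar>x\<bar> powr p - min (\<bar>x\<bar>) m powr p \<le> b * (l powr (p - real k) * \<bar>y\<bar> ^ k + \<bar>y - x\<bar> powr p)" for x y :: real
  proof (cases "\<bar>x\<bar> \<le> m")
    case True
    then show ?thesis using b by (simp add: min_def)
  next
    case False
    have "\<bar>x\<bar> powr p \<le> b * (l powr (p - real k) * \<bar>y\<bar> ^ k + \<bar>y - x\<bar> powr p)"
    proof (cases "\<bar>y - x\<bar> \<le> \<bar>y\<bar>")
      case True
      then have xy: "\<bar>x\<bar> \<le> 2 * \<bar>y\<bar>" by linarith
      then have y: "l < \<bar>y\<bar>" using False by (simp add: m_def)
      have "\<bar>x\<bar> powr p \<le> (2 * \<bar>y\<bar>) powr p" using xy p by (intro powr_mono2) auto
      also have "\<dots> = b * \<bar>y\<bar> powr p" by (simp add: powr_mult b_def)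
      also have "\<bar>y\<bar> powr p = \<bar>y\<bar> powr (p - real k) * \<bar>y\<bar> ^ k"
        using y l by (simp add: powr_realpow[symmetric] powr_add[symmetric])
      also have "b * (\<bar>y\<bar> powr (p - real k) * \<bar>y\<bar> ^ k) \<le> b * (l powr (p - real k) * \<bar>y\<bar> ^ k)"
        using b y l k by (intro mult_left_mono mult_right_mono powr_mono2') auto
      also have "\<dots> \<le> b * (l powr (p - real k) * \<bar>y\<bar> ^ k + \<bar>y - x\<bar> powr p)" using b by simp
      finally show ?thesis .
    next
      case False
      then have "\<bar>x\<bar> \<le> 2 * \<bar>y - x\<bar>" by (auto simp: abs_if split: if_splits)
      then have "\<bar>x\<bar> powr p \<le> (2 * \<bar>y - x\<bar>) powr p" using p by (intro powr_mono2) auto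
      also have "\<dots> = b * \<bar>y - x\<bar> powr p" by (simp add: powr_mult b_def)
      also have "\<dots> \<le> b * (l powr (p - real k) * \<bar>y\<bar> ^ k + \<bar>y - x\<bar> powr p)" using b by simp
      finally show ?thesis .
    qed
    then show ?thesis using powr_ge_zero[of "min (\<bar>x\<bar>) m" p] by linarith
  qed
  have "(\<integral>\<^sup>+\<omega>. ennreal (\<bar>X \<omega>\<bar> powr p - min (\<bar>X \<omega>\<bar>) m powr p) \<partial>P) \<le> ennreal e" if P: "P \<in> \<P>" for P
  proof -
    note [measurable] = L_G_P_measurable[OF P X] H0_P_measurable[OF P Xn(1)[of i]] H0_P_measurable[OF P Z]
    have "(\<integral>\<^sup>+\<omega>. ennreal (\<bar>X \<omega>\<bar> powr p - min (\<bar>X \<omega>\<bar>) m powr p) \<partial>P)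
        \<le> (\<integral>\<^sup>+\<omega>. ennreal b * (ennreal (l powr (p - real k)) * ennreal (Z \<omega>) + ennreal (\<bar>Xn i \<omega> - X \<omega>\<bar> powr p)) \<partial>P)"
    proof (rule nn_integral_mono)
      fix \<omega>
      have "ennreal (\<bar>X \<omega>\<bar> powr p - min (\<bar>X \<omega>\<bar>) m powr p)
          \<le> ennreal (b * (l powr (p - real k) * Z \<omega> + \<bar>Xn i \<omega> - X \<omega>\<bar> powr p))"
        unfolding Z_def by (intro ennreal_leI pt)
      also have "\<dots> = ennreal b * (ennreal (l powr (p - real k)) * ennreal (Z \<omega>) + ennreal (\<bar>Xn i \<omega> - X \<omega>\<bar> powr p))"
        using b by (subst ennreal_mult', simp, subst ennreal_plus) (auto simp: Z_def ennreal_mult')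
      finally show "ennreal (\<bar>X \<omega>\<bar> powr p - min (\<bar>X \<omega>\<bar>) m powr p)
        \<le> ennreal b * (ennreal (l powr (p - real k)) * ennreal (Z \<omega>) + ennreal (\<bar>Xn i \<omega> - X \<omega>\<bar> powr p))" .
    qed
    also have "\<dots> = ennreal b * (ennreal (l powr (p - real k)) * (\<integral>\<^sup>+\<omega>. ennreal (Z \<omega>) \<partial>P)
        + (\<integral>\<^sup>+\<omega>. ennreal (\<bar>Xn i \<omega> - X \<omega>\<bar> powr p) \<partial>P))"
      by (subst nn_integral_cmult, measurable) (subst nn_integral_add, auto simp: nn_integral_cmult)
    also have "\<dots> \<le> ennreal b * (ennreal (l powr (p - real k)) * ennreal (E Z) + ennreal (e / (2 * b)))"
      using H0_nn_integral_le[OF P Z] Lp_dist_ge[OF P, of "Xn i" X p] i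
      by (intro mult_left_mono add_mono) (auto simp: Z_def)
    also have "\<dots> \<le> ennreal b * (ennreal (e / (2 * b)) + ennreal (e / (2 * b)))"
      using l(2) \<open>0 \<le> E Z\<close> by (intro mult_left_mono add_mono) (auto simp: ennreal_mult'[symmetric] intro!: ennreal_leI)
    also have "\<dots> = ennreal e"
      using b e by (simp add: ennreal_mult'[symmetric] ennreal_plus[symmetric] del: ennreal_plus)
    finally show ?thesis .
  qed
  then show "\<exists>m>0. \<forall>P\<in>\<P>. (\<integral>\<^sup>+\<omega>. ennreal (\<bar>X \<omega>\<bar> powr p - min (\<bar>X \<omega>\<bar>) m powr p) \<partial>P) \<le> ennreal e"
    using m by (intro exI[of _ m]) auto
qed

section \<open>The filtration of the canonical process\<close>

text \<open>A generator of the filtration that suits a Dynkin argument: it is stable under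
  intersection because the minimum of two cylinder variables is one, and its indicators are limits
  of cylinder variables with values in [0, 1].\<close>

definition positive_sets :: "real \<Rightarrow> 'd path set set" where
  "positive_sets s = (\<lambda>X. {\<omega>\<in>Omega T. 0 < X \<omega>}) ` H0 s"

lemma positive_setsI: "X \<in> H0 s \<Longrightarrow> {\<omega>\<in>Omega T. 0 < X \<omega>} \<in> positive_sets s"
  unfolding positive_sets_def by (rule imageI)

lemma positive_setsE:
  assumes "A \<in> positive_sets s"
  obtains X where "X \<in> H0 s" "A = {\<omega>\<in>Omega T. 0 < X \<omega>}"
  using assms unfolding positive_sets_def by (elim imageE)

lemma positive_sets_Pow: "positive_sets s \<subseteq> Pow (Omega T)"
  unfolding positive_sets_def by (rule image_subsetI) simp

definition Fil :: "real \<Rightarrow> 'd path measure" where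
  "Fil s = sigma (Omega T) (positive_sets s)"

lemma space_Fil [simp]: "space (Fil s) = Omega T"
  by (simp add: Fil_def space_measure_of_conv)

lemma sets_Fil: "sets (Fil s) = sigma_sets (Omega T) (positive_sets s)"
  unfolding Fil_def by (rule sets_measure_of[OF positive_sets_Pow])

lemma subalgebra_Fil_P:
  assumes P: "P \<in> \<P>" and s: "s \<le> T"
  shows "subalgebra P (Fil s)"
proof -
  have "positive_sets s \<subseteq> sets P"
  proof
    fix A assume "A \<in> positive_sets s"
    then obtain X where X: "X \<in> H0 s" "A = {\<omega>\<in>Omega T. 0 < X \<omega>}" by (rule positive_setsE)
    note [measurable] = H0_P_measurable[OF P H0_mono[OF s X(1)]]
    have "{\<omega>\<in>space P. 0 < X \<omega>} \<in> sets P" by measurable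
    then show "A \<in> sets P" by (simp add: P_space[OF P] X(2))
  qed
  then have "sets (Fil s) \<subseteq> sets P"
    unfolding sets_Fil P_space[OF P, symmetric] by (rule sets.sigma_sets_subset)
  then show ?thesis by (simp add: subalgebra_def P_space[OF P])
qed

lemma subalgebra_Fil:
  assumes "s \<le> s'"
  shows "subalgebra (Fil s') (Fil s)"
proof -
  have "positive_sets s \<subseteq> positive_sets s'"
    unfolding positive_sets_def by (rule image_mono) (rule subsetI, rule H0_mono[OF assms])
  then have "sigma_sets (Omega T) (positive_sets s) \<subseteq> sigma_sets (Omega T) (positive_sets s')"
    by (rule sigma_sets_mono')
  then show ?thesis by (simp add: subalgebra_def sets_Fil)
qed

lemma H0_Fil_measurable:
  assumes X: "X \<in> H0 s" and s: "0 \<le> s"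
  shows "X \<in> borel_measurable (Fil s)"
proof (subst borel_measurable_iff_greater, intro allI)
  fix a
  have "(\<lambda>\<omega>. X \<omega> - a) \<in> H0 s" by (intro H0_diff X H0_const s)
  then have "{\<omega>\<in>Omega T. 0 < X \<omega> - a} \<in> sets (Fil s)" unfolding sets_Fil by (intro sigma_sets.Basic positive_setsI)
  then show "{\<omega>\<in>space (Fil s). a < X \<omega>} \<in> sets (Fil s)" by simp
qed

text \<open>A Dynkin argument leads from cylinder weights to sets. On a generator, min 1 (k * max 0
  X) tends to the indicator, with \<bar>I\<bar> as integrable majorant.\<close>

lemma Fil_orthogonal_set:
  assumes P: "P \<in> \<P>" and s: "0 \<le> s" "s \<le> T" and I: "integrable P I"
    and orth: "\<And>Y. Y \<in> H0 s \<Longrightarrow> (\<And>\<omega>. 0 \<le> Y \<omega> \<and> Y \<omega> \<le> 1) \<Longrightarrow> (\<integral>\<omega>. Y \<omega> * I \<omega> \<partial>P) = 0"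
    and A: "A \<in> sets (Fil s)"
  shows "(LINT \<omega>:A|P. I \<omega>) = 0"
proof -
  have AP: "A \<in> sets P" if "A \<in> sets (Fil s)" for A
    using subalgebra_Fil_P[OF P s(2)] that by (auto simp: subalgebra_def)
  let ?G = "positive_sets s"
  have "Int_stable ?G"
  proof (rule Int_stableI)
    fix a b assume "a \<in> ?G" "b \<in> ?G"
    then obtain X Y where XY: "X \<in> H0 s" "Y \<in> H0 s" "a = {\<omega>\<in>Omega T. 0 < X \<omega>}" "b = {\<omega>\<in>Omega T. 0 < Y \<omega>}"
      by (elim positive_setsE) simp
    then have "a \<inter> b = {\<omega>\<in>Omega T. 0 < min (X \<omega>) (Y \<omega>)}" by auto
    then show "a \<inter> b \<in> ?G" using positive_setsI[OF H0_min[OF XY(1,2)]] by simp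
  qed
  moreover have "?G \<subseteq> Pow (Omega T)" by (rule positive_sets_Pow)
  moreover have "A \<in> sigma_sets (Omega T) ?G" using A by (simp add: sets_Fil)
  ultimately show ?thesis
  proof (induction rule: sigma_sets_induct_disjoint)
    case (basic A)
    then obtain X where X: "X \<in> H0 s" "A = {\<omega>\<in>Omega T. 0 < X \<omega>}" by (rule positive_setsE)
    note [measurable] = borel_measurable_integrable[OF I] H0_P_measurable[OF P H0_mono[OF s(2) X(1)]]
    define Y where "Y k \<omega> = min 1 (real k * max 0 (X \<omega>))" for k :: nat and \<omega>
    have Y: "Y k \<in> H0 s" for k
    proof -
      have "poly_lipschitz (\<lambda>x. min 1 (real k * max 0 x))"
      proof (rule poly_lipschitz_lipschitz[of _ "real k"])
        fix a b :: real
        have "\<bar>min 1 (real k * max 0 a) - min 1 (real k * max 0 b)\<bar> \<le> \<bar>real k * max 0 a - real k * max 0 b\<bar>"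
          by (auto simp: min_def)
        also have "\<dots> = real k * \<bar>max 0 a - max 0 b\<bar>" by (simp add: right_diff_distrib[symmetric] abs_mult)
        also have "\<dots> \<le> real k * \<bar>a - b\<bar>" by (intro mult_left_mono) (auto simp: max_def)
        finally show "\<bar>min 1 (real k * max 0 a) - min 1 (real k * max 0 b)\<bar> \<le> real k * \<bar>a - b\<bar>" .
      qed
      from H0_comp[OF this X(1)] show ?thesis by (simp add: Y_def[abs_def])
    qed
    have "(\<lambda>k. \<integral>\<omega>. Y k \<omega> * I \<omega> \<partial>P) \<longlonglongrightarrow> (\<integral>\<omega>. indicator A \<omega> * I \<omega> \<partial>P)"
    proof (rule integral_dominated_convergence[where w = "\<lambda>\<omega>. \<bar>I \<omega>\<bar>"])
      show "(\<lambda>\<omega>. indicator A \<omega> * I \<omega>) \<in> borel_measurable P"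
        using AP[of A] basic by (auto simp: sets_Fil)
      show "(\<lambda>\<omega>. Y k \<omega> * I \<omega>) \<in> borel_measurable P" for k unfolding Y_def by measurable
      show "AE \<omega> in P. norm (Y k \<omega> * I \<omega>) \<le> \<bar>I \<omega>\<bar>" for k
        by (auto simp: Y_def abs_mult intro!: mult_left_le_one_le)
      show "AE \<omega> in P. (\<lambda>k. Y k \<omega> * I \<omega>) \<longlonglongrightarrow> indicator A \<omega> * I \<omega>"
      proof (rule AE_I2)
        fix \<omega> assume \<omega>: "\<omega> \<in> space P"
        have "(\<lambda>k. Y k \<omega>) \<longlonglongrightarrow> indicator A \<omega>"
        proof (cases "0 < X \<omega>")
          case True
          obtain k0 :: nat where "1 / X \<omega> < real k0" using reals_Archimedean2 by blast
          then have k0: "1 \<le> real k0 * X \<omega>" using True by (simp add: field_simps)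
          have "Y k \<omega> = 1" if "k0 \<le> k" for k
          proof -
            have "real k0 * X \<omega> \<le> real k * X \<omega>" using True that by (intro mult_right_mono) auto
            then have "1 \<le> real k * X \<omega>" using k0 by linarith
            then show ?thesis using True by (simp add: Y_def)
          qed
          then have "(\<lambda>k. Y k \<omega>) \<longlonglongrightarrow> 1"
            by (intro tendsto_eventually) (auto simp: eventually_sequentially)
          then show ?thesis using True \<omega> by (simp add: X(2) P_space[OF P])
        qed (simp add: X(2) Y_def max_def)
        then show "(\<lambda>k. Y k \<omega> * I \<omega>) \<longlonglongrightarrow> indicator A \<omega> * I \<omega>" by (rule tendsto_mult) simp
      qed
    qed (use I in auto)
    moreover have "(\<integral>\<omega>. Y k \<omega> * I \<omega> \<partial>P) = 0" for k
      by (rule orth[OF Y]) (auto simp: Y_def)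
    ultimately show ?case by (simp add: set_lebesgue_integral_def LIMSEQ_const_iff)
  next
    case empty
    then show ?case by (simp add: set_lebesgue_integral_def)
  next
    case (compl A)
    have A: "A \<in> sets P" using AP compl by (simp add: sets_Fil)
    have "(\<integral>\<omega>. 1 * I \<omega> \<partial>P) = 0" using orth[OF H0_const[OF s(1), of 1]] by simp
    then have I0: "(\<integral>\<omega>. I \<omega> \<partial>P) = 0" by simp
    have "(LINT \<omega>:Omega T - A|P. I \<omega>) = (\<integral>\<omega>. I \<omega> - indicator A \<omega> * I \<omega> \<partial>P)"
      unfolding set_lebesgue_integral_def
      by (intro Bochner_Integration.integral_cong) (auto simp: P_space[OF P] indicator_def)
    also have "\<dots> = (\<integral>\<omega>. I \<omega> \<partial>P) - (\<integral>\<omega>. indicator A \<omega> * I \<omega> \<partial>P)"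
      using I integrable_mult_indicator[OF A I] by (intro Bochner_Integration.integral_diff) auto
    finally show ?case using I0 compl.IH by (simp add: set_lebesgue_integral_def)
  next
    case (union A)
    have A: "A i \<in> sets P" for i using union AP by (auto simp: sets_Fil)
    have "(LINT \<omega>:(\<Union>i. A i)|P. I \<omega>) = (\<Sum>i. LINT \<omega>:A i|P. I \<omega>)"
    proof (rule lebesgue_integral_countable_add)
      show "set_integrable P (\<Union>i. A i) I"
        unfolding set_integrable_def using A by (intro integrable_mult_indicator I) auto
    qed (use A union.hyps in \<open>auto simp: disjoint_family_on_def\<close>)
    then show ?case using union.IH by simp
  qed
qed

text \<open>Orthogonality to all sets of \<open>Fil s\<close> says that the conditional expectation
  of I vanishes; unbounded weights H are then reached by pulling them out of it.\<close>

lemma Fil_orthogonal: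
  assumes P: "P \<in> \<P>" and s: "0 \<le> s" "s \<le> T" and I: "integrable P I"
    and orth: "\<And>Y. Y \<in> H0 s \<Longrightarrow> (\<And>\<omega>. 0 \<le> Y \<omega> \<and> Y \<omega> \<le> 1) \<Longrightarrow> (\<integral>\<omega>. Y \<omega> * I \<omega> \<partial>P) = 0"
    and H: "H \<in> borel_measurable (Fil s)" "integrable P (\<lambda>\<omega>. H \<omega> * I \<omega>)"
  shows "(\<integral>\<omega>. H \<omega> * I \<omega> \<partial>P) = 0"
proof -
  interpret prob_space P by (rule P_prob[OF P])
  interpret finite_measure_subalgebra P "Fil s"
    by unfold_locales (rule subalgebra_Fil_P[OF P s(2)])
  have "AE \<omega> in P. real_cond_exp P (Fil s) I \<omega> = 0"
  proof (rule real_cond_exp_charact)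
    fix A assume A: "A \<in> sets (Fil s)"
    have "(LINT \<omega>:A|P. I \<omega>) = 0"
      by (rule Fil_orthogonal_set[OF P s I _ A]) (rule orth)
    then show "(LINT \<omega>:A|P. I \<omega>) = (LINT \<omega>:A|P. 0)" by (simp add: set_lebesgue_integral_def)
  qed (use I in simp_all)
  then have "(\<integral>\<omega>. H \<omega> * real_cond_exp P (Fil s) I \<omega> \<partial>P) = (\<integral>\<omega>. 0 \<partial>P)"
  proof (intro integral_cong_AE)
    note [measurable] = measurable_from_subalg[OF subalg H(1)]
    show "(\<lambda>\<omega>. H \<omega> * real_cond_exp P (Fil s) I \<omega>) \<in> borel_measurable P" by measurable
  qed auto
  then show ?thesis
    using real_cond_exp_intg(2)[OF H(2,1) borel_measurable_integrable[OF I]] by simp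
qed

text \<open>A subsequence converges almost everywhere under P, and its pointwise limit is
  measurable. The version depends on P because \<open>Fil s\<close> is not completed.\<close>

lemma L1_limit_Fil_version:
  assumes P: "P \<in> \<P>" and s: "0 \<le> s" "s \<le> T" and Yn: "\<And>n. Yn n \<in> H0 s"
    and Y: "Y \<in> L_G T \<P> 1" and lim: "(\<lambda>n. Lp_dist \<P> 1 (Yn n) Y) \<longlonglongrightarrow> 0"
  obtains Y' where "Y' \<in> borel_measurable (Fil s)" "AE \<omega> in P. Y \<omega> = Y' \<omega>"
proof -
  have YnT: "Yn n \<in> H0 T" for n by (rule H0_mono[OF s(2) Yn])
  note [measurable] = L_G_P_measurable[OF P Y] H0_P_measurable[OF P YnT]
  have "\<forall>\<^sub>F n in sequentially. Lp_dist \<P> 1 (Yn n) Y < 1"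
    by (rule order_tendstoD(2)[OF lim]) simp
  then obtain n0 where n0: "\<And>n. n0 \<le> n \<Longrightarrow> Lp_dist \<P> 1 (Yn n) Y < 1" by (auto simp: eventually_sequentially)
  \<comment> \<open>The shift by n0 leaves terms at finite distance, hence integrable
    differences.\<close>
  define u where "u n \<omega> = Yn (n + n0) \<omega> - Y \<omega>" for n \<omega>
  have nn: "(\<integral>\<^sup>+\<omega>. ennreal (norm (u n \<omega>)) \<partial>P) \<le> Lp_dist \<P> 1 (Yn (n + n0)) Y" for n
    using L1_dist_ge[OF P] by (simp add: u_def)
  have um[measurable]: "u n \<in> borel_measurable P" for n unfolding u_def by measurable
  have iu: "integrable P (u n)" for n
  proof (rule integrableI_bounded)
    show "(\<integral>\<^sup>+\<omega>. ennreal (norm (u n \<omega>)) \<partial>P) < \<infinity>"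
      using order.strict_trans1[OF nn n0[of "n + n0"]] order.strict_trans[OF _ ennreal_one_less_top] by auto
  qed measurable
  have "(\<lambda>n. \<integral>\<^sup>+\<omega>. ennreal (norm (u n \<omega>)) \<partial>P) \<longlonglongrightarrow> 0"
    by (rule ennreal_squeeze_zero[OF LIMSEQ_ignore_initial_segment[OF lim, of n0] nn])
  moreover have "(\<integral>\<^sup>+\<omega>. ennreal (norm (u n \<omega>)) \<partial>P) = ennreal (\<integral>\<omega>. norm (u n \<omega>) \<partial>P)" for n
    using iu by (intro nn_integral_eq_integral) auto
  ultimately have "(\<lambda>n. ennreal (\<integral>\<omega>. norm (u n \<omega>) \<partial>P)) \<longlonglongrightarrow> ennreal 0" by simp
  then have "(\<lambda>n. \<integral>\<omega>. norm (u n \<omega>) \<partial>P) \<longlonglongrightarrow> 0"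
    by (subst (asm) tendsto_ennreal_iff) auto
  then obtain r where r: "strict_mono r" "AE \<omega> in P. (\<lambda>n. u (r n) \<omega>) \<longlonglongrightarrow> 0"
    using tendsto_L1_AE_subseq[of P u] iu by blast
  define Y' where "Y' \<omega> = lim (\<lambda>n. Yn (r n + n0) \<omega>)" for \<omega>
  show ?thesis
  proof (rule that)
    have [measurable]: "Yn n \<in> borel_measurable (Fil s)" for n by (rule H0_Fil_measurable[OF Yn s(1)])
    show "Y' \<in> borel_measurable (Fil s)" unfolding Y'_def by (rule borel_measurable_lim_metric) measurable
    show "AE \<omega> in P. Y \<omega> = Y' \<omega>"
      using r(2)
    proof eventually_elim
      case (elim \<omega>)
      then have "(\<lambda>n. Yn (r n + n0) \<omega>) \<longlonglongrightarrow> Y \<omega>" by (simp add: u_def LIM_zero_iff)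
      then show ?case unfolding Y'_def by (simp add: limI)
    qed
  qed
qed

lemma conditional_Fil_version:
  assumes P: "P \<in> \<P>" and s: "s \<in> {0..T}" and Y: "is_cond_E T \<P> E s X Y"
  obtains Y' where "Y' \<in> borel_measurable (Fil s)" "AE \<omega> in P. Y \<omega> = Y' \<omega>"
proof -
  have L: "X \<in> L_G T \<P> 1" "Y \<in> L_G T \<P> 1" using Y by (auto simp: is_cond_E_def)
  obtain Xn where Xn: "\<And>n. Xn n \<in> H0 T" "(\<lambda>n. Lp_dist \<P> 1 (Xn n) X) \<longlonglongrightarrow> 0"
    using L(1) by (rule L_GE) blast
  have "\<forall>n. \<exists>Z. is_cond_E0 T E s (Xn n) Z \<and> Z \<in> H0 s"
  proof
    fix n
    show "\<exists>Z. is_cond_E0 T E s (Xn n) Z \<and> Z \<in> H0 s"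
      by (rule is_cond_E0_exists[OF Xn(1)[of n] s]) blast
  qed
  then obtain Yn where Yn: "\<And>n. is_cond_E0 T E s (Xn n) (Yn n)" "\<And>n. Yn n \<in> H0 s" by metis
  show ?thesis
    using L1_limit_Fil_version[OF P _ _ Yn(2) L(2) is_cond_E_lim[OF Y Yn(1) Xn(2)]] s that by auto
qed


section \<open>Stochastic integrals are martingales under every representing measure\<close>

lemma Lip_const: "0 \<le> s \<Longrightarrow> (\<lambda>_. c) \<in> Lip s"
proof -
  assume s: "0 \<le> s"
  have "(\<lambda>_. c) \<in> bdd_Lip_tuple 1"
    unfolding bdd_Lip_tuple_def by (auto intro!: exI[of _ 0])
  then show ?thesis
    unfolding Lip_def using s by (intro CollectI exI[of _ 1] exI[of _ "\<lambda>_. 0"] exI[of _ "\<lambda>_. c"]) auto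
qed

lemma inner_increment_H0:
  assumes "0 \<le> u" "u \<le> v" "\<And>k. (\<lambda>\<omega>. \<eta> \<omega> $ k) \<in> H0 u"
  shows "(\<lambda>\<omega>. \<eta> \<omega> \<bullet> (B v \<omega> - B u \<omega>)) \<in> H0 v"
  unfolding inner_vec_def inner_real_def
  using assms by (intro H0_sum increment_product_mem) auto

lemma integral_inner_increment:
  assumes P: "P \<in> \<P>" and u: "0 \<le> u" "u \<le> v" "v \<le> T" and Y: "Y \<in> H0 u"
    and \<eta>: "\<And>k. (\<lambda>\<omega>. \<eta> \<omega> $ k) \<in> H0 u"
  shows "(\<integral>\<omega>. Y \<omega> * (\<eta> \<omega> \<bullet> (B v \<omega> - B u \<omega>)) \<partial>P) = 0"
proof -
  have Y\<eta>: "(\<lambda>\<omega>. Y \<omega> * \<eta> \<omega> $ k) \<in> H0 u" for k by (rule H0_mult[OF Y \<eta>])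
  have "(\<integral>\<omega>. Y \<omega> * (\<eta> \<omega> \<bullet> (B v \<omega> - B u \<omega>)) \<partial>P)
      = (\<integral>\<omega>. (\<Sum>k\<in>UNIV. (Y \<omega> * \<eta> \<omega> $ k) * (B v \<omega> - B u \<omega>) $ k) \<partial>P)"
    by (simp add: inner_vec_def sum_distrib_left mult.assoc)
  also have "\<dots> = (\<Sum>k\<in>UNIV. \<integral>\<omega>. (Y \<omega> * \<eta> \<omega> $ k) * (B v \<omega> - B u \<omega>) $ k \<partial>P)"
    by (intro Bochner_Integration.integral_sum H0_integrable[OF P] H0_mono[OF u(3)] increment_product_mem u Y\<eta>)
  also have "\<dots> = 0"
    by (intro sum.neutral ballI integral_increment_zero[OF P u] Y\<eta>)
  finally show ?thesis .
qed

lemma partition_uptoD: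
  assumes "partition_upto T N t"
  shows "t 0 = 0" "\<And>i j. i < j \<Longrightarrow> j \<le> N \<Longrightarrow> t i < t j" "\<And>i j. i \<le> j \<Longrightarrow> j \<le> N \<Longrightarrow> t i \<le> t j"
proof -
  have m: "strict_mono_on {0..N} t" "t 0 = 0" using assms by (auto simp: partition_upto_def)
  show "t 0 = 0" by fact
  show lt: "t i < t j" if "i < j" "j \<le> N" for i j using that strict_mono_onD[OF m(1), of i j] by auto
  show "t i \<le> t j" if "i \<le> j" "j \<le> N" for i j using that lt[of i j] by (cases "i = j") auto
qed

lemma simple_integral_H0:
  assumes "simple_process T N t \<eta>"
  shows "simple_integral N t \<eta> \<in> H0 T"
proof -
  have p: "partition_upto T N t" "t N = T" "\<And>j k. j < N \<Longrightarrow> (\<lambda>\<omega>. \<eta> j \<omega> $ k) \<in> Lip (t j)"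
    using assms by (auto simp: simple_process_def)
  have "(\<lambda>\<omega>. \<eta> j \<omega> \<bullet> (B (t (Suc j)) \<omega> - B (t j) \<omega>)) \<in> H0 T" if j: "j < N" for j
  proof (rule H0_mono)
    show "(\<lambda>\<omega>. \<eta> j \<omega> \<bullet> (B (t (Suc j)) \<omega> - B (t j) \<omega>)) \<in> H0 (t (Suc j))"
      using partition_times[OF p(1), of j] partition_uptoD(3)[OF p(1), of j "Suc j"] p(3)[OF j] Lip_subset_H0 j
      by (intro inner_increment_H0) auto
    show "t (Suc j) \<le> T" using partition_times[OF p(1), of "Suc j"] j by simp
  qed
  then show ?thesis
    unfolding simple_integral_def[abs_def] using T by (intro H0_sum) auto
qed

text \<open>The process stopped at \<open>s\<close> jumps to zero at the new partition point \<open>s\<close>.\<close>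

lemma stopped_simple_process:
  assumes simple: "simple_process T N t \<eta>" and s: "0 \<le> s" "s < T"
  obtains N' t' \<eta>' where "simple_process T N' t' \<eta>'"
    "\<And>r \<omega>. r < s \<Longrightarrow> process_of N' t' \<eta>' r \<omega> = process_of N t \<eta> r \<omega>"
    "\<And>r \<omega>. s < r \<Longrightarrow> process_of N' t' \<eta>' r \<omega> = 0"
    "\<And>P Y. P \<in> \<P> \<Longrightarrow> Y \<in> H0 s \<Longrightarrow>
       (\<integral>\<omega>. Y \<omega> * (simple_integral N t \<eta> \<omega> - simple_integral N' t' \<eta>' \<omega>) \<partial>P) = 0"
proof -
  have p: "partition_upto T N t" "t N = T" "\<And>j k. j < N \<Longrightarrow> (\<lambda>\<omega>. \<eta> j \<omega> $ k) \<in> Lip (t j)"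
    using simple by (auto simp: simple_process_def)
  note pD = partition_uptoD[OF p(1)]
  \<comment> \<open>The first index whose time is not before s. The new partition keeps the points
    before it and continues with s and T.\<close>
  define J where "J = (LEAST j. s \<le> t j)"
  have J: "s \<le> t J" "J \<le> N"
    using s p(2) by (auto simp: J_def intro: LeastI[of _ N] Least_le)
  have before: "t j < s" if "j < J" for j
    using not_less_Least[of j "\<lambda>j. s \<le> t j"] that by (simp add: J_def)
  have J0: "J = 0 \<Longrightarrow> s = 0" using J(1) pD(1) s by simp
  define t' where "t' j = (if j < J then t j else if j = J then s else T)" for j
  define \<eta>' where "\<eta>' j = (if j < J then \<eta> j else (\<lambda>_. 0))" for j
  have "partition_upto T (Suc J) t'"
    unfolding partition_upto_def
  proof (intro conjI strict_mono_onI)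
    show "t' 0 = 0" using J0 pD(1) by (auto simp: t'_def)
    show "t' i < t' j" if "i \<in> {0..Suc J}" "j \<in> {0..Suc J}" "i < j" for i j
      using that before s J(2) pD(2)[of i j] order.strict_trans[OF before s(2)] by (auto simp: t'_def)
  qed (auto simp: t'_def)
  then have simple': "simple_process T (Suc J) t' \<eta>'"
    unfolding simple_process_def using p(3) J(2) s by (auto simp: t'_def \<eta>'_def intro: Lip_const)
  have t'_le: "t j \<le> t' (Suc j)" "t' (Suc j) \<le> t (Suc j)" if "j < J" for j
    using that before[OF that] J pD(3)[of j "Suc j"] by (cases "Suc j = J"; auto simp: t'_def)+
  have po': "process_of (Suc J) t' \<eta>' r \<omega> = (\<Sum>j<J. indicator {t j..<t' (Suc j)} r *\<^sub>R \<eta> j \<omega>)" for r \<omega>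
    by (simp add: process_of_def \<eta>'_def) (intro sum.cong, auto simp: t'_def)
  have left: "process_of (Suc J) t' \<eta>' r \<omega> = process_of N t \<eta> r \<omega>" if r: "r < s" for r \<omega>
  proof -
    have "(\<Sum>j<J. indicator {t j..<t' (Suc j)} r *\<^sub>R \<eta> j \<omega>) = (\<Sum>j<J. indicator {t j..<t (Suc j)} r *\<^sub>R \<eta> j \<omega>)"
    proof (intro sum.cong refl)
      fix j assume "j \<in> {..<J}"
      then have "r < t' (Suc j) \<longleftrightarrow> r < t (Suc j)" using r J by (cases "Suc j = J") (auto simp: t'_def)
      then show "indicator {t j..<t' (Suc j)} r *\<^sub>R \<eta> j \<omega> = indicator {t j..<t (Suc j)} r *\<^sub>R \<eta> j \<omega>"
        by (auto simp: indicator_def)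
    qed
    also have "\<dots> = (\<Sum>j<N. indicator {t j..<t (Suc j)} r *\<^sub>R \<eta> j \<omega>)"
    proof (rule sum.mono_neutral_left)
      show "\<forall>j\<in>{..<N} - {..<J}. indicator {t j..<t (Suc j)} r *\<^sub>R \<eta> j \<omega> = 0"
      proof
        fix j assume "j \<in> {..<N} - {..<J}"
        then have "s \<le> t j" using J(1) pD(3)[of J j] by auto
        then show "indicator {t j..<t (Suc j)} r *\<^sub>R \<eta> j \<omega> = 0" using r by simp
      qed
    qed (use J in auto)
    finally show ?thesis by (simp add: po') (simp add: process_of_def)
  qed
  have right: "process_of (Suc J) t' \<eta>' r \<omega> = 0" if r: "s < r" for r \<omega>
  proof -
    have "t' (Suc j) \<le> s" if "j < J" for j
      using that before[of "Suc j"] by (auto simp: t'_def)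
    then show ?thesis using r unfolding po' by (intro sum.neutral) (force simp: indicator_def)
  qed
  have zero: "(\<integral>\<omega>. Y \<omega> * (simple_integral N t \<eta> \<omega> - simple_integral (Suc J) t' \<eta>' \<omega>) \<partial>P) = 0"
    if P: "P \<in> \<P>" and Y: "Y \<in> H0 s" for P Y
  proof -
    \<comment> \<open>The part of the j-th interval that stopping removes starts at u j: at the new
      right end for j < J and at t j from J on. It is empty or lies after s.\<close>
    define u where "u j = (if j < J then t' (Suc j) else t j)" for j
    have u: "s \<le> u j \<or> u j = t (Suc j)" "t j \<le> u j" "u j \<le> t (Suc j)" if "j < N" for j
      using that t'_le[of j] pD(3)[of j "Suc j"] pD(3)[of J j] J(1) by (auto simp: u_def t'_def)
    have diff: "simple_integral N t \<eta> \<omega> - simple_integral (Suc J) t' \<eta>' \<omega>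
        = (\<Sum>j<N. \<eta> j \<omega> \<bullet> (B (t (Suc j)) \<omega> - B (u j) \<omega>))" for \<omega>
    proof -
      have "simple_integral (Suc J) t' \<eta>' \<omega> = (\<Sum>j<J. \<eta> j \<omega> \<bullet> (B (t' (Suc j)) \<omega> - B (t j) \<omega>))"
        by (simp add: simple_integral_def \<eta>'_def) (intro sum.cong, auto simp: t'_def)
      also have "\<dots> = (\<Sum>j<N. if j < J then \<eta> j \<omega> \<bullet> (B (t' (Suc j)) \<omega> - B (t j) \<omega>) else 0)"
        using J(2) by (intro sum.mono_neutral_cong_left) auto
      finally show ?thesis
        unfolding simple_integral_def
        by (simp add: sum_subtractf[symmetric]) (intro sum.cong, auto simp: u_def inner_diff_right)
    qed
    have term_: "(\<lambda>\<omega>. Y \<omega> * (\<eta> j \<omega> \<bullet> (B (t (Suc j)) \<omega> - B (u j) \<omega>))) \<in> H0 T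
        \<and> (\<integral>\<omega>. Y \<omega> * (\<eta> j \<omega> \<bullet> (B (t (Suc j)) \<omega> - B (u j) \<omega>)) \<partial>P) = 0" if j: "j < N" for j
    proof (cases "u j = t (Suc j)")
      case True
      then show ?thesis using H0_const[of T 0] T by simp
    next
      case False
      then have su: "s \<le> u j" using u(1)[OF j] by simp
      have tj: "0 \<le> t j" "t (Suc j) \<le> T" using partition_times[OF p(1), of j] partition_times[OF p(1), of "Suc j"] j by auto
      have Yu: "Y \<in> H0 (u j)" by (rule H0_mono[OF su Y])
      have \<eta>u: "(\<lambda>\<omega>. \<eta> j \<omega> $ k) \<in> H0 (u j)" for k
        by (rule H0_mono[OF u(2)[OF j]]) (use p(3)[OF j] Lip_subset_H0 in auto)
      have "(\<lambda>\<omega>. \<eta> j \<omega> \<bullet> (B (t (Suc j)) \<omega> - B (u j) \<omega>)) \<in> H0 (t (Suc j))"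
        using u(2,3)[OF j] tj by (intro inner_increment_H0 \<eta>u) auto
      then have "(\<lambda>\<omega>. \<eta> j \<omega> \<bullet> (B (t (Suc j)) \<omega> - B (u j) \<omega>)) \<in> H0 T" by (rule H0_mono[OF tj(2)])
      moreover have "Y \<in> H0 T" using s by (intro H0_mono[OF _ Y]) simp
      ultimately have "(\<lambda>\<omega>. Y \<omega> * (\<eta> j \<omega> \<bullet> (B (t (Suc j)) \<omega> - B (u j) \<omega>))) \<in> H0 T"
        by (intro H0_mult)
      moreover have "(\<integral>\<omega>. Y \<omega> * (\<eta> j \<omega> \<bullet> (B (t (Suc j)) \<omega> - B (u j) \<omega>)) \<partial>P) = 0"
        using u(2,3)[OF j] tj by (intro integral_inner_increment[OF P _ _ _ Yu \<eta>u]) auto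
      ultimately show ?thesis by simp
    qed
    have "(\<integral>\<omega>. Y \<omega> * (simple_integral N t \<eta> \<omega> - simple_integral (Suc J) t' \<eta>' \<omega>) \<partial>P)
        = (\<integral>\<omega>. (\<Sum>j<N. Y \<omega> * (\<eta> j \<omega> \<bullet> (B (t (Suc j)) \<omega> - B (u j) \<omega>))) \<partial>P)"
      by (simp only: diff sum_distrib_left)
    also have "\<dots> = (\<Sum>j<N. \<integral>\<omega>. Y \<omega> * (\<eta> j \<omega> \<bullet> (B (t (Suc j)) \<omega> - B (u j) \<omega>)) \<partial>P)"
      using term_ by (intro Bochner_Integration.integral_sum H0_integrable[OF P]) auto
    also have "\<dots> = 0" using term_ by (intro sum.neutral) auto
    finally show ?thesis .
  qed
  show ?thesis by (rule that[OF simple' left right zero])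
qed

text \<open>Simple processes that approximate the integrand on [0, t] are stopped at s. Stopping
  does not increase the distance to the integrand on [0, s], so the stopped integrals approximate
  \<open>Is\<close>, and they differ from the original ones by increments after s, which are
  orthogonal to Y.\<close>

lemma integral_increment_orthogonal:
  assumes P: "P \<in> \<P>" and s: "0 \<le> s" "s < t" "t \<le> T"
    and Is: "is_integral_upto T \<P> 1 s Z Is" and It: "is_integral_upto T \<P> 1 t Z It"
    and Y: "Y \<in> H0 s" "\<And>\<omega>. 0 \<le> Y \<omega> \<and> Y \<omega> \<le> 1"
  shows "(\<integral>\<omega>. Y \<omega> * (It \<omega> - Is \<omega>) \<partial>P) = 0"
proof -
  have H: "(\<lambda>r \<omega>. indicator {0..t} r *\<^sub>R Z r \<omega>) \<in> H_G T \<P> 1" "It \<in> L_G T \<P> 1"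
    and limt: "\<And>N \<tau> \<eta>. (\<And>n. simple_process T (N n) (\<tau> n) (\<eta> n)) \<Longrightarrow>
        (\<lambda>n. Hp_dist T \<P> 1 (process_of (N n) (\<tau> n) (\<eta> n)) (\<lambda>r \<omega>. indicator {0..t} r *\<^sub>R Z r \<omega>)) \<longlonglongrightarrow> 0 \<Longrightarrow>
        (\<lambda>n. Lp_dist \<P> 1 (simple_integral (N n) (\<tau> n) (\<eta> n)) It) \<longlonglongrightarrow> 0"
    using It unfolding is_integral_upto_def is_integral_def by blast+
  have Hs: "Is \<in> L_G T \<P> 1"
    and lims: "\<And>N \<tau> \<eta>. (\<And>n. simple_process T (N n) (\<tau> n) (\<eta> n)) \<Longrightarrow>
        (\<lambda>n. Hp_dist T \<P> 1 (process_of (N n) (\<tau> n) (\<eta> n)) (\<lambda>r \<omega>. indicator {0..s} r *\<^sub>R Z r \<omega>)) \<longlonglongrightarrow> 0 \<Longrightarrow>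
        (\<lambda>n. Lp_dist \<P> 1 (simple_integral (N n) (\<tau> n) (\<eta> n)) Is) \<longlonglongrightarrow> 0"
    using Is unfolding is_integral_upto_def is_integral_def by blast+
  obtain N \<tau> \<eta> where simple: "\<And>n. simple_process T (N n) (\<tau> n) (\<eta> n)"
    and lim: "(\<lambda>n. Hp_dist T \<P> 1 (process_of (N n) (\<tau> n) (\<eta> n)) (\<lambda>r \<omega>. indicator {0..t} r *\<^sub>R Z r \<omega>)) \<longlonglongrightarrow> 0"
    using H(1) unfolding H_G_def by blast
  have sT: "s < T" using s by simp
  define good where "good n N' t' \<eta>' \<longleftrightarrow> simple_process T N' t' \<eta>' \<and>
    (\<forall>r \<omega>. r < s \<longrightarrow> process_of N' t' \<eta>' r \<omega> = process_of (N n) (\<tau> n) (\<eta> n) r \<omega>) \<and>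
    (\<forall>r \<omega>. s < r \<longrightarrow> process_of N' t' \<eta>' r \<omega> = 0) \<and>
    (\<integral>\<omega>. Y \<omega> * (simple_integral (N n) (\<tau> n) (\<eta> n) \<omega> - simple_integral N' t' \<eta>' \<omega>) \<partial>P) = 0" for n N' t' \<eta>'
  have "\<exists>N' t' \<eta>'. good n N' t' \<eta>'" for n
  proof -
    obtain N' t' \<eta>' where "simple_process T N' t' \<eta>'"
      "\<And>r \<omega>. r < s \<Longrightarrow> process_of N' t' \<eta>' r \<omega> = process_of (N n) (\<tau> n) (\<eta> n) r \<omega>"
      "\<And>r \<omega>. s < r \<Longrightarrow> process_of N' t' \<eta>' r \<omega> = 0"
      "\<And>P Y. P \<in> \<P> \<Longrightarrow> Y \<in> H0 s \<Longrightarrow>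
       (\<integral>\<omega>. Y \<omega> * (simple_integral (N n) (\<tau> n) (\<eta> n) \<omega> - simple_integral N' t' \<eta>' \<omega>) \<partial>P) = 0"
      by (rule stopped_simple_process[OF simple[of n] s(1) sT]) (rule that)
    then show ?thesis
      using P Y(1) unfolding good_def by (intro exI[of _ N'] exI[of _ t'] exI[of _ \<eta>']) auto
  qed
  then obtain N' t' \<eta>' where "\<And>n. good n (N' n) (t' n) (\<eta>' n)" by metis
  then have simple': "\<And>n. simple_process T (N' n) (t' n) (\<eta>' n)"
    and left: "\<And>n r \<omega>. r < s \<Longrightarrow> process_of (N' n) (t' n) (\<eta>' n) r \<omega> = process_of (N n) (\<tau> n) (\<eta> n) r \<omega>"
    and right: "\<And>n r \<omega>. s < r \<Longrightarrow> process_of (N' n) (t' n) (\<eta>' n) r \<omega> = 0"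
    and zero: "\<And>n. (\<integral>\<omega>. Y \<omega> * (simple_integral (N n) (\<tau> n) (\<eta> n) \<omega> - simple_integral (N' n) (t' n) (\<eta>' n) \<omega>) \<partial>P) = 0"
    unfolding good_def by blast+
  have powr_mono: "ennreal_powr x (1/2) \<le> ennreal_powr y (1/2)" if "x \<le> y" for x y :: ennreal
    using that by (auto simp: ennreal_powr_def top_unique intro!: ennreal_leI powr_mono2 enn2real_mono simp: less_top)
  have Hp_le: "Hp_dist T \<P> 1 (process_of (N' n) (t' n) (\<eta>' n)) (\<lambda>r \<omega>. indicator {0..s} r *\<^sub>R Z r \<omega>)
      \<le> Hp_dist T \<P> 1 (process_of (N n) (\<tau> n) (\<eta> n)) (\<lambda>r \<omega>. indicator {0..t} r *\<^sub>R Z r \<omega>)" for n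
    unfolding Hp_dist_def
  proof (rule SUP_mono', rule nn_integral_mono, rule powr_mono, rule nn_integral_mono_AE)
    fix P :: "'d path measure" and \<omega> assume "\<omega> \<in> space P"
    \<comment> \<open>The comparison can fail at the single time s, a null set for the time
      integral.\<close>
    have "AE r in lborel. r \<noteq> s" by (rule AE_lborel_singleton)
    then have "AE r in restrict_space lborel {0..T}. r \<noteq> s"
      by (subst AE_restrict_space_iff) (auto elim: eventually_mono)
    then show "AE r in restrict_space lborel {0..T}.
        ennreal ((norm (process_of (N' n) (t' n) (\<eta>' n) r \<omega> - indicator {0..s} r *\<^sub>R Z r \<omega>))\<^sup>2)
        \<le> ennreal ((norm (process_of (N n) (\<tau> n) (\<eta> n) r \<omega> - indicator {0..t} r *\<^sub>R Z r \<omega>))\<^sup>2)"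
    proof eventually_elim
      case (elim r)
      show ?case
      proof (cases "r < s")
        case True
        then show ?thesis using s left[OF True] by (auto simp: indicator_def)
      next
        case False
        then have "s < r" using elim by simp
        then show ?thesis by (simp add: right)
      qed
    qed
  qed
  have lim_t: "(\<lambda>n. Lp_dist \<P> 1 (simple_integral (N n) (\<tau> n) (\<eta> n)) It) \<longlonglongrightarrow> 0"
    by (rule limt[OF simple lim])
  have lim_s: "(\<lambda>n. Lp_dist \<P> 1 (simple_integral (N' n) (t' n) (\<eta>' n)) Is) \<longlonglongrightarrow> 0"
    by (rule lims[OF simple' ennreal_squeeze_zero[OF lim Hp_le]])
  define a where "a n = simple_integral (N n) (\<tau> n) (\<eta> n)" for n
  define b where "b n = simple_integral (N' n) (t' n) (\<eta>' n)" for n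
  have ab: "a n \<in> H0 T" "b n \<in> H0 T" for n
    unfolding a_def b_def by (intro simple_integral_H0 simple simple')+
  have YT: "Y \<in> H0 T" using sT by (intro H0_mono[OF _ Y(1)]) simp
  note [measurable] = H0_P_measurable[OF P ab(1)] H0_P_measurable[OF P ab(2)] H0_P_measurable[OF P YT]
    L_G_P_measurable[OF P H(2)] L_G_P_measurable[OF P Hs]
  have bound: "ennreal \<bar>\<integral>\<omega>. Y \<omega> * (It \<omega> - Is \<omega>) \<partial>P\<bar> \<le> Lp_dist \<P> 1 (a n) It + Lp_dist \<P> 1 (b n) Is" for n
  proof (cases "integrable P (\<lambda>\<omega>. Y \<omega> * (It \<omega> - Is \<omega>))")
    case False
    then show ?thesis by (simp add: not_integrable_integral_eq)
  next
    case True
    have i: "integrable P (\<lambda>\<omega>. Y \<omega> * (a n \<omega> - b n \<omega>))"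
      by (intro H0_integrable[OF P] H0_mult H0_diff YT ab)
    have "(\<integral>\<omega>. Y \<omega> * (It \<omega> - Is \<omega>) \<partial>P) = (\<integral>\<omega>. Y \<omega> * (It \<omega> - Is \<omega>) - Y \<omega> * (a n \<omega> - b n \<omega>) \<partial>P)"
      using Bochner_Integration.integral_diff[OF True i] zero[of n] by (simp add: a_def b_def)
    then have "\<bar>\<integral>\<omega>. Y \<omega> * (It \<omega> - Is \<omega>) \<partial>P\<bar> \<le> (\<integral>\<omega>. \<bar>Y \<omega> * (It \<omega> - Is \<omega>) - Y \<omega> * (a n \<omega> - b n \<omega>)\<bar> \<partial>P)"
      by (simp add: integral_abs_bound)
    then have "ennreal \<bar>\<integral>\<omega>. Y \<omega> * (It \<omega> - Is \<omega>) \<partial>P\<bar> \<le> (\<integral>\<^sup>+\<omega>. ennreal \<bar>Y \<omega> * (It \<omega> - Is \<omega>) - Y \<omega> * (a n \<omega> - b n \<omega>)\<bar> \<partial>P)"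
      using True i by (subst nn_integral_eq_integral) (auto intro!: ennreal_leI)
    also have "\<dots> \<le> (\<integral>\<^sup>+\<omega>. ennreal \<bar>a n \<omega> - It \<omega>\<bar> + ennreal \<bar>b n \<omega> - Is \<omega>\<bar> \<partial>P)"
    proof (rule nn_integral_mono)
      fix \<omega>
      have "\<bar>Y \<omega> * (It \<omega> - Is \<omega>) - Y \<omega> * (a n \<omega> - b n \<omega>)\<bar> = \<bar>Y \<omega>\<bar> * \<bar>(b n \<omega> - Is \<omega>) - (a n \<omega> - It \<omega>)\<bar>"
        by (simp add: abs_mult[symmetric] algebra_simps)
      also have "\<dots> \<le> 1 * (\<bar>a n \<omega> - It \<omega>\<bar> + \<bar>b n \<omega> - Is \<omega>\<bar>)"
        using Y(2)[of \<omega>] by (intro mult_mono) auto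
      finally have "ennreal \<bar>Y \<omega> * (It \<omega> - Is \<omega>) - Y \<omega> * (a n \<omega> - b n \<omega>)\<bar> \<le> ennreal (\<bar>a n \<omega> - It \<omega>\<bar> + \<bar>b n \<omega> - Is \<omega>\<bar>)"
        by (intro ennreal_leI) simp
      then show "ennreal \<bar>Y \<omega> * (It \<omega> - Is \<omega>) - Y \<omega> * (a n \<omega> - b n \<omega>)\<bar> \<le> ennreal \<bar>a n \<omega> - It \<omega>\<bar> + ennreal \<bar>b n \<omega> - Is \<omega>\<bar>"
        by simp
    qed
    also have "\<dots> = (\<integral>\<^sup>+\<omega>. ennreal \<bar>a n \<omega> - It \<omega>\<bar> \<partial>P) + (\<integral>\<^sup>+\<omega>. ennreal \<bar>b n \<omega> - Is \<omega>\<bar> \<partial>P)"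
      by (rule nn_integral_add) measurable
    also have "\<dots> \<le> Lp_dist \<P> 1 (a n) It + Lp_dist \<P> 1 (b n) Is"
      by (intro add_mono L1_dist_ge P)
    finally show ?thesis .
  qed
  have "(\<lambda>n. Lp_dist \<P> 1 (a n) It + Lp_dist \<P> 1 (b n) Is) \<longlonglongrightarrow> 0 + 0"
    unfolding a_def b_def by (intro tendsto_add lim_t lim_s)
  then have "ennreal \<bar>\<integral>\<omega>. Y \<omega> * (It \<omega> - Is \<omega>) \<partial>P\<bar> \<le> 0"
    using bound by (intro LIMSEQ_le_const) auto
  then show ?thesis by simp
qed

end

section \<open>Refining time grids\<close>

text \<open>For n > 0 the indices beyond n stay at T. All times lie in [0, T] when T \<ge> 0, so
  that facts about the grid can be stated for every index.\<close>

definition grid :: "real \<Rightarrow> nat \<Rightarrow> nat \<Rightarrow> real" where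
  "grid T n i = T * real (min i n) / real n"

text \<open>The running maximum also includes the index n, at which the step is empty.\<close>

definition mesh :: "real \<Rightarrow> (real \<Rightarrow> real) \<Rightarrow> nat \<Rightarrow> real" where
  "mesh T f n = running_max (\<lambda>i. f (grid T n (Suc i)) - f (grid T n i)) n"

lemma grid_mono_index: "0 \<le> T \<Longrightarrow> i \<le> j \<Longrightarrow> grid T n i \<le> grid T n j"
  unfolding grid_def by (intro divide_right_mono mult_left_mono) auto

lemma grid_0 [simp]: "grid T n 0 = 0"
  by (simp add: grid_def)

lemma grid_n: "0 < n \<Longrightarrow> grid T n n = T"
  by (simp add: grid_def)

lemma grid_mem: "0 \<le> T \<Longrightarrow> grid T n i \<in> {0..T}"
proof -
  assume T: "0 \<le> T"
  have "T * (real (min i n) / real n) \<le> T * 1"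
    using T by (intro mult_left_mono) (auto simp: divide_le_eq)
  then show ?thesis using T by (simp add: grid_def)
qed

lemma grid_step_le: "0 \<le> T \<Longrightarrow> grid T n (Suc i) - grid T n i \<le> T / real n"
proof -
  assume T: "0 \<le> T"
  have "grid T n (Suc i) - grid T n i = T * (real (min (Suc i) n) - real (min i n)) / real n"
    by (simp add: grid_def diff_divide_distrib right_diff_distrib)
  also have "\<dots> \<le> T * 1 / real n"
    using T by (intro divide_right_mono mult_left_mono) auto
  finally show ?thesis by simp
qed

lemma mesh_ge: "i < n \<Longrightarrow> f (grid T n (Suc i)) - f (grid T n i) \<le> mesh T f n"
  using running_max_ge[of i n "\<lambda>i. f (grid T n (Suc i)) - f (grid T n i)"] by (simp add: mesh_def)

lemma mesh_nonneg [simp]: "0 \<le> mesh T f n"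
  by (simp add: mesh_def)

lemma mesh_le:
  assumes "0 \<le> T" "f 0 = 0" "mono_on {0..T} f"
  shows "mesh T f n \<le> f T"
  unfolding mesh_def
proof (rule running_max_le)
  fix i
  have m: "grid T n i \<in> {0..T}" "grid T n (Suc i) \<in> {0..T}" "grid T n i \<le> grid T n (Suc i)"
    using grid_mem[OF assms(1)] grid_mono_index[OF assms(1)] by auto
  have "f 0 \<le> f (grid T n i)" "f (grid T n i) \<le> f (grid T n (Suc i))" "f (grid T n (Suc i)) \<le> f T"
    using m assms(1) by (auto intro!: mono_onD[OF assms(3)])
  then show "\<bar>f (grid T n (Suc i)) - f (grid T n i)\<bar> \<le> f T" using assms(2) by simp
qed

lemma mesh_tendsto:
  assumes T: "0 < T" and cont: "continuous_on {0..T} f"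
  shows "(\<lambda>n. mesh T f n) \<longlonglongrightarrow> 0"
proof (rule LIMSEQ_I)
  fix e :: real assume "0 < e"
  have "uniformly_continuous_on {0..T} f"
    by (rule compact_uniformly_continuous[OF cont]) simp
  then obtain d where d: "0 < d" "\<And>x y. x \<in> {0..T} \<Longrightarrow> y \<in> {0..T} \<Longrightarrow> dist y x < d \<Longrightarrow> dist (f y) (f x) < e / 2"
    using \<open>0 < e\<close> unfolding uniformly_continuous_on_def by (meson half_gt_zero)
  obtain n0 :: nat where n0: "T / d < real n0" using reals_Archimedean2 by blast
  have "norm (mesh T f n - 0) < e" if n: "n0 \<le> n" for n
  proof -
    have "0 < real n0" using n0 T d by (metis divide_pos_pos order.strict_trans)
    then have "T / real n \<le> T / real n0" using n T by (intro divide_left_mono) auto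
    also have "\<dots> < d" using n0 d \<open>0 < real n0\<close> by (simp add: field_simps)
    finally have small: "T / real n < d" .
    have "mesh T f n \<le> e / 2"
      unfolding mesh_def
    proof (rule running_max_le)
      fix i
      have "dist (grid T n (Suc i)) (grid T n i) < d"
        using grid_step_le[of T n i] grid_mono_index[of T i "Suc i" n] T small by (simp add: dist_real_def)
      then have "dist (f (grid T n (Suc i))) (f (grid T n i)) < e / 2"
        using T by (intro d(2) grid_mem) auto
      then show "\<bar>f (grid T n (Suc i)) - f (grid T n i)\<bar> \<le> e / 2" by (simp add: dist_real_def)
    qed
    then show ?thesis using \<open>0 < e\<close> by simp
  qed
  then show "\<exists>no. \<forall>n\<ge>no. norm (mesh T f n - 0) < e" by blast
qed

lemma grid_error_tendsto:
  assumes "\<delta> \<longlonglongrightarrow> 0" "0 \<le> v" "0 < S"  "\<And>n. 0 \<le> \<delta> n"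
  shows "(\<lambda>n. grid_error \<alpha> S (\<delta> n) v) \<longlonglongrightarrow> 0"
proof (cases "\<alpha> \<le> 2")
  case True
  have lim: "(\<lambda>n. S powr (\<alpha> / 2 - 1) * \<delta> n * v) \<longlonglongrightarrow> 0"
    by (intro tendsto_mult_left_zero tendsto_mult_right_zero assms(1))
  have "\<forall>\<^sub>F n in sequentially. norm (grid_error \<alpha> S (\<delta> n) v) \<le> S powr (\<alpha> / 2 - 1) * \<delta> n * v"
    using True assms by (intro always_eventually allI) (simp add: grid_error_def abs_mult mult_right_mono)
  then show ?thesis by (rule Lim_null_comparison[OF _ lim])
next
  case False
  have "(\<lambda>n. ((\<alpha> - 1) * v powr (\<alpha> - 2) * v) * \<delta> n) \<longlonglongrightarrow> 0"
    by (rule tendsto_mult_right_zero[OF assms(1)])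
  then show ?thesis using False by (simp add: grid_error_def)
qed

text \<open>Fatou's lemma in the form that removes the truncation in
  \<open>K_moment\<close>.\<close>

lemma nn_integral_limit_le:
  assumes u: "\<And>n. u n \<in> borel_measurable M" and lim: "AE x in M. (\<lambda>n. u n x) \<longlonglongrightarrow> f x"
    and le: "\<And>n. (\<integral>\<^sup>+x. u n x \<partial>M) \<le> (c :: ennreal)"
  shows "(\<integral>\<^sup>+x. f x \<partial>M) \<le> c"
proof -
  have "(\<integral>\<^sup>+x. f x \<partial>M) = (\<integral>\<^sup>+x. liminf (\<lambda>n. u n x) \<partial>M)"
    using lim by (intro nn_integral_cong_AE) (auto elim!: eventually_mono simp: lim_imp_Liminf)
  also have "\<dots> \<le> liminf (\<lambda>n. \<integral>\<^sup>+x. u n x \<partial>M)" by (rule nn_integral_liminf[OF u])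
  also have "\<dots> \<le> liminf (\<lambda>n. c)" by (intro Liminf_mono always_eventually) (simp add: le)
  also have "\<dots> = c" by (simp add: Liminf_const)
  finally show ?thesis .
qed

context G_expectation
begin

section \<open>Martingales and adapted versions under one representing measure\<close>

lemma qs_AE:
  assumes "qs T \<P> Q" "P \<in> \<P>"
  shows "AE \<omega> in P. Q \<omega>"
proof -
  obtain A where A: "A \<in> sets (Borel_Omega T)" "capacity \<P> A = 0" "\<And>\<omega>. \<omega> \<in> Omega T - A \<Longrightarrow> Q \<omega>"
    using assms(1) unfolding qs_def by blast
  have "emeasure P A \<le> capacity \<P> A" unfolding capacity_def by (rule SUP_upper[OF assms(2)])
  then have "A \<in> null_sets P" using A(1,2) P_sets[OF assms(2)] by auto
  then show ?thesis by (rule AE_I') (use A(3) P_space[OF assms(2)] in auto)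
qed

lemma L_G1_integrable:
  assumes X: "X \<in> L_G T \<P> 1" and P: "P \<in> \<P>"
  shows "integrable P X"
proof -
  obtain Xn where Xn: "\<And>n. Xn n \<in> H0 T" "(\<lambda>n. Lp_dist \<P> 1 (Xn n) X) \<longlonglongrightarrow> 0"
    using X by (rule L_GE) blast
  have "\<forall>\<^sub>F n in sequentially. Lp_dist \<P> 1 (Xn n) X < 1" by (rule order_tendstoD(2)[OF Xn(2)]) simp
  then obtain n where n: "Lp_dist \<P> 1 (Xn n) X < 1" by (auto simp: eventually_sequentially)
  note [measurable] = L_G_P_measurable[OF P X] H0_P_measurable[OF P Xn(1)]
  have "integrable P (\<lambda>\<omega>. Xn n \<omega> - X \<omega>)"
  proof (rule integrableI_bounded)
    have "(\<integral>\<^sup>+\<omega>. ennreal (norm (Xn n \<omega> - X \<omega>)) \<partial>P) < 1"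
      using order.strict_trans1[OF L1_dist_ge[OF P, of "Xn n" X] n] by simp
    then show "(\<integral>\<^sup>+\<omega>. ennreal (norm (Xn n \<omega> - X \<omega>)) \<partial>P) < \<infinity>"
      using order.strict_trans[OF _ ennreal_one_less_top] by simp
  qed measurable
  then have "integrable P (\<lambda>\<omega>. Xn n \<omega> - (Xn n \<omega> - X \<omega>))"
    by (rule Bochner_Integration.integrable_diff[OF H0_integrable[OF P Xn(1)]])
  then show ?thesis by simp
qed

text \<open>The counterpart of \<open>discrete_martingale\<close> in continuous time, without
  adaptedness: the processes at hand are \<open>Fil\<close>-measurable only up to null sets, and
  \<open>grid_versions\<close> repairs this at the grid times.\<close>

definition martingale_under :: "'d path measure \<Rightarrow> (real \<Rightarrow> 'd path \<Rightarrow> real) \<Rightarrow> bool" where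
  "martingale_under P X \<longleftrightarrow> (\<forall>t\<in>{0..T}. integrable P (X t)) \<and>
    (\<forall>s t H. 0 \<le> s \<and> s \<le> t \<and> t \<le> T \<and> H \<in> borel_measurable (Fil s) \<and> integrable P (\<lambda>\<omega>. H \<omega> * (X t \<omega> - X s \<omega>))
       \<longrightarrow> (\<integral>\<omega>. H \<omega> * (X t \<omega> - X s \<omega>) \<partial>P) = 0)"

lemma decomposition_integral:
  assumes "G_decomposition T \<P> E \<xi> M K"
  obtains I c where "\<exists>Z. \<forall>t\<in>{0..T}. is_integral_upto T \<P> 1 t Z (I t)"
    "\<And>t \<omega>. t \<in> {0..T} \<Longrightarrow> \<omega> \<in> Omega T \<Longrightarrow> M t \<omega> = c + I t \<omega>"
proof -
  obtain Z where Z: "\<forall>t\<in>{0..T}. \<exists>I. is_integral_upto T \<P> 1 t Z I \<and> (\<forall>\<omega>\<in>Omega T. M t \<omega> = ext_E T \<P> E \<xi> + I \<omega>)"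
    using assms unfolding G_decomposition_def by (elim conjE bexE)
  from bchoice[OF this] obtain I where I: "\<forall>t\<in>{0..T}. is_integral_upto T \<P> 1 t Z (I t) \<and>
      (\<forall>\<omega>\<in>Omega T. M t \<omega> = ext_E T \<P> E \<xi> + I t \<omega>)" ..
  show ?thesis by (rule that[of I "ext_E T \<P> E \<xi>"]) (use I in auto)
qed

text \<open>The linear combination serves both estimates: coefficients 1 and 0 give M, coefficients
  1 and 1 the difference. Constants cancel in increments, which leaves stochastic integrals; these
  are orthogonal to cylinder weights, hence by \<open>Fil_orthogonal\<close> to all weights.\<close>

lemma martingale_part:
  assumes dec: "G_decomposition T \<P> E \<xi> M K" "G_decomposition T \<P> E \<xi>' M' K'" and P: "P \<in> \<P>"
  shows "martingale_under P (\<lambda>t \<omega>. a * M t \<omega> - b * M' t \<omega>)"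
proof -
  obtain I c where I: "\<exists>Z. \<forall>t\<in>{0..T}. is_integral_upto T \<P> 1 t Z (I t)"
      "\<And>t \<omega>. t \<in> {0..T} \<Longrightarrow> \<omega> \<in> Omega T \<Longrightarrow> M t \<omega> = c + I t \<omega>"
    by (rule decomposition_integral[OF dec(1)]) blast
  obtain I' c' where I': "\<exists>Z. \<forall>t\<in>{0..T}. is_integral_upto T \<P> 1 t Z (I' t)"
      "\<And>t \<omega>. t \<in> {0..T} \<Longrightarrow> \<omega> \<in> Omega T \<Longrightarrow> M' t \<omega> = c' + I' t \<omega>"
    by (rule decomposition_integral[OF dec(2)]) blast
  obtain Z where Z: "\<And>t. t \<in> {0..T} \<Longrightarrow> is_integral_upto T \<P> 1 t Z (I t)" using I(1) by blast
  obtain Z' where Z': "\<And>t. t \<in> {0..T} \<Longrightarrow> is_integral_upto T \<P> 1 t Z' (I' t)" using I'(1) by blast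
  interpret prob_space P by (rule P_prob[OF P])
  have L: "I t \<in> L_G T \<P> 1" "I' t \<in> L_G T \<P> 1" if "t \<in> {0..T}" for t
    using Z[OF that] Z'[OF that] unfolding is_integral_upto_def is_integral_def by auto
  have int: "integrable P (I t)" "integrable P (I' t)" if "t \<in> {0..T}" for t
    using L[OF that] L_G1_integrable P by auto
  have iX: "integrable P (\<lambda>\<omega>. a * M t \<omega> - b * M' t \<omega>)" if t: "t \<in> {0..T}" for t
  proof -
    have "integrable P (\<lambda>\<omega>. a * (c + I t \<omega>) - b * (c' + I' t \<omega>))" using int[OF t] by auto
    then show ?thesis
      by (rule Bochner_Integration.integrable_cong[THEN iffD1, rotated -1]) (use I(2)[OF t] I'(2)[OF t] P_space[OF P] in auto)
  qed
  have zero: "(\<integral>\<omega>. H \<omega> * ((a * M t \<omega> - b * M' t \<omega>) - (a * M s \<omega> - b * M' s \<omega>)) \<partial>P) = 0"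
    if st: "0 \<le> s" "s \<le> t" "t \<le> T" and H: "H \<in> borel_measurable (Fil s)"
      "integrable P (\<lambda>\<omega>. H \<omega> * ((a * M t \<omega> - b * M' t \<omega>) - (a * M s \<omega> - b * M' s \<omega>)))" for s t H
  proof (cases "s = t")
    case False
    then have lt: "s < t" using st by simp
    have mem: "s \<in> {0..T}" "t \<in> {0..T}" using st by auto
    define J where "J \<omega> = a * (I t \<omega> - I s \<omega>) - b * (I' t \<omega> - I' s \<omega>)" for \<omega>
    have eq: "(a * M t \<omega> - b * M' t \<omega>) - (a * M s \<omega> - b * M' s \<omega>) = J \<omega>" if "\<omega> \<in> space P" for \<omega>
      using I(2)[OF mem(1)] I(2)[OF mem(2)] I'(2)[OF mem(1)] I'(2)[OF mem(2)] that P_space[OF P]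
      by (simp add: J_def algebra_simps)
    have "(\<integral>\<omega>. H \<omega> * J \<omega> \<partial>P) = 0"
    proof (rule Fil_orthogonal[OF P st(1) _ _ _ H(1)])
      show "s \<le> T" using st by simp
      show "integrable P J" unfolding J_def using int[OF mem(1)] int[OF mem(2)] by auto
      show "integrable P (\<lambda>\<omega>. H \<omega> * J \<omega>)"
        using H(2) by (rule Bochner_Integration.integrable_cong[THEN iffD1, rotated -1]) (use eq in auto)
      fix Y :: "'d path \<Rightarrow> real"
      assume Y: "Y \<in> H0 s" "\<And>\<omega>. 0 \<le> Y \<omega> \<and> Y \<omega> \<le> 1"
      have iY: "integrable P (\<lambda>\<omega>. Y \<omega> * f \<omega>)" if "integrable P f" for f
      proof (rule Bochner_Integration.integrable_bound[OF that])
        have "s \<le> T" using st by simp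
        then show "(\<lambda>\<omega>. Y \<omega> * f \<omega>) \<in> borel_measurable P"
          by (intro borel_measurable_times H0_P_measurable[OF P H0_mono[OF _ Y(1)]] borel_measurable_integrable[OF that])
        show "AE \<omega> in P. norm (Y \<omega> * f \<omega>) \<le> norm (f \<omega>)"
          using Y(2) by (auto simp: abs_mult intro!: mult_left_le_one_le)
      qed
      have "(\<integral>\<omega>. Y \<omega> * J \<omega> \<partial>P) = (\<integral>\<omega>. a * (Y \<omega> * (I t \<omega> - I s \<omega>)) - b * (Y \<omega> * (I' t \<omega> - I' s \<omega>)) \<partial>P)"
        by (simp add: J_def algebra_simps)
      also have "\<dots> = a * (\<integral>\<omega>. Y \<omega> * (I t \<omega> - I s \<omega>) \<partial>P) - b * (\<integral>\<omega>. Y \<omega> * (I' t \<omega> - I' s \<omega>) \<partial>P)"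
      proof -
        have "integrable P (\<lambda>\<omega>. Y \<omega> * (I t \<omega> - I s \<omega>))" "integrable P (\<lambda>\<omega>. Y \<omega> * (I' t \<omega> - I' s \<omega>))"
          using int[OF mem(1)] int[OF mem(2)] by (auto intro!: iY)
        then show ?thesis by simp
      qed
      also have "\<dots> = 0"
        using integral_increment_orthogonal[OF P st(1) lt st(3) Z[OF mem(1)] Z[OF mem(2)] Y]
          integral_increment_orthogonal[OF P st(1) lt st(3) Z'[OF mem(1)] Z'[OF mem(2)] Y] by simp
      finally show "(\<integral>\<omega>. Y \<omega> * J \<omega> \<partial>P) = 0" .
    qed
    moreover have "(\<integral>\<omega>. H \<omega> * ((a * M t \<omega> - b * M' t \<omega>) - (a * M s \<omega> - b * M' s \<omega>)) \<partial>P) = (\<integral>\<omega>. H \<omega> * J \<omega> \<partial>P)"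
      by (rule Bochner_Integration.integral_cong) (use eq in auto)
    ultimately show ?thesis by simp
  qed simp
  show ?thesis unfolding martingale_under_def
    by (intro conjI ballI allI impI iX zero; (elim conjE)?; assumption)
qed

lemma grid_discrete_martingale:
  assumes P: "P \<in> \<P>" and X: "martingale_under P X"
    and N: "\<And>i. i \<le> n \<Longrightarrow> N i \<in> borel_measurable (Fil (grid T n i))"
    and eq: "\<And>i. i \<le> n \<Longrightarrow> AE \<omega> in P. N i \<omega> = X (grid T n i) \<omega>"
  shows "discrete_martingale P (\<lambda>i. Fil (grid T n i)) n N"
proof -
  interpret prob_space P by (rule P_prob[OF P])
  have T0: "0 \<le> T" using T by simp
  show ?thesis
  proof unfold_locales
    show "subalgebra P (Fil (grid T n i))" for i
      using grid_mem[OF T0] by (intro subalgebra_Fil_P[OF P]) auto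
    show "subalgebra (Fil (grid T n j)) (Fil (grid T n i))" if "i \<le> j" for i j
      by (intro subalgebra_Fil grid_mono_index T0 that)
    show "N i \<in> borel_measurable (Fil (grid T n i))" if "i \<le> n" for i by (rule N[OF that])
    fix i j H assume ij: "i \<le> j" "j \<le> n" and H: "H \<in> borel_measurable (Fil (grid T n i))"
      and int: "integrable P (\<lambda>\<omega>. H \<omega> * (N j \<omega> - N i \<omega>))"
    have i: "i \<le> n" using ij by simp
    have sub: "subalgebra P (Fil (grid T n i))" for i
      using grid_mem[OF T0] by (intro subalgebra_Fil_P[OF P]) auto
    have ae: "AE \<omega> in P. H \<omega> * (N j \<omega> - N i \<omega>) = H \<omega> * (X (grid T n j) \<omega> - X (grid T n i) \<omega>)"
      using eq[OF ij(2)] eq[OF i] by eventually_elim simp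
    note [measurable] = measurable_from_subalg[OF sub H] measurable_from_subalg[OF sub N[OF i]] measurable_from_subalg[OF sub N[OF ij(2)]]
    have iX: "integrable P (X (grid T n i))" for i
      using X grid_mem[OF T0] unfolding martingale_under_def by blast
    note [measurable] = borel_measurable_integrable[OF iX]
    have m1: "(\<lambda>\<omega>. H \<omega> * (N j \<omega> - N i \<omega>)) \<in> borel_measurable P" by measurable
    have m2: "(\<lambda>\<omega>. H \<omega> * (X (grid T n j) \<omega> - X (grid T n i) \<omega>)) \<in> borel_measurable P" by measurable
    have "integrable P (\<lambda>\<omega>. H \<omega> * (X (grid T n j) \<omega> - X (grid T n i) \<omega>))"
      using integrable_cong_AE[OF m1 m2 ae] int by simp
    then have "(\<integral>\<omega>. H \<omega> * (X (grid T n j) \<omega> - X (grid T n i) \<omega>) \<partial>P) = 0"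
      using X grid_mem[OF T0, of n i] grid_mem[OF T0, of n j] grid_mono_index[OF T0 ij(1)] H
      unfolding martingale_under_def by (auto dest!: spec[of _ "grid T n i"] spec[of _ "grid T n j"] spec[of _ H])
    then show "(\<integral>\<omega>. H \<omega> * (N j \<omega> - N i \<omega>) \<partial>P) = 0"
      using integral_cong_AE[OF m1 m2 ae] by simp
  qed
qed

lemma decomposition_K_measurable:
  assumes dec: "G_decomposition T \<P> E \<xi> M K" and t: "t \<in> {0..T}"
  shows "K t \<in> L_G T \<P> 1"
proof -
  have "(\<lambda>\<omega>. - K t \<omega>) \<in> L_G T \<P> 1"
    using dec t unfolding G_decomposition_def G_martingale_def by blast
  from L_G_diff[OF _ H0_L_G[OF H0_const[of T 0]] this] show ?thesis using T by simp
qed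

text \<open>Y is kept besides its version y, because the maximal inequality speaks of conditional
  expectations while the martingale argument needs \<open>Fil\<close>-measurable functions.\<close>

lemma grid_versions:
  assumes dec: "G_decomposition T \<P> E \<xi> M K" and P: "P \<in> \<P>"
  obtains Y y k where
    "\<And>i. is_cond_E T \<P> E (grid T n i) \<xi> (Y i)"
    "\<And>i. y i \<in> borel_measurable (Fil (grid T n i))" "\<And>i. k i \<in> borel_measurable (Fil (grid T n i))"
    "AE \<omega> in P. \<forall>i. Y i \<omega> = y i \<omega> \<and> K (grid T n i) \<omega> = k i \<omega> \<and> M (grid T n i) \<omega> = y i \<omega> + k i \<omega>"
proof -
  have mem: "grid T n i \<in> {0..T}" for i using grid_mem T by auto
  have "\<exists>Y y k. is_cond_E T \<P> E (grid T n i) \<xi> Y \<and> y \<in> borel_measurable (Fil (grid T n i)) \<and>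
      k \<in> borel_measurable (Fil (grid T n i)) \<and>
      (AE \<omega> in P. Y \<omega> = y \<omega> \<and> K (grid T n i) \<omega> = k \<omega> \<and> M (grid T n i) \<omega> = y \<omega> + k \<omega>)" for i
  proof -
    obtain Y where Y: "is_cond_E T \<P> E (grid T n i) \<xi> Y" "qs T \<P> (\<lambda>\<omega>. Y \<omega> = M (grid T n i) \<omega> - K (grid T n i) \<omega>)"
      using dec mem[of i] unfolding G_decomposition_def by blast
    obtain y where y: "y \<in> borel_measurable (Fil (grid T n i))" "AE \<omega> in P. Y \<omega> = y \<omega>"
      by (rule conditional_Fil_version[OF P mem Y(1)])
    \<comment> \<open>A G-martingale is its own conditional expectation at the same time, so -K has
      a \<open>Fil\<close> version like every conditional expectation.\<close>
    have "is_cond_E T \<P> E (grid T n i) (\<lambda>\<omega>. - K (grid T n i) \<omega>) (\<lambda>\<omega>. - K (grid T n i) \<omega>)"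
      using dec mem[of i] unfolding G_decomposition_def G_martingale_def by auto
    then obtain k where k: "k \<in> borel_measurable (Fil (grid T n i))" "AE \<omega> in P. - K (grid T n i) \<omega> = k \<omega>"
      by (rule conditional_Fil_version[OF P mem])
    have "AE \<omega> in P. Y \<omega> = y \<omega> \<and> K (grid T n i) \<omega> = - k \<omega> \<and> M (grid T n i) \<omega> = y \<omega> + - k \<omega>"
      using y(2) k(2) qs_AE[OF Y(2) P] by eventually_elim auto
    then show ?thesis using Y(1) y(1) k(1)
      by (intro exI[of _ Y] exI[of _ y] exI[of _ "\<lambda>\<omega>. - k \<omega>"]) auto
  qed
  then have "\<forall>i. \<exists>Z. is_cond_E T \<P> E (grid T n i) \<xi> (fst Z) \<and> fst (snd Z) \<in> borel_measurable (Fil (grid T n i)) \<and>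
      snd (snd Z) \<in> borel_measurable (Fil (grid T n i)) \<and>
      (AE \<omega> in P. fst Z \<omega> = fst (snd Z) \<omega> \<and> K (grid T n i) \<omega> = snd (snd Z) \<omega> \<and>
        M (grid T n i) \<omega> = fst (snd Z) \<omega> + snd (snd Z) \<omega>)"
    by (simp only: split_paired_Ex fst_conv snd_conv) blast
  from choice[OF this] obtain Z where Z: "\<forall>i. is_cond_E T \<P> E (grid T n i) \<xi> (fst (Z i)) \<and>
      fst (snd (Z i)) \<in> borel_measurable (Fil (grid T n i)) \<and>
      snd (snd (Z i)) \<in> borel_measurable (Fil (grid T n i)) \<and>
      (AE \<omega> in P. fst (Z i) \<omega> = fst (snd (Z i)) \<omega> \<and> K (grid T n i) \<omega> = snd (snd (Z i)) \<omega> \<and>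
        M (grid T n i) \<omega> = fst (snd (Z i)) \<omega> + snd (snd (Z i)) \<omega>)" ..
  define Y where "Y i = fst (Z i)" for i
  define y where "y i = fst (snd (Z i))" for i
  define k where "k i = snd (snd (Z i))" for i
  note * = Z[folded Y_def y_def k_def, rule_format]
  show ?thesis
  proof (rule that[of Y y k])
    show "AE \<omega> in P. \<forall>i. Y i \<omega> = y i \<omega> \<and> K (grid T n i) \<omega> = k i \<omega> \<and> M (grid T n i) \<omega> = y i \<omega> + k i \<omega>"
      unfolding AE_all_countable by (rule allI, rule *[THEN conjunct2, THEN conjunct2, THEN conjunct2])
  qed (rule *[THEN conjunct1] *[THEN conjunct2, THEN conjunct1] *[THEN conjunct2, THEN conjunct2, THEN conjunct1])+
qed

lemma decomposition_paths:
  assumes dec: "G_decomposition T \<P> E \<xi> M K" and P: "P \<in> \<P>"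
  shows "AE \<omega> in P. K 0 \<omega> = 0 \<and> continuous_on {0..T} (\<lambda>t. K t \<omega>) \<and> mono_on {0..T} (\<lambda>t. K t \<omega>)"
proof -
  have "qs T \<P> (\<lambda>\<omega>. K 0 \<omega> = 0 \<and> continuous_on {0..T} (\<lambda>t. K t \<omega>) \<and> mono_on {0..T} (\<lambda>t. K t \<omega>))"
    using dec unfolding G_decomposition_def by (elim conjE)
  then show ?thesis by (rule qs_AE[OF _ P])
qed

lemma path_on_grid:
  assumes "K 0 = 0" "mono_on {0..T} K"
  shows "K (grid T n 0) = 0" "K (grid T n i) \<le> K (grid T n (Suc i))" "0 \<le> K (grid T n i)"
proof -
  have mem: "grid T n i \<in> {0..T}" for i using grid_mem T by auto
  have T0: "0 \<le> T" using T by simp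
  show "K (grid T n 0) = 0" using assms by simp
  show "K (grid T n i) \<le> K (grid T n (Suc i))"
    by (rule mono_onD[OF assms(2) mem mem grid_mono_index[OF T0]]) simp
  have "K 0 \<le> K (grid T n i)" using mem[of i] T0 by (intro mono_onD[OF assms(2)]) auto
  then show "0 \<le> K (grid T n i)" using assms by simp
qed

end

section \<open>Moment bounds\<close>

lemma borel_measurable_running_max:
  "(\<And>i. i \<le> n \<Longrightarrow> X i \<in> borel_measurable M) \<Longrightarrow> (\<lambda>\<omega>. running_max (\<lambda>i. X i \<omega>) n) \<in> borel_measurable M"
proof (induction n)
  case (Suc n)
  then have [measurable]: "(\<lambda>\<omega>. running_max (\<lambda>i. X i \<omega>) n) \<in> borel_measurable M" "X (Suc n) \<in> borel_measurable M"
    by simp_all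
  show ?case by simp
next
  case 0
  then have [measurable]: "X 0 \<in> borel_measurable M" by simp
  show ?case by simp
qed

lemma nn_integral_le_integrable:
  assumes "f \<in> borel_measurable M" "\<And>x. 0 \<le> f x" "0 \<le> c" "(\<integral>\<^sup>+x. ennreal (f x) \<partial>M) \<le> ennreal c"
  shows "integrable M f" "(\<integral>x. f x \<partial>M) \<le> c"
proof -
  show i: "integrable M f"
    using assms(2,4) by (intro integrableI_bounded assms(1)) (auto simp: le_less_trans[OF _ ennreal_less_top])
  then show "(\<integral>x. f x \<partial>M) \<le> c"
    using nn_integral_eq_integral[OF i] assms by simp
qed

context G_expectation
begin

lemma decomposition_K_P_measurable:
  assumes "G_decomposition T \<P> E \<xi> M K" "P \<in> \<P>" "t \<in> {0..T}"
  shows "K t \<in> borel_measurable P"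
  by (rule L_G_P_measurable[OF assms(2) decomposition_K_measurable[OF assms(1,3)]])

lemma mesh_P_measurable:
  assumes "\<And>t. t \<in> {0..T} \<Longrightarrow> f t \<in> borel_measurable P"
  shows "(\<lambda>\<omega>. mesh T (\<lambda>t. f t \<omega>) n) \<in> borel_measurable P"
  unfolding mesh_def using T
  by (intro borel_measurable_running_max borel_measurable_diff assms grid_mem) auto

lemma version_moment:
  assumes Y: "\<And>i. is_cond_E T \<P> E (grid T n i) \<xi> (Y i)" "\<And>i. is_cond_E T \<P> E (grid T n i) \<xi>' (Y' i)"
    and D: "\<And>i. D i \<in> borel_measurable P" "AE \<omega> in P. \<forall>i. Y i \<omega> - Y' i \<omega> = D i \<omega>"
    and P: "P \<in> \<P>" and \<alpha>: "1 < \<alpha>" "\<alpha> < \<beta>"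
    and L: "0 < L" "Lp_dist \<P> \<beta> \<xi> \<xi>' \<le> ennreal (L powr \<beta>)"
  shows "integrable P (\<lambda>\<omega>. running_max (\<lambda>i. D i \<omega>) n powr \<alpha>)"
    "(\<integral>\<omega>. running_max (\<lambda>i. D i \<omega>) n powr \<alpha> \<partial>P) \<le> tail_const \<alpha> \<beta> * L powr \<alpha>"
proof -
  have T0: "0 \<le> T" using T by simp
  have [measurable]: "(\<lambda>\<omega>. running_max (\<lambda>i. D i \<omega>) n) \<in> borel_measurable P"
    by (rule borel_measurable_running_max) (rule D(1))
  have "(\<integral>\<^sup>+\<omega>. ennreal (running_max (\<lambda>i. D i \<omega>) n powr \<alpha>) \<partial>P)
      = (\<integral>\<^sup>+\<omega>. ennreal (running_max (\<lambda>i. Y i \<omega> - Y' i \<omega>) n powr \<alpha>) \<partial>P)"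
    using D(2) by (intro nn_integral_cong_AE) (auto elim!: eventually_mono)
  also have "\<dots> \<le> ennreal (tail_const \<alpha> \<beta> * L powr \<alpha>)"
    by (rule conditional_moment[OF Y grid_mem[OF T0] P \<alpha> L])
  finally have le: "(\<integral>\<^sup>+\<omega>. ennreal (running_max (\<lambda>i. D i \<omega>) n powr \<alpha>) \<partial>P) \<le> ennreal (tail_const \<alpha> \<beta> * L powr \<alpha>)" .
  have c: "0 \<le> tail_const \<alpha> \<beta> * L powr \<alpha>" using tail_const_ge[of \<alpha> \<beta>] \<alpha> by (intro mult_nonneg_nonneg) auto
  show "integrable P (\<lambda>\<omega>. running_max (\<lambda>i. D i \<omega>) n powr \<alpha>)"
    "(\<integral>\<omega>. running_max (\<lambda>i. D i \<omega>) n powr \<alpha> \<partial>P) \<le> tail_const \<alpha> \<beta> * L powr \<alpha>"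
    by (rule nn_integral_le_integrable[OF _ _ c le]; simp)+
qed

text \<open>The mesh of an increasing path from 0 is at most its end value, and \<open>K T\<close>
  is integrable; dominated convergence asks for no higher moment.\<close>

lemma mesh_integral_tendsto:
  assumes dec: "G_decomposition T \<P> E \<xi> M K" and P: "P \<in> \<P>"
  shows "integrable P (\<lambda>\<omega>. mesh T (\<lambda>t. K t \<omega>) n)"
    "(\<lambda>n. \<integral>\<omega>. mesh T (\<lambda>t. K t \<omega>) n \<partial>P) \<longlonglongrightarrow> 0"
proof -
  have T0: "0 \<le> T" "T \<in> {0..T}" using T by auto
  note K = decomposition_K_P_measurable[OF dec P]
  have iK: "integrable P (K T)" by (rule L_G1_integrable[OF decomposition_K_measurable[OF dec T0(2)] P])
  have le: "AE \<omega> in P. norm (mesh T (\<lambda>t. K t \<omega>) n) \<le> K T \<omega>" for n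
    using decomposition_paths[OF dec P]
  proof eventually_elim
    case (elim \<omega>)
    then show ?case using mesh_le[OF T0(1), of "\<lambda>t. K t \<omega>" n] by simp
  qed
  show "integrable P (\<lambda>\<omega>. mesh T (\<lambda>t. K t \<omega>) n)"
    by (rule Bochner_Integration.integrable_bound[OF iK mesh_P_measurable[OF K]])
      (use le[of n] in \<open>auto elim!: eventually_mono\<close>)
  have "(\<lambda>n. \<integral>\<omega>. mesh T (\<lambda>t. K t \<omega>) n \<partial>P) \<longlonglongrightarrow> (\<integral>\<omega>. 0 \<partial>P)"
  proof (rule integral_dominated_convergence[where w="K T"])
    show "AE \<omega> in P. (\<lambda>n. mesh T (\<lambda>t. K t \<omega>) n) \<longlonglongrightarrow> 0"
      using decomposition_paths[OF dec P] by eventually_elim (rule mesh_tendsto[OF T], simp)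
    show "(\<lambda>\<omega>. mesh T (\<lambda>t. K t \<omega>) n) \<in> borel_measurable P" for n
      by (rule mesh_P_measurable[OF K])
  qed (use iK le in auto)
  then show "(\<lambda>n. \<integral>\<omega>. mesh T (\<lambda>t. K t \<omega>) n \<partial>P) \<longlonglongrightarrow> 0" by simp
qed

text \<open>\<open>increasing_part_bound\<close> for N = Y + K, the martingale M at the grid times,
  with the running maximum of Y as Q.\<close>

lemma truncated_K_moment:
  assumes dec: "G_decomposition T \<P> E \<xi> M K" and P: "P \<in> \<P>" and \<alpha>: "1 < \<alpha>" "\<alpha> < \<beta>"
    and L: "0 < L" "Lp_dist \<P> \<beta> \<xi> (\<lambda>_. 0) \<le> ennreal (L powr \<beta>)" and c: "0 < c" and n: "0 < n"
  shows "(\<integral>\<omega>. min (K T \<omega>) c powr \<alpha> \<partial>P)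
    \<le> (4 * \<alpha>) powr \<alpha> * (tail_const \<alpha> \<beta> * L powr \<alpha>) + 2 * \<alpha> * c powr (\<alpha> - 1) * (\<integral>\<omega>. mesh T (\<lambda>t. K t \<omega>) n \<partial>P)"
proof -
  have T0: "0 \<le> T" "T \<in> {0..T}" using T by auto
  obtain Y y k where Y: "\<And>i. is_cond_E T \<P> E (grid T n i) \<xi> (Y i)"
    and yF: "\<And>i. y i \<in> borel_measurable (Fil (grid T n i))" and kF: "\<And>i. k i \<in> borel_measurable (Fil (grid T n i))"
    and ae: "AE \<omega> in P. \<forall>i. Y i \<omega> = y i \<omega> \<and> K (grid T n i) \<omega> = k i \<omega> \<and> M (grid T n i) \<omega> = y i \<omega> + k i \<omega>"
    by (rule grid_versions[OF dec P, of n]) blast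
  define N where "N i \<omega> = y i \<omega> + k i \<omega>" for i \<omega>
  have mart: "martingale_under P (\<lambda>t \<omega>. 1 * M t \<omega> - 0 * M t \<omega>)" by (rule martingale_part[OF dec dec P])
  have dm: "discrete_martingale P (\<lambda>i. Fil (grid T n i)) n N"
  proof (rule grid_discrete_martingale[OF P mart])
    show "N i \<in> borel_measurable (Fil (grid T n i))" for i
      unfolding N_def by (rule borel_measurable_add[OF yF kF])
    show "AE \<omega> in P. N i \<omega> = 1 * M (grid T n i) \<omega> - 0 * M (grid T n i) \<omega>" for i
      using ae by eventually_elim (simp add: N_def)
  qed
  interpret dm: discrete_martingale P "\<lambda>i. Fil (grid T n i)" n N by (rule dm)
  have y: "y i \<in> borel_measurable P" for i by (rule dm.measurable_M[OF yF])
  have k: "k i \<in> borel_measurable P" for i by (rule dm.measurable_M[OF kF])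
  define Q where "Q \<omega> = running_max (\<lambda>i. y i \<omega>) n" for \<omega>
  have Q: "Q \<in> borel_measurable P" unfolding Q_def by (rule borel_measurable_running_max[OF y])
  have zero: "is_cond_E T \<P> E (grid T n i) (\<lambda>_. 0) (\<lambda>_. 0)" for i
    by (rule is_cond_E_zero[OF grid_mem[OF T0(1)]])
  have aeD: "AE \<omega> in P. \<forall>i. Y i \<omega> - 0 = y i \<omega>" using ae by eventually_elim simp
  note Qm = version_moment[OF Y zero y aeD P \<alpha> L, folded Q_def]
  have N: "integrable P (N i)" for i
  proof -
    have iM: "integrable P (\<lambda>\<omega>. 1 * M (grid T n i) \<omega> - 0 * M (grid T n i) \<omega>)"
      using mart grid_mem[OF T0(1), of n i] unfolding martingale_under_def by blast
    have Nm: "N i \<in> borel_measurable P" unfolding N_def by (rule borel_measurable_add[OF y k])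
    show ?thesis
      by (rule integrable_cong_AE_imp[OF iM Nm]) (use ae in \<open>auto simp: N_def elim!: eventually_mono\<close>)
  qed
  have path: "AE \<omega> in P. k 0 \<omega> = 0 \<and> (\<forall>i<n. k i \<omega> \<le> k (Suc i) \<omega> \<and> k (Suc i) \<omega> - k i \<omega> \<le> mesh T (\<lambda>t. K t \<omega>) n)
      \<and> (\<forall>i\<le>n. \<bar>N i \<omega> - k i \<omega>\<bar> \<le> Q \<omega>) \<and> 0 \<le> mesh T (\<lambda>t. K t \<omega>) n"
    using ae decomposition_paths[OF dec P]
  proof eventually_elim
    case (elim \<omega>)
    have K: "k i \<omega> = K (grid T n i) \<omega>" for i using elim(1) by simp
    show ?case
      using path_on_grid[of "\<lambda>t. K t \<omega>" n] elim(2) mesh_ge[of _ n "\<lambda>t. K t \<omega>" T] running_max_ge[of _ n "\<lambda>i. y i \<omega>"]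
      by (simp add: K N_def Q_def)
  qed
  have "(\<integral>\<omega>. min (k n \<omega>) c powr \<alpha> \<partial>P)
     \<le> (4 * \<alpha>) powr \<alpha> * (\<integral>\<omega>. Q \<omega> powr \<alpha> \<partial>P) + 2 * \<alpha> * c powr (\<alpha> - 1) * (\<integral>\<omega>. mesh T (\<lambda>t. K t \<omega>) n \<partial>P)"
    by (rule dm.increasing_part_bound[OF \<alpha>(1) c kF N path mesh_integral_tendsto(1)[OF dec P] Qm(1) Q])
  moreover have "(4 * \<alpha>) powr \<alpha> * (\<integral>\<omega>. Q \<omega> powr \<alpha> \<partial>P) \<le> (4 * \<alpha>) powr \<alpha> * (tail_const \<alpha> \<beta> * L powr \<alpha>)"
    by (rule mult_left_mono[OF Qm(2)]) simp
  moreover have "(\<integral>\<omega>. min (k n \<omega>) c powr \<alpha> \<partial>P) = (\<integral>\<omega>. min (K T \<omega>) c powr \<alpha> \<partial>P)"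
  proof (rule integral_cong_AE)
    note [measurable] = k decomposition_K_P_measurable[OF dec P T0(2)]
    show "(\<lambda>\<omega>. min (k n \<omega>) c powr \<alpha>) \<in> borel_measurable P" "(\<lambda>\<omega>. min (K T \<omega>) c powr \<alpha>) \<in> borel_measurable P"
      by measurable
    show "AE \<omega> in P. min (k n \<omega>) c powr \<alpha> = min (K T \<omega>) c powr \<alpha>"
      using ae
    proof eventually_elim
      case (elim \<omega>)
      from spec[OF elim, of n] show ?case by (simp add: grid_n[OF n])
    qed
  qed
  ultimately show ?thesis by linarith
qed

text \<open>The order of the limits matters: for fixed c the mesh term vanishes as the grid is
  refined, and only then does c tend to infinity, by Fatou's lemma.\<close>

lemma K_moment:
  assumes dec: "G_decomposition T \<P> E \<xi> M K" and P: "P \<in> \<P>" and \<alpha>: "1 < \<alpha>" "\<alpha> < \<beta>"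
    and L: "0 < L" "Lp_dist \<P> \<beta> \<xi> (\<lambda>_. 0) \<le> ennreal (L powr \<beta>)"
  shows "(\<integral>\<^sup>+\<omega>. ennreal (\<bar>K T \<omega>\<bar> powr \<alpha>) \<partial>P) \<le> ennreal ((4 * \<alpha>) powr \<alpha> * (tail_const \<alpha> \<beta> * L powr \<alpha>))"
proof -
  have T0: "0 \<le> T" "T \<in> {0..T}" using T by auto
  note [measurable] = decomposition_K_P_measurable[OF dec P T0(2)]
  interpret prob_space P by (rule P_prob[OF P])
  define W where "W = (4 * \<alpha>) powr \<alpha> * (tail_const \<alpha> \<beta> * L powr \<alpha>)"
  have K0: "AE \<omega> in P. 0 \<le> K T \<omega>"
    using decomposition_paths[OF dec P]
  proof eventually_elim
    case (elim \<omega>)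
    then show ?case using mono_onD[of "{0..T}" "\<lambda>t. K t \<omega>" 0 T] T0 by simp
  qed
  have trunc: "(\<integral>\<omega>. min (K T \<omega>) c powr \<alpha> \<partial>P) \<le> W" if c: "0 < c" for c
  proof (rule LIMSEQ_le_const)
    have "(\<lambda>n. W + 2 * \<alpha> * c powr (\<alpha> - 1) * (\<integral>\<omega>. mesh T (\<lambda>t. K t \<omega>) n \<partial>P)) \<longlonglongrightarrow> W + 2 * \<alpha> * c powr (\<alpha> - 1) * 0"
      by (rule tendsto_add[OF tendsto_const tendsto_mult_left[OF mesh_integral_tendsto(2)[OF dec P]]])
    then show "(\<lambda>n. W + 2 * \<alpha> * c powr (\<alpha> - 1) * (\<integral>\<omega>. mesh T (\<lambda>t. K t \<omega>) n \<partial>P)) \<longlonglongrightarrow> W" by simp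
    show "\<exists>N. \<forall>n\<ge>N. (\<integral>\<omega>. min (K T \<omega>) c powr \<alpha> \<partial>P) \<le> W + 2 * \<alpha> * c powr (\<alpha> - 1) * (\<integral>\<omega>. mesh T (\<lambda>t. K t \<omega>) n \<partial>P)"
      unfolding W_def by (intro exI[of _ 1] allI impI truncated_K_moment[OF dec P \<alpha> L c]) simp
  qed
  show ?thesis
    unfolding W_def[symmetric]
  proof (rule nn_integral_limit_le[where u="\<lambda>j \<omega>. ennreal (min (K T \<omega>) (real (Suc j)) powr \<alpha>)"])
    show "(\<lambda>\<omega>. ennreal (min (K T \<omega>) (real (Suc j)) powr \<alpha>)) \<in> borel_measurable P" for j by measurable
    show "AE \<omega> in P. (\<lambda>j. ennreal (min (K T \<omega>) (real (Suc j)) powr \<alpha>)) \<longlonglongrightarrow> ennreal (\<bar>K T \<omega>\<bar> powr \<alpha>)"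
      using K0
    proof eventually_elim
      case (elim \<omega>)
      obtain j0 :: nat where j0: "K T \<omega> \<le> real j0" using real_arch_simple by blast
      have "\<forall>\<^sub>F j in sequentially. ennreal (min (K T \<omega>) (real (Suc j)) powr \<alpha>) = ennreal (\<bar>K T \<omega>\<bar> powr \<alpha>)"
        unfolding eventually_sequentially
      proof (intro exI[of _ j0] allI impI)
        fix j assume "j0 \<le> j"
        then have "K T \<omega> \<le> real (Suc j)" using j0 by simp
        then show "ennreal (min (K T \<omega>) (real (Suc j)) powr \<alpha>) = ennreal (\<bar>K T \<omega>\<bar> powr \<alpha>)"
          using elim by (simp add: min_def)
      qed
      then show ?case by (rule tendsto_eventually)
    qed
    fix j
    have "integrable P (\<lambda>\<omega>. min (K T \<omega>) (real (Suc j)) powr \<alpha>)"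
    proof (rule integrable_const_bound[of _ "real (Suc j) powr \<alpha>"])
      show "AE \<omega> in P. norm (min (K T \<omega>) (real (Suc j)) powr \<alpha>) \<le> real (Suc j) powr \<alpha>"
        using K0 by eventually_elim (use \<alpha> in \<open>simp add: powr_mono2\<close>)
    qed measurable
    then have "(\<integral>\<^sup>+\<omega>. ennreal (min (K T \<omega>) (real (Suc j)) powr \<alpha>) \<partial>P) = ennreal (\<integral>\<omega>. min (K T \<omega>) (real (Suc j)) powr \<alpha> \<partial>P)"
      by (rule nn_integral_eq_integral) simp
    then show "(\<integral>\<^sup>+\<omega>. ennreal (min (K T \<omega>) (real (Suc j)) powr \<alpha>) \<partial>P) \<le> ennreal W"
      using trunc[of "real (Suc j)"] by (simp add: ennreal_leI)
  qed
qed

text \<open>The floor \<epsilon> of the running maximum is taken to be x, the bound on the norm of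
  \<xi> - \<xi>', so that x + R still has its \<alpha>-th moment of order x powr \<alpha>; X is the
  resulting bound. Young's inequality with the best weight s turns the mixed term into sqrt (X *
  v).\<close>

lemma difference_step:
  assumes C: "0 \<le> C"
    and bound: "difference_constant P \<alpha> C"
    and dec: "G_decomposition T \<P> E \<xi> M K" "G_decomposition T \<P> E \<xi>' M' K'"
    and P: "P \<in> \<P>" and \<alpha>: "1 < \<alpha>" "\<alpha> < \<beta>"
    and x: "0 < x" "Lp_dist \<P> \<beta> \<xi> \<xi>' \<le> ennreal (x powr \<beta>)"
    and V: "integrable P (\<lambda>\<omega>. (K T \<omega> + K' T \<omega>) powr \<alpha>)" "(\<integral>\<omega>. (K T \<omega> + K' T \<omega>) powr \<alpha> \<partial>P) \<le> v" "0 < v"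
    and X: "X = 2 powr \<alpha> * ((1 + tail_const \<alpha> \<beta>) * x powr \<alpha>)" and n: "0 < n"
  shows "integrable P (\<lambda>\<omega>. \<bar>M T \<omega> - M' T \<omega>\<bar> powr \<alpha>) \<and>
    (\<integral>\<omega>. \<bar>M T \<omega> - M' T \<omega>\<bar> powr \<alpha> \<partial>P) \<le> 2 powr \<alpha> * (X + C * (X + sqrt (X * v)
      + (\<integral>\<omega>. grid_error \<alpha> (x * x) (mesh T (\<lambda>t. K t \<omega> + K' t \<omega>) n) (K T \<omega> + K' T \<omega>) \<partial>P)))"
proof -
  have T0: "0 \<le> T" "T \<in> {0..T}" using T by auto
  interpret P: prob_space P by (rule P_prob[OF P])
  obtain Y y k where Y: "\<And>i. is_cond_E T \<P> E (grid T n i) \<xi> (Y i)"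
    and yF: "\<And>i. y i \<in> borel_measurable (Fil (grid T n i))" and kF: "\<And>i. k i \<in> borel_measurable (Fil (grid T n i))"
    and ae: "AE \<omega> in P. \<forall>i. Y i \<omega> = y i \<omega> \<and> K (grid T n i) \<omega> = k i \<omega> \<and> M (grid T n i) \<omega> = y i \<omega> + k i \<omega>"
    by (rule grid_versions[OF dec(1) P, of n]) blast
  obtain Y' y' k' where Y': "\<And>i. is_cond_E T \<P> E (grid T n i) \<xi>' (Y' i)"
    and yF': "\<And>i. y' i \<in> borel_measurable (Fil (grid T n i))" and kF': "\<And>i. k' i \<in> borel_measurable (Fil (grid T n i))"
    and ae': "AE \<omega> in P. \<forall>i. Y' i \<omega> = y' i \<omega> \<and> K' (grid T n i) \<omega> = k' i \<omega> \<and> M' (grid T n i) \<omega> = y' i \<omega> + k' i \<omega>"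
    by (rule grid_versions[OF dec(2) P, of n]) blast
  define D where "D i \<omega> = y i \<omega> - y' i \<omega>" for i \<omega>
  define V where "V \<omega> = K T \<omega> + K' T \<omega>" for \<omega>
  define \<delta> where "\<delta> \<omega> = mesh T (\<lambda>t. K t \<omega> + K' t \<omega>) n" for \<omega>
  define R where "R \<omega> = running_max (\<lambda>i. D i \<omega>) n" for \<omega>
  have DF: "D i \<in> borel_measurable (Fil (grid T n i))" for i
    unfolding D_def by (rule borel_measurable_diff[OF yF yF'])
  have mart: "martingale_under P (\<lambda>t \<omega>. 1 * M t \<omega> - 1 * M' t \<omega>)" by (rule martingale_part[OF dec P])
  have dm: "discrete_martingale P (\<lambda>i. Fil (grid T n i)) n (\<lambda>i \<omega>. D i \<omega> + (k i \<omega> - k' i \<omega>))"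
  proof (rule grid_discrete_martingale[OF P mart])
    show "(\<lambda>\<omega>. D i \<omega> + (k i \<omega> - k' i \<omega>)) \<in> borel_measurable (Fil (grid T n i))" for i
      by (intro borel_measurable_add borel_measurable_diff DF kF kF')
    show "AE \<omega> in P. D i \<omega> + (k i \<omega> - k' i \<omega>) = 1 * M (grid T n i) \<omega> - 1 * M' (grid T n i) \<omega>" for i
      using ae ae' by eventually_elim (simp add: D_def)
  qed
  interpret dm: discrete_martingale P "\<lambda>i. Fil (grid T n i)" n "\<lambda>i \<omega>. D i \<omega> + (k i \<omega> - k' i \<omega>)" by (rule dm)
  have D: "D i \<in> borel_measurable P" for i by (rule dm.measurable_M[OF DF])
  note K_meas = decomposition_K_P_measurable[OF dec(1) P] decomposition_K_P_measurable[OF dec(2) P]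
  have [measurable]: "\<delta> \<in> borel_measurable P"
    unfolding \<delta>_def by (intro mesh_P_measurable borel_measurable_add K_meas)
  have [measurable]: "R \<in> borel_measurable P" unfolding R_def by (rule borel_measurable_running_max[OF D])
  note [measurable] = K_meas(1)[OF T0(2)] K_meas(2)[OF T0(2)] dm.measurable_M[OF kF] dm.measurable_M[OF kF']
  have V_M[measurable]: "V \<in> borel_measurable P" unfolding V_def by measurable
  have aeD: "AE \<omega> in P. \<forall>i. Y i \<omega> - Y' i \<omega> = D i \<omega>" using ae ae' by eventually_elim (simp add: D_def)
  note Rm = version_moment[OF Y Y' D aeD P \<alpha> x, folded R_def]
  have aeT: "AE \<omega> in P. K T \<omega> = k n \<omega> \<and> K' T \<omega> = k' n \<omega> \<and> M T \<omega> - M' T \<omega> = D n \<omega> + (K T \<omega> - K' T \<omega>)"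
    using ae ae'
  proof eventually_elim
    case (elim \<omega>)
    from spec[OF elim(1), of n] spec[OF elim(2), of n] show ?case by (simp add: grid_n[OF n] D_def)
  qed
  have aeV: "AE \<omega> in P. k n \<omega> + k' n \<omega> = V \<omega>" using aeT by eventually_elim (simp add: V_def)
  have path: "AE \<omega> in P. k 0 \<omega> = 0 \<and> k' 0 \<omega> = 0 \<and> 0 \<le> \<delta> \<omega> \<and> \<delta> \<omega> \<le> k n \<omega> + k' n \<omega> \<and>
        (\<forall>i<n. k i \<omega> \<le> k (Suc i) \<omega> \<and> k' i \<omega> \<le> k' (Suc i) \<omega> \<and>
               (k (Suc i) \<omega> + k' (Suc i) \<omega>) - (k i \<omega> + k' i \<omega>) \<le> \<delta> \<omega>)"
    using ae ae' decomposition_paths[OF dec(1) P] decomposition_paths[OF dec(2) P]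
  proof eventually_elim
    case (elim \<omega>)
    have K: "k i \<omega> = K (grid T n i) \<omega>" "k' i \<omega> = K' (grid T n i) \<omega>" for i using elim(1,2) by simp_all
    have mono: "mono_on {0..T} (\<lambda>t. K t \<omega> + K' t \<omega>)"
      using elim(3,4) by (auto simp: mono_on_def intro!: add_mono)
    have "\<delta> \<omega> \<le> K T \<omega> + K' T \<omega>"
      unfolding \<delta>_def using mesh_le[OF T0(1) _ mono] elim(3,4) by simp
    then show ?case
      using path_on_grid[of "\<lambda>t. K t \<omega>" n] path_on_grid[of "\<lambda>t. K' t \<omega>" n] elim(3,4)
        mesh_ge[of _ n "\<lambda>t. K t \<omega> + K' t \<omega>" T]
      by (simp add: K \<delta>_def grid_n[OF n])
  qed
  have V0: "AE \<omega> in P. 0 \<le> V \<omega>" using path aeV by eventually_elim linarith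
  have ikV: "integrable P (\<lambda>\<omega>. (k n \<omega> + k' n \<omega>) powr \<alpha>)"
    by (rule integrable_cong_AE_imp[OF V(1)]) (use aeV in \<open>auto simp: V_def elim!: eventually_mono\<close>)
  have "(\<integral>\<omega>. \<bar>k n \<omega> - k' n \<omega>\<bar> powr \<alpha> \<partial>P) = (\<integral>\<omega>. \<bar>K T \<omega> - K' T \<omega>\<bar> powr \<alpha> \<partial>P)"
  proof (rule integral_cong_AE)
    show "AE \<omega> in P. \<bar>k n \<omega> - k' n \<omega>\<bar> powr \<alpha> = \<bar>K T \<omega> - K' T \<omega>\<bar> powr \<alpha>"
      using aeT by eventually_elim simp
  qed measurable
  moreover have
    "(\<integral>\<omega>. ((x + R \<omega>) * (k n \<omega> + k' n \<omega>)) powr (\<alpha> / 2) \<partial>P) = (\<integral>\<omega>. ((x + R \<omega>) * V \<omega>) powr (\<alpha> / 2) \<partial>P)"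
    "(\<integral>\<omega>. grid_error \<alpha> (x * x) (\<delta> \<omega>) (k n \<omega> + k' n \<omega>) \<partial>P) = (\<integral>\<omega>. grid_error \<alpha> (x * x) (\<delta> \<omega>) (V \<omega>) \<partial>P)"
    using aeV by (auto intro!: integral_cong_AE elim!: eventually_mono)
  ultimately
  have main: "(\<integral>\<omega>. \<bar>K T \<omega> - K' T \<omega>\<bar> powr \<alpha> \<partial>P) \<le> C * ((\<integral>\<omega>. (x + R \<omega>) powr \<alpha> \<partial>P)
      + (\<integral>\<omega>. ((x + R \<omega>) * V \<omega>) powr (\<alpha> / 2) \<partial>P) + (\<integral>\<omega>. grid_error \<alpha> (x * x) (\<delta> \<omega>) (V \<omega>) \<partial>P))"
    using bound[unfolded difference_constant_def, rule_format, of "\<lambda>i. Fil (grid T n i)" n D k k' x \<delta>, OF dm x(1) DF kF kF' _ path ikV Rm(1)[unfolded R_def], folded R_def] by simp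
  define t where "t = tail_const \<alpha> \<beta>"
  have t: "1 \<le> t" unfolding t_def using tail_const_ge[of \<alpha> \<beta>] \<alpha> by simp
  have X': "X = 2 powr \<alpha> * (x powr \<alpha> + t * x powr \<alpha>)" by (simp add: X t_def algebra_simps)
  have X0: "0 < X" using x t by (auto simp: X' intro!: mult_pos_pos add_pos_pos)
  have R0: "0 \<le> R \<omega>" for \<omega> by (simp add: R_def)
  have powR: "(x + R \<omega>) powr \<alpha> \<le> 2 powr \<alpha> * (x powr \<alpha> + R \<omega> powr \<alpha>)" for \<omega>
    using x R0 \<alpha> by (intro powr_add_le) auto
  have iR: "integrable P (\<lambda>\<omega>. 2 powr \<alpha> * (x powr \<alpha> + R \<omega> powr \<alpha>))" using Rm(1) by simp
  have ixR: "integrable P (\<lambda>\<omega>. (x + R \<omega>) powr \<alpha>)"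
    by (rule Bochner_Integration.integrable_bound[OF iR]) (use powR in \<open>auto simp: abs_mult\<close>)
  have "(\<integral>\<omega>. (x + R \<omega>) powr \<alpha> \<partial>P) \<le> (\<integral>\<omega>. 2 powr \<alpha> * (x powr \<alpha> + R \<omega> powr \<alpha>) \<partial>P)"
    by (rule integral_mono[OF ixR iR powR])
  also have "\<dots> = 2 powr \<alpha> * (x powr \<alpha> + (\<integral>\<omega>. R \<omega> powr \<alpha> \<partial>P))"
    using Rm(1) by (simp add: P.prob_space)
  also have "\<dots> \<le> X" unfolding X' t_def by (intro mult_left_mono add_left_mono Rm(2)) simp
  finally have EX: "(\<integral>\<omega>. (x + R \<omega>) powr \<alpha> \<partial>P) \<le> X" .
  \<comment> \<open>The weight for which s * X and v / s agree.\<close>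
  define s where "s = sqrt (v / X)"
  have s: "0 < s" using V(3) X0 by (simp add: s_def)
  have young: "((x + R \<omega>) * V \<omega>) powr (\<alpha> / 2) \<le> (s * (x + R \<omega>) powr \<alpha> + V \<omega> powr \<alpha> / s) / 2" if "0 \<le> V \<omega>" for \<omega>
  proof -
    define a where "a = (x + R \<omega>) powr (\<alpha> / 2)"
    define b where "b = V \<omega> powr (\<alpha> / 2)"
    have "0 \<le> (s * a - b)\<^sup>2 / s" using s by simp
    also have "\<dots> = s * (a * a) - 2 * (a * b) + b * b / s"
      using s by (simp add: power2_eq_square field_simps)
    finally have "a * b \<le> (s * (a * a) + b * b / s) / 2" by simp
    moreover have "a * a = (x + R \<omega>) powr \<alpha>" "b * b = V \<omega> powr \<alpha>"
      by (simp_all add: a_def b_def flip: powr_add)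
    moreover have "((x + R \<omega>) * V \<omega>) powr (\<alpha> / 2) = a * b"
      using x R0[of \<omega>] that by (simp add: a_def b_def powr_mult)
    ultimately show ?thesis by simp
  qed
  have iV: "integrable P (\<lambda>\<omega>. V \<omega> powr \<alpha>)" using V(1) by (simp add: V_def)
  have iy: "integrable P (\<lambda>\<omega>. (s * (x + R \<omega>) powr \<alpha> + V \<omega> powr \<alpha> / s) / 2)" using ixR iV by simp
  have "(\<integral>\<omega>. ((x + R \<omega>) * V \<omega>) powr (\<alpha> / 2) \<partial>P) \<le> (\<integral>\<omega>. (s * (x + R \<omega>) powr \<alpha> + V \<omega> powr \<alpha> / s) / 2 \<partial>P)"
  proof (rule integral_mono_AE[OF _ iy])
    show "AE \<omega> in P. ((x + R \<omega>) * V \<omega>) powr (\<alpha> / 2) \<le> (s * (x + R \<omega>) powr \<alpha> + V \<omega> powr \<alpha> / s) / 2"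
      using V0 by eventually_elim (rule young)
    then show "integrable P (\<lambda>\<omega>. ((x + R \<omega>) * V \<omega>) powr (\<alpha> / 2))"
      by (intro Bochner_Integration.integrable_bound[OF iy]) (auto elim!: eventually_mono)
  qed
  also have "\<dots> = (s * (\<integral>\<omega>. (x + R \<omega>) powr \<alpha> \<partial>P) + (\<integral>\<omega>. V \<omega> powr \<alpha> \<partial>P) / s) / 2" using ixR iV by simp
  also have "\<dots> \<le> (s * X + v / s) / 2"
    using s EX V(2) by (intro divide_right_mono add_mono mult_left_mono) (auto simp: V_def)
  also have "\<dots> = sqrt (X * v)"
  proof -
    have ss: "s * s = v / X" using V(3) X0 by (simp add: s_def)
    have "s * X = v / s" using ss s X0 by (simp add: field_simps)
    moreover have "s * X = sqrt (X * v)"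
    proof -
      have "s * X = sqrt v * (X / sqrt X)" by (simp add: s_def real_sqrt_divide)
      then show ?thesis using X0 real_div_sqrt[of X] by (simp add: real_sqrt_mult mult.commute)
    qed
    ultimately show ?thesis by simp
  qed
  finally have EV: "(\<integral>\<omega>. ((x + R \<omega>) * V \<omega>) powr (\<alpha> / 2) \<partial>P) \<le> sqrt (X * v)" .
  define e where "e = (\<integral>\<omega>. grid_error \<alpha> (x * x) (\<delta> \<omega>) (V \<omega>) \<partial>P)"
  have KK: "(\<integral>\<omega>. \<bar>K T \<omega> - K' T \<omega>\<bar> powr \<alpha> \<partial>P) \<le> C * (X + sqrt (X * v) + e)"
    using order_trans[OF main mult_left_mono[OF add_mono[OF add_mono[OF EX EV] order_refl] C]] by (simp add: e_def)
  have Mle: "AE \<omega> in P. \<bar>M T \<omega> - M' T \<omega>\<bar> powr \<alpha> \<le> 2 powr \<alpha> * (R \<omega> powr \<alpha> + \<bar>K T \<omega> - K' T \<omega>\<bar> powr \<alpha>)"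
    using aeT
  proof eventually_elim
    case (elim \<omega>)
    have "\<bar>M T \<omega> - M' T \<omega>\<bar> \<le> R \<omega> + \<bar>K T \<omega> - K' T \<omega>\<bar>"
      using elim running_max_ge[OF order_refl, of "\<lambda>i. D i \<omega>" n] by (simp add: R_def)
    then have "\<bar>M T \<omega> - M' T \<omega>\<bar> powr \<alpha> \<le> (R \<omega> + \<bar>K T \<omega> - K' T \<omega>\<bar>) powr \<alpha>"
      using \<alpha> by (intro powr_mono2) auto
    also have "\<dots> \<le> 2 powr \<alpha> * (R \<omega> powr \<alpha> + \<bar>K T \<omega> - K' T \<omega>\<bar> powr \<alpha>)"
      using R0 \<alpha> by (intro powr_add_le) auto
    finally show ?case .
  qed
  have iKK: "integrable P (\<lambda>\<omega>. \<bar>K T \<omega> - K' T \<omega>\<bar> powr \<alpha>)"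
  proof (rule Bochner_Integration.integrable_bound[OF iV])
    show "AE \<omega> in P. norm (\<bar>K T \<omega> - K' T \<omega>\<bar> powr \<alpha>) \<le> norm (V \<omega> powr \<alpha>)"
      using decomposition_paths[OF dec(1) P] decomposition_paths[OF dec(2) P]
    proof eventually_elim
      case (elim \<omega>)
      have "0 \<le> K T \<omega>" "0 \<le> K' T \<omega>"
        using elim path_on_grid(3)[of "\<lambda>t. K t \<omega>" n n] path_on_grid(3)[of "\<lambda>t. K' t \<omega>" n n] by (auto simp: grid_n[OF n])
      then show ?case unfolding V_def using \<alpha> by (auto intro!: powr_mono2)
    qed
  qed measurable
  have iRHS: "integrable P (\<lambda>\<omega>. 2 powr \<alpha> * (R \<omega> powr \<alpha> + \<bar>K T \<omega> - K' T \<omega>\<bar> powr \<alpha>))" using Rm(1) iKK by simp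
  have iMM: "integrable P (\<lambda>\<omega>. M T \<omega> - M' T \<omega>)"
    using mart T0 unfolding martingale_under_def by auto
  have iM: "integrable P (\<lambda>\<omega>. \<bar>M T \<omega> - M' T \<omega>\<bar> powr \<alpha>)"
    using Mle borel_measurable_integrable[OF iMM]
    by (intro Bochner_Integration.integrable_bound[OF iRHS]) (auto elim!: eventually_mono)
  have "(\<integral>\<omega>. \<bar>M T \<omega> - M' T \<omega>\<bar> powr \<alpha> \<partial>P) \<le> (\<integral>\<omega>. 2 powr \<alpha> * (R \<omega> powr \<alpha> + \<bar>K T \<omega> - K' T \<omega>\<bar> powr \<alpha>) \<partial>P)"
    by (rule integral_mono_AE[OF iM iRHS Mle])
  also have "\<dots> = 2 powr \<alpha> * ((\<integral>\<omega>. R \<omega> powr \<alpha> \<partial>P) + (\<integral>\<omega>. \<bar>K T \<omega> - K' T \<omega>\<bar> powr \<alpha> \<partial>P))"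
    using Rm(1) iKK by simp
  also have "\<dots> \<le> 2 powr \<alpha> * (X + C * (X + sqrt (X * v) + e))"
  proof (intro mult_left_mono add_mono KK)
    have "(\<integral>\<omega>. R \<omega> powr \<alpha> \<partial>P) \<le> (\<integral>\<omega>. (x + R \<omega>) powr \<alpha> \<partial>P)"
      using R0 x \<alpha> by (intro integral_mono Rm(1) ixR powr_mono2) auto
    then show "(\<integral>\<omega>. R \<omega> powr \<alpha> \<partial>P) \<le> X" using EX by simp
  qed simp
  finally show ?thesis using iM unfolding e_def \<delta>_def V_def by simp
qed


lemma K_sum_moment:
  assumes dec: "G_decomposition T \<P> E \<xi> M K" "G_decomposition T \<P> E \<xi>' M' K'"
    and P: "P \<in> \<P>" and \<alpha>: "1 < \<alpha>" "\<alpha> < \<beta>"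
    and L: "0 < L" "Lp_dist \<P> \<beta> \<xi> (\<lambda>_. 0) \<le> ennreal (L powr \<beta>)"
    and L': "0 < L'" "Lp_dist \<P> \<beta> \<xi>' (\<lambda>_. 0) \<le> ennreal (L' powr \<beta>)"
  shows "integrable P (\<lambda>\<omega>. (K T \<omega> + K' T \<omega>) powr \<alpha>)"
    "(\<integral>\<omega>. (K T \<omega> + K' T \<omega>) powr \<alpha> \<partial>P) \<le> 2 powr \<alpha> * ((4 * \<alpha>) powr \<alpha> * tail_const \<alpha> \<beta>) * (L powr \<alpha> + L' powr \<alpha>)"
proof -
  have T0: "T \<in> {0..T}" using T by auto
  note [measurable] = decomposition_K_P_measurable[OF dec(1) P T0] decomposition_K_P_measurable[OF dec(2) P T0]
  define w where "w = (4 * \<alpha>) powr \<alpha> * tail_const \<alpha> \<beta>"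
  have w: "0 \<le> w" unfolding w_def using tail_const_ge[of \<alpha> \<beta>] \<alpha> by (intro mult_nonneg_nonneg) auto
  have m: "(\<integral>\<^sup>+\<omega>. ennreal (\<bar>K T \<omega>\<bar> powr \<alpha>) \<partial>P) \<le> ennreal (w * L powr \<alpha>)"
    "(\<integral>\<^sup>+\<omega>. ennreal (\<bar>K' T \<omega>\<bar> powr \<alpha>) \<partial>P) \<le> ennreal (w * L' powr \<alpha>)"
    using K_moment[OF dec(1) P \<alpha> L] K_moment[OF dec(2) P \<alpha> L'] by (simp_all add: w_def mult.assoc)
  have w': "0 \<le> w * L powr \<alpha>" "0 \<le> w * L' powr \<alpha>" using w by auto
  have K: "integrable P (\<lambda>\<omega>. \<bar>K T \<omega>\<bar> powr \<alpha>)" "(\<integral>\<omega>. \<bar>K T \<omega>\<bar> powr \<alpha> \<partial>P) \<le> w * L powr \<alpha>"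
    by (rule nn_integral_le_integrable[OF _ _ w'(1) m(1)]; simp)+
  have K': "integrable P (\<lambda>\<omega>. \<bar>K' T \<omega>\<bar> powr \<alpha>)" "(\<integral>\<omega>. \<bar>K' T \<omega>\<bar> powr \<alpha> \<partial>P) \<le> w * L' powr \<alpha>"
    by (rule nn_integral_le_integrable[OF _ _ w'(2) m(2)]; simp)+
  have i: "integrable P (\<lambda>\<omega>. 2 powr \<alpha> * (\<bar>K T \<omega>\<bar> powr \<alpha> + \<bar>K' T \<omega>\<bar> powr \<alpha>))" using K K' by simp
  have le: "AE \<omega> in P. (K T \<omega> + K' T \<omega>) powr \<alpha> \<le> 2 powr \<alpha> * (\<bar>K T \<omega>\<bar> powr \<alpha> + \<bar>K' T \<omega>\<bar> powr \<alpha>)"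
    using decomposition_paths[OF dec(1) P] decomposition_paths[OF dec(2) P]
  proof eventually_elim
    case (elim \<omega>)
    have "0 \<le> K T \<omega>" "0 \<le> K' T \<omega>"
      using elim path_on_grid(3)[of "\<lambda>t. K t \<omega>" 1 1] path_on_grid(3)[of "\<lambda>t. K' t \<omega>" 1 1] by (auto simp: grid_n)
    then show ?case using powr_add_le[of "K T \<omega>" "K' T \<omega>" \<alpha>] \<alpha> by simp
  qed
  show iV: "integrable P (\<lambda>\<omega>. (K T \<omega> + K' T \<omega>) powr \<alpha>)"
    by (rule Bochner_Integration.integrable_bound[OF i]) (use le in \<open>auto elim!: eventually_mono\<close>)
  have "(\<integral>\<omega>. (K T \<omega> + K' T \<omega>) powr \<alpha> \<partial>P) \<le> (\<integral>\<omega>. 2 powr \<alpha> * (\<bar>K T \<omega>\<bar> powr \<alpha> + \<bar>K' T \<omega>\<bar> powr \<alpha>) \<partial>P)"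
    by (rule integral_mono_AE[OF iV i le])
  also have "\<dots> = 2 powr \<alpha> * ((\<integral>\<omega>. \<bar>K T \<omega>\<bar> powr \<alpha> \<partial>P) + (\<integral>\<omega>. \<bar>K' T \<omega>\<bar> powr \<alpha> \<partial>P))" using K K' by simp
  also have "\<dots> \<le> 2 powr \<alpha> * (w * L powr \<alpha> + w * L' powr \<alpha>)" using K(2) K'(2) by (intro mult_left_mono add_mono) auto
  finally show "(\<integral>\<omega>. (K T \<omega> + K' T \<omega>) powr \<alpha> \<partial>P)
      \<le> 2 powr \<alpha> * ((4 * \<alpha>) powr \<alpha> * tail_const \<alpha> \<beta>) * (L powr \<alpha> + L' powr \<alpha>)"
    unfolding w_def by (simp add: algebra_simps)
qed

text \<open>Continuity of almost every path sends the mesh to zero, and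
  \<open>grid_error_bounds\<close> supplies the majorant, integrable by hypothesis V.\<close>

lemma grid_error_integral_tendsto:
  assumes dec: "G_decomposition T \<P> E \<xi> M K" "G_decomposition T \<P> E \<xi>' M' K'"
    and P: "P \<in> \<P>" and \<alpha>: "1 < \<alpha>" and S: "0 < S"
    and V: "integrable P (\<lambda>\<omega>. (K T \<omega> + K' T \<omega>) powr \<alpha>)"
  shows "(\<lambda>n. \<integral>\<omega>. grid_error \<alpha> S (mesh T (\<lambda>t. K t \<omega> + K' t \<omega>) n) (K T \<omega> + K' T \<omega>) \<partial>P) \<longlonglongrightarrow> 0"
proof -
  have T0: "0 \<le> T" "T \<in> {0..T}" using T by auto
  note K_meas = decomposition_K_P_measurable[OF dec(1) P] decomposition_K_P_measurable[OF dec(2) P]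
  have [measurable]: "(\<lambda>\<omega>. mesh T (\<lambda>t. K t \<omega> + K' t \<omega>) n) \<in> borel_measurable P" for n
    by (intro mesh_P_measurable borel_measurable_add K_meas)
  note [measurable] = K_meas(1)[OF T0(2)] K_meas(2)[OF T0(2)]
  have path: "AE \<omega> in P. mesh T (\<lambda>t. K t \<omega> + K' t \<omega>) n \<le> K T \<omega> + K' T \<omega>
      \<and> (\<lambda>n. mesh T (\<lambda>t. K t \<omega> + K' t \<omega>) n) \<longlonglongrightarrow> 0" for n
    using decomposition_paths[OF dec(1) P] decomposition_paths[OF dec(2) P]
  proof eventually_elim
    case (elim \<omega>)
    have mono: "mono_on {0..T} (\<lambda>t. K t \<omega> + K' t \<omega>)"
      using elim by (auto simp: mono_on_def intro!: add_mono)
    show ?case using mesh_le[OF T0(1) _ mono, of n] elim by (auto intro!: mesh_tendsto[OF T] continuous_on_add)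
  qed
  have "(\<lambda>n. \<integral>\<omega>. grid_error \<alpha> S (mesh T (\<lambda>t. K t \<omega> + K' t \<omega>) n) (K T \<omega> + K' T \<omega>) \<partial>P) \<longlonglongrightarrow> (\<integral>\<omega>. 0 \<partial>P)"
  proof (rule integral_dominated_convergence[where w="\<lambda>\<omega>. (\<alpha> + 1) * (K T \<omega> + K' T \<omega>) powr \<alpha>"])
    show "AE \<omega> in P. (\<lambda>n. grid_error \<alpha> S (mesh T (\<lambda>t. K t \<omega> + K' t \<omega>) n) (K T \<omega> + K' T \<omega>)) \<longlonglongrightarrow> 0"
      using path[of 0]
    proof eventually_elim
      case (elim \<omega>)
      then show ?case
        using order_trans[OF mesh_nonneg, of T "\<lambda>t. K t \<omega> + K' t \<omega>" 0 "K T \<omega> + K' T \<omega>"]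
        by (intro grid_error_tendsto S) simp_all
    qed
    show "AE \<omega> in P. norm (grid_error \<alpha> S (mesh T (\<lambda>t. K t \<omega> + K' t \<omega>) n) (K T \<omega> + K' T \<omega>)) \<le> (\<alpha> + 1) * (K T \<omega> + K' T \<omega>) powr \<alpha>" for n
      using path[of n] by eventually_elim (use grid_error_bounds[OF \<alpha> mesh_nonneg] in simp)
  qed (use V in simp_all)
  then show ?thesis by simp
qed

section \<open>From moments under each measure to norms\<close>

lemma decomposition_L_G:
  assumes dec: "G_decomposition T \<P> E \<xi> M K"
  shows "\<xi> \<in> L_G T \<P> 1"
proof -
  have "\<forall>t\<in>{0..T}. \<exists>Y. is_cond_E T \<P> E t \<xi> Y \<and> qs T \<P> (\<lambda>\<omega>. Y \<omega> = M t \<omega> - K t \<omega>)"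
    using dec unfolding G_decomposition_def by (elim conjE)
  moreover have "0 \<in> {0..T}" using T by simp
  ultimately show ?thesis unfolding is_cond_E_def by blast
qed

lemma decomposition_M_difference_L_G:
  assumes dec: "G_decomposition T \<P> E \<xi> M K" "G_decomposition T \<P> E \<xi>' M' K'"
  shows "(\<lambda>\<omega>. M T \<omega> - M' T \<omega>) \<in> L_G T \<P> 1"
proof -
  have T0: "T \<in> {0..T}" "0 \<le> T" using T by auto
  obtain I c where I: "\<exists>Z. \<forall>t\<in>{0..T}. is_integral_upto T \<P> 1 t Z (I t)"
      "\<And>t \<omega>. t \<in> {0..T} \<Longrightarrow> \<omega> \<in> Omega T \<Longrightarrow> M t \<omega> = c + I t \<omega>"
    by (rule decomposition_integral[OF dec(1)]) blast
  obtain I' c' where I': "\<exists>Z. \<forall>t\<in>{0..T}. is_integral_upto T \<P> 1 t Z (I' t)"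
      "\<And>t \<omega>. t \<in> {0..T} \<Longrightarrow> \<omega> \<in> Omega T \<Longrightarrow> M' t \<omega> = c' + I' t \<omega>"
    by (rule decomposition_integral[OF dec(2)]) blast
  have L: "I T \<in> L_G T \<P> 1" "I' T \<in> L_G T \<P> 1"
    using I(1) I'(1) T0 unfolding is_integral_upto_def is_integral_def by blast+
  have "(\<lambda>\<omega>. (I T \<omega> - I' T \<omega>) - (c' - c)) \<in> L_G T \<P> 1"
    by (intro L_G_diff L H0_L_G H0_const T0) simp_all
  then show ?thesis by (rule L_G_cong) (simp add: I(2) I'(2) T0)
qed

lemma G_norm_powr_le:
  assumes "(\<lambda>\<omega>. \<bar>X \<omega>\<bar> powr p) \<in> L_G T \<P> 1" "0 < p" "0 \<le> c"
    and "\<And>P. P \<in> \<P> \<Longrightarrow> (\<integral>\<^sup>+\<omega>. ennreal (\<bar>X \<omega>\<bar> powr p) \<partial>P) \<le> ennreal c"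
  shows "G_norm T \<P> E p X powr p \<le> c"
proof -
  have "Lp_dist \<P> p X (\<lambda>_. 0) \<le> ennreal c" unfolding Lp_dist_def using assms(4) by (intro SUP_least) simp
  then have "enn2real (Lp_dist \<P> p X (\<lambda>_. 0)) \<le> c"
    using enn2real_mono[of _ "ennreal c"] assms(3) by simp
  then show ?thesis using assms(2) by (simp add: G_norm_eq(2)[OF assms(1)] powr_powr)
qed

lemma Lp_dist_le_G_norm:
  assumes X: "X \<in> L_G T \<P> 1" "X \<in> L_G T \<P> p" and p: "1 \<le> p" and L: "G_norm T \<P> E p X \<le> L"
  shows "Lp_dist \<P> p X (\<lambda>_. 0) \<le> ennreal (L powr p)"
proof -
  note G = G_norm_eq[OF abs_powr_L_G_closure[OF X(1) p X(2)]]
  have "enn2real (Lp_dist \<P> p X (\<lambda>_. 0)) = G_norm T \<P> E p X powr p"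
    using p by (simp add: G(2) powr_powr)
  also have "\<dots> \<le> L powr p" using L p G(2) by (intro powr_mono2) auto
  finally have "ennreal (enn2real (Lp_dist \<P> p X (\<lambda>_. 0))) \<le> ennreal (L powr p)" by (rule ennreal_leI)
  then show ?thesis using G(1) by (simp add: ennreal_enn2real_if split: if_splits)
qed

lemma G_norm_nonneg: "(\<lambda>\<omega>. \<bar>X \<omega>\<bar> powr p) \<in> L_G T \<P> 1 \<Longrightarrow> 0 \<le> G_norm T \<P> E p X"
  by (simp add: G_norm_eq(2))

end

text \<open>Stated outside the locale because the constant has to come before the horizon, the
  spaces and the expectation. The error of \<open>difference_step\<close> disappears as the grid is
  refined.\<close>

lemma difference_moment:
  fixes \<alpha> \<beta> :: real
  assumes \<alpha>: "1 < \<alpha>" "\<alpha> < \<beta>"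
  obtains A where "0 \<le> A"
    "\<And>(T :: real) (G :: real^'d^'d \<Rightarrow> real) (\<Omega>' :: 'b set) H' E' (\<zeta> :: nat \<Rightarrow> 'b \<Rightarrow> real^'d)
        (E :: ('d::finite path \<Rightarrow> real) \<Rightarrow> real) \<P> P \<xi> M K \<xi>' M' K' x L L'.
      G_expectation T \<Omega>' H' E' G \<zeta> E \<P> \<Longrightarrow>
      G_decomposition T \<P> E \<xi> M K \<Longrightarrow> G_decomposition T \<P> E \<xi>' M' K' \<Longrightarrow> P \<in> \<P> \<Longrightarrow>
      0 < x \<Longrightarrow> Lp_dist \<P> \<beta> \<xi> \<xi>' \<le> ennreal (x powr \<beta>) \<Longrightarrow>
      0 < L \<Longrightarrow> Lp_dist \<P> \<beta> \<xi> (\<lambda>_. 0) \<le> ennreal (L powr \<beta>) \<Longrightarrow>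
      0 < L' \<Longrightarrow> Lp_dist \<P> \<beta> \<xi>' (\<lambda>_. 0) \<le> ennreal (L' powr \<beta>) \<Longrightarrow>
      (\<integral>\<^sup>+\<omega>. ennreal (\<bar>M T \<omega> - M' T \<omega>\<bar> powr \<alpha>) \<partial>P)
        \<le> ennreal (A * (x powr \<alpha> + sqrt (x powr \<alpha>) * sqrt (L powr \<alpha> + L' powr \<alpha>)))"
proof -
  obtain C where C: "0 \<le> C" and bound: "\<And>P :: 'd path measure. difference_constant P \<alpha> C"
    by (rule difference_constant_exists[OF \<alpha>(1), where ?'a="'d path"]) blast
  define b where "b = 2 powr \<alpha>"
  define q where "q = b * (1 + tail_const \<alpha> \<beta>)"
  define r where "r = b * ((4 * \<alpha>) powr \<alpha> * tail_const \<alpha> \<beta>)"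
  define A where "A = b * (q + C * q) + b * (C * (sqrt q * sqrt r))"
  have tail: "1 \<le> tail_const \<alpha> \<beta>" using tail_const_ge[of \<alpha> \<beta>] \<alpha> by simp
  have b: "0 < b" by (simp add: b_def)
  have q: "0 < q" using b tail by (simp add: q_def)
  have r: "0 < r" using b tail \<alpha> by (simp add: r_def)
  have A: "0 \<le> A" using b q r C by (simp add: A_def)
  show ?thesis
  proof (rule that[OF A])
    fix T :: real and G :: "real^'d^'d \<Rightarrow> real" and \<Omega>' :: "'b set" and H' E' and \<zeta> :: "nat \<Rightarrow> 'b \<Rightarrow> real^'d"
      and E :: "('d path \<Rightarrow> real) \<Rightarrow> real" and \<P> P \<xi> M K \<xi>' M' K' x L L'
    assume "G_expectation T \<Omega>' H' E' G \<zeta> E \<P>"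
      and dec: "G_decomposition T \<P> E \<xi> M K" "G_decomposition T \<P> E \<xi>' M' K'" and P: "P \<in> \<P>"
      and x: "0 < x" "Lp_dist \<P> \<beta> \<xi> \<xi>' \<le> ennreal (x powr \<beta>)"
      and L: "0 < L" "Lp_dist \<P> \<beta> \<xi> (\<lambda>_. 0) \<le> ennreal (L powr \<beta>)"
      and L': "0 < L'" "Lp_dist \<P> \<beta> \<xi>' (\<lambda>_. 0) \<le> ennreal (L' powr \<beta>)"
    interpret G_expectation T \<Omega>' H' E' G \<zeta> E \<P> by fact
    define l where "l = L powr \<alpha> + L' powr \<alpha>"
    have l: "0 < l" using L(1) L'(1) by (simp add: l_def add_pos_pos)
    define u where "u = x powr \<alpha>"
    have u: "0 < u" using x(1) by (simp add: u_def)
    note V = K_sum_moment[OF dec P \<alpha> L L', folded b_def, folded r_def l_def]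
    have rl: "0 < r * l" using r l by simp
    define e where "e n = (\<integral>\<omega>. grid_error \<alpha> (x * x) (mesh T (\<lambda>t. K t \<omega> + K' t \<omega>) n) (K T \<omega> + K' T \<omega>) \<partial>P)" for n
    have qu: "q * u = 2 powr \<alpha> * ((1 + tail_const \<alpha> \<beta>) * x powr \<alpha>)"
      by (simp add: q_def b_def u_def)
    have step: "integrable P (\<lambda>\<omega>. \<bar>M T \<omega> - M' T \<omega>\<bar> powr \<alpha>) \<and>
        (\<integral>\<omega>. \<bar>M T \<omega> - M' T \<omega>\<bar> powr \<alpha> \<partial>P) \<le> b * (q * u + C * (q * u + sqrt (q * u * (r * l)) + e n))"
      if "0 < n" for n
      unfolding e_def b_def by (rule difference_step[OF C bound dec P \<alpha> x V rl qu that])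
    have "(\<lambda>n. e n) \<longlonglongrightarrow> 0"
      unfolding e_def using x by (intro grid_error_integral_tendsto[OF dec P \<alpha>(1) _ V(1)]) simp
    then have "(\<lambda>n. b * (q * u + C * (q * u + sqrt (q * u * (r * l)) + e n)))
        \<longlonglongrightarrow> b * (q * u + C * (q * u + sqrt (q * u * (r * l)) + 0))"
      by (intro tendsto_mult tendsto_add tendsto_const)
    then have "(\<integral>\<omega>. \<bar>M T \<omega> - M' T \<omega>\<bar> powr \<alpha> \<partial>P) \<le> b * (q * u + C * (q * u + sqrt (q * u * (r * l)) + 0))"
      by (rule LIMSEQ_le_const) (use step in \<open>auto intro!: exI[of _ 1]\<close>)
    also have "\<dots> = b * (q + C * q) * u + b * (C * (sqrt q * sqrt r)) * (sqrt u * sqrt l)"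
      by (simp add: real_sqrt_mult algebra_simps)
    also have "\<dots> \<le> A * u + A * (sqrt u * sqrt l)"
      using b q r C u l by (intro add_mono mult_right_mono) (auto simp: A_def)
    also have "\<dots> = A * (u + sqrt u * sqrt l)" by (simp add: distrib_left)
    finally have "(\<integral>\<omega>. \<bar>M T \<omega> - M' T \<omega>\<bar> powr \<alpha> \<partial>P) \<le> A * (u + sqrt u * sqrt l)" .
    moreover have "(\<integral>\<^sup>+\<omega>. ennreal (\<bar>M T \<omega> - M' T \<omega>\<bar> powr \<alpha>) \<partial>P) = ennreal (\<integral>\<omega>. \<bar>M T \<omega> - M' T \<omega>\<bar> powr \<alpha> \<partial>P)"
      using step[of 1] by (intro nn_integral_eq_integral) auto
    ultimately show "(\<integral>\<^sup>+\<omega>. ennreal (\<bar>M T \<omega> - M' T \<omega>\<bar> powr \<alpha>) \<partial>P)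
        \<le> ennreal (A * (x powr \<alpha> + sqrt (x powr \<alpha>) * sqrt (L powr \<alpha> + L' powr \<alpha>)))"
      by (simp add: u_def l_def ennreal_leI)
  qed
qed

text \<open>The moment bounds ask for strictly positive bounds on norms that may vanish; they are
  applied with the norm plus 1 / (n + 1), and n tends to infinity.\<close>

lemma powr_vanishing_shift: "0 \<le> y \<Longrightarrow> 0 < \<alpha> \<Longrightarrow> (\<lambda>n. (y + 1 / real (Suc n)) powr \<alpha>) \<longlonglongrightarrow> y powr \<alpha>"
proof -
  assume y: "0 \<le> y" "0 < \<alpha>"
  have "(\<lambda>n. y + 1 / real (Suc n)) \<longlonglongrightarrow> y + 0"
    by (intro tendsto_add tendsto_const LIMSEQ_Suc[OF lim_1_over_n])
  then show ?thesis
    using y by (intro tendsto_powr') (auto intro!: always_eventually)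
qed

context G_expectation
begin

text \<open>A moment of some order p strictly between \<alpha> and \<beta> places \<bar>K T\<bar>
  powr \<alpha> in the completion; the estimate itself is \<open>K_moment\<close> for
  \<alpha>.\<close>

lemma K_norm_bound:
  assumes \<alpha>: "1 < \<alpha>" "\<alpha> < \<beta>" and \<xi>: "\<xi> \<in> L_G T \<P> \<beta>" and dec: "G_decomposition T \<P> E \<xi> M K"
  shows "G_norm T \<P> E \<alpha> (K T) powr \<alpha> \<le> (4 * \<alpha>) powr \<alpha> * tail_const \<alpha> \<beta> * G_norm T \<P> E \<beta> \<xi> powr \<alpha>"
proof -
  have T0: "T \<in> {0..T}" using T by auto
  define y where "y = G_norm T \<P> E \<beta> \<xi>"
  note \<xi>1 = decomposition_L_G[OF dec]
  have \<beta>: "1 \<le> \<beta>" using \<alpha> by simp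
  have y: "0 \<le> y" unfolding y_def by (rule G_norm_nonneg[OF abs_powr_L_G_closure[OF \<xi>1 \<beta> \<xi>]])
  have L: "Lp_dist \<P> \<beta> \<xi> (\<lambda>_. 0) \<le> ennreal (L powr \<beta>)" if "y \<le> L" for L
    by (rule Lp_dist_le_G_norm[OF \<xi>1 \<xi> \<beta> that[unfolded y_def]])
  define p where "p = (\<alpha> + \<beta>) / 2"
  have p: "1 < p" "p < \<beta>" "\<alpha> < p" using \<alpha> by (auto simp: p_def)
  have K1: "K T \<in> L_G T \<P> 1" by (rule decomposition_K_measurable[OF dec T0])
  have "Lp_dist \<P> p (K T) (\<lambda>_. 0) \<le> ennreal ((4 * p) powr p * (tail_const p \<beta> * (y + 1) powr p))"
    unfolding Lp_dist_def using K_moment[OF dec _ p(1,2) _ L, of _ "y + 1"] y by (intro SUP_least) simp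
  then have fin: "Lp_dist \<P> p (K T) (\<lambda>_. 0) < \<infinity>" by (rule order.strict_trans1) simp
  have K\<alpha>: "(\<lambda>\<omega>. \<bar>K T \<omega>\<bar> powr \<alpha>) \<in> L_G T \<P> 1"
    using \<alpha> by (intro abs_powr_L_G_moment[OF K1 _ p(3) fin]) simp
  define W where "W = (4 * \<alpha>) powr \<alpha> * tail_const \<alpha> \<beta>"
  have W: "0 \<le> W" unfolding W_def using tail_const_ge[of \<alpha> \<beta>] \<alpha> by (intro mult_nonneg_nonneg) auto
  have step: "G_norm T \<P> E \<alpha> (K T) powr \<alpha> \<le> W * (y + 1 / real (Suc n)) powr \<alpha>" for n
  proof (rule G_norm_powr_le[OF K\<alpha>])
    fix P assume P: "P \<in> \<P>"
    have n: "0 < y + 1 / real (Suc n)" using y by (intro add_nonneg_pos) auto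
    show "(\<integral>\<^sup>+\<omega>. ennreal (\<bar>K T \<omega>\<bar> powr \<alpha>) \<partial>P) \<le> ennreal (W * (y + 1 / real (Suc n)) powr \<alpha>)"
      using K_moment[OF dec P \<alpha> n L] by (simp add: W_def mult.assoc)
  qed (use \<alpha> W in auto)
  have "(\<lambda>n. W * (y + 1 / real (Suc n)) powr \<alpha>) \<longlonglongrightarrow> W * y powr \<alpha>"
    using y \<alpha> by (intro tendsto_mult_left powr_vanishing_shift) auto
  then have "G_norm T \<P> E \<alpha> (K T) powr \<alpha> \<le> W * y powr \<alpha>"
    by (rule LIMSEQ_le_const) (use step in blast)
  then show ?thesis by (simp add: W_def y_def)
qed

end

text \<open>\<open>difference_moment\<close> is used twice, at \<alpha> for the estimate and at p
  for the finiteness that gives the norm of order \<alpha> its meaning. The nonnegativity of the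
  norms is recorded for the comparison of exponents.\<close>

lemma M_difference_norm_bound:
  fixes \<alpha> \<beta> :: real
  assumes \<alpha>: "1 < \<alpha>" "\<alpha> < \<beta>"
  obtains A where "0 \<le> A"
    "\<And>(T :: real) (G :: real^'d^'d \<Rightarrow> real) (\<Omega>' :: 'b set) H' E' (\<zeta> :: nat \<Rightarrow> 'b \<Rightarrow> real^'d)
        (E :: ('d::finite path \<Rightarrow> real) \<Rightarrow> real) \<P> \<xi> M K \<xi>' M' K'.
      G_expectation T \<Omega>' H' E' G \<zeta> E \<P> \<Longrightarrow> \<xi> \<in> L_G T \<P> \<beta> \<Longrightarrow> \<xi>' \<in> L_G T \<P> \<beta> \<Longrightarrow>
      G_decomposition T \<P> E \<xi> M K \<Longrightarrow> G_decomposition T \<P> E \<xi>' M' K' \<Longrightarrow>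
      G_norm T \<P> E \<alpha> (\<lambda>\<omega>. M T \<omega> - M' T \<omega>) powr \<alpha>
        \<le> A * (G_norm T \<P> E \<beta> (\<lambda>\<omega>. \<xi> \<omega> - \<xi>' \<omega>) powr \<alpha>
              + sqrt (G_norm T \<P> E \<beta> (\<lambda>\<omega>. \<xi> \<omega> - \<xi>' \<omega>) powr \<alpha>)
                * sqrt (G_norm T \<P> E \<beta> \<xi> powr \<alpha> + G_norm T \<P> E \<beta> \<xi>' powr \<alpha>)) \<and>
      0 \<le> G_norm T \<P> E \<beta> \<xi> \<and> 0 \<le> G_norm T \<P> E \<beta> \<xi>'"
proof -
  define p where "p = (\<alpha> + \<beta>) / 2"
  have p: "1 < p" "p < \<beta>" "\<alpha> < p" using \<alpha> by (auto simp: p_def)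
  obtain A where A: "0 \<le> A"
    and moment: "\<And>(T :: real) (G :: real^'d^'d \<Rightarrow> real) (\<Omega>' :: 'b set) H' E' (\<zeta> :: nat \<Rightarrow> 'b \<Rightarrow> real^'d)
        (E :: ('d::finite path \<Rightarrow> real) \<Rightarrow> real) \<P> P \<xi> M K \<xi>' M' K' x L L'.
      G_expectation T \<Omega>' H' E' G \<zeta> E \<P> \<Longrightarrow>
      G_decomposition T \<P> E \<xi> M K \<Longrightarrow> G_decomposition T \<P> E \<xi>' M' K' \<Longrightarrow> P \<in> \<P> \<Longrightarrow>
      0 < x \<Longrightarrow> Lp_dist \<P> \<beta> \<xi> \<xi>' \<le> ennreal (x powr \<beta>) \<Longrightarrow>
      0 < L \<Longrightarrow> Lp_dist \<P> \<beta> \<xi> (\<lambda>_. 0) \<le> ennreal (L powr \<beta>) \<Longrightarrow>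
      0 < L' \<Longrightarrow> Lp_dist \<P> \<beta> \<xi>' (\<lambda>_. 0) \<le> ennreal (L' powr \<beta>) \<Longrightarrow>
      (\<integral>\<^sup>+\<omega>. ennreal (\<bar>M T \<omega> - M' T \<omega>\<bar> powr \<alpha>) \<partial>P)
        \<le> ennreal (A * (x powr \<alpha> + sqrt (x powr \<alpha>) * sqrt (L powr \<alpha> + L' powr \<alpha>)))"
    by (fact difference_moment[OF \<alpha>, where ?'d='d and ?'b='b])
  obtain A' where "0 \<le> A'"
    and moment': "\<And>(T :: real) (G :: real^'d^'d \<Rightarrow> real) (\<Omega>' :: 'b set) H' E' (\<zeta> :: nat \<Rightarrow> 'b \<Rightarrow> real^'d)
        (E :: ('d::finite path \<Rightarrow> real) \<Rightarrow> real) \<P> P \<xi> M K \<xi>' M' K' x L L'.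
      G_expectation T \<Omega>' H' E' G \<zeta> E \<P> \<Longrightarrow>
      G_decomposition T \<P> E \<xi> M K \<Longrightarrow> G_decomposition T \<P> E \<xi>' M' K' \<Longrightarrow> P \<in> \<P> \<Longrightarrow>
      0 < x \<Longrightarrow> Lp_dist \<P> \<beta> \<xi> \<xi>' \<le> ennreal (x powr \<beta>) \<Longrightarrow>
      0 < L \<Longrightarrow> Lp_dist \<P> \<beta> \<xi> (\<lambda>_. 0) \<le> ennreal (L powr \<beta>) \<Longrightarrow>
      0 < L' \<Longrightarrow> Lp_dist \<P> \<beta> \<xi>' (\<lambda>_. 0) \<le> ennreal (L' powr \<beta>) \<Longrightarrow>
      (\<integral>\<^sup>+\<omega>. ennreal (\<bar>M T \<omega> - M' T \<omega>\<bar> powr p) \<partial>P)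
        \<le> ennreal (A' * (x powr p + sqrt (x powr p) * sqrt (L powr p + L' powr p)))"
    by (fact difference_moment[OF p(1,2), where ?'d='d and ?'b='b])
  show ?thesis
  proof (rule that[OF A])
    fix T :: real and G :: "real^'d^'d \<Rightarrow> real" and \<Omega>' :: "'b set" and H' E' and \<zeta> :: "nat \<Rightarrow> 'b \<Rightarrow> real^'d"
      and E :: "('d path \<Rightarrow> real) \<Rightarrow> real" and \<P> \<xi> M K \<xi>' M' K'
    assume GE: "G_expectation T \<Omega>' H' E' G \<zeta> E \<P>" and \<xi>: "\<xi> \<in> L_G T \<P> \<beta>" and \<xi>': "\<xi>' \<in> L_G T \<P> \<beta>"
      and dec: "G_decomposition T \<P> E \<xi> M K" "G_decomposition T \<P> E \<xi>' M' K'"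
    interpret G_expectation T \<Omega>' H' E' G \<zeta> E \<P> by (rule GE)
    have \<beta>: "1 \<le> \<beta>" using \<alpha> by simp
    define D where "D \<omega> = \<xi> \<omega> - \<xi>' \<omega>" for \<omega>
    define N where "N \<omega> = M T \<omega> - M' T \<omega>" for \<omega>
    define l where "l = G_norm T \<P> E \<beta> \<xi>"
    define l' where "l' = G_norm T \<P> E \<beta> \<xi>'"
    define z where "z = G_norm T \<P> E \<beta> D"
    note \<xi>1 = decomposition_L_G[OF dec(1)] decomposition_L_G[OF dec(2)]
    have D1: "D \<in> L_G T \<P> 1" unfolding D_def by (intro L_G_diff \<xi>1) simp
    have D: "D \<in> L_G T \<P> \<beta>" unfolding D_def using \<beta> by (intro L_G_diff \<xi> \<xi>') simp
    have l: "0 \<le> l" unfolding l_def by (rule G_norm_nonneg[OF abs_powr_L_G_closure[OF \<xi>1(1) \<beta> \<xi>]])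
    have l': "0 \<le> l'" unfolding l'_def by (rule G_norm_nonneg[OF abs_powr_L_G_closure[OF \<xi>1(2) \<beta> \<xi>']])
    have z: "0 \<le> z" unfolding z_def by (rule G_norm_nonneg[OF abs_powr_L_G_closure[OF D1 \<beta> D]])
    have Ll: "Lp_dist \<P> \<beta> \<xi> (\<lambda>_. 0) \<le> ennreal (L powr \<beta>)" if "l \<le> L" for L
      by (rule Lp_dist_le_G_norm[OF \<xi>1(1) \<xi> \<beta> that[unfolded l_def]])
    have Ll': "Lp_dist \<P> \<beta> \<xi>' (\<lambda>_. 0) \<le> ennreal (L powr \<beta>)" if "l' \<le> L" for L
      by (rule Lp_dist_le_G_norm[OF \<xi>1(2) \<xi>' \<beta> that[unfolded l'_def]])
    have Lz: "Lp_dist \<P> \<beta> \<xi> \<xi>' \<le> ennreal (L powr \<beta>)" if "z \<le> L" for L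
    proof -
      have "Lp_dist \<P> \<beta> \<xi> \<xi>' = Lp_dist \<P> \<beta> D (\<lambda>_. 0)" by (simp add: Lp_dist_def D_def)
      then show ?thesis using Lp_dist_le_G_norm[OF D1 D \<beta> that[unfolded z_def]] by simp
    qed
    have N1: "N \<in> L_G T \<P> 1" unfolding N_def by (rule decomposition_M_difference_L_G[OF dec])
    have "Lp_dist \<P> p N (\<lambda>_. 0) \<le> ennreal (A' * ((z + 1) powr p + sqrt ((z + 1) powr p) * sqrt ((l + 1) powr p + (l' + 1) powr p)))"
      unfolding Lp_dist_def
    proof (rule SUP_least)
      fix P assume P: "P \<in> \<P>"
      show "(\<integral>\<^sup>+\<omega>. ennreal (\<bar>N \<omega> - 0\<bar> powr p) \<partial>P) \<le> ennreal (A' * ((z + 1) powr p + sqrt ((z + 1) powr p) * sqrt ((l + 1) powr p + (l' + 1) powr p)))"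
        using moment'[OF GE dec P _ Lz _ Ll _ Ll', of "z + 1" "l + 1" "l' + 1"] z l l' by (simp add: N_def)
    qed
    then have fin: "Lp_dist \<P> p N (\<lambda>_. 0) < \<infinity>" by (rule order.strict_trans1) simp
    have N\<alpha>: "(\<lambda>\<omega>. \<bar>N \<omega>\<bar> powr \<alpha>) \<in> L_G T \<P> 1"
      using \<alpha> by (intro abs_powr_L_G_moment[OF N1 _ p(3) fin]) simp
    define R where "R n y = (y + 1 / real (Suc n)) powr \<alpha>" for n y
    have step: "G_norm T \<P> E \<alpha> N powr \<alpha> \<le> A * (R n z + sqrt (R n z) * sqrt (R n l + R n l'))" for n
    proof (rule G_norm_powr_le[OF N\<alpha>])
      have pos: "0 < y + 1 / real (Suc n)" "y \<le> y + 1 / real (Suc n)" if "0 \<le> y" for y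
        using that by (auto intro!: add_nonneg_pos)
      fix P assume P: "P \<in> \<P>"
      show "(\<integral>\<^sup>+\<omega>. ennreal (\<bar>N \<omega>\<bar> powr \<alpha>) \<partial>P) \<le> ennreal (A * (R n z + sqrt (R n z) * sqrt (R n l + R n l')))"
        unfolding N_def R_def
        by (rule moment[OF GE dec P pos(1)[OF z] Lz[OF pos(2)[OF z]] pos(1)[OF l] Ll[OF pos(2)[OF l]] pos(1)[OF l'] Ll'[OF pos(2)[OF l']]])
    qed (use \<alpha> A in \<open>auto simp: R_def intro!: mult_nonneg_nonneg add_nonneg_nonneg\<close>)
    have R: "(\<lambda>n. R n y) \<longlonglongrightarrow> y powr \<alpha>" if "0 \<le> y" for y
      unfolding R_def using that \<alpha> by (intro powr_vanishing_shift) auto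
    have "(\<lambda>n. A * (R n z + sqrt (R n z) * sqrt (R n l + R n l')))
        \<longlonglongrightarrow> A * (z powr \<alpha> + sqrt (z powr \<alpha>) * sqrt (l powr \<alpha> + l' powr \<alpha>))"
      by (intro tendsto_mult tendsto_add tendsto_real_sqrt tendsto_const R z l l')
    then have "G_norm T \<P> E \<alpha> N powr \<alpha> \<le> A * (z powr \<alpha> + sqrt (z powr \<alpha>) * sqrt (l powr \<alpha> + l' powr \<alpha>))"
      by (rule LIMSEQ_le_const) (use step in blast)
    then show "G_norm T \<P> E \<alpha> (\<lambda>\<omega>. M T \<omega> - M' T \<omega>) powr \<alpha>
        \<le> A * (G_norm T \<P> E \<beta> (\<lambda>\<omega>. \<xi> \<omega> - \<xi>' \<omega>) powr \<alpha>
              + sqrt (G_norm T \<P> E \<beta> (\<lambda>\<omega>. \<xi> \<omega> - \<xi>' \<omega>) powr \<alpha>)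
                * sqrt (G_norm T \<P> E \<beta> \<xi> powr \<alpha> + G_norm T \<P> E \<beta> \<xi>' powr \<alpha>)) \<and>
        0 \<le> G_norm T \<P> E \<beta> \<xi> \<and> 0 \<le> G_norm T \<P> E \<beta> \<xi>'"
      using l l' unfolding N_def[abs_def] D_def[abs_def] l_def l'_def z_def by simp
  qed
qed

section \<open>Comparison of exponents and assembly\<close>

lemma powr_le_one_plus: "0 \<le> (x::real) \<Longrightarrow> 0 \<le> a \<Longrightarrow> a \<le> b \<Longrightarrow> x powr a \<le> 1 + x powr b"
proof (cases "x \<le> 1")
  case True
  assume "0 \<le> x" "0 \<le> a"
  then show ?thesis using True powr_le1[of a x] by (simp add: add_increasing2)
next
  case False
  assume "a \<le> b"
  then have "x powr a \<le> x powr b" using False by (intro powr_mono) auto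
  then show ?thesis by simp
qed

theorem corollary4p9:
  fixes \<alpha> \<beta> \<gamma> :: real
  assumes "\<beta> > 1" "1 < \<alpha>" "\<alpha> < \<beta>" "1 < \<gamma>" "\<gamma> < \<beta> / \<alpha>" "\<gamma> \<le> 2"
  shows "\<exists>C::real.
    \<forall>(T::real) (G :: real^'d^'d \<Rightarrow> real)
      (\<Omega>' :: 'b set) H' E' (\<zeta> :: nat \<Rightarrow> 'b \<Rightarrow> real^'d)
      (E :: ('d::finite path \<Rightarrow> real) \<Rightarrow> real) (\<P> :: 'd path measure set).
      T > 0 \<and> sublinear_expectation \<Omega>' H' E' \<and> iid_G_normal H' E' G \<zeta> \<and> nondegenerate G \<and>
      is_G_expectation T E' \<zeta> E \<and> represents T E \<P> \<longrightarrow>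
      (\<forall>\<xi>\<in>L_G T \<P> \<beta>. \<forall>\<xi>'\<in>L_G T \<P> \<beta>. \<forall>M K M' K'.
         G_decomposition T \<P> E \<xi> M K \<and> G_decomposition T \<P> E \<xi>' M' K' \<longrightarrow>
         G_norm T \<P> E \<alpha> (K T) powr \<alpha>
           \<le> C * (G_norm T \<P> E \<beta> \<xi> powr \<alpha> + G_norm T \<P> E \<beta> \<xi> powr (\<beta> / \<gamma>)) \<and>
         G_norm T \<P> E \<alpha> (\<lambda>\<omega>. M T \<omega> - M' T \<omega>) powr \<alpha>
           \<le> C * (G_norm T \<P> E \<beta> (\<lambda>\<omega>. \<xi> \<omega> - \<xi>' \<omega>) powr \<alpha>
                   + G_norm T \<P> E \<beta> (\<lambda>\<omega>. \<xi> \<omega> - \<xi>' \<omega>) powr (\<beta> / \<gamma>))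
             + C * sqrt (G_norm T \<P> E \<beta> (\<lambda>\<omega>. \<xi> \<omega> - \<xi>' \<omega>) powr \<alpha>
                   + G_norm T \<P> E \<beta> (\<lambda>\<omega>. \<xi> \<omega> - \<xi>' \<omega>) powr (\<beta> / \<gamma>))
                 * sqrt (1 + G_norm T \<P> E \<beta> \<xi> powr (\<beta> / \<gamma>)
                           + G_norm T \<P> E \<beta> \<xi>' powr (\<beta> / \<gamma>)))"
proof -
  note \<alpha> = assms(2,3)
  obtain A where A: "0 \<le> A"
    and bound: "\<And>(T :: real) (G :: real^'d^'d \<Rightarrow> real) (\<Omega>' :: 'b set) H' E' (\<zeta> :: nat \<Rightarrow> 'b \<Rightarrow> real^'d)
        (E :: ('d::finite path \<Rightarrow> real) \<Rightarrow> real) \<P> \<xi> M K \<xi>' M' K'.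
      G_expectation T \<Omega>' H' E' G \<zeta> E \<P> \<Longrightarrow> \<xi> \<in> L_G T \<P> \<beta> \<Longrightarrow> \<xi>' \<in> L_G T \<P> \<beta> \<Longrightarrow>
      G_decomposition T \<P> E \<xi> M K \<Longrightarrow> G_decomposition T \<P> E \<xi>' M' K' \<Longrightarrow>
      G_norm T \<P> E \<alpha> (\<lambda>\<omega>. M T \<omega> - M' T \<omega>) powr \<alpha>
        \<le> A * (G_norm T \<P> E \<beta> (\<lambda>\<omega>. \<xi> \<omega> - \<xi>' \<omega>) powr \<alpha>
              + sqrt (G_norm T \<P> E \<beta> (\<lambda>\<omega>. \<xi> \<omega> - \<xi>' \<omega>) powr \<alpha>)
                * sqrt (G_norm T \<P> E \<beta> \<xi> powr \<alpha> + G_norm T \<P> E \<beta> \<xi>' powr \<alpha>)) \<and>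
      0 \<le> G_norm T \<P> E \<beta> \<xi> \<and> 0 \<le> G_norm T \<P> E \<beta> \<xi>'"
    by (fact M_difference_norm_bound[OF \<alpha>, where ?'d='d and ?'b='b])
  define W where "W = (4 * \<alpha>) powr \<alpha> * tail_const \<alpha> \<beta>"
  have W: "0 \<le> W" unfolding W_def using tail_const_ge[of \<alpha> \<beta>] \<alpha> by (intro mult_nonneg_nonneg) auto
  \<comment> \<open>W serves the estimate of K, and 2 * A the mixed term, whose square root
    contributes a factor 2.\<close>
  define C where "C = W + 2 * A"
  have C: "W \<le> C" "A \<le> C" "2 * A \<le> C" "0 \<le> C" using A W by (auto simp: C_def)
  define c where "c = \<beta> / \<gamma>"
  have "\<gamma> * \<alpha> < \<beta>" using assms by (simp add: field_simps)
  then have c: "\<alpha> \<le> c" using assms(4) by (simp add: c_def field_simps)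
  show ?thesis
  proof (rule exI[of _ C], intro allI impI ballI)
    fix T :: real and G :: "real^'d^'d \<Rightarrow> real" and \<Omega>' :: "'b set" and H' E' and \<zeta> :: "nat \<Rightarrow> 'b \<Rightarrow> real^'d"
      and E :: "('d path \<Rightarrow> real) \<Rightarrow> real" and \<P> \<xi> \<xi>' M K M' K'
    assume hyps: "T > 0 \<and> sublinear_expectation \<Omega>' H' E' \<and> iid_G_normal H' E' G \<zeta> \<and> nondegenerate G \<and>
        is_G_expectation T E' \<zeta> E \<and> represents T E \<P>"
      and \<xi>: "\<xi> \<in> L_G T \<P> \<beta>" "\<xi>' \<in> L_G T \<P> \<beta>"
      and dec: "G_decomposition T \<P> E \<xi> M K \<and> G_decomposition T \<P> E \<xi>' M' K'"
    have GE: "G_expectation T \<Omega>' H' E' G \<zeta> E \<P>" by (rule G_expectation.intro) (use hyps in auto)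
    interpret G_expectation T \<Omega>' H' E' G \<zeta> E \<P> by (rule GE)
    note dec1 = dec[THEN conjunct1] and dec2 = dec[THEN conjunct2]
    define y where "y = G_norm T \<P> E \<beta> \<xi>"
    define y' where "y' = G_norm T \<P> E \<beta> \<xi>'"
    define z where "z = G_norm T \<P> E \<beta> (\<lambda>\<omega>. \<xi> \<omega> - \<xi>' \<omega>)"
    note b = bound[OF GE \<xi> dec1 dec2, folded y_def y'_def z_def]
    have "G_norm T \<P> E \<alpha> (K T) powr \<alpha> \<le> W * y powr \<alpha>"
      using K_norm_bound[OF \<alpha> \<xi>(1) dec1] by (simp add: W_def y_def)
    also have "\<dots> \<le> C * (y powr \<alpha> + y powr c)" using C by (intro mult_mono) auto
    finally have K: "G_norm T \<P> E \<alpha> (K T) powr \<alpha> \<le> C * (y powr \<alpha> + y powr c)" .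
    \<comment> \<open>The factor 2 would do; 4 has the square root 2.\<close>
    have "y powr \<alpha> + y' powr \<alpha> \<le> 4 * (1 + y powr c + y' powr c)"
    proof -
      have "0 \<le> y" "0 \<le> y'" "0 \<le> \<alpha>" using b \<alpha> by auto
      then have "y powr \<alpha> \<le> 1 + y powr c" "y' powr \<alpha> \<le> 1 + y' powr c" "0 \<le> y powr c" "0 \<le> y' powr c"
        using c by (simp_all add: powr_le_one_plus)
      then show ?thesis by argo
    qed
    then have "sqrt (y powr \<alpha> + y' powr \<alpha>) \<le> sqrt (4 * (1 + y powr c + y' powr c))" by (rule real_sqrt_le_mono)
    also have "\<dots> = 2 * sqrt (1 + y powr c + y' powr c)" by (simp only: real_sqrt_mult real_sqrt_four)
    finally have sq: "sqrt (y powr \<alpha> + y' powr \<alpha>) \<le> 2 * sqrt (1 + y powr c + y' powr c)" .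
    have "G_norm T \<P> E \<alpha> (\<lambda>\<omega>. M T \<omega> - M' T \<omega>) powr \<alpha>
        \<le> A * z powr \<alpha> + A * (sqrt (z powr \<alpha>) * sqrt (y powr \<alpha> + y' powr \<alpha>))"
      using b by (simp add: distrib_left)
    also have "\<dots> \<le> A * z powr \<alpha> + A * (sqrt (z powr \<alpha> + z powr c) * (2 * sqrt (1 + y powr c + y' powr c)))"
      using A sq by (intro add_left_mono mult_left_mono mult_mono) auto
    also have "\<dots> = A * z powr \<alpha> + (2 * A) * (sqrt (z powr \<alpha> + z powr c) * sqrt (1 + y powr c + y' powr c))"
      by simp
    also have "\<dots> \<le> C * (z powr \<alpha> + z powr c) + C * (sqrt (z powr \<alpha> + z powr c) * sqrt (1 + y powr c + y' powr c))"
      using C A by (intro add_mono mult_mono) auto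
    finally show "G_norm T \<P> E \<alpha> (K T) powr \<alpha>
           \<le> C * (G_norm T \<P> E \<beta> \<xi> powr \<alpha> + G_norm T \<P> E \<beta> \<xi> powr (\<beta> / \<gamma>)) \<and>
         G_norm T \<P> E \<alpha> (\<lambda>\<omega>. M T \<omega> - M' T \<omega>) powr \<alpha>
           \<le> C * (G_norm T \<P> E \<beta> (\<lambda>\<omega>. \<xi> \<omega> - \<xi>' \<omega>) powr \<alpha>
                   + G_norm T \<P> E \<beta> (\<lambda>\<omega>. \<xi> \<omega> - \<xi>' \<omega>) powr (\<beta> / \<gamma>))
             + C * sqrt (G_norm T \<P> E \<beta> (\<lambda>\<omega>. \<xi> \<omega> - \<xi>' \<omega>) powr \<alpha>
                   + G_norm T \<P> E \<beta> (\<lambda>\<omega>. \<xi> \<omega> - \<xi>' \<omega>) powr (\<beta> / \<gamma>))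
                 * sqrt (1 + G_norm T \<P> E \<beta> \<xi> powr (\<beta> / \<gamma>)
                           + G_norm T \<P> E \<beta> \<xi>' powr (\<beta> / \<gamma>))"
      using K unfolding y_def y'_def z_def c_def by (simp add: mult.assoc)
  qed
qed

end
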